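(* Let $\Sigma^+$ be a topologically mixing one-sided countable Markov shift with finite Gurevich entropy, let $\phi$ be a $\theta$-weakly H\"older continuous SPR potential with $\sup\phi<\infty$, and let $m$ be the unique equilibrium measure of $\phi$. Let $\beta>0$ with $e^{-\beta}\le\theta$. (1) For every $\psi\in\mathcal H_\beta$, $\sigma_m(\psi)=0$ if and only if $\psi=r-r\circ\sigma+c$ with $c\in\mathbb R$ and $r$ continuous (possibly unbounded). (2) If $\psi,\varphi\in\mathcal H_\beta$ and $\psi-\varphi=r-r\circ\sigma+c$ with $r$ continuous and $c\in\mathbb R$, then $\sigma_m(\psi)=\sigma_m(\varphi)$. (3) There is a constant $M=M_\theta(\phi)>1$ depending only on $\theta$ and $\phi$ such that $\sigma_m(\psi)\le M\|\psi\|_\beta$ for all $\psi\in\mathcal H_\beta$.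
   Context: One-sided TMS over a countable directed graph: $\Sigma^+=\{(x_0,x_1,\dots):x_i\to x_{i+1}\}$, left shift $\sigma$, metric $e^{-t(\underline x,\underline y)}$, $t=\min\{i:x_i\ne y_i\}$; mixing: strongly connected, gcd of loop lengths 1. $\theta$-weakly H\"older: $\sup\{|\phi(\underline x)-\phi(\underline y)|:x_i=y_i,i<n\}\le A\theta^n$ for $n\ge2$. $\phi_n=\sum_{k<n}\phi\circ\sigma^k$; $P_G(\phi)=\lim\frac1n\log\sum_{\sigma^n\underline x=\underline x}e^{\phi_n(\underline x)}1_{[a]}(\underline x)$; Gurevich entropy $P_G(0)$. Equilibrium measure: invariant probability maximizing $h_\mu(\sigma)+\int\phi d\mu$. SPR: $\limsup\frac1n\log Z_n^\ast(\phi,a)<P_G(\phi)$ for some (every) state $a$, with $Z_n^\ast(\phi,a)=\sum_{\sigma^n\underline x=\underline x}e^{\phi_n(\underline x)}1_{[\tau_a=n]}(\underline x)$, $\tau_a$ the first return time to $[a]$ (equivalent to the paper's discriminant definition). $\mathcal H_\beta$: $\|\psi\|_\beta=\|\psi\|_\infty+\sup_{\underline x\ne\underline y}|\psi(\underline x)-\psi(\underline y)|e^{\beta t(\underline x,\underline y)}<\infty$. Asymptotic variance: $\sigma_m^2(\psi)=\lim_n\frac1n\int(\psi_n-\int\psi_ndm)^2dm$, $\psi_n=\sum_{k<n}\psi\circ\sigma^k$, $\sigma_m(\psi)\ge0$. *)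

theory Defs
  imports "HOL-Probability.Probability"
begin

text \<open>The states form the countable type 'a; the edge relation is E.\<close>

definition sigma_plus :: "('a \<Rightarrow> 'a \<Rightarrow> bool) \<Rightarrow> (nat \<Rightarrow> 'a) set" where
  "sigma_plus E = {x. \<forall>i. E (x i) (x (Suc i))}"

definition shift :: "(nat \<Rightarrow> 'a) \<Rightarrow> (nat \<Rightarrow> 'a)" where
  "shift x = (\<lambda>i. x (Suc i))"

definition mixing :: "('a \<Rightarrow> 'a \<Rightarrow> bool) \<Rightarrow> bool" where
  "mixing E \<longleftrightarrow> (\<forall>a b. E\<^sup>+\<^sup>+ a b) \<and>
     Gcd {n::nat. 0 < n \<and> (\<exists>a. (E ^^ n) a a)} = 1"

definition birkhoff :: "((nat \<Rightarrow> 'a) \<Rightarrow> real) \<Rightarrow> nat \<Rightarrow> (nat \<Rightarrow> 'a) \<Rightarrow> real" where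
  "birkhoff f n x = (\<Sum>k<n. f ((shift ^^ k) x))"

text \<open>Separation time t(x,y) = min{i. x_i \<noteq> y_i} (for x \<noteq> y).\<close>
definition sep_time :: "(nat \<Rightarrow> 'a) \<Rightarrow> (nat \<Rightarrow> 'a) \<Rightarrow> nat" where
  "sep_time x y = (LEAST i. x i \<noteq> y i)"

definition shift_continuous :: "('a \<Rightarrow> 'a \<Rightarrow> bool) \<Rightarrow> ((nat \<Rightarrow> 'a) \<Rightarrow> real) \<Rightarrow> bool" where
  "shift_continuous E r \<longleftrightarrow>
     (\<forall>x\<in>sigma_plus E. \<forall>\<epsilon>>0. \<exists>\<delta>>0. \<forall>y\<in>sigma_plus E.
        (x = y \<or> exp (- real (sep_time x y)) < \<delta>) \<longrightarrow> \<bar>r x - r y\<bar> < \<epsilon>)"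

definition weakly_holder :: "('a \<Rightarrow> 'a \<Rightarrow> bool) \<Rightarrow> real \<Rightarrow> ((nat \<Rightarrow> 'a) \<Rightarrow> real) \<Rightarrow> bool" where
  "weakly_holder E \<theta> f \<longleftrightarrow> (\<exists>A. \<forall>n\<ge>2. \<forall>x\<in>sigma_plus E. \<forall>y\<in>sigma_plus E.
      (\<forall>i<n. x i = y i) \<longrightarrow> \<bar>f x - f y\<bar> \<le> A * \<theta> ^ n)"

definition eln :: "ennreal \<Rightarrow> ereal" where
  "eln z = (if z = \<infinity> then \<infinity> else if z = 0 then - \<infinity> else ereal (ln (enn2real z)))"

definition Zn :: "('a \<Rightarrow> 'a \<Rightarrow> bool) \<Rightarrow> ((nat \<Rightarrow> 'a) \<Rightarrow> real) \<Rightarrow> 'a \<Rightarrow> nat \<Rightarrow> ennreal" where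
  "Zn E f a n = infsum (\<lambda>x. ennreal (exp (birkhoff f n x)))
      {x \<in> sigma_plus E. (shift ^^ n) x = x \<and> x 0 = a}"

definition Zn_star :: "('a \<Rightarrow> 'a \<Rightarrow> bool) \<Rightarrow> ((nat \<Rightarrow> 'a) \<Rightarrow> real) \<Rightarrow> 'a \<Rightarrow> nat \<Rightarrow> ennreal" where
  "Zn_star E f a n = infsum (\<lambda>x. ennreal (exp (birkhoff f n x)))
      {x \<in> sigma_plus E. (shift ^^ n) x = x \<and> x 0 = a \<and>
          0 < n \<and> (\<forall>k. 0 < k \<and> k < n \<longrightarrow> x k \<noteq> a)}"

definition gurevich_pressure :: "('a \<Rightarrow> 'a \<Rightarrow> bool) \<Rightarrow> ((nat \<Rightarrow> 'a) \<Rightarrow> real) \<Rightarrow> 'a \<Rightarrow> ereal" where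
  "gurevich_pressure E f a = limsup (\<lambda>n. eln (Zn E f a n) / ereal (real n))"

definition SPR :: "('a \<Rightarrow> 'a \<Rightarrow> bool) \<Rightarrow> ((nat \<Rightarrow> 'a) \<Rightarrow> real) \<Rightarrow> bool" where
  "SPR E f \<longleftrightarrow> (\<exists>a. limsup (\<lambda>n. eln (Zn_star E f a n) / ereal (real n))
                        < gurevich_pressure E f a)"

definition shift_space :: "('a \<Rightarrow> 'a \<Rightarrow> bool) \<Rightarrow> (nat \<Rightarrow> 'a) measure" where
  "shift_space E = sigma (sigma_plus E)
     {{x \<in> sigma_plus E. \<forall>i<n. x i = w i} | n w. True}"

definition invariant_prob :: "('a \<Rightarrow> 'a \<Rightarrow> bool) \<Rightarrow> (nat \<Rightarrow> 'a) measure \<Rightarrow> bool" where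
  "invariant_prob E \<mu> \<longleftrightarrow> sets \<mu> = sets (shift_space E) \<and> prob_space \<mu> \<and>
     (\<forall>A\<in>sets \<mu>. emeasure \<mu> (shift -` A \<inter> space \<mu>) = emeasure \<mu> A)"

definition finite_partition :: "'b measure \<Rightarrow> 'b set set \<Rightarrow> bool" where
  "finite_partition \<mu> P \<longleftrightarrow> finite P \<and> P \<subseteq> sets \<mu> \<and> \<Union>P = space \<mu> \<and> disjoint P"

definition part_entropy :: "'b measure \<Rightarrow> 'b set set \<Rightarrow> real" where
  "part_entropy \<mu> P = - (\<Sum>A\<in>P. measure \<mu> A * ln (measure \<mu> A))"

definition refine :: "(nat \<Rightarrow> 'a) measure \<Rightarrow> (nat \<Rightarrow> 'a) set set \<Rightarrow> nat \<Rightarrow> (nat \<Rightarrow> 'a) set set" where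
  "refine \<mu> P n = {space \<mu> \<inter> (\<Inter>k<n. (shift ^^ k) -` F k) | F. \<forall>k<n. F k \<in> P}"

definition entropy_wrt :: "(nat \<Rightarrow> 'a) measure \<Rightarrow> (nat \<Rightarrow> 'a) set set \<Rightarrow> real" where
  "entropy_wrt \<mu> P = lim (\<lambda>n. part_entropy \<mu> (refine \<mu> P n) / real n)"

definition ks_entropy :: "(nat \<Rightarrow> 'a) measure \<Rightarrow> ereal" where
  "ks_entropy \<mu> = (SUP P\<in>{P. finite_partition \<mu> P}. ereal (entropy_wrt \<mu> P))"

definition ext_integral :: "'b measure \<Rightarrow> ('b \<Rightarrow> real) \<Rightarrow> ereal" where
  "ext_integral \<mu> f = enn2ereal (\<integral>\<^sup>+x. ennreal (f x) \<partial>\<mu>) - enn2ereal (\<integral>\<^sup>+x. ennreal (- f x) \<partial>\<mu>)"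

definition equilibrium_measure :: "('a \<Rightarrow> 'a \<Rightarrow> bool) \<Rightarrow> ((nat \<Rightarrow> 'a) \<Rightarrow> real) \<Rightarrow> (nat \<Rightarrow> 'a) measure \<Rightarrow> bool" where
  "equilibrium_measure E f m \<longleftrightarrow> invariant_prob E m \<and>
     (\<forall>\<nu>. invariant_prob E \<nu> \<longrightarrow> ks_entropy \<nu> + ext_integral \<nu> f \<le> ks_entropy m + ext_integral m f)"

definition sup_part :: "('a \<Rightarrow> 'a \<Rightarrow> bool) \<Rightarrow> ((nat \<Rightarrow> 'a) \<Rightarrow> real) \<Rightarrow> real set" where
  "sup_part E f = (\<lambda>x. \<bar>f x\<bar>) ` sigma_plus E"

definition hol_part :: "('a \<Rightarrow> 'a \<Rightarrow> bool) \<Rightarrow> real \<Rightarrow> ((nat \<Rightarrow> 'a) \<Rightarrow> real) \<Rightarrow> real set" where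
  "hol_part E \<beta> f = {\<bar>f x - f y\<bar> * exp (\<beta> * real (sep_time x y)) | x y.
       x \<in> sigma_plus E \<and> y \<in> sigma_plus E \<and> x \<noteq> y}"

definition in_H :: "('a \<Rightarrow> 'a \<Rightarrow> bool) \<Rightarrow> real \<Rightarrow> ((nat \<Rightarrow> 'a) \<Rightarrow> real) \<Rightarrow> bool" where
  "in_H E \<beta> f \<longleftrightarrow> bdd_above (sup_part E f) \<and> bdd_above (hol_part E \<beta> f)"

definition H_norm :: "('a \<Rightarrow> 'a \<Rightarrow> bool) \<Rightarrow> real \<Rightarrow> ((nat \<Rightarrow> 'a) \<Rightarrow> real) \<Rightarrow> real" where
  "H_norm E \<beta> f = Sup (insert 0 (sup_part E f)) + Sup (insert 0 (hol_part E \<beta> f))"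

definition asymp_var :: "(nat \<Rightarrow> 'a) measure \<Rightarrow> ((nat \<Rightarrow> 'a) \<Rightarrow> real) \<Rightarrow> real" where
  "asymp_var m f = lim (\<lambda>n. (1 / real n) *
      (\<integral>x. (birkhoff f n x - (\<integral>y. birkhoff f n y \<partial>m))\<^sup>2 \<partial>m))"

definition asymp_sd :: "(nat \<Rightarrow> 'a) measure \<Rightarrow> ((nat \<Rightarrow> 'a) \<Rightarrow> real) \<Rightarrow> real" where
  "asymp_sd m f = sqrt (asymp_var m f)"

end

theory Submission
  imports Defs
begin

text \<open>
  Normalising the potential by a positive harmonic function \<open>h\<close> of the transfer operator turns it into
  a Markov operator \<open>T\<close> with \<open>T 1 = 1\<close>; strong positive recurrence enters through the exponential decay
  of the weights of first returns to a state \<open>a\<close>, which also yields \<open>h\<close> from a cone contraction for the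
  operator induced on \<open>[a]\<close>.  The variational principle, applied to small perturbations of the
  potential, shows that an equilibrium measure \<open>m\<close> satisfies \<open>\<integral> T u dm = \<integral> u dm\<close>.  The Green function
  \<open>\<Sum> B\<^sup>k 1\<close> of excursions away from \<open>a\<close> is square integrable and dominates both a continuous solution
  \<open>v\<close> of the Poisson equation \<open>T v = v - (\<psi> - \<integral> \<psi> dm)\<close> and every continuous \<open>r\<close> with bounded
  \<open>r - r \<circ> shift\<close>.  With \<open>u = \<psi> - \<integral> \<psi> dm - v\<close> one gets \<open>\<psi> - \<integral> \<psi> dm = M + u - u \<circ> shift\<close>, where
  \<open>M = v + u \<circ> shift\<close> is a sequence of orthogonal increments along the shift, so the asymptotic
  variance of \<open>\<psi>\<close> is \<open>\<integral> M\<^sup>2 dm\<close>.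
\<close>

text \<open>With countably many states a cylinder need not be compact, and the solutions
  \<open>r\<close> and \<open>v\<close> may be unbounded, so no spectral gap is sought for the
  operator on all of \<open>X\<close>. Contraction is used on the cylinder of \<open>a\<close>
  alone, where cone functions have bounded oscillation; the excursion sum carries the result to the
  rest of \<open>X\<close>, at the price of unboundedness measured by the Green function. The
  measure \<open>m\<close> is known only as a maximiser, so its relation to \<open>T\<close> must be
  extracted from competing potentials. A competitor needs just a positive superharmonic function,
  which bounds entropy plus integral from above; its pressure is never computed. The Poisson
  equation is solved by a series: \<open>G\<close> solves it up to re-entry at \<open>a\<close>,
  iterates of \<open>Lb\<close> push the re-entry term forward, and they tend to a constant.
  Subtracting a multiple \<kappa> of the solution for the function 1 makes this constant vanish, so
  \<open>m\<close> does not enter the construction of \<open>v\<close>. A continuous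
  \<open>r\<close> with bounded \<open>r - r o shift\<close> grows at most linearly in the number of
  steps from \<open>a\<close>, and the Green function is at least that number.\<close>

lemma funpow_shift: "(shift ^^ k) x = (%i. x (i + k))"
 by (induction k) (auto simp: shift_def)

lemma funpow_shift_add: "(shift ^^ j) ((shift ^^ k) x) = (shift ^^ (j + k)) x"
 by (simp add: funpow_shift add.assoc)

lemma shift_case_nat [simp]: "shift (case_nat b x) = x"
 by (simp add: shift_def)

lemma case_nat_shift [simp]: "case_nat (x 0) (shift x) = x"
 by (auto simp: shift_def split: nat.splits)

lemma case_nat_in_sigma [simp]: "case_nat b x : sigma_plus E \<longleftrightarrow> E b (x 0) & x : sigma_plus E"
 unfolding sigma_plus_def by (auto split: nat.splits)

lemma shift_in_sigma [intro]: "x : sigma_plus E ==> shift x : sigma_plus E"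
 by (simp add: sigma_plus_def shift_def)

lemma funpow_shift_in_sigma [intro]: "x : sigma_plus E ==> (shift ^^ k) x : sigma_plus E"
 by (simp add: sigma_plus_def funpow_shift)

lemma birkhoff_0 [simp]: "birkhoff f 0 x = 0"
 by (simp add: birkhoff_def)

lemma birkhoff_Suc: "birkhoff f (Suc n) x = birkhoff f n x + f ((shift ^^ n) x)"
 by (simp add: birkhoff_def)

lemma birkhoff_Suc_shift: "birkhoff f (Suc n) x = f x + birkhoff f n (shift x)"
 unfolding birkhoff_def sum.lessThan_Suc_shift by (simp add: funpow_swap1)

text \<open>\<open>sep_time x x\<close> is a least element of the empty set, hence unspecified.
  Counting common letters treats the diagonal like any other pair and keeps \<open>n\<close>
  available as an induction parameter.\<close>

definition agree :: "nat => (nat => 'a) => (nat => 'a) => bool" where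
 "agree n x y \<longleftrightarrow> (\<forall>i<n. x i = y i)"

lemma agree_sym: "agree n x y ==> agree n y x"
 by (simp add: agree_def)

lemma agree_mono: "agree n x y ==> k <= n ==> agree k x y"
 by (simp add: agree_def)

lemma agree_case_nat [simp]: "agree (Suc n) (case_nat b x) (case_nat b y) \<longleftrightarrow> agree n x y"
 unfolding agree_def by (auto split: nat.splits)

lemma agree_shift: "agree (Suc n) x y ==> agree n (shift x) (shift y)"
 by (simp add: agree_def shift_def)

lemma agree_funpow_shift: "agree n x y ==> agree (n - k) ((shift ^^ k) x) ((shift ^^ k) y)"
 by (simp add: agree_def funpow_shift)

lemma agree_trivial [simp]: "agree n x x" "agree 0 x y"
 by (simp_all add: agree_def)

lemma agree_1 [simp]: "agree (Suc 0) x y \<longleftrightarrow> x 0 = y 0"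
 by (simp add: agree_def)

section \<open>Measurability on the shift space\<close>

lemma space_shift_space [simp]: "space (shift_space E) = sigma_plus E"
 by (simp add: shift_space_def space_measure_of_conv)

lemma cylinder_in_sets:
 "{x : sigma_plus E. \<forall>i<n. x i = w i} : sets (shift_space E)"
 unfolding shift_space_def by (subst sets_measure_of) (auto intro!: sigma_sets.Basic)

lemma cylinder_agree_in_sets: "{y : sigma_plus E. agree n y w} : sets (shift_space E)"
 unfolding agree_def by (rule cylinder_in_sets)

lemma measurable_to_shift_space:
 assumes "!!x. x : space M ==> f x : sigma_plus E"
  and "!!n w. {x : space M. \<forall>i<n. f x i = w i} : sets M"
 shows "f : measurable M (shift_space E)"
 unfolding shift_space_def
proof (rule measurable_sigma_sets[where ?\<Omega> = "sigma_plus E" and ?A = "{{x : sigma_plus E. \<forall>i<n. x i = w i} |n w. True}"])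
 show "sets (sigma (sigma_plus E) {{x : sigma_plus E. \<forall>i<n. x i = w i} |n w. True}) =
  sigma_sets (sigma_plus E) {{x : sigma_plus E. \<forall>i<n. x i = w i} |n w. True}"
  by (subst sets_measure_of) auto
 show "f : space M \<rightarrow> sigma_plus E" using assms(1) by auto
 fix y assume "y : {{x : sigma_plus E. \<forall>i<n. x i = w i} |n w. True}"
 then obtain n w where y: "y = {x : sigma_plus E. \<forall>i<n. x i = w i}" by auto
 have eq: "f -` y \<inter> space M = {x : space M. \<forall>i<n. f x i = w i}" using assms(1) y by auto
 show "f -` y \<inter> space M : sets M" unfolding eq by (rule assms(2))
qed auto

text \<open>An open set is the union of the cylinders inside it, and the finite words that index
  them form a countable type because the alphabet is countable. Most measurability proofs below
  reduce to this.\<close>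

lemma locally_constant_set_measurable:
 fixes E :: "'a::countable => 'a => bool"
 assumes "U \<subseteq> sigma_plus E"
  and loc: "!!x. x : U ==> \<exists>n. \<forall>y\<in>sigma_plus E. agree n y x --> y : U"
 shows "U : sets (shift_space E)"
proof -
 define cyl where "cyl w = {y : sigma_plus E. agree (length w) y (%i. w ! i)}" for w :: "'a list"
 have m: "cyl w : sets (shift_space E)" for w
  unfolding cyl_def by (rule cylinder_agree_in_sets)
 have "U = (\<Union>w\<in>{w. cyl w \<subseteq> U}. cyl w)"
 proof (rule set_eqI, rule iffI)
  fix x assume x: "x : U"
  then obtain n where n: "\<forall>y\<in>sigma_plus E. agree n y x --> y : U" using loc by blast
  have "agree n y (%i. map x [0..<n] ! i) \<longleftrightarrow> agree n y x" for y
   by (auto simp: agree_def)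
  then have "cyl (map x [0..<n]) = {y : sigma_plus E. agree n y x}"
   by (simp add: cyl_def)
  then show "x : (\<Union>w\<in>{w. cyl w \<subseteq> U}. cyl w)"
   using n x assms(1) by (intro UN_I[of "map x [0..<n]"]) auto
 qed auto
 also have "... : sets (shift_space E)"
  by (rule sets.countable_UN') (use m in auto)
 finally show ?thesis .
qed

lemma measurable_coord [measurable]:
 fixes E :: "'a::countable => 'a => bool"
 shows "(%x. x i) : measurable (shift_space E) (count_space UNIV)"
proof (rule measurableI)
 fix A :: "'a set"
 show "(%x. x i) -` A \<inter> space (shift_space E) : sets (shift_space E)"
  by (rule locally_constant_set_measurable) (auto simp: agree_def intro!: exI[of _ "Suc i"])
qed simp

lemma measurable_shift [measurable]:
 fixes E :: "'a::countable => 'a => bool"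
 shows "shift : measurable (shift_space E) (shift_space E)"
proof (rule measurable_to_shift_space)
 show "{x : space (shift_space E). \<forall>i<n. shift x i = w i} : sets (shift_space E)" for n and w :: "nat => 'a"
  by (rule locally_constant_set_measurable)
   (auto simp: agree_def shift_def intro!: exI[of _ "Suc n"])
qed auto

lemma measurable_funpow_shift [measurable]:
 fixes E :: "'a::countable => 'a => bool"
 shows "(shift ^^ k) : measurable (shift_space E) (shift_space E)"
proof (induction k)
 case (Suc k)
 then show ?case using measurable_comp[OF Suc measurable_shift[of E]] by simp
qed simp

text \<open>Prepending \<open>b\<close> is only a partial map of the shift space; the identity in
  the forbidden case keeps the values admissible. In \<open>tr\<close> that value is multiplied by
  zero.\<close>

lemma measurable_case_nat:
 fixes E :: "'a::countable => 'a => bool"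
 shows "(%x. if E b (x 0) then case_nat b x else x) : measurable (shift_space E) (shift_space E)"
proof (rule measurable_to_shift_space)
 show "{x : space (shift_space E). \<forall>i<n. (if E b (x 0) then case_nat b x else x) i = w i} : sets (shift_space E)"
  for n and w :: "nat => 'a"
 proof (rule locally_constant_set_measurable)
  fix x assume x: "x : {x : space (shift_space E). \<forall>i<n. (if E b (x 0) then case_nat b x else x) i = w i}"
  show "\<exists>k. \<forall>y\<in>sigma_plus E. agree k y x -->
    y : {x : space (shift_space E). \<forall>i<n. (if E b (x 0) then case_nat b x else x) i = w i}"
   using x
   by (intro exI[of _ "Suc n"]) (auto simp: agree_def split: nat.splits if_splits)
 qed auto
qed auto

lemma measurable_locally:
 fixes E :: "'a::countable => 'a => bool" and u :: "_ => 'b::{second_countable_topology}"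
 assumes "!!x U. x : sigma_plus E ==> open U ==> u x : U ==> \<exists>n. \<forall>y\<in>sigma_plus E. agree n y x --> u y : U"
 shows "u : borel_measurable (shift_space E)"
proof (rule borel_measurableI)
 fix S :: "'b set" assume "open S"
 then show "u -` S \<inter> space (shift_space E) : sets (shift_space E)"
  by (intro locally_constant_set_measurable) (use assms in auto)
qed

section \<open>Common letters, the metric and continuity\<close>

lemma agree_of_sep_time:
 assumes "x ~= y" "n <= sep_time x y" shows "agree n x y"
 unfolding agree_def sep_time_def
proof (intro allI impI)
 fix i assume "i < n"
 then have "i < (LEAST i. x i ~= y i)" using assms by (simp add: sep_time_def)
 then show "x i = y i" using not_less_Least by blast
qed

lemma sep_time_ge_of_agree:
 assumes "x ~= y" "agree n x y" shows "n <= sep_time x y"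
proof -
 obtain i where "x i ~= y i" using assms(1) by blast
 then have "x (sep_time x y) ~= y (sep_time x y)"
  unfolding sep_time_def by (rule LeastI)
 then show ?thesis using assms(2) unfolding agree_def by (meson not_le)
qed

text \<open>The distance is below \<open>exp (- n)\<close> exactly when more than \<open>n\<close>
  letters agree, so metric balls are cylinders. The pair \<open>x = y\<close>, where
  \<open>sep_time\<close> says nothing, is split off in both directions.\<close>

lemma shift_continuous_iff:
 "shift_continuous E r \<longleftrightarrow>
  (\<forall>x\<in>sigma_plus E. \<forall>\<epsilon>>0. \<exists>n. \<forall>y\<in>sigma_plus E. agree n x y --> \<bar>r x - r y\<bar> < \<epsilon>)"
proof -
 have "(\<exists>\<delta>>0. \<forall>y\<in>sigma_plus E. (x = y \<or> exp (- real (sep_time x y)) < \<delta>) --> \<bar>r x - r y\<bar> < \<epsilon>) \<longleftrightarrow>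
   (\<exists>n. \<forall>y\<in>sigma_plus E. agree n x y --> \<bar>r x - r y\<bar> < \<epsilon>)" (is "?L \<longleftrightarrow> ?R") if "\<epsilon> > 0" for x \<epsilon>
 proof
  assume ?L
  then obtain \<delta> where d: "\<delta> > 0"
   "\<forall>y\<in>sigma_plus E. (x = y \<or> exp (- real (sep_time x y)) < \<delta>) --> \<bar>r x - r y\<bar> < \<epsilon>" by blast
  obtain n :: nat where n: "real n > - ln \<delta>" using reals_Archimedean2 by blast
  have "\<bar>r x - r y\<bar> < \<epsilon>" if y: "y : sigma_plus E" "agree n x y" for y
  proof (cases "x = y")
   case False
   then have "n <= sep_time x y" using sep_time_ge_of_agree y by blast
   then have "- real (sep_time x y) < ln \<delta>" using n by linarith
   then have "exp (- real (sep_time x y)) < \<delta>"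
    using d(1) by (metis exp_less_mono exp_ln)
   then show ?thesis using d y by blast
  qed (use that \<open>\<epsilon> > 0\<close> in auto)
  then show ?R by blast
 next
  assume ?R
  then obtain n where n: "\<forall>y\<in>sigma_plus E. agree n x y --> \<bar>r x - r y\<bar> < \<epsilon>" by blast
  have "\<bar>r x - r y\<bar> < \<epsilon>" if y: "y : sigma_plus E" "x = y \<or> exp (- real (sep_time x y)) < exp (- real n)" for y
  proof (cases "x = y")
   case False
   then have "n <= sep_time x y" using y by auto
   then have "agree n x y" using agree_of_sep_time False by blast
   then show ?thesis using n y by blast
  qed (use \<open>\<epsilon> > 0\<close> in auto)
  then show ?L by (intro exI[of _ "exp (- real n)"]) auto
 qed
 then show ?thesis unfolding shift_continuous_def by (intro ball_cong all_cong1 imp_cong refl)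
qed

lemma measurable_shift_continuous:
 fixes E :: "'a::countable => 'a => bool"
 assumes "shift_continuous E r" shows "r : borel_measurable (shift_space E)"
proof (rule measurable_locally)
 fix x and U :: "real set" assume x: "x : sigma_plus E" "open U" "r x : U"
 then obtain \<epsilon> where e: "\<epsilon> > 0" "ball (r x) \<epsilon> \<subseteq> U" using open_contains_ball by blast
 then obtain n where "\<forall>y\<in>sigma_plus E. agree n x y --> \<bar>r x - r y\<bar> < \<epsilon>"
  using assms x unfolding shift_continuous_iff by blast
 then show "\<exists>n. \<forall>y\<in>sigma_plus E. agree n y x --> r y : U"
  using e by (intro exI[of _ n]) (auto simp: dist_real_def agree_def)
qed

section \<open>The transfer operator\<close>

text \<open>Values in the extended nonnegative reals make every manipulation of sums unconditional;
 restricting the prepended letter to a set of states gives the excursion operators below.\<close>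

definition tr :: "('a => 'a => bool) => ((nat => 'a) => real) => 'a set =>
  ((nat => 'a) => ennreal) => (nat => 'a) => ennreal" where
 "tr E f S u x = (\<integral>\<^sup>+b. (if b : S & E b (x 0)
   then ennreal (exp (f (case_nat b x))) * u (case_nat b x) else 0) \<partial>count_space UNIV)"

lemma tr_mono:
 assumes "!!y. y : sigma_plus E ==> y 0 : S ==> u y <= v y" "x : sigma_plus E"
 shows "tr E f S u x <= tr E f S v x"
 unfolding tr_def by (intro nn_integral_mono) (use assms in \<open>auto intro!: mult_left_mono\<close>)

lemma tr_cong:
 assumes "!!y. y : sigma_plus E ==> y 0 : S ==> u y = v y" "x : sigma_plus E"
 shows "tr E f S u x = tr E f S v x"
 by (rule antisym) (use assms in \<open>auto intro!: tr_mono\<close>)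

lemma tr_add: "tr E f S (%y. u y + v y) x = tr E f S u x + tr E f S v x"
 unfolding tr_def by (subst nn_integral_add[symmetric]) (auto intro!: nn_integral_cong simp: distrib_left)

lemma tr_cmult: "tr E f S (%y. c * u y) x = c * tr E f S u x"
 unfolding tr_def by (subst nn_integral_cmult[symmetric]) (auto intro!: nn_integral_cong simp: ac_simps)

lemma tr_zero [simp]: "tr E f S (%y. 0) x = 0"
 unfolding tr_def by (simp cong: if_cong)

text \<open>All points \<open>case_nat b x\<close> have the same shift \<open>x\<close>, so a factor
  that depends on the shift alone leaves the sum. This is the algebra behind the duality between the
  transfer operator and composition with the shift.\<close>

lemma tr_mult_shift: "tr E f S (%y. w (shift y) * u y) x = w x * tr E f S u x"
 unfolding tr_def by (subst nn_integral_cmult[symmetric]) (auto intro!: nn_integral_cong simp: ac_simps)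

lemma tr_suminf: "tr E f S (%y. \<Sum>k. u k y) x = (\<Sum>k. tr E f S (u k) x)"
 unfolding tr_def
 by (subst nn_integral_suminf[symmetric]) (auto intro!: nn_integral_cong simp: ennreal_suminf_cmult)

lemma tr_sum: "tr E f S (%y. \<Sum>k\<in>I. u k y) x = (\<Sum>k\<in>I. tr E f S (u k) x)"
 by (induction I rule: infinite_finite_induct) (auto simp: tr_add)

lemma tr_SUP:
 assumes "!!k y. u k y <= u (Suc k) y"
 shows "tr E f S (%y. SUP k. u k y) x = (SUP k. tr E f S (u k) x)"
proof -
 have "tr E f S (%y. SUP k. u k y) x = (\<integral>\<^sup>+b. (SUP k. (if b : S & E b (x 0)
   then ennreal (exp (f (case_nat b x))) * u k (case_nat b x) else 0)) \<partial>count_space UNIV)"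
  unfolding tr_def by (auto intro!: nn_integral_cong simp: SUP_mult_left_ennreal)
 also have "... = (SUP k. tr E f S (u k) x)"
  unfolding tr_def using assms
  by (intro nn_integral_monotone_convergence_SUP) (auto intro!: incseq_SucI le_funI mult_left_mono)
 finally show ?thesis .
qed

lemma tr_restrict: "tr E f S u x = tr E f UNIV (%y. indicator S (y 0) * u y) x"
 unfolding tr_def by (intro nn_integral_cong) (auto simp: indicator_def)

lemma tr_split: "tr E f UNIV u x = tr E f S u x + tr E f (- S) u x"
 unfolding tr_def by (subst nn_integral_add[symmetric]) (auto intro!: nn_integral_cong)

lemma tr_le_UNIV: "tr E f S u x <= tr E f UNIV u x"
 unfolding tr_split[of E f u x S] by simp

lemma tr_singleton:
 "tr E f {a} u x = (if E a (x 0) then ennreal (exp (f (case_nat a x))) * u (case_nat a x) else 0)"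
 unfolding tr_def by (subst nn_integral_count_space'[where A="{a}"]) auto

lemma tr_ge_point:
 assumes "b : S" "E b (x 0)"
 shows "ennreal (exp (f (case_nat b x))) * u (case_nat b x) <= tr E f S u x"
 unfolding tr_def using assms by (intro order_trans[OF _ nn_integral_ge_point[of b]]) auto

lemma tr_measurable [measurable]:
 fixes E :: "'a::countable => 'a => bool"
 assumes [measurable]: "f : borel_measurable (shift_space E)" "u : borel_measurable (shift_space E)"
 shows "tr E f S u : borel_measurable (shift_space E)"
proof -
 have [measurable]: "(%x. (if b : S & E b (x 0)
   then ennreal (exp (f (case_nat b x))) * u (case_nat b x) else 0)) : borel_measurable (shift_space E)" for b
 proof -
  have "(%x. (if b : S & E b (x 0) then ennreal (exp (f (case_nat b x))) * u (case_nat b x) else 0)) =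
   (%x. of_bool (b : S & E b (x 0)) * (ennreal (exp (f (if E b (x 0) then case_nat b x else x))) *
     u (if E b (x 0) then case_nat b x else x)))"
   by auto
  also have "... : borel_measurable (shift_space E)"
  proof (intro borel_measurable_times_ennreal)
   show "(%x. of_bool (b : S & E b (x 0)) :: ennreal) : borel_measurable (shift_space E)"
    by (rule measurable_compose[OF measurable_coord[of 0]]) simp
   show "(%x. ennreal (exp (f (if E b (x 0) then case_nat b x else x)))) : borel_measurable (shift_space E)"
    using measurable_compose[OF measurable_case_nat[of E b] assms(1)] by measurable
   show "(%x. u (if E b (x 0) then case_nat b x else x)) : borel_measurable (shift_space E)"
    using measurable_compose[OF measurable_case_nat[of E b] assms(2)] by measurable
  qed
  finally show ?thesis .
 qed
 \<comment> \<open>A countable parameter \<open>b\<close> turns separate measurability into joint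
   measurability, which integrating out \<open>b\<close> against counting measure requires.\<close>
 have "(%(x, b). (if b : S & E b (x 0) then ennreal (exp (f (case_nat b x))) * u (case_nat b x) else 0))
   : borel_measurable (shift_space E \<Otimes>\<^sub>M count_space UNIV)"
  unfolding case_prod_beta
  by (rule measurable_compose_countable'[where I=UNIV and g=snd and
    f="%b p. (if b : S & E b (fst p 0) then ennreal (exp (f (case_nat b (fst p)))) * u (case_nat b (fst p)) else 0)"])
   (auto intro: measurable_compose[OF measurable_fst])
 then show ?thesis
  unfolding tr_def
  by (rule sigma_finite_measure.borel_measurable_nn_integral[OF sigma_finite_measure_count_space])
qed

lemma tr_funpow_mono:
 assumes "!!y. y : sigma_plus E ==> u y <= v y" "x : sigma_plus E"
 shows "(tr E f S ^^ n) u x <= (tr E f S ^^ n) v x"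
 using assms(2) by (induction n arbitrary: x) (use assms(1) in \<open>auto intro: tr_mono\<close>)

lemma tr_funpow_cong:
 assumes "!!y. y : sigma_plus E ==> u y = v y" "x : sigma_plus E"
 shows "(tr E f S ^^ n) u x = (tr E f S ^^ n) v x"
 by (rule antisym) (use assms in \<open>auto intro!: tr_funpow_mono\<close>)

lemma tr_funpow_add:
 "(tr E f S ^^ n) (%y. u y + v y) = (%x. (tr E f S ^^ n) u x + (tr E f S ^^ n) v x)"
 by (induction n) (simp_all add: tr_add)

lemma tr_funpow_cmult: "(tr E f S ^^ n) (%y. c * u y) = (%x. c * (tr E f S ^^ n) u x)"
 by (induction n) (simp_all add: tr_cmult)

lemma tr_funpow_zero [simp]: "(tr E f S ^^ n) (%y. 0) = (%x. 0)"
 by (induction n) simp_all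

lemma tr_funpow_measurable [measurable]:
 fixes E :: "'a::countable => 'a => bool"
 assumes [measurable]: "f : borel_measurable (shift_space E)" "u : borel_measurable (shift_space E)"
 shows "(tr E f S ^^ n) u : borel_measurable (shift_space E)"
 by (induction n) (auto intro: tr_measurable simp: assms)

text \<open>This turns operator iterates into the weighted orbit sums that define partition
  functions; the restriction to \<open>S\<close> is what later singles out excursions and first
  returns.\<close>

lemma tr_funpow_preimages:
 fixes x :: "nat => 'a"
 assumes "x : sigma_plus E"
 shows "(tr E f S ^^ n) u x = (\<integral>\<^sup>+y. ennreal (exp (birkhoff f n y)) * u y
   \<partial>count_space {y : sigma_plus E. (shift ^^ n) y = x & (\<forall>i<n. y i : S)})"
 using assms
proof (induction n arbitrary: x)
 case 0
 then have "{y : sigma_plus E. (shift ^^ 0) y = x & (\<forall>i<0. y i : S)} = {x}" by auto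
 then show ?case by (simp add: nn_integral_count_space_finite)
next
 case (Suc n)
 define Y where "Y n x = {y : sigma_plus E. (shift ^^ n) y = x & (\<forall>i<n. y i : S)}" for n and x :: "nat => 'a"
 define g where "g n y = ennreal (exp (birkhoff f n y)) * u y" for n y
 \<comment> \<open>The outermost application of the operator prepends the letter at position
   \<open>n\<close> of the preimage, so \<open>b\<close> is determined by \<open>y\<close> and the
   double sum collapses to a sum over \<open>y\<close>.\<close>
 have split: "(b : S & E b (x 0) & y : Y n (case_nat b x)) \<longleftrightarrow> (y : Y (Suc n) x & b = y n)" for b y
 proof
  assume h: "b : S & E b (x 0) & y : Y n (case_nat b x)"
  then have yn: "(shift ^^ n) y = case_nat b x" "y : sigma_plus E" "\<forall>i<n. y i : S" by (auto simp: Y_def)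
  have "y n = b" using fun_cong[OF yn(1), of 0] by (simp add: funpow_shift del: funpow.simps)
  moreover have "(shift ^^ Suc n) y = x" using yn(1) by simp
  ultimately show "y : Y (Suc n) x & b = y n" using yn h by (auto simp: Y_def less_Suc_eq)
 next
  assume h: "y : Y (Suc n) x & b = y n"
  then have yn: "shift ((shift ^^ n) y) = x" "y : sigma_plus E" "\<forall>i<Suc n. y i : S" "b = y n" by (auto simp: Y_def)
  have b: "b = ((shift ^^ n) y) 0" using yn(4) by (simp add: funpow_shift)
  have eq: "(shift ^^ n) y = case_nat b x" unfolding b yn(1)[symmetric] by simp
  have "case_nat b x : sigma_plus E" unfolding eq[symmetric] using yn(2) by auto
  then show "b : S & E b (x 0) & y : Y n (case_nat b x)"
   using yn eq by (auto simp: Y_def)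
 qed
 have "(tr E f S ^^ Suc n) u x = (\<integral>\<^sup>+b. (if b : S & E b (x 0)
   then ennreal (exp (f (case_nat b x))) * (tr E f S ^^ n) u (case_nat b x) else 0) \<partial>count_space UNIV)"
  by (simp add: tr_def)
 also have "... = (\<integral>\<^sup>+b. (\<integral>\<^sup>+y. (if b : S & E b (x 0) & y : Y n (case_nat b x) then g (Suc n) y else 0) \<partial>count_space UNIV) \<partial>count_space UNIV)"
 proof (intro nn_integral_cong)
  fix b
  show "(if b : S & E b (x 0) then ennreal (exp (f (case_nat b x))) * (tr E f S ^^ n) u (case_nat b x) else 0) =
   (\<integral>\<^sup>+y. (if b : S & E b (x 0) & y : Y n (case_nat b x) then g (Suc n) y else 0) \<partial>count_space UNIV)"
  proof (cases "b : S & E b (x 0)")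
   case True
   then have "(tr E f S ^^ n) u (case_nat b x) = (\<integral>\<^sup>+y. g n y \<partial>count_space (Y n (case_nat b x)))"
    using Suc by (simp add: Y_def g_def)
   then have "ennreal (exp (f (case_nat b x))) * (tr E f S ^^ n) u (case_nat b x) =
    (\<integral>\<^sup>+y. ennreal (exp (f (case_nat b x))) * (g n y * indicator (Y n (case_nat b x)) y) \<partial>count_space UNIV)"
    by (simp add: nn_integral_count_space_indicator nn_integral_cmult)
   also have "... = (\<integral>\<^sup>+y. (if b : S & E b (x 0) & y : Y n (case_nat b x) then g (Suc n) y else 0) \<partial>count_space UNIV)"
    using True
    by (intro nn_integral_cong)
     (auto simp: indicator_def g_def birkhoff_Suc exp_add ennreal_mult Y_def ac_simps)
   finally show ?thesis using True by simp
  qed auto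
 qed
 also have "... = (\<integral>\<^sup>+b. (\<integral>\<^sup>+y. (if y : Y (Suc n) x & b = y n then g (Suc n) y else 0) \<partial>count_space UNIV) \<partial>count_space UNIV)"
  by (simp add: split)
 also have "... = (\<integral>\<^sup>+y. (\<integral>\<^sup>+b. (if y : Y (Suc n) x & b = y n then g (Suc n) y else 0) \<partial>count_space UNIV) \<partial>count_space UNIV)"
  using nn_integral_fst_count_space[of "%(b, y). if y : Y (Suc n) x & b = y n then g (Suc n) y else 0"]
   nn_integral_snd_count_space[of "%(b, y). if y : Y (Suc n) x & b = y n then g (Suc n) y else 0"]
  by simp
 also have "... = (\<integral>\<^sup>+y. g (Suc n) y * indicator (Y (Suc n) x) y \<partial>count_space UNIV)"
 proof (intro nn_integral_cong)
  fix y
  show "(\<integral>\<^sup>+b. (if y : Y (Suc n) x & b = y n then g (Suc n) y else 0) \<partial>count_space UNIV) =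
    g (Suc n) y * indicator (Y (Suc n) x) y"
   by (subst nn_integral_count_space'[where A="{y n}"]) auto
 qed
 also have "... = (\<integral>\<^sup>+y. g (Suc n) y \<partial>count_space (Y (Suc n) x))"
  by (simp add: nn_integral_count_space_indicator)
 finally show ?case by (simp add: Y_def g_def)
qed

lemma infsum_ennreal_eq_nn_integral:
 "infsum f A = (\<integral>\<^sup>+x. f x \<partial>count_space A)" for f :: "'b => ennreal"
proof -
 have "infsum f A = (SUP F\<in>{F. finite F & F \<subseteq> A}. sum f F)"
  by (rule nonneg_infsum_complete) simp
 also have "... = (\<integral>\<^sup>+x. f x \<partial>count_space A)"
 proof (rule antisym)
  show "(SUP F\<in>{F. finite F & F \<subseteq> A}. sum f F) <= (\<integral>\<^sup>+x. f x \<partial>count_space A)"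
  proof (rule SUP_least)
   fix F assume "F : {F. finite F & F \<subseteq> A}"
   then have "sum f F = (\<integral>\<^sup>+x. f x * indicator F x \<partial>count_space A)"
    by (subst nn_integral_count_space'[where A=F]) (auto intro!: sum.cong)
   also have "... <= (\<integral>\<^sup>+x. f x \<partial>count_space A)"
    by (intro nn_integral_mono) (auto simp: indicator_def)
   finally show "sum f F <= (\<integral>\<^sup>+x. f x \<partial>count_space A)" .
  qed
  show "(\<integral>\<^sup>+x. f x \<partial>count_space A) <= (SUP F\<in>{F. finite F & F \<subseteq> A}. sum f F)"
   unfolding nn_integral_def
  proof (rule SUP_least)
   fix g assume g: "g : {g. simple_function (count_space A) g & g <= f}"
   show "integral\<^sup>S (count_space A) g <= (SUP F\<in>{F. finite F & F \<subseteq> A}. sum f F)"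
   proof (cases "finite {x\<in>A. g x ~= 0}")
    case True
    have "integral\<^sup>S (count_space A) g = (\<integral>\<^sup>+x. g x \<partial>count_space A)"
     using g by (intro nn_integral_eq_simple_integral[symmetric]) auto
    also have "... = sum g {x\<in>A. g x ~= 0}"
     using True by (intro nn_integral_count_space') auto
    also have "... <= sum f {x\<in>A. g x ~= 0}" using g by (intro sum_mono) (auto simp: le_fun_def)
    also have "... <= (SUP F\<in>{F. finite F & F \<subseteq> A}. sum f F)"
     using True by (intro SUP_upper) auto
    finally show ?thesis .
   next
    \<comment> \<open>A simple function takes finitely many values, so with infinite support it
      takes some nonzero value infinitely often, and the finite partial sums of \<open>f\<close> are
      unbounded.\<close>
    case False
    have "finite (g ` A)" using g by (auto simp: simple_function_def)
    then obtain c where c: "c ~= 0" "infinite {x\<in>A. g x = c}"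
    proof -
     have "{x\<in>A. g x ~= 0} = (\<Union>c\<in>g ` A - {0}. {x\<in>A. g x = c})" by auto
     then have "\<exists>c\<in>g ` A - {0}. infinite {x\<in>A. g x = c}"
      using False \<open>finite (g ` A)\<close> by (metis (no_types, lifting) finite_Diff finite_UN)
     then show thesis using that by auto
    qed
    have "(SUP F\<in>{F. finite F & F \<subseteq> A}. sum f F) = \<infinity>"
    proof (rule ccontr)
     assume "(SUP F\<in>{F. finite F & F \<subseteq> A}. sum f F) ~= \<infinity>"
     then have fin: "(SUP F\<in>{F. finite F & F \<subseteq> A}. sum f F) < top"
      unfolding less_top infinity_ennreal_def by blast
     have "of_nat n * c <= (SUP F\<in>{F. finite F & F \<subseteq> A}. sum f F)" for n
     proof -
      obtain F where F: "F \<subseteq> {x\<in>A. g x = c}" "card F = n" "finite F"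
       using c(2) infinite_arbitrarily_large by metis
      have "of_nat n * c = sum g F"
       using F by (subst sum.cong[OF refl, of F g "%_. c"]) auto
      also have "... <= sum f F" using g by (intro sum_mono) (auto simp: le_fun_def)
      also have "... <= (SUP F\<in>{F. finite F & F \<subseteq> A}. sum f F)" using F by (intro SUP_upper) auto
      finally show ?thesis .
     qed
     then have le: "(SUP n. of_nat n * c) <= (SUP F\<in>{F. finite F & F \<subseteq> A}. sum f F)" by (rule SUP_least)
     have "(SUP n. of_nat n * c) = (SUP n. of_nat n) * c"
      by (simp add: SUP_mult_right_ennreal)
     also have "... = top" using c(1) by (simp add: ennreal_SUP_of_nat_eq_top ennreal_top_mult)
     finally show False using le fin by (metis not_le)
    qed
    then show ?thesis by (metis infinity_ennreal_def top_greatest)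
   qed
  qed
 qed
 finally show ?thesis .
qed

section \<open>Log-Lipschitz cones\<close>

locale markov_shift =
 fixes E :: "'a::countable => 'a => bool" and \<theta> :: real
 assumes theta: "0 < \<theta>" "\<theta> < 1" and irr: "!!a b. E\<^sup>+\<^sup>+ a b"
begin

abbreviation X :: "(nat => 'a) set" where "X \<equiv> sigma_plus E"

abbreviation V :: "'a => (nat => 'a) set" where "V a \<equiv> {x : X. x 0 = a}"

definition wvar :: "real => ((nat => 'a) => real) => bool" where
 "wvar B f \<longleftrightarrow> (\<forall>n\<ge>2. \<forall>x\<in>X. \<forall>y\<in>X. agree n x y --> \<bar>f x - f y\<bar> <= B * \<theta> ^ n)"

definition cone :: "(nat => 'a) set => real => ((nat => 'a) => ennreal) => bool" where
 "cone Y D u \<longleftrightarrow> (\<forall>n\<ge>1. \<forall>x\<in>Y. \<forall>y\<in>Y. agree n x y --> u x <= ennreal (exp (D * \<theta> ^ n)) * u y)"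

lemma coneI:
 assumes "!!n x y. n >= 1 ==> x : Y ==> y : Y ==> agree n x y ==> u x <= ennreal (exp (D * \<theta> ^ n)) * u y"
 shows "cone Y D u"
 using assms unfolding cone_def by blast

lemma coneD:
 assumes "cone Y D u" "n >= 1" "x : Y" "y : Y" "agree n x y"
 shows "u x <= ennreal (exp (D * \<theta> ^ n)) * u y"
 using assms unfolding cone_def by blast

lemma theta_pow: "0 < \<theta> ^ n" "\<theta> ^ n <= 1"
 using theta by (auto simp: power_le_one)

lemma cone_mono: "cone Y D u ==> D <= D' ==> cone Y D' u"
 unfolding cone_def
 by (meson dual_order.trans ennreal_leI exp_le_cancel_iff mult_right_mono theta_pow(1) less_imp_le zero_le)

lemma cone_subset: "cone Y D u ==> Z \<subseteq> Y ==> cone Z D u"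
 unfolding cone_def by blast

lemma cone_cong: "cone Y D u ==> (!!x. x : Y ==> u x = v x) ==> cone Y D v"
 unfolding cone_def by auto

lemma cone_const: "0 <= D ==> cone Y D (%_. c)"
 by (rule cone_mono[of _ 0]) (auto simp: cone_def)

lemma cone_mult: "cone Y D u ==> cone Y D' v ==> cone Y (D + D') (%x. u x * v x)"
 unfolding cone_def
proof (intro allI impI ballI)
 fix n x y assume *: "\<forall>n\<ge>1. \<forall>x\<in>Y. \<forall>y\<in>Y. agree n x y --> u x <= ennreal (exp (D * \<theta> ^ n)) * u y"
  "\<forall>n\<ge>1. \<forall>x\<in>Y. \<forall>y\<in>Y. agree n x y --> v x <= ennreal (exp (D' * \<theta> ^ n)) * v y"
  "1 <= n" "x : Y" "y : Y" "agree n x y"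
 have "u x * v x <= (ennreal (exp (D * \<theta> ^ n)) * u y) * (ennreal (exp (D' * \<theta> ^ n)) * v y)"
  using * by (intro mult_mono) auto
 also have "... = ennreal (exp ((D + D') * \<theta> ^ n)) * (u y * v y)"
  by (simp add: distrib_right exp_add ennreal_mult ac_simps)
 finally show "u x * v x <= ennreal (exp ((D + D') * \<theta> ^ n)) * (u y * v y)" .
qed

lemma cone_suminf: "(!!k. cone Y D (u k)) ==> cone Y D (%x. \<Sum>k. u k x)"
 unfolding cone_def by (auto simp flip: ennreal_suminf_cmult intro!: suminf_le)

lemma cone_inverse:
 assumes "cone Y D u" "!!x. x : Y ==> u x ~= 0 & u x ~= top"
 shows "cone Y D (%x. inverse (u x))"
proof (rule coneI)
 fix n x y assume *: "1 <= n" "x : Y" "y : Y" "agree n x y"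
 have le: "u y <= ennreal (exp (D * \<theta> ^ n)) * u x"
  using coneD[OF assms(1), of n y x] * agree_sym by blast
 obtain r where r: "u x = ennreal r" "0 < r"
  using assms(2)[OF *(2)] by (metis ennreal_cases ennreal_eq_0_iff less_eq_real_def order_less_irrefl)
 obtain s where s: "u y = ennreal s" "0 < s"
  using assms(2)[OF *(3)] by (metis ennreal_cases ennreal_eq_0_iff less_eq_real_def order_less_irrefl)
 have "s <= exp (D * \<theta> ^ n) * r" using le r s by (simp add: ennreal_mult[symmetric])
 then have "inverse r <= exp (D * \<theta> ^ n) * inverse s" using r s by (simp add: field_simps)
 then show "inverse (u x) <= ennreal (exp (D * \<theta> ^ n)) * inverse (u y)"
  using r s by (simp add: inverse_ennreal ennreal_mult[symmetric])
qed

text \<open>Prepending the same letter to two points gains one common coordinate, hence a factor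
  \<theta> on the distortion of both the weight and \<open>u\<close>. Only the points with a
  prepended letter are fed to \<open>u\<close>, so \<open>u\<close> is controlled on
  \<open>Y\<close> while the result is controlled on \<open>X\<close>.\<close>

lemma cone_tr:
 assumes f: "wvar B f" and u: "cone Y D u"
  and Y: "!!x b. x : X ==> b : S ==> E b (x 0) ==> case_nat b x : Y"
 shows "cone X (\<theta> * (B + D)) (tr E f S u)"
proof (rule coneI)
 fix n x y assume *: "1 <= n" "x : X" "y : X" "agree n x y"
 then have x0: "x 0 = y 0" by (auto simp: agree_def)
 have "ennreal (exp (f (case_nat b x))) * u (case_nat b x) \<le>
   ennreal (exp (\<theta> * (B + D) * \<theta> ^ n)) * (ennreal (exp (f (case_nat b y))) * u (case_nat b y))"
  if b: "b : S" "E b (x 0)" for b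
 proof -
  have ag: "agree (Suc n) (case_nat b x) (case_nat b y)" using * by simp
  have "\<bar>f (case_nat b x) - f (case_nat b y)\<bar> <= B * \<theta> ^ Suc n"
   using f[unfolded wvar_def, rule_format, OF _ _ _ ag] b * x0 by simp
  then have 1: "exp (f (case_nat b x)) <= exp (B * \<theta> ^ Suc n) * exp (f (case_nat b y))"
   unfolding exp_add[symmetric] exp_le_cancel_iff by linarith
  have 2: "u (case_nat b x) <= ennreal (exp (D * \<theta> ^ Suc n)) * u (case_nat b y)"
   using coneD[OF u _ _ _ ag] Y b * x0 by simp
  have "ennreal (exp (f (case_nat b x))) * u (case_nat b x) \<le>
   ennreal (exp (B * \<theta> ^ Suc n) * exp (f (case_nat b y))) * (ennreal (exp (D * \<theta> ^ Suc n)) * u (case_nat b y))"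
   using 1 2 by (intro mult_mono ennreal_leI) auto
  also have "... = (ennreal (exp (B * \<theta> ^ Suc n)) * ennreal (exp (D * \<theta> ^ Suc n))) * (ennreal (exp (f (case_nat b y))) * u (case_nat b y))"
   by (simp add: ennreal_mult ac_simps)
  also have "ennreal (exp (B * \<theta> ^ Suc n)) * ennreal (exp (D * \<theta> ^ Suc n)) = ennreal (exp (\<theta> * (B + D) * \<theta> ^ n))"
   by (simp add: ennreal_mult[symmetric] exp_add[symmetric] algebra_simps)
  finally show ?thesis .
 qed
 then show "tr E f S u x <= ennreal (exp (\<theta> * (B + D) * \<theta> ^ n)) * tr E f S u y"
  unfolding tr_def x0[symmetric]
  by (subst nn_integral_cmult[symmetric]) (auto intro!: nn_integral_mono)
qed

lemma cone_tr_funpow: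
 assumes f: "wvar B f" and u: "cone X D u" and D: "\<theta> * (B + D) <= D"
 shows "cone X D ((tr E f S ^^ n) u)"
proof (induction n)
 case (Suc n)
 have "cone X (\<theta> * (B + D)) (tr E f S ((tr E f S ^^ n) u))"
  by (rule cone_tr[OF f Suc]) auto
 then show ?case using D by (auto intro: cone_mono)
qed (simp add: u)

text \<open>Only lower semicontinuity is claimed, because \<open>u x\<close> may be infinite;
  superlevel sets are then open, which suffices for Borel measurability.\<close>

lemma cone_locally:
 assumes "cone X D u" "x : X" "c < u x"
 shows "\<exists>n. \<forall>y\<in>X. agree n y x --> c < u y"
proof -
 have lim: "(%n. ennreal (exp (- (D * \<theta> ^ n))) * u x) \<longlonglongrightarrow> ennreal (exp (- (D * 0))) * u x"
 proof (cases "u x = top")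
  case True
  then show ?thesis by (simp add: ennreal_mult_top)
 next
  case False
  have "(%n. \<theta> ^ n) \<longlonglongrightarrow> 0" using theta by (intro LIMSEQ_power_zero) auto
  from tendsto_exp[OF tendsto_minus[OF tendsto_mult[OF tendsto_const this]]]
  have "(%n. exp (- (D * \<theta> ^ n))) \<longlonglongrightarrow> exp (- (D * 0))" .
  then have "(%n. ennreal (exp (- (D * \<theta> ^ n)))) \<longlonglongrightarrow> ennreal (exp (- (D * 0)))" by (rule tendsto_ennrealI)
  from tendsto_mult_ennreal[OF this tendsto_const, of "u x"] show ?thesis using False by simp
 qed
 then have "\<forall>\<^sub>F n in sequentially. c < ennreal (exp (- (D * \<theta> ^ n))) * u x"
  using assms(3) by (intro order_tendstoD(1)[OF lim]) simp
 then obtain N where N: "!!n. n >= N ==> c < ennreal (exp (- (D * \<theta> ^ n))) * u x"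
  by (auto simp: eventually_sequentially)
 define n where "n = max N 1"
 have "c < u y" if y: "y : X" "agree n y x" for y
 proof -
  have "u x <= ennreal (exp (D * \<theta> ^ n)) * u y"
   using coneD[OF assms(1), of n x y] y assms(2) agree_sym by (auto simp: n_def)
  then have "ennreal (exp (- (D * \<theta> ^ n))) * u x <= ennreal (exp (- (D * \<theta> ^ n))) * (ennreal (exp (D * \<theta> ^ n)) * u y)"
   by (intro mult_left_mono) auto
  also have "... = u y"
   by (simp add: mult.assoc[symmetric] ennreal_mult[symmetric] exp_add[symmetric])
  finally show ?thesis using N[of n] by (simp add: n_def)
 qed
 then show ?thesis by blast
qed

lemma cone_measurable: "cone X D u ==> u : borel_measurable (shift_space E)"
proof (rule borel_measurableI_greater)
 fix c assume "cone X D u"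
 then show "{x : space (shift_space E). c < u x} : sets (shift_space E)"
  by (intro locally_constant_set_measurable) (auto dest: cone_locally)
qed

lemma wvar_measurable:
 assumes "wvar B f" shows "f : borel_measurable (shift_space E)"
proof (rule measurable_shift_continuous, unfold shift_continuous_iff, intro ballI allI impI)
 fix x and \<epsilon> :: real assume x: "x : X" and e: "\<epsilon> > 0"
 have "(%n. B * \<theta> ^ n) \<longlonglongrightarrow> B * 0" using theta by (intro tendsto_intros LIMSEQ_power_zero) auto
 then have "\<forall>\<^sub>F n in sequentially. B * \<theta> ^ n < \<epsilon>" using e by (intro order_tendstoD) auto
 then obtain N where N: "!!n. n >= N ==> B * \<theta> ^ n < \<epsilon>" by (auto simp: eventually_sequentially)
 show "\<exists>n. \<forall>y\<in>X. agree n x y --> \<bar>f x - f y\<bar> < \<epsilon>"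
  using assms x N[of "max N 2"] unfolding wvar_def
  by (intro exI[of _ "max N 2"]) (meson le_less_trans max.cobounded1 max.cobounded2)
qed

lemma wvar_nonneg: "wvar B f ==> wvar (max B 0) f"
 unfolding wvar_def using theta
 by (meson dual_order.trans max.cobounded1 mult_right_mono theta_pow(1) less_imp_le)

lemma wvar_add: "wvar B f ==> wvar C g ==> wvar (B + C) (%x. f x + g x)"
 unfolding wvar_def
proof (intro allI impI ballI)
 fix n :: nat and x y assume *: "\<forall>n\<ge>2. \<forall>x\<in>X. \<forall>y\<in>X. agree n x y --> \<bar>f x - f y\<bar> <= B * \<theta> ^ n"
  "\<forall>n\<ge>2. \<forall>x\<in>X. \<forall>y\<in>X. agree n x y --> \<bar>g x - g y\<bar> <= C * \<theta> ^ n" "2 <= n" "x : X" "y : X" "agree n x y"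
 then have "\<bar>f x - f y\<bar> <= B * \<theta> ^ n" "\<bar>g x - g y\<bar> <= C * \<theta> ^ n" by blast+
 then show "\<bar>f x + g x - (f y + g y)\<bar> <= (B + C) * \<theta> ^ n" by (simp add: algebra_simps abs_le_iff)
qed

lemma wvar_const: "wvar 0 (%_. c)"
 by (simp add: wvar_def)

lemma wvar_add_const: "wvar B f ==> wvar B (%x. f x + c)"
 by (simp add: wvar_def)

lemma wvar_ln_cone:
 assumes u: "cone X D (%x. ennreal (u x))" and pos: "!!x. x : X ==> u x > 0"
 shows "!!n x y. n >= 1 ==> x : X ==> y : X ==> agree n x y ==> \<bar>ln (u x) - ln (u y)\<bar> <= D * \<theta> ^ n"
proof -
 fix n x y assume *: "n >= (1::nat)" "x : X" "y : X" "agree n x y"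
 have le: "ln (u x) <= D * \<theta> ^ n + ln (u y)" if h: "x : X" "y : X" "agree n x y" for x y
 proof -
  have "ennreal (u x) <= ennreal (exp (D * \<theta> ^ n)) * ennreal (u y)" using coneD[OF u *(1)] h by blast
  then have "u x <= exp (D * \<theta> ^ n) * u y"
   using pos h by (simp add: ennreal_mult[symmetric] less_imp_le)
  then have "ln (u x) <= ln (exp (D * \<theta> ^ n) * u y)" using pos h by (subst ln_le_cancel_iff) auto
  then show ?thesis using pos[OF h(2)] by (simp add: ln_mult)
 qed
 show "\<bar>ln (u x) - ln (u y)\<bar> <= D * \<theta> ^ n" using le[of x y] le[of y x] * agree_sym[OF *(4)] by fastforce
qed

lemma wvar_ln:
 assumes "cone X D (%x. ennreal (u x))" "!!x. x : X ==> u x > 0"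
 shows "wvar D (%x. ln (u x))"
 using wvar_ln_cone[OF assms] unfolding wvar_def by simp

text \<open>The shift forgets one coordinate, whence the division by \<theta>. The bound at
  \<open>n = 2\<close> uses the cone condition at 1, which is one reason why cones start
  there.\<close>

lemma wvar_ln_shift:
 assumes "cone X D (%x. ennreal (u x))" "!!x. x : X ==> u x > 0"
 shows "wvar (D / \<theta>) (%x. - ln (u (shift x)))"
 unfolding wvar_def
proof (intro allI impI ballI)
 fix n :: nat and x y assume *: "2 <= n" "x : X" "y : X" "agree n x y"
 obtain k where k: "n = Suc k" "k >= 1" using *(1) by (cases n) auto
 have "\<bar>ln (u (shift x)) - ln (u (shift y))\<bar> <= D * \<theta> ^ k"
  using wvar_ln_cone[OF assms, of k "shift x" "shift y"] agree_shift[of k x y] * k by auto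
 also have "D * \<theta> ^ k = D / \<theta> * \<theta> ^ n" using k theta by simp
 finally show "\<bar>- ln (u (shift x)) - - ln (u (shift y))\<bar> <= D / \<theta> * \<theta> ^ n" by linarith
qed

text \<open>Bounded distortion: the summands with index \<open>i\<close> see
  \<open>n + k - i\<close> common letters, which gives a geometric series. With
  \<open>k >= 1\<close> even the last summand sees two common letters, the least number at which
  \<open>wvar\<close> says anything.\<close>

lemma wvar_birkhoff:
 assumes f: "wvar B f" "B >= 0" and xy: "x : X" "y : X" "agree (n + k) x y" "k >= 1"
 shows "\<bar>birkhoff f n x - birkhoff f n y\<bar> <= B * \<theta> ^ k / (1 - \<theta>)"
proof -
 have "\<bar>birkhoff f n x - birkhoff f n y\<bar> <= B * \<theta> ^ k * (\<Sum>i<n. \<theta> ^ i)"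
  using xy(1-3)
 proof (induction n arbitrary: x y)
  case (Suc n)
  have 1: "\<bar>f x - f y\<bar> <= B * \<theta> ^ (Suc n + k)"
   using f(1)[unfolded wvar_def, rule_format, of "Suc n + k" x y] Suc.prems \<open>k >= 1\<close> by simp
  have 2: "\<bar>birkhoff f n (shift x) - birkhoff f n (shift y)\<bar> <= B * \<theta> ^ k * (\<Sum>i<n. \<theta> ^ i)"
   using Suc.IH[of "shift x" "shift y"] Suc.prems agree_shift[of "n + k" x y] by auto
  have "B * \<theta> ^ (Suc n + k) <= B * \<theta> ^ k * \<theta> ^ n"
  proof -
   have "\<theta> ^ (Suc n + k) <= \<theta> ^ (k + n)" using theta by (intro power_decreasing) auto
   then show ?thesis using f(2) by (simp add: power_add mult_left_mono mult.assoc)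
  qed
  then show ?case using 1 2 by (simp add: birkhoff_Suc_shift distrib_left)
 qed simp
 also have "... <= B * \<theta> ^ k * (1 / (1 - \<theta>))"
 proof (intro mult_left_mono)
  have "(\<Sum>i<n. \<theta> ^ i) = (1 - \<theta> ^ n) / (1 - \<theta>)" using theta by (simp add: sum_gp_strict)
  also have "... <= 1 / (1 - \<theta>)" using theta by (intro divide_right_mono) auto
  finally show "(\<Sum>i<n. \<theta> ^ i) <= 1 / (1 - \<theta>)" .
 qed (use f theta in auto)
 finally show ?thesis by simp
qed

lemma wvar_birkhoff_1:
 assumes "wvar B f" "B >= 0" "x : X" "y : X" "agree (Suc n) x y"
 shows "\<bar>birkhoff f n x - birkhoff f n y\<bar> <= B / (1 - \<theta>)"
proof -
 have "\<bar>birkhoff f n x - birkhoff f n y\<bar> <= B * \<theta> ^ 1 / (1 - \<theta>)"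
  using wvar_birkhoff[OF assms(1-4), of n 1] assms(5) by simp
 also have "... <= B * 1 / (1 - \<theta>)" using theta assms(2) by (intro divide_right_mono mult_left_mono) auto
 finally show ?thesis by simp
qed

section \<open>Irreducibility\<close>

lemma path_to:
 assumes "x : X" obtains n y where "n >= 1" "y : X" "y 0 = b" "(shift ^^ n) y = x"
proof -
 have "\<exists>n y. n >= 1 & y : X & y 0 = b & (shift ^^ n) y = x" if "E\<^sup>+\<^sup>+ b c" "x : X" "x 0 = c" for c x
  using that
 proof (induction arbitrary: x rule: tranclp_induct)
  case (base c)
  then show ?case by (intro exI[of _ 1] exI[of _ "case_nat b x"]) auto
 next
  case (step c d)
  have "case_nat c x : X" using step by simp
  then obtain n y where "n >= 1 & y : X & y 0 = b & (shift ^^ n) y = case_nat c x"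
   using step.IH[of "case_nat c x"] by auto
  then show ?case by (intro exI[of _ "Suc n"] exI[of _ y]) auto
 qed
 from this[OF irr assms refl]
 have "\<exists>n y. n >= 1 & y : X & y 0 = b & (shift ^^ n) y = x" .
 then show thesis using that by blast
qed

lemma V_nonempty: "V a ~= {}"
proof -
 have "\<exists>c. E b c" for b using irr[of b b] by (metis tranclpD)
 then obtain s where s: "!!b. E b (s b)" by metis
 have "(%i. (s ^^ i) a) : V a" using s by (auto simp: sigma_plus_def)
 then show ?thesis by blast
qed

lemma periodic_point_exists:
 obtains z N where "z : X" "z 0 = a" "N >= 1" "(shift ^^ N) z = z"
proof -
 obtain x where x: "x : X" "x 0 = a" using V_nonempty[of a] by auto
 obtain n y where y: "n >= 1" "y : X" "y 0 = a" "(shift ^^ n) y = x" using path_to[OF x(1), of a] .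
 have yn: "y n = a" using fun_cong[OF y(4), of 0] x by (simp add: funpow_shift)
 define z where "z i = y (i mod n)" for i
 have "z : X"
 proof -
  have "E (z i) (z (Suc i))" for i
  proof (cases "Suc (i mod n) = n")
   case True
   then have "z (Suc i) = y n" using yn y by (simp add: z_def mod_Suc)
   moreover have "y n = y (Suc (i mod n))" using True by simp
   ultimately show ?thesis using y(2) by (auto simp: z_def sigma_plus_def)
  next
   case False
   then show ?thesis using y(2) by (simp add: z_def mod_Suc sigma_plus_def)
  qed
  then show ?thesis by (simp add: sigma_plus_def)
 qed
 moreover have "(shift ^^ n) z = z" by (simp add: funpow_shift z_def fun_eq_iff)
 moreover have "z 0 = a" using y by (simp add: z_def)
 ultimately show thesis using that y(1) by blast
qed

lemma superharmonic_path:
 assumes H: "!!x. x : X ==> tr E f UNIV H x <= H x" and y: "y : X"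
 shows "ennreal (exp (birkhoff f n y)) * H y <= H ((shift ^^ n) y)"
proof (induction n)
 case (Suc n)
 define z where "z = (shift ^^ n) y"
 have z: "z : X" using y by (auto simp: z_def)
 have "ennreal (exp (birkhoff f (Suc n) y)) * H y = ennreal (exp (f z)) * (ennreal (exp (birkhoff f n y)) * H y)"
  by (simp add: birkhoff_Suc z_def exp_add ennreal_mult ac_simps)
 also have "... <= ennreal (exp (f (case_nat (z 0) (shift z)))) * H (case_nat (z 0) (shift z))"
  using Suc by (auto simp: z_def intro!: mult_left_mono)
 also have "... <= tr E f UNIV H (shift z)"
  using z by (intro tr_ge_point) (auto simp: sigma_plus_def shift_def)
 also have "... <= H (shift z)" using z by (intro H) auto
 finally show ?case by (simp add: z_def)
qed simp

text \<open>Irreducibility supplies a path that starts in the cylinder of \<open>x 0\<close> and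
  ends at \<open>x0\<close>. Superharmonicity makes \<open>H\<close> finite at the start of the
  path, and the cone condition carries this to \<open>x\<close>, which has the same first
  letter.\<close>

lemma superharmonic_finite:
 assumes H: "!!x. x : X ==> tr E f UNIV H x <= H x" and c: "cone X D H"
  and x0: "x0 : X" "H x0 ~= top" and x: "x : X"
 shows "H x ~= top"
proof -
 obtain n y where y: "n >= 1" "y : X" "y 0 = x 0" "(shift ^^ n) y = x0" using path_to[OF x0(1), of "x 0"] .
 have "ennreal (exp (birkhoff f n y)) * H y <= H x0" using superharmonic_path[OF H y(2), of n] y by simp
 then have "ennreal (exp (birkhoff f n y)) * H y ~= top" using x0(2) by (metis top.extremum_uniqueI)
 then have "H y < top" by (auto simp: ennreal_mult_eq_top_iff less_top[symmetric])
 then have "ennreal (exp (D * \<theta> ^ 1)) * H y < top" by (simp add: ennreal_mult_less_top)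
 moreover have "H x <= ennreal (exp (D * \<theta> ^ 1)) * H y" using coneD[OF c, of 1 x y] x y by simp
 ultimately show ?thesis by (metis le_less_trans less_irrefl)
qed

text \<open>Mirror image of the finiteness argument: the path now ends at \<open>x\<close> and
  starts in the cylinder of the point where \<open>H\<close> does not vanish.\<close>

lemma superharmonic_pos:
 assumes H: "!!x. x : X ==> tr E f UNIV H x <= H x" and c: "cone X D H"
  and x0: "x0 : X" "H x0 ~= 0" and x: "x : X"
 shows "H x ~= 0"
proof -
 obtain n y where y: "n >= 1" "y : X" "y 0 = x0 0" "(shift ^^ n) y = x" using path_to[OF x, of "x0 0"] .
 have "ennreal (exp (birkhoff f n y)) * H y <= H x" using superharmonic_path[OF H y(2), of n] y by simp
 moreover have "H y ~= 0"
 proof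
  assume "H y = 0"
  then have "H x0 <= ennreal (exp (D * \<theta> ^ 1)) * 0" using coneD[OF c, of 1 x0 y] x0 y by simp
  then show False using x0 by simp
 qed
 ultimately show ?thesis by auto
qed

section \<open>Partition functions as transfer-operator iterates\<close>

text \<open>A preimage of \<open>x\<close> that starts at \<open>a = x 0\<close> begins with a word
  returning to \<open>a\<close>, and so does a periodic point; repeating the word and prolonging it
  by \<open>x\<close> are inverse to each other. Paired points share \<open>n + 1\<close> letters,
  so bounded distortion compares their weights. The predicate \<open>R\<close> may look at the word
  only.\<close>

lemma preimages_periodic:
 assumes x: "x : X" "x 0 = a" and n: "n >= 1" and R: "!!y z. agree n y z ==> R y = R z"
  and f: "wvar B f" "B >= 0"
 defines "P \<equiv> {y : X. (shift ^^ n) y = x & y 0 = a & R y}"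
  and "Q \<equiv> {z : X. (shift ^^ n) z = z & z 0 = a & R z}"
 shows "(\<integral>\<^sup>+y. ennreal (exp (birkhoff f n y)) \<partial>count_space P) \<le>
   ennreal (exp (B / (1 - \<theta>))) * (\<integral>\<^sup>+z. ennreal (exp (birkhoff f n z)) \<partial>count_space Q)" (is ?A)
  and "(\<integral>\<^sup>+z. ennreal (exp (birkhoff f n z)) \<partial>count_space Q) \<le>
   ennreal (exp (B / (1 - \<theta>))) * (\<integral>\<^sup>+y. ennreal (exp (birkhoff f n y)) \<partial>count_space P)" (is ?B)
proof -
 define per where "per y = (%i. y (i mod n))" for y :: "nat => 'a"
 have per_in: "per y : Q" if "y : P" for y
 proof -
  have y: "y : X" "(shift ^^ n) y = x" "y 0 = a" "R y" using that by (auto simp: P_def)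
  have yn: "y n = a" using fun_cong[OF y(2), of 0] x by (simp add: funpow_shift)
  have "E (per y i) (per y (Suc i))" for i
  proof (cases "Suc (i mod n) = n")
   case True
   then have "per y (Suc i) = y (Suc (i mod n))" using yn y(3) by (simp add: per_def mod_Suc)
   then show ?thesis using y(1) by (auto simp: per_def sigma_plus_def)
  next
   case False
   then show ?thesis using y(1) by (simp add: per_def mod_Suc sigma_plus_def)
  qed
  moreover have "R (per y)" using R[of "per y" y] y by (simp add: agree_def per_def)
  ultimately show ?thesis using y by (simp add: Q_def sigma_plus_def funpow_shift per_def)
 qed
 define app where "app z = (%i. if i < n then z i else x (i - n))" for z :: "nat => 'a"
 have app_in: "app z : P" if "z : Q" for z
 proof -
  have z: "z : X" "(shift ^^ n) z = z" "z 0 = a" "R z" using that by (auto simp: Q_def)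
  have zn: "z n = a" using fun_cong[OF z(2), of 0] z by (simp add: funpow_shift)
  have "E (app z i) (app z (Suc i))" for i
  proof -
   consider "Suc i < n" | "Suc i = n" | "n <= i" by linarith
   then show ?thesis
   proof cases
    case 2
    then have "app z (Suc i) = z (Suc i)" using zn x by (simp add: app_def)
    moreover have "E (z i) (z (Suc i))" using z(1) by (simp add: sigma_plus_def)
    ultimately show ?thesis using 2 by (simp add: app_def)
   qed (use z(1) x(1) in \<open>auto simp: app_def sigma_plus_def Suc_diff_le\<close>)
  qed
  moreover have "R (app z)" using R[of "app z" z] z by (simp add: agree_def app_def)
  ultimately show ?thesis using z n by (simp add: P_def sigma_plus_def funpow_shift app_def)
 qed
 have pa: "per (app z) = z" if "z : Q" for z
 proof
  fix i
  have "z (j + n * k) = z j" for j k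
  proof (induction k)
   case (Suc k)
   have "z (j + n * k + n) = z (j + n * k)"
    using that by (auto simp: Q_def funpow_shift dest: fun_cong[of _ _ "j + n * k"])
   then show ?case using Suc by (simp add: algebra_simps)
  qed simp
  from this[of "i mod n" "i div n"] show "per (app z) i = z i"
   using n by (simp add: per_def app_def)
 qed
 have ap: "app (per y) = y" if "y : P" for y
 proof
  fix i
  have "y (i - n + n) = x (i - n)" using that by (auto simp: P_def funpow_shift)
  then show "app (per y) i = y i" by (auto simp: app_def per_def)
 qed
 have bij: "bij_betw per P Q" by (rule bij_betw_byWitness[where f'=app]) (use per_in app_in pa ap in auto)
 have d: "\<bar>birkhoff f n y - birkhoff f n (per y)\<bar> <= B / (1 - \<theta>)" if "y : P" for y
 proof (rule wvar_birkhoff_1[OF f])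
  have "y n = a" using that x fun_cong[of "(shift ^^ n) y" x 0] by (auto simp: P_def funpow_shift)
  then show "agree (Suc n) y (per y)"
   using that by (auto simp: agree_def per_def P_def less_Suc_eq)
 qed (use that per_in[OF that] in \<open>auto simp: P_def Q_def\<close>)
 have Q: "(\<integral>\<^sup>+z. ennreal (exp (birkhoff f n z)) \<partial>count_space Q) = (\<integral>\<^sup>+y. ennreal (exp (birkhoff f n (per y))) \<partial>count_space P)"
  by (rule nn_integral_bij_count_space[OF bij, symmetric])
 have e: "exp s <= exp c * exp t" if "\<bar>s - t\<bar> <= c" for s t c :: real
  unfolding exp_add[symmetric] exp_le_cancel_iff using that by linarith
 show ?A unfolding Q
  by (subst nn_integral_cmult[symmetric])
   (auto intro!: nn_integral_mono simp: ennreal_mult[symmetric] e d)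
 show ?B unfolding Q
  by (subst nn_integral_cmult[symmetric])
   (auto intro!: nn_integral_mono simp: ennreal_mult[symmetric] e d abs_minus_commute)
qed

lemma tr_funpow_Zn:
 assumes x: "x : X" "x 0 = a" and n: "n >= 1" and f: "wvar B f" "B >= 0"
 shows "(tr E f UNIV ^^ n) (%y. indicator {a} (y 0)) x <= ennreal (exp (B / (1 - \<theta>))) * Zn E f a n"
  and "Zn E f a n <= ennreal (exp (B / (1 - \<theta>))) * (tr E f UNIV ^^ n) (%y. indicator {a} (y 0)) x"
proof -
 have eq: "(tr E f UNIV ^^ n) (%y. indicator {a} (y 0)) x =
   (\<integral>\<^sup>+y. ennreal (exp (birkhoff f n y)) \<partial>count_space {y : X. (shift ^^ n) y = x & y 0 = a & True})"
  unfolding tr_funpow_preimages[OF x(1)]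
  by (auto simp: nn_integral_count_space_indicator intro!: nn_integral_cong split: split_indicator)
 have Z: "Zn E f a n = (\<integral>\<^sup>+z. ennreal (exp (birkhoff f n z)) \<partial>count_space {z : X. (shift ^^ n) z = z & z 0 = a & True})"
  by (simp add: Zn_def infsum_ennreal_eq_nn_integral)
 show "(tr E f UNIV ^^ n) (%y. indicator {a} (y 0)) x <= ennreal (exp (B / (1 - \<theta>))) * Zn E f a n"
  unfolding eq Z by (rule preimages_periodic(1)[OF x n _ f]) simp
 show "Zn E f a n <= ennreal (exp (B / (1 - \<theta>))) * (tr E f UNIV ^^ n) (%y. indicator {a} (y 0)) x"
  unfolding eq Z by (rule preimages_periodic(2)[OF x n _ f]) simp
qed

text \<open>The excursion has \<open>k\<close> letters outside \<open>a\<close> after the initial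
  \<open>a\<close>, so its return time is \<open>Suc k\<close>; the same shift of index reappears
  when the potential is perturbed by a constant.\<close>

lemma tr_first_return_Zn_star:
 assumes x: "x : X" "x 0 = a" and f: "wvar B f" "B >= 0"
 shows "(tr E f (- {a}) ^^ k) (tr E f {a} (%_. 1)) x <= ennreal (exp (B / (1 - \<theta>))) * Zn_star E f a (Suc k)"
proof -
 define R where "R y \<longleftrightarrow> (\<forall>j. 0 < j & j < Suc k --> y j ~= a)" for y :: "nat => 'a"
 define P where "P = {y : X. (shift ^^ Suc k) y = x & y 0 = a & R y}"
 define P0 where "P0 = {y : X. (shift ^^ k) y = x & (\<forall>i<k. y i : - {a}) & E a (y 0)}"
 have bij: "bij_betw (case_nat a) P0 P"
 proof (rule bij_betw_byWitness[where f'=shift])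
  show "\<forall>y\<in>P0. shift (case_nat a y) = y" by simp
  show "\<forall>y\<in>P. case_nat a (shift y) = y" by (auto simp: P_def simp del: case_nat_shift) (metis case_nat_shift)
  show "case_nat a ` P0 \<subseteq> P"
   by (auto simp: P0_def P_def R_def funpow_swap1 split: nat.splits)
  show "shift ` P \<subseteq> P0"
  proof (clarsimp simp: P0_def P_def R_def funpow_swap1, intro conjI)
   fix y assume y: "y : X" "a = y 0" "\<forall>j. 0 < j & j < Suc k --> y j ~= y 0"
   show "shift y : X" using y by auto
   show "\<forall>i<k. shift y i ~= y 0" using y by (simp add: shift_def)
   show "E (y 0) (shift y 0)" using y by (simp add: shift_def sigma_plus_def)
  qed
 qed
 have "(tr E f (- {a}) ^^ k) (tr E f {a} (%_. 1)) x =
  (\<integral>\<^sup>+y. ennreal (exp (birkhoff f (Suc k) (case_nat a y))) \<partial>count_space P0)"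
  unfolding tr_funpow_preimages[OF x(1)] tr_singleton
  by (auto simp: nn_integral_count_space_indicator P0_def birkhoff_Suc_shift exp_add ennreal_mult ac_simps
    intro!: nn_integral_cong split: split_indicator)
 also have "... = (\<integral>\<^sup>+y. ennreal (exp (birkhoff f (Suc k) y)) \<partial>count_space P)"
  by (rule nn_integral_bij_count_space[OF bij])
 also have "... <= ennreal (exp (B / (1 - \<theta>))) *
   (\<integral>\<^sup>+z. ennreal (exp (birkhoff f (Suc k) z)) \<partial>count_space {z : X. (shift ^^ Suc k) z = z & z 0 = a & R z})"
  unfolding P_def by (rule preimages_periodic(1)[OF x _ _ f]) (auto simp: R_def agree_def)
 also have "{z : X. (shift ^^ Suc k) z = z & z 0 = a & R z} = {z : X. (shift ^^ Suc k) z = z & z 0 = a &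
   0 < Suc k & (\<forall>j. 0 < j & j < Suc k --> z j ~= a)}"
  by (auto simp: R_def)
 finally show ?thesis unfolding Zn_star_def infsum_ennreal_eq_nn_integral .
qed

end

lemma le_of_exp_geometric:
 fixes A B' C \<gamma> :: real
 assumes "0 <= \<gamma>" "\<gamma> < 1" "!!n. A <= exp (C * \<gamma> ^ n) * B'"
 shows "A <= B'"
proof -
 have "(%n. \<gamma> ^ n) \<longlonglongrightarrow> 0" using assms by (intro LIMSEQ_power_zero) auto
 from tendsto_mult_right[OF tendsto_exp[OF tendsto_mult_left[OF this, of C]], of B']
 have "(%n. exp (C * \<gamma> ^ n) * B') \<longlonglongrightarrow> B'" by simp
 then show ?thesis by (rule LIMSEQ_le_const) (use assms in auto)
qed

context markov_shift
begin

section \<open>The induced operator\<close>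

text \<open>\<open>G\<close> sums over excursions that avoid \<open>a\<close>, so \<open>Lb\<close> is the transfer operator of the first
 return map to the cylinder of \<open>a\<close>, extended to all of \<open>X\<close>, without any reference to words.\<close>

definition G :: "((nat => 'a) => real) => 'a => ((nat => 'a) => ennreal) => (nat => 'a) => ennreal" where
 "G f a u x = (\<Sum>k. (tr E f (- {a}) ^^ k) u x)"

definition Lb :: "((nat => 'a) => real) => 'a => ((nat => 'a) => ennreal) => (nat => 'a) => ennreal" where
 "Lb f a u = G f a (tr E f {a} u)"

lemma G_mono:
 assumes "!!y. y : X ==> u y <= v y" "x : X" shows "G f a u x <= G f a v x"
 unfolding G_def by (intro suminf_le tr_funpow_mono assms) auto

lemma G_add: "G f a (%x. u x + v x) x = G f a u x + G f a v x"
 unfolding G_def tr_funpow_add by (rule suminf_add[symmetric]) auto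

lemma G_cmult: "G f a (%x. c * u x) x = c * G f a u x"
 unfolding G_def tr_funpow_cmult by (rule ennreal_suminf_cmult)

lemma G_unfold: "G f a u x = u x + tr E f (- {a}) (G f a u) x"
proof -
 have "G f a u x = (tr E f (- {a}) ^^ 0) u x + (\<Sum>k. (tr E f (- {a}) ^^ Suc k) u x)"
  unfolding G_def by (subst suminf_offset[of _ 1]) auto
 also have "(\<Sum>k. (tr E f (- {a}) ^^ Suc k) u x) = tr E f (- {a}) (G f a u) x"
  unfolding G_def tr_suminf by simp
 finally show ?thesis by simp
qed

text \<open>The excursion series is the smallest nonnegative supersolution of its own renewal
  equation. This serves to bound a full Green function from below by its excursions.\<close>

lemma G_least:
 assumes U: "!!x. x : X ==> w x + tr E f (- {a}) U x <= U x" and x: "x : X"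
 shows "G f a w x <= U x"
proof -
 have "(\<Sum>k<n. (tr E f (- {a}) ^^ k) w x) <= U x" if "x : X" for n x
  using that
 proof (induction n arbitrary: x)
  case (Suc n)
  have "(\<Sum>k<Suc n. (tr E f (- {a}) ^^ k) w x) = w x + tr E f (- {a}) (%x. \<Sum>k<n. (tr E f (- {a}) ^^ k) w x) x"
   by (simp add: sum.lessThan_Suc_shift tr_sum del: sum.lessThan_Suc)
  also have "... <= w x + tr E f (- {a}) U x"
   using Suc by (intro add_left_mono tr_mono) auto
  also have "... <= U x" using U Suc by blast
  finally show ?case .
 qed simp
 then show ?thesis unfolding G_def by (auto simp: suminf_eq_SUP intro!: SUP_least x)
qed

lemma G_ge: "u x <= G f a u x"
 by (subst G_unfold) simp

text \<open>The innermost step prepends \<open>a\<close>, so \<open>Lb\<close> reads its argument on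
  the cylinder of \<open>a\<close> alone although it produces a function on
  \<open>X\<close>.\<close>

lemma Lb_mono:
 assumes "!!y. y : V a ==> u y <= v y" "x : X" shows "Lb f a u x <= Lb f a v x"
 unfolding Lb_def
proof (rule G_mono[OF _ assms(2)])
 fix y assume "y : X"
 then show "tr E f {a} u y <= tr E f {a} v y" using assms(1) by (intro tr_mono) auto
qed

lemma Lb_cong:
 assumes "!!y. y : V a ==> u y = v y" "x : X" shows "Lb f a u x = Lb f a v x"
 by (rule antisym) (use assms in \<open>auto intro!: Lb_mono\<close>)

lemma Lb_add: "Lb f a (%x. u x + v x) x = Lb f a u x + Lb f a v x"
 unfolding Lb_def G_add[symmetric] by (simp add: tr_add[abs_def])

lemma Lb_cmult: "Lb f a (%x. c * u x) x = c * Lb f a u x"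
 unfolding Lb_def G_cmult[symmetric] by (simp add: tr_cmult[abs_def])

lemma Lb_zero [simp]: "Lb f a (%x. 0) x = 0"
 using Lb_cmult[of f a 0 "%_. 0" x] by simp

lemma Lb_unfold: "Lb f a u x = tr E f {a} u x + tr E f (- {a}) (Lb f a u) x"
 unfolding Lb_def by (rule G_unfold)

lemma cone_G:
 assumes "wvar B f" "cone X D u" "\<theta> * (B + D) <= D"
 shows "cone X D (G f a u)"
 unfolding G_def[abs_def] by (intro cone_suminf cone_tr_funpow[OF assms])

text \<open>The gain \<theta> is made by the one step that prepends \<open>a\<close>. The excursion
  sum then preserves the improved cone, because an admissible constant \<open>D\<close> yields the
  admissible constant \<open>\<theta> * (B + D)\<close>.\<close>

lemma cone_Lb:
 assumes f: "wvar B f" and u: "cone (V a) D u" and D: "\<theta> * (B + D) <= D"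
 shows "cone X (\<theta> * (B + D)) (Lb f a u)"
 unfolding Lb_def
proof (rule cone_G[OF f])
 show "cone X (\<theta> * (B + D)) (tr E f {a} u)" by (rule cone_tr[OF f u]) auto
 show "\<theta> * (B + \<theta> * (B + D)) <= \<theta> * (B + D)" using D theta by (intro mult_left_mono) auto
qed

lemma cone_V_bounds:
 assumes "cone (V a) D u" "x : V a" "y : V a" "0 <= D"
 shows "u x <= ennreal (exp D) * u y"
proof -
 have "u x <= ennreal (exp (D * \<theta> ^ 1)) * u y" using coneD[OF assms(1), of 1 x y] assms by simp
 also have "... <= ennreal (exp D) * u y"
  using assms(4) theta by (intro mult_right_mono ennreal_leI) (auto intro: mult_left_le)
 finally show ?thesis .
qed

text \<open>The fraction \<open>(D - D') / D * exp (- D)\<close> of the infimum can be removed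
  without leaving the larger cone, and the infimum is at least \<open>exp (- D)\<close> times the
  function; the product of both is the proportion lost in one step.\<close>

definition gam :: "real => real => real" where
 "gam D D' = 1 - (D - D') / D * exp (- (2 * D))"

lemma gam_bounds:
 assumes "0 <= D'" "D' < D" shows "0 <= gam D D'" "gam D D' < 1"
proof -
 have "(D - D') / D <= 1" "0 < (D - D') / D" using assms by (auto simp: field_simps)
 moreover have "exp (- (2 * D)) <= 1" "0 < exp (- (2 * D))" using assms by auto
 ultimately have "(D - D') / D * exp (- (2 * D)) <= 1" "0 < (D - D') / D * exp (- (2 * D))"
  by (auto intro: mult_le_one mult_pos_pos simp del: times_divide_eq_left)
 then show "0 <= gam D D'" "gam D D' < 1" unfolding gam_def by linarith+
qed

text \<open>A function in the smaller cone stays in the larger one after subtracting a fixed fraction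
 of its infimum. Since constants are fixed, each step therefore shrinks the nonconstant part
 by a definite factor.\<close>

lemma cone_contraction:
 fixes K :: "nat => ((nat => 'a) => ennreal) => (nat => 'a) => ennreal"
 assumes const: "!!n c u x. x : V a ==> 0 <= c ==> K n (%y. ennreal c + u y) x = ennreal c + K n u x"
  and mono: "!!n u v x. (!!y. y : V a ==> u y <= v y) ==> x : V a ==> K n u x <= K n v x"
  and zero: "!!n x. x : V a ==> K n (%_. 0) x = 0"
  and conemap: "!!n u. cone (V a) D u ==> cone (V a) D' (K n u)"
  and D: "0 <= D'" "D' < D"
  and U0: "cone (V a) D (U 0)" "!!x. x : V a ==> U 0 x <= ennreal S" "0 <= S"
  and US: "!!n x. x : V a ==> U (Suc n) x = K n (U n) x"
 shows "\<exists>c\<ge>0. \<forall>x\<in>V a. ennreal c <= U n x & U n x <= ennreal (c + gam D D' ^ n * S)"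
proof -
 define \<gamma> where "\<gamma> = gam D D'"
 have \<gamma>: "0 <= \<gamma>" "\<gamma> < 1" using gam_bounds[OF D] by (auto simp: \<gamma>_def)
 have cong: "K n u x = K n v x" if "!!y. y : V a ==> u y = v y" "x : V a" for n u v x
  by (rule antisym; rule mono) (use that in auto)
 \<comment> \<open>The iterate splits into an accumulated constant, which the operators reproduce
   exactly, and a remainder \<open>w\<close> that stays in the cone while its bound shrinks.\<close>
 have "\<exists>c\<ge>0. \<exists>w. (\<forall>x\<in>V a. 0 <= w x & w x <= \<gamma> ^ n * S) & cone (V a) D (%x. ennreal (w x)) &
   (\<forall>x\<in>V a. U n x = ennreal (c + w x))"
 proof (induction n)
  case 0
  have "U 0 x = ennreal (enn2real (U 0 x))" "enn2real (U 0 x) <= S" if "x : V a" for x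
   using U0(2)[OF that] U0(3)
   by (auto simp: enn2real_leI less_top[symmetric] dest: neq_top_trans[rotated] intro!: ennreal_enn2real[symmetric])
  then show ?case using U0
   by (intro exI[of _ 0] conjI exI[of _ "%x. enn2real (U 0 x)"])
    (auto intro: cone_cong)
 next
  case (Suc n)
  then obtain c w where c: "c >= 0" and w: "!!x. x : V a ==> 0 <= w x & w x <= \<gamma> ^ n * S"
   and cw: "cone (V a) D (%x. ennreal (w x))" and Un: "!!x. x : V a ==> U n x = ennreal (c + w x)" by blast
  define W where "W = K n (%x. ennreal (w x))"
  have S0: "0 <= \<gamma> ^ n * S" using \<gamma> U0(3) by simp
  have Wle: "W x <= ennreal (\<gamma> ^ n * S)" if x: "x : V a" for x
  proof -
   have "W x <= K n (%y. ennreal (\<gamma> ^ n * S) + 0) x"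
    unfolding W_def using w x by (intro mono) (auto intro!: ennreal_leI)
   also have "... = ennreal (\<gamma> ^ n * S)" unfolding const[OF x S0] zero[OF x] by simp
   finally show ?thesis .
  qed
  define w1 where "w1 x = enn2real (W x)" for x
  have W1: "W x = ennreal (w1 x)" if "x : V a" for x
   using Wle[OF that] unfolding w1_def by (metis ennreal_enn2real ennreal_less_top le_less_trans)
  have w10: "0 <= w1 x" for x by (simp add: w1_def)
  have w1le: "w1 x <= \<gamma> ^ n * S" if "x : V a" for x
   using Wle[OF that] S0 unfolding w1_def by (simp add: enn2real_leI)
  have cW: "cone (V a) D' W" unfolding W_def by (rule conemap[OF cw])
  have w1cone: "w1 x <= exp (D' * \<theta> ^ k) * w1 y" if "k >= 1" "x : V a" "y : V a" "agree k x y" for k x y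
   using coneD[OF cW that] W1 that w10 by (simp add: ennreal_mult[symmetric])
  define i where "i = Inf (w1 ` V a)"
  have bdd: "bdd_below (w1 ` V a)" using w10 by (intro bdd_belowI[of _ 0]) auto
  have ile: "i <= w1 x" if "x : V a" for x unfolding i_def using bdd that by (intro cInf_lower) auto
  have i0: "0 <= i" unfolding i_def using V_nonempty w10 by (intro cInf_greatest) auto
  have ige: "exp (- D) * w1 x <= i" if x: "x : V a" for x
   unfolding i_def
  proof (rule cInf_greatest)
   show "w1 ` V a ~= {}" using V_nonempty by auto
   fix t assume "t : w1 ` V a"
   then obtain y where y: "y : V a" "t = w1 y" by blast
   have "w1 x <= exp (D' * \<theta> ^ 1) * w1 y" using w1cone[of 1 x y] x y by simp
   also have "... <= exp D * w1 y" using D theta w10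
    by (intro mult_right_mono) (auto intro: order_trans[OF mult_left_le])
   finally have "exp (- D) * w1 x <= exp (- D) * (exp D * w1 y)" by (intro mult_left_mono) auto
   then show "exp (- D) * w1 x <= t" using y by (simp add: mult.assoc[symmetric] exp_add[symmetric])
  qed
  \<comment> \<open>Chosen so that \<open>\<eta> * D * exp D = D - D'\<close>, which balances the
    harm done by subtracting a constant against the slack between the two cones.\<close>
  define \<eta> where "\<eta> = (D - D') / D * exp (- D)"
  have \<eta>: "0 < \<eta>" "\<eta> <= 1"
  proof -
   have "(D - D') / D <= 1" "0 < (D - D') / D" using D by (auto simp: field_simps)
   moreover have "exp (- D) <= 1" "0 < exp (- D)" using D by auto
   ultimately show "0 < \<eta>" "\<eta> <= 1"
    unfolding \<eta>_def by (auto intro: mult_le_one mult_pos_pos simp del: times_divide_eq_left)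
  qed
  define w2 where "w2 x = w1 x - \<eta> * i" for x
  have w20: "0 <= w2 x" if "x : V a" for x
   using ile[OF that] i0 \<eta> mult_left_le_one_le[of i \<eta>] by (simp add: w2_def)
  have w2le: "w2 x <= \<gamma> ^ Suc n * S" if x: "x : V a" for x
  proof -
   have "\<eta> * (exp (- D) * w1 x) <= \<eta> * i" using ige[OF x] \<eta> by (intro mult_left_mono) auto
   then have "w2 x <= w1 x - \<eta> * exp (- D) * w1 x" by (simp add: w2_def mult.assoc)
   also have "... = \<gamma> * w1 x"
    by (simp add: \<gamma>_def gam_def \<eta>_def algebra_simps exp_add[symmetric] exp_minus)
     (simp add: field_simps exp_add[symmetric])
   also have "... <= \<gamma> * (\<gamma> ^ n * S)" using w1le[OF x] \<gamma> by (intro mult_left_mono)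
   finally show ?thesis by simp
  qed
  have w2cone: "cone (V a) D (%x. ennreal (w2 x))"
  proof (rule coneI)
   fix k x y assume k: "1 <= k" "x : V a" "y : V a" "agree k x y"
   define t where "t = \<theta> ^ k"
   have t: "0 < t" "t <= 1" using theta_pow by (auto simp: t_def)
   have "exp (D * t) - 1 <= D * t * exp (D * t)"
   proof -
    have "1 - D * t <= exp (- (D * t))" using exp_ge_add_one_self[of "- (D * t)"] by simp
    then have "(1 - D * t) * exp (D * t) <= exp (- (D * t)) * exp (D * t)" by (intro mult_right_mono) auto
    then show ?thesis by (simp add: exp_add[symmetric] algebra_simps)
   qed
   also have "... <= D * t * exp D" using D t by (intro mult_left_mono) auto
   finally have e1: "exp (D * t) - 1 <= D * t * exp D" .
   have e2: "(D - D') * t <= exp (D * t) - exp (D' * t)"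
   proof -
    define s where "s = (D - D') * t"
    have s: "0 <= s" using D t by (simp add: s_def)
    have Dt: "D * t = D' * t + s" by (simp add: s_def left_diff_distrib)
    have "1 <= exp (D' * t)" using D t by simp
    then have "1 * (exp s - 1) <= exp (D' * t) * (exp s - 1)" using s by (intro mult_right_mono) auto
    moreover have "exp (D * t) - exp (D' * t) = exp (D' * t) * (exp s - 1)"
     unfolding Dt exp_add by (simp add: right_diff_distrib)
    moreover have "s <= 1 * (exp s - 1)" by (metis exp_ge_add_one_self le_diff_eq add.commute mult_1)
    ultimately have "s <= exp (D * t) - exp (D' * t)" by (metis order_trans)
    then show ?thesis unfolding s_def .
   qed
   have "\<eta> * i * (exp (D * t) - 1) <= \<eta> * w1 y * (D * t * exp D)"
    using e1 ile[OF k(3)] \<eta> i0 D t w10 by (intro mult_mono) auto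
   also have "... = w1 y * ((D - D') * t)" using D by (simp add: \<eta>_def exp_minus field_simps)
   also have "... <= w1 y * (exp (D * t) - exp (D' * t))" using e2 w10 by (intro mult_left_mono) auto
   finally have "\<eta> * i * (exp (D * t) - 1) <= w1 y * (exp (D * t) - exp (D' * t))" .
   moreover have "w1 x <= exp (D' * t) * w1 y" using w1cone[OF k] by (simp add: t_def)
   ultimately have "w2 x <= exp (D * t) * w2 y" by (simp add: w2_def algebra_simps)
   then show "ennreal (w2 x) <= ennreal (exp (D * \<theta> ^ k)) * ennreal (w2 y)"
    using w20[OF k(3)] by (simp add: t_def ennreal_mult[symmetric] ennreal_leI)
  qed
  have "U (Suc n) x = ennreal (c + \<eta> * i + w2 x)" if x: "x : V a" for x
  proof -
   have "U (Suc n) x = K n (%y. ennreal c + ennreal (w y)) x"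
    unfolding US[OF x] using c w Un x by (intro cong) auto
   also have "... = ennreal c + ennreal (w1 x)" using const[OF x c] W1[OF x] by (simp add: W_def)
   also have "... = ennreal (c + w1 x)" using c w10 by simp
   finally show ?thesis by (simp add: w2_def)
  qed
  then show ?case using w20 w2le w2cone c \<eta> i0
   by (intro exI[of _ "c + \<eta> * i"] conjI exI[of _ w2]) auto
 qed
 then obtain c w where "c >= 0" "\<forall>x\<in>V a. 0 <= w x & w x <= \<gamma> ^ n * S" "\<forall>x\<in>V a. U n x = ennreal (c + w x)" by blast
 then show ?thesis unfolding \<gamma>_def by (intro exI[of _ c]) (auto intro!: ennreal_leI)
qed

text \<open>The ratios \<open>Q (Suc n) / Q n\<close> of iterates of 1 evolve under operators that
  fix constants, so the contraction makes them uniformly close to constants. Their limit is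
  \<open>l\<close>, and \<open>h\<close> is the infinite product of the ratios divided by
  \<open>l\<close>, that is, the limit of \<open>Q n / l ^ n\<close>. This replaces a compactness
  argument.\<close>

lemma induced_eigenfunction:
 assumes f: "wvar B f" "0 <= B"
  and fin: "!!x. x : V a ==> Lb f a (%_. 1) x ~= top" and pos: "!!x. x : V a ==> Lb f a (%_. 1) x ~= 0"
 obtains l h C where "l > 0" "C > 0" "!!x. x : V a ==> inverse C <= h x & h x <= C"
  "cone (V a) (B * \<theta> / (1 - \<theta>)) (%x. ennreal (h x))"
  "!!x. x : V a ==> Lb f a (%x. ennreal (h x)) x = ennreal (l * h x)"
proof -
 \<comment> \<open>The fixed point of \<open>D = \<theta> * (B + D)\<close>, hence the smallest
   constant that the cone lemmas accept.\<close>
 define Ds where "Ds = B * \<theta> / (1 - \<theta>)"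
 have Ds: "0 <= Ds" "\<theta> * (B + Ds) = Ds" using f(2) theta by (auto simp: Ds_def field_simps)
 define Q where "Q n = (Lb f a ^^ n) (%_. 1)" for n
 have Q0: "Q 0 = (%_. 1)" and QS: "Q (Suc n) = Lb f a (Q n)" for n by (auto simp: Q_def)
 have Qcone: "cone X Ds (Q n)" for n
 proof (induction n)
  case (Suc n)
  then show ?case using cone_Lb[OF f(1) cone_subset[OF Suc], of a] Ds by (simp add: QS)
 qed (auto simp: Q0 cone_const Ds)
 obtain x0 where x0: "x0 : V a" using V_nonempty by blast
 have Q1: "Q (Suc 0) x ~= 0 & Q (Suc 0) x ~= top" if "x : V a" for x
  using fin pos that by (simp add: QS Q0)
 have Qfin: "Q n x ~= 0 & Q n x ~= top" if "x : V a" for n x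
  using that
 proof (induction n arbitrary: x)
  case (Suc n)
  have bd: "Q n y <= ennreal (exp Ds) * Q n x0" "Q n x0 <= ennreal (exp Ds) * Q n y" if "y : V a" for y
   using cone_V_bounds[OF cone_subset[OF Qcone]] that x0 Ds(1) by auto
  have "Q (Suc n) x <= Lb f a (%y. ennreal (exp Ds) * Q n x0 * 1) x"
   unfolding QS using bd Suc.prems by (intro Lb_mono) auto
  also have "... = ennreal (exp Ds) * Q n x0 * Q (Suc 0) x" by (simp only: Lb_cmult) (simp add: QS Q0)
  also have "... < top" using Suc.IH[OF x0] Q1[OF Suc.prems] by (simp add: ennreal_mult_less_top less_top)
  finally have "Q (Suc n) x ~= top" by simp
  moreover have "Lb f a (%y. Q n x0 * 1) x <= Lb f a (%y. ennreal (exp Ds) * Q n y) x"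
   using bd Suc.prems by (intro Lb_mono) auto
  then have "Q n x0 * Q (Suc 0) x <= ennreal (exp Ds) * Q (Suc n) x"
   unfolding Lb_cmult by (simp add: QS Q0)
  then have "Q (Suc n) x ~= 0" using Suc.IH[OF x0] Q1[OF Suc.prems] by auto
  ultimately show ?case by simp
 qed (simp add: Q0)
 define q where "q n x = enn2real (Q n x)" for n x
 have q: "Q n x = ennreal (q n x)" "0 < q n x" if "x : V a" for n x
  using Qfin[OF that, of n] by (auto simp: q_def less_top enn2real_positive_iff zero_less_iff_neq_zero)
 have q0: "0 <= q n x" for n x by (simp add: q_def)
 define U where "U n x = Q (Suc n) x * inverse (Q n x)" for n x
 \<comment> \<open>\<open>Lb\<close> conjugated by \<open>Q n\<close> and \<open>Q (Suc n)\<close>: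
   a different operator for each \<open>n\<close>, but each one fixes constants and maps a common
   cone into a smaller one.\<close>
 define K where "K n u x = Lb f a (%y. Q n y * u y) x * inverse (Q (Suc n) x)" for n u x
 \<comment> \<open>The factor \<open>Q n\<close> together with the distortion of the weights costs
   one \<open>Ds\<close>, and the division by \<open>Q (Suc n)\<close> another. The image cone
   therefore has the constant \<open>D'\<close> below, and this \<open>D\<close> makes
   \<open>D' < D\<close>.\<close>
 define D where "D = 2 * Ds / (1 - \<theta>) + 1"
 define D' where "D' = \<theta> * D + 2 * Ds"
 have D: "0 <= D'" "D' < D" "Ds <= D"
 proof -
  have "(1 - \<theta>) * D = 2 * Ds + (1 - \<theta>)" using theta by (simp add: D_def field_simps)
  then show "D' < D" unfolding D'_def using theta by (simp add: algebra_simps)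
  have "Ds * (1 - \<theta>) <= 2 * Ds" using theta Ds mult_left_le[of "1 - \<theta>" Ds] by simp
  then show "Ds <= D" using theta by (simp add: D_def pos_le_divide_eq add_increasing2)
  then show "0 <= D'" unfolding D'_def using theta Ds by simp
 qed
 have Qinv: "Q n x * inverse (Q n x) = 1" if "x : V a" for n x
  using Qfin[OF that] by (metis ennreal_divide_self divide_ennreal_def less_top zero_less_iff_neq_zero)
 have U_le: "\<exists>S\<ge>0. \<forall>x\<in>V a. U 0 x <= ennreal S"
 proof -
  have "U 0 x <= ennreal (exp Ds * q (Suc 0) x0)" if "x : V a" for x
  proof -
   have "U 0 x = Q (Suc 0) x" by (simp add: U_def Q0)
   also have "... <= ennreal (exp Ds) * Q (Suc 0) x0"
    by (rule cone_V_bounds[OF cone_subset[OF Qcone] that x0 Ds(1)]) auto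
   also have "... = ennreal (exp Ds * q (Suc 0) x0)"
    unfolding q(1)[OF x0] by (rule ennreal_mult[symmetric]) (auto simp: q0)
   finally show ?thesis .
  qed
  then show ?thesis using q(2)[OF x0, of "Suc 0"] by (intro exI[of _ "exp Ds * q (Suc 0) x0"]) auto
 qed
 then obtain S where S: "S >= 0" "!!x. x : V a ==> U 0 x <= ennreal S" by blast
 have Kconst: "K n (%y. ennreal c + u y) x = ennreal c + K n u x" if "x : V a" "0 <= c" for n c u x
 proof -
  have "Lb f a (%y. Q n y * (ennreal c + u y)) x = ennreal c * Q (Suc n) x + Lb f a (%y. Q n y * u y) x"
   using Lb_add[of f a "%y. ennreal c * Q n y" "%y. Q n y * u y" x] Lb_cmult[of f a "ennreal c" "Q n" x]
   by (simp add: distrib_left mult.commute QS)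
  then show ?thesis using Qinv[OF that(1), of "Suc n"]
   by (simp add: K_def distrib_right mult.assoc)
 qed
 have Kmono: "K n u x <= K n v x" if "!!y. y : V a ==> u y <= v y" "x : V a" for n u v x
  unfolding K_def using that by (intro mult_right_mono Lb_mono mult_left_mono) auto
 have Kzero: "K n (%_. 0) x = 0" for n x by (simp add: K_def)
 have US: "U (Suc n) x = K n (U n) x" if "x : V a" for n x
 proof -
  have "Lb f a (%y. Q n y * U n y) x = Lb f a (Q (Suc n)) x"
  proof (rule Lb_cong)
   fix y assume y: "y : V a"
   have "Q n y * U n y = Q (Suc n) y * (Q n y * inverse (Q n y))" by (simp add: U_def ac_simps)
   then show "Q n y * U n y = Q (Suc n) y" using Qinv[OF y] by simp
  qed (use that in auto)
  then show ?thesis by (simp add: U_def K_def QS)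
 qed
 have Kcone: "cone (V a) D' (K n u)" if "cone (V a) D u" for n u
 proof -
  have "cone (V a) (Ds + D) (%y. Q n y * u y)"
   by (intro cone_mult cone_subset[OF Qcone] that) auto
  moreover have "\<theta> * (B + (Ds + D)) = Ds + \<theta> * D" using Ds(2) by (simp add: algebra_simps)
  moreover have "Ds + \<theta> * D <= Ds + D" using theta D Ds by (simp add: mult_left_le_one_le)
  ultimately have "cone X (Ds + \<theta> * D) (Lb f a (%y. Q n y * u y))"
   using cone_Lb[OF f(1), of a "Ds + D"] by simp
  moreover have "cone (V a) Ds (%x. inverse (Q (Suc n) x))"
   by (intro cone_inverse cone_subset[OF Qcone] Qfin) auto
  ultimately have "cone (V a) (Ds + \<theta> * D + Ds) (K n u)"
   unfolding K_def by (intro cone_mult) (auto intro: cone_subset)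
  then show ?thesis by (simp add: D'_def algebra_simps)
 qed
 define \<gamma> where "\<gamma> = gam D D'"
 have \<gamma>: "0 <= \<gamma>" "\<gamma> < 1" using gam_bounds D by (auto simp: \<gamma>_def)
 have con: "\<exists>c\<ge>0. \<forall>x\<in>V a. ennreal c <= U n x & U n x <= ennreal (c + \<gamma> ^ n * S)" for n
  unfolding \<gamma>_def
 proof (rule cone_contraction[OF Kconst Kmono Kzero Kcone D(1,2) _ S(2,1) US])
  show "cone (V a) D (U 0)"
   unfolding U_def Q0 using cone_mono[OF cone_subset[OF Qcone[of "Suc 0"], of "V a"] D(3)] by auto
 qed auto
 define r where "r n x = q (Suc n) x / q n x" for n x
 have r: "U n x = ennreal (r n x)" "0 < r n x" if "x : V a" for n x
  using q[OF that] by (auto simp: U_def r_def inverse_ennreal ennreal_mult[symmetric] divide_inverse less_imp_le)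
 \<comment> \<open>Since \<open>K n\<close> fixes constants, an interval that contains the values of
   \<open>U n\<close> also contains those of \<open>U (Suc n)\<close>; one power of \<gamma> thus
   bounds both the oscillation and the increment.\<close>
 have step: "\<exists>c\<ge>0. \<forall>x\<in>V a. c <= r n x & r n x <= c + \<gamma> ^ n * S & c <= r (Suc n) x & r (Suc n) x <= c + \<gamma> ^ n * S" for n
 proof -
  obtain c where c: "c >= 0" "!!x. x : V a ==> ennreal c <= U n x & U n x <= ennreal (c + \<gamma> ^ n * S)" using con by blast
  have s: "0 <= c + \<gamma> ^ n * S" using c S \<gamma> by simp
  have "ennreal c <= U (Suc n) x & U (Suc n) x <= ennreal (c + \<gamma> ^ n * S)" if x: "x : V a" for x
  proof
   have cc: "K n (%y. ennreal d) x = ennreal d" if "0 <= d" for d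
    using Kconst[OF x that, of n "%_. 0"] Kzero by simp
   show "ennreal c <= U (Suc n) x"
    unfolding US[OF x] using Kmono[of "%_. ennreal c" "U n" x n] c x cc[OF c(1)] by simp
   show "U (Suc n) x <= ennreal (c + \<gamma> ^ n * S)"
    unfolding US[OF x] using Kmono[of "U n" "%_. ennreal (c + \<gamma> ^ n * S)" x n] c x cc[OF s] by simp
  qed
  then show ?thesis using c r s by (intro exI[of _ c]) (auto simp: less_imp_le)
 qed
 have r_step: "\<bar>r (Suc n) x - r n x\<bar> <= \<gamma> ^ n * S" and r_osc: "\<bar>r n x - r n y\<bar> <= \<gamma> ^ n * S"
  if "x : V a" "y : V a" for n x y
  using step[of n] that by (auto simp: abs_le_iff) (smt (verit))+
 \<comment> \<open>A positive lower bound for all ratios at once: it keeps the limit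
   \<open>l\<close> away from 0 and makes the logarithm Lipschitz on the ratios.\<close>
 define m0 where "m0 = exp (- Ds) * r 0 x0"
 have m0: "0 < m0" using r(2)[OF x0] by (simp add: m0_def)
 have rm0: "m0 <= r n x" if "x : V a" for n x
 proof -
  have "ennreal m0 <= U n x" using that
  proof (induction n arbitrary: x)
   case 0
   have "Q (Suc 0) x0 <= ennreal (exp Ds) * Q (Suc 0) x"
    using cone_V_bounds[OF cone_subset[OF Qcone], of a x0 x] 0 x0 Ds(1) by auto
   then have "q (Suc 0) x0 <= exp Ds * q (Suc 0) x"
    using q[OF 0, of "Suc 0"] q[OF x0, of "Suc 0"] by (simp add: ennreal_mult[symmetric])
   then have "m0 <= r 0 x" using q[OF 0, of 0] q[OF x0, of 0] Q0
    by (simp add: m0_def r_def q_def exp_minus field_simps)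
   then show ?case using r[OF 0] by (simp add: ennreal_leI)
  next
   case (Suc n)
   have "K n (%y. ennreal m0) x <= K n (U n) x" using Suc by (intro Kmono) auto
   then show ?case using Kconst[OF Suc.prems, of m0 n "%_. 0"] Kzero m0 US[OF Suc.prems] by simp
  qed
  then show ?thesis using r[OF that, of n] m0 by (simp add: ennreal_le_iff2)
 qed
 have "convergent (%n. r n x0)"
 proof -
  have "summable (%n. \<gamma> ^ n * S)" using \<gamma> by (intro summable_mult2 summable_geometric) auto
  then have "summable (%n. r (Suc n) x0 - r n x0)"
   by (rule summable_comparison_test'[of _ 0]) (use r_step[OF x0 x0] in auto)
  then have "convergent (%n. \<Sum>k<n. r (Suc k) x0 - r k x0)"
   by (simp add: summable_iff_convergent)
  then show ?thesis
   unfolding sum_lessThan_telescope[of "%k. r k x0"] by (simp add: convergent_diff_const_right_iff)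
 qed
 then obtain l where l: "(%n. r n x0) \<longlonglongrightarrow> l" by (auto simp: convergent_def)
 have l0: "m0 <= l" by (rule LIMSEQ_le_const[OF l]) (use rm0[OF x0] in auto)
 define C1 where "C1 = S / (1 - \<gamma>) + S"
 have rl: "\<bar>r n x - l\<bar> <= C1 * \<gamma> ^ n" if x: "x : V a" for n x
 proof -
  have "\<bar>r (n + k) x0 - r n x0\<bar> <= S / (1 - \<gamma>) * \<gamma> ^ n" for k
  proof -
   have "\<bar>r (n + k) x0 - r n x0\<bar> <= \<gamma> ^ n * S * (\<Sum>i<k. \<gamma> ^ i)"
   proof (induction k)
    case (Suc k)
    have "\<bar>r (Suc (n + k)) x0 - r (n + k) x0\<bar> <= \<gamma> ^ (n + k) * S" by (rule r_step[OF x0 x0])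
    then show ?case using Suc by (simp add: distrib_left power_add algebra_simps)
   qed simp
   also have "... <= \<gamma> ^ n * S * (1 / (1 - \<gamma>))"
   proof (intro mult_left_mono)
    have "(\<Sum>i<k. \<gamma> ^ i) = (1 - \<gamma> ^ k) / (1 - \<gamma>)" using \<gamma> by (simp add: sum_gp_strict)
    also have "... <= 1 / (1 - \<gamma>)" using \<gamma> by (intro divide_right_mono) auto
    finally show "(\<Sum>i<k. \<gamma> ^ i) <= 1 / (1 - \<gamma>)" .
   qed (use \<gamma> S in auto)
   finally show ?thesis by (simp add: mult.commute)
  qed
  moreover have "(%k. \<bar>r (n + k) x0 - r n x0\<bar>) \<longlonglongrightarrow> \<bar>l - r n x0\<bar>"
   by (intro tendsto_intros) (use LIMSEQ_ignore_initial_segment[OF l, of n] in \<open>simp add: add.commute\<close>)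
  ultimately have "\<bar>l - r n x0\<bar> <= S / (1 - \<gamma>) * \<gamma> ^ n"
   by (intro LIMSEQ_le_const2) auto
  then show ?thesis using r_osc[OF x x0, of n] by (simp add: C1_def algebra_simps abs_le_iff)
 qed
 define d where "d n x = ln (r n x) - ln l" for n x
 define C2 where "C2 = C1 / m0"
 have C20: "0 <= C2" using S \<gamma> m0 by (simp add: C2_def C1_def)
 have dle: "\<bar>d n x\<bar> <= C2 * \<gamma> ^ n" if x: "x : V a" for n x
 proof -
  have lnb: "ln s - ln t <= \<bar>s - t\<bar> / m0" if "m0 <= s" "m0 <= t" for s t
  proof -
   have "ln s - ln t = ln (s / t)" using that m0 by (simp add: ln_div)
   also have "... <= s / t - 1" using that m0 by (intro ln_le_minus_one) auto
   also have "... = (s - t) / t" using that m0 by (simp add: diff_divide_distrib)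
   also have "... <= \<bar>s - t\<bar> / t" using that m0 by (intro divide_right_mono) auto
   also have "... <= \<bar>s - t\<bar> / m0" using that m0 by (intro divide_left_mono) auto
   finally show ?thesis .
  qed
  have "\<bar>d n x\<bar> <= \<bar>r n x - l\<bar> / m0"
   using lnb[of "r n x" l] lnb[of l "r n x"] rm0[OF x, of n] l0 by (auto simp: d_def abs_le_iff abs_minus_commute)
  also have "... <= C1 * \<gamma> ^ n / m0" using rl[OF x, of n] m0 by (intro divide_right_mono) auto
  finally show ?thesis by (simp add: C2_def)
 qed
 have dsum: "summable (%n. d n x)" if "x : V a" for x
 proof (rule summable_comparison_test'[of "%n. C2 * \<gamma> ^ n" 0])
  show "summable (%n. C2 * \<gamma> ^ n)" using \<gamma> by (intro summable_mult summable_geometric) auto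
 qed (use dle[OF that] in auto)
 define h where "h x = exp (\<Sum>n. d n x)" for x
 define C3 where "C3 = C2 / (1 - \<gamma>)"
 have C30: "0 <= C3" using C20 \<gamma> by (simp add: C3_def)
 have tail: "\<bar>(\<Sum>n. d n x) - (\<Sum>k<n. d k x)\<bar> <= C3 * \<gamma> ^ n" if x: "x : V a" for n x
 proof -
  have "(\<Sum>n. d n x) - (\<Sum>k<n. d k x) = (\<Sum>k. d (k + n) x)"
   using suminf_minus_initial_segment[OF dsum[OF x], of n] by simp
  also have "\<bar>...\<bar> <= (\<Sum>k. C2 * \<gamma> ^ (k + n))"
  proof (rule order_trans[OF summable_rabs])
   have s: "summable (%k. C2 * \<gamma> ^ (k + n))"
    using \<gamma> by (simp add: power_add mult.assoc[symmetric]) (intro summable_mult2 summable_mult summable_geometric; simp)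
   show s2: "summable (%k. \<bar>d (k + n) x\<bar>)"
    by (rule summable_comparison_test'[OF s, of 0]) (use dle[OF x] in auto)
   show "(\<Sum>k. \<bar>d (k + n) x\<bar>) <= (\<Sum>k. C2 * \<gamma> ^ (k + n))"
    by (rule suminf_le[OF _ s2 s]) (use dle[OF x] in auto)
  qed
  also have "... = C2 * \<gamma> ^ n * (\<Sum>k. \<gamma> ^ k)"
   using \<gamma> by (subst suminf_mult[symmetric]) (auto simp: power_add ac_simps summable_geometric)
  also have "... = C3 * \<gamma> ^ n" using \<gamma> by (simp add: suminf_geometric C3_def)
  finally show ?thesis .
 qed
 have lq: "(\<Sum>k<n. d k x) = ln (q n x / l ^ n)" if x: "x : V a" for n x
 proof (induction n)
  case 0
  then show ?case by (simp add: q_def Q0)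
 next
  case (Suc n)
  have "q (Suc n) x / l ^ Suc n = (q n x / l ^ n) * (r n x / l)"
   using q[OF x, of n] by (simp add: r_def)
  moreover have "ln ((q n x / l ^ n) * (r n x / l)) = ln (q n x / l ^ n) + ln (r n x / l)"
   using q(2)[OF x, of n] r(2)[OF x, of n] l0 m0 by (intro ln_mult_pos divide_pos_pos zero_less_power) linarith+
  moreover have "ln (r n x / l) = d n x" unfolding d_def
   using r(2)[OF x, of n] l0 m0 by (intro ln_divide_pos) linarith+
  ultimately show ?case using Suc by (simp only: sum.lessThan_Suc)
 qed
 have hq: "h x <= exp (C3 * \<gamma> ^ n) * (q n x / l ^ n)" "q n x / l ^ n <= exp (C3 * \<gamma> ^ n) * h x" if x: "x : V a" for n x
 proof -
  have p: "0 < q n x / l ^ n" using q[OF x, of n] l0 m0 by simp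
  have "ln (h x) - ln (q n x / l ^ n) <= C3 * \<gamma> ^ n" "ln (q n x / l ^ n) - ln (h x) <= C3 * \<gamma> ^ n"
   using tail[OF x, of n] lq[OF x, of n] by (auto simp: h_def)
  then have "exp (ln (h x)) <= exp (C3 * \<gamma> ^ n + ln (q n x / l ^ n))" "exp (ln (q n x / l ^ n)) <= exp (C3 * \<gamma> ^ n + ln (h x))"
   by (auto simp del: exp_ln)
  then show "h x <= exp (C3 * \<gamma> ^ n) * (q n x / l ^ n)" "q n x / l ^ n <= exp (C3 * \<gamma> ^ n) * h x"
   using p by (auto simp: exp_add h_def)
 qed
 have lpos: "l > 0" using l0 m0 by linarith
 have h0: "0 < h x" for x by (simp add: h_def)
 have e2: "exp (2 * C3 * \<gamma> ^ n) = exp (C3 * \<gamma> ^ n) * exp (C3 * \<gamma> ^ n)" for n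
  by (simp add: exp_add[symmetric])
 show thesis
 proof (rule that[of l "exp C3" h])
  show "l > 0" "exp C3 > 0" using lpos by auto
  fix x assume x: "x : V a"
  show "inverse (exp C3) <= h x & h x <= exp C3"
   using hq[OF x, of 0] by (simp add: q_def Q0 exp_minus[symmetric]) (simp add: exp_minus field_simps)
  have Lq: "Lb f a (%x. ennreal (q n x / l ^ n)) x = ennreal (l * (q (Suc n) x / l ^ Suc n))" for n
  proof -
   have "Lb f a (%x. ennreal (q n x / l ^ n)) x = Lb f a (%x. ennreal (1 / l ^ n) * Q n x) x"
    using x q(1) q0 lpos by (intro Lb_cong) (auto simp: ennreal_mult[symmetric])
   also have "... = ennreal (1 / l ^ n) * Q (Suc n) x" by (simp add: Lb_cmult QS)
   also have "... = ennreal (l * (q (Suc n) x / l ^ Suc n))"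
    using q[OF x, of "Suc n"] lpos by (simp add: ennreal_mult[symmetric])
   finally show ?thesis .
  qed
  \<comment> \<open>A multiplicative error passes through \<open>Lb\<close> by monotonicity and
    homogeneity alone, so no limit has to be exchanged with the infinite sums; the error disappears
    as \<open>n\<close> grows.\<close>
  have le1: "Lb f a (%x. ennreal (h x)) x <= ennreal (exp (2 * C3 * \<gamma> ^ n) * (l * h x))" for n
  proof -
   have "Lb f a (%x. ennreal (h x)) x <= Lb f a (%x. ennreal (exp (C3 * \<gamma> ^ n)) * ennreal (q n x / l ^ n)) x"
    using hq(1)[of _ n] x q0 lpos by (intro Lb_mono) (auto simp: ennreal_mult[symmetric] intro!: ennreal_leI)
   also have "... = ennreal (exp (C3 * \<gamma> ^ n)) * ennreal (l * (q (Suc n) x / l ^ Suc n))"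
    unfolding Lb_cmult Lq ..
   also have "... <= ennreal (exp (C3 * \<gamma> ^ n)) * ennreal (l * (exp (C3 * \<gamma> ^ n) * h x))"
   proof (intro mult_left_mono ennreal_leI)
    have "q (Suc n) x / l ^ Suc n <= exp (C3 * \<gamma> ^ Suc n) * h x" by (rule hq(2)[OF x])
    also have "... <= exp (C3 * \<gamma> ^ n) * h x"
     using C30 \<gamma> h0[of x] by (intro mult_right_mono) (auto intro!: mult_left_mono simp: mult_left_le_one_le)
    finally show "q (Suc n) x / l ^ Suc n <= exp (C3 * \<gamma> ^ n) * h x" .
   qed (use lpos in auto)
   also have "... = ennreal (exp (2 * C3 * \<gamma> ^ n) * (l * h x))"
    unfolding e2 using lpos h0[of x] by (simp add: ennreal_mult[symmetric] ac_simps)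
   finally show ?thesis .
  qed
  have le2: "ennreal (l * h x) <= ennreal (exp (2 * C3 * \<gamma> ^ n)) * Lb f a (%x. ennreal (h x)) x" for n
  proof -
   have "l * h x <= exp (C3 * \<gamma> ^ n) * (l * (q (Suc n) x / l ^ Suc n))"
   proof -
    have "h x <= exp (C3 * \<gamma> ^ Suc n) * (q (Suc n) x / l ^ Suc n)" by (rule hq(1)[OF x])
    also have "... <= exp (C3 * \<gamma> ^ n) * (q (Suc n) x / l ^ Suc n)"
     using C30 \<gamma> q[OF x, of "Suc n"] lpos
     by (intro mult_right_mono) (auto intro!: mult_left_mono simp: mult_left_le_one_le)
    finally have "l * h x <= l * (exp (C3 * \<gamma> ^ n) * (q (Suc n) x / l ^ Suc n))" using lpos by (intro mult_left_mono) auto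
    then show ?thesis unfolding mult.left_commute[of l "exp (C3 * \<gamma> ^ n)"] .
   qed
   then have "ennreal (l * h x) <= ennreal (exp (C3 * \<gamma> ^ n)) * ennreal (l * (q (Suc n) x / l ^ Suc n))"
    using q[OF x, of "Suc n"] lpos by (subst ennreal_mult[symmetric]) (auto intro!: ennreal_leI)
   also have "... = ennreal (exp (C3 * \<gamma> ^ n)) * Lb f a (%x. ennreal (q n x / l ^ n)) x" unfolding Lq ..
   also have "... <= ennreal (exp (C3 * \<gamma> ^ n)) * Lb f a (%x. ennreal (exp (C3 * \<gamma> ^ n)) * ennreal (h x)) x"
    using hq(2)[of _ n] x h0 by (intro mult_left_mono Lb_mono) (auto simp: ennreal_mult[symmetric] less_imp_le intro!: ennreal_leI)
   also have "... = ennreal (exp (2 * C3 * \<gamma> ^ n)) * Lb f a (%x. ennreal (h x)) x"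
    unfolding Lb_cmult e2 by (simp add: ennreal_mult mult.assoc)
   finally show ?thesis .
  qed
  have "Lb f a (%x. ennreal (h x)) x < top" using le1[of 0] by (metis ennreal_less_top le_less_trans)
  then obtain z where z: "Lb f a (%x. ennreal (h x)) x = ennreal z" "0 <= z"
   by (metis ennreal_cases less_irrefl)
  have "z <= l * h x" by (rule le_of_exp_geometric[OF \<gamma>, of _ "2 * C3"]) (use le1 z lpos h0[of x] in auto)
  moreover have "l * h x <= z"
   by (rule le_of_exp_geometric[OF \<gamma>, of _ "2 * C3"]) (use le2 z lpos h0[of x] in \<open>auto simp: ennreal_mult[symmetric]\<close>)
  ultimately show "Lb f a (%x. ennreal (h x)) x = ennreal (l * h x)" using z by simp
 next
  show "cone (V a) (B * \<theta> / (1 - \<theta>)) (%x. ennreal (h x))"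
  proof (rule coneI, fold Ds_def)
   fix k x y assume k: "1 <= k" "x : V a" "y : V a" "agree k x y"
   have "h x <= exp (2 * C3 * \<gamma> ^ n) * (exp (Ds * \<theta> ^ k) * h y)" for n
   proof -
    have "Q n x <= ennreal (exp (Ds * \<theta> ^ k)) * Q n y" using coneD[OF Qcone k(1)] k by auto
    then have "q n x <= exp (Ds * \<theta> ^ k) * q n y" using q[OF k(2), of n] q[OF k(3), of n]
     by (simp add: ennreal_mult[symmetric])
    then have a: "q n x / l ^ n <= exp (Ds * \<theta> ^ k) * (q n y / l ^ n)"
     using divide_right_mono[of "q n x" _ "l ^ n"] lpos by simp
    have "h x <= exp (C3 * \<gamma> ^ n) * (q n x / l ^ n)" by (rule hq(1)[OF k(2)])
    also have "... <= exp (C3 * \<gamma> ^ n) * (exp (Ds * \<theta> ^ k) * (q n y / l ^ n))" using a by (intro mult_left_mono) auto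
    also have "... <= exp (C3 * \<gamma> ^ n) * (exp (Ds * \<theta> ^ k) * (exp (C3 * \<gamma> ^ n) * h y))"
     using hq(2)[OF k(3), of n] by (intro mult_left_mono) auto
    also have "... = exp (2 * C3 * \<gamma> ^ n) * (exp (Ds * \<theta> ^ k) * h y)"
     unfolding e2 by (simp add: ac_simps)
    finally show ?thesis .
   qed
   then have "h x <= exp (Ds * \<theta> ^ k) * h y" by (rule le_of_exp_geometric[OF \<gamma>])
   then show "ennreal (h x) <= ennreal (exp (Ds * \<theta> ^ k)) * ennreal (h y)"
    using h0[of y] by (simp add: ennreal_mult[symmetric] less_imp_le ennreal_leI)
  qed
 qed
qed

end

section \<open>Exponential growth rates of extended nonnegative sequences\<close>

lemma eln_le: "z <= ennreal (exp t) ==> eln z <= ereal t"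
proof -
 assume z: "z <= ennreal (exp t)"
 then have "z ~= top" by (metis ennreal_neq_top top.extremum_uniqueI)
 then obtain r where r: "z = ennreal r" "0 <= r" by (metis ennreal_cases)
 have "r <= exp t" using z r by simp
 then have "r ~= 0 ==> ln r <= t" using r by (metis exp_gt_zero less_eq_real_def ln_exp ln_le_cancel_iff order_le_less_trans)
 then show ?thesis using r by (auto simp: eln_def ennreal_eq_0_iff)
qed

lemma le_of_eln_less: "eln z < ereal t ==> z <= ennreal (exp t)"
proof -
 assume z: "eln z < ereal t"
 then have nt: "z ~= top" by (auto simp: eln_def split: if_splits)
 then obtain r where r: "z = ennreal r" "0 <= r" by (metis ennreal_cases)
 show ?thesis
 proof (cases "r = 0")
  case False
  then have "ln r < t" using z r by (auto simp: eln_def ennreal_eq_0_iff split: if_splits)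
  then have "r <= exp t" using False r by (metis exp_less_mono exp_ln less_eq_real_def)
  then show ?thesis using r by (simp add: ennreal_leI)
 qed (use r in auto)
qed

lemma limsup_eln_le:
 assumes "!!n. n >= 1 ==> Z n <= ennreal (C * exp (real n * q))" "C > 0"
 shows "limsup (%n. eln (Z n) / ereal (real n)) <= ereal q"
proof -
 have "limsup (%n. eln (Z n) / ereal (real n)) <= limsup (%n. ereal (ln C / real n + q))"
 proof (rule Limsup_mono, rule eventually_sequentiallyI[of 1])
  fix n :: nat assume n: "1 <= n"
  have "C * exp (real n * q) = exp (ln C + real n * q)" using assms(2) by (simp add: exp_add)
  then have "eln (Z n) <= ereal (ln C + real n * q)" using assms(1)[OF n] by (intro eln_le) simp
  then have "eln (Z n) / ereal (real n) <= ereal (ln C + real n * q) / ereal (real n)"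
   using n by (intro ereal_divide_right_mono) auto
  also have "... = ereal (ln C / real n + q)" using n by (simp add: add_divide_distrib)
  finally show "eln (Z n) / ereal (real n) <= ereal (ln C / real n + q)" .
 qed
 also have "... = ereal q"
 proof (rule lim_imp_Limsup)
  have "(%n. ln C / real n + q) \<longlonglongrightarrow> 0 + q"
   by (intro tendsto_intros lim_const_over_n)
  then show "(%n. ereal (ln C / real n + q)) \<longlonglongrightarrow> ereal q" by simp
 qed simp
 finally show ?thesis .
qed

lemma limsup_eln_lessD:
 assumes "limsup (%n. eln (Z n) / ereal (real n)) < ereal q"
 shows "\<exists>N. \<forall>n\<ge>N. Z n <= ennreal (exp (real n * q))"
proof -
 have "\<forall>\<^sub>F n in sequentially. eln (Z n) / ereal (real n) < ereal q"
  by (rule Limsup_lessD[OF assms])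
 then obtain N where N: "!!n. n >= N ==> eln (Z n) / ereal (real n) < ereal q"
  by (auto simp: eventually_sequentially)
 have "Z n <= ennreal (exp (real n * q))" if n: "n >= max N 1" for n
 proof (rule le_of_eln_less)
  have "eln (Z n) / ereal (real n) < ereal q" using N n by simp
  moreover have "0 < ereal (real n)" "ereal (real n) < \<infinity>" using n by auto
  ultimately have "eln (Z n) < ereal q * ereal (real n)"
   by (subst (asm) ereal_divide_less_pos) (auto simp: mult.commute)
  then show "eln (Z n) < ereal (real n * q)" by (simp add: mult.commute)
 qed
 then show ?thesis by blast
qed

lemma limsup_eln_frequently:
 assumes "ereal q < limsup (%n. eln (Z n) / ereal (real n))"
 shows "\<exists>n\<ge>N. n >= 1 & ennreal (exp (real n * q)) < Z n"
proof (rule ccontr)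
 assume "\<not> ?thesis"
 then have *: "!!n. n >= max N 1 ==> Z n <= ennreal (exp (real n * q))" by (force simp: not_less)
 have "limsup (%n. eln (Z n) / ereal (real n)) <= ereal q"
 proof (rule Limsup_bounded, rule eventually_sequentiallyI[of "max N 1"])
  fix n assume n: "max N 1 <= n"
  have "eln (Z n) / ereal (real n) <= ereal (real n * q) / ereal (real n)"
   using n eln_le[OF *[OF n]] by (intro ereal_divide_right_mono) auto
  also have "... = ereal q" using n by simp
  finally show "eln (Z n) / ereal (real n) <= ereal q" .
 qed
 then show False using assms by simp
qed

text \<open>The sum has the closed form \<open>s \<delta>\<close>, which is continuous at 0 and
  vanishes there. It measures the effect of a constant \<delta> on the induced operator when the
  excursion weights decay like \<open>\<rho> ^ k\<close>.\<close>

lemma small_perturbation: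
 fixes C \<rho> \<epsilon> :: real
 assumes "0 <= \<rho>" "\<rho> < 1" "0 < \<epsilon>"
 obtains \<delta> where "\<delta> > 0" "\<rho> * exp \<delta> < 1"
  "summable (%k. C * \<rho> ^ k * (exp (\<delta> * (real k + 1)) - 1))"
  "(\<Sum>k. C * \<rho> ^ k * (exp (\<delta> * (real k + 1)) - 1)) < \<epsilon>"
proof -
 define s where "s \<delta> = C * (exp \<delta> / (1 - \<rho> * exp \<delta>) - 1 / (1 - \<rho>))" for \<delta> :: real
 have "isCont s 0" unfolding s_def using assms by (intro continuous_intros) auto
 then have "s \<midarrow>0\<rightarrow> 0" using assms by (simp add: isCont_def s_def)
 then have e1: "\<forall>\<^sub>F \<delta> in at_right 0. s \<delta> < \<epsilon>"
  using assms by (intro order_tendstoD(2)[of s 0]) (auto intro: tendsto_within_subset)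
 have "isCont (%\<delta>. \<rho> * exp \<delta>) 0" by (intro continuous_intros)
 then have "(%\<delta>. \<rho> * exp \<delta>) \<midarrow>0\<rightarrow> \<rho>" by (simp add: isCont_def)
 then have e2: "\<forall>\<^sub>F \<delta> in at_right 0. \<rho> * exp \<delta> < 1"
  using assms by (intro order_tendstoD(2)[of _ \<rho>]) (auto intro: tendsto_within_subset)
 have "\<forall>\<^sub>F \<delta> in at_right (0::real). 0 < \<delta> & s \<delta> < \<epsilon> & \<rho> * exp \<delta> < 1"
  using e1 e2 eventually_at_right_less[of 0] by eventually_elim auto
 then obtain \<delta> where d: "0 < \<delta>" "s \<delta> < \<epsilon>" "\<rho> * exp \<delta> < 1"
  using eventually_happens[of _ "at_right (0::real)"] by (auto simp: trivial_limit_at_right_real)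
 have eq: "C * \<rho> ^ k * (exp (\<delta> * (real k + 1)) - 1) = C * exp \<delta> * (\<rho> * exp \<delta>) ^ k - C * \<rho> ^ k" for k
  by (simp add: power_mult_distrib exp_of_nat_mult[symmetric] distrib_left exp_add algebra_simps)
 have 1: "(%k. C * exp \<delta> * (\<rho> * exp \<delta>) ^ k) sums (C * exp \<delta> * (1 / (1 - \<rho> * exp \<delta>)))"
  using assms d by (intro sums_mult geometric_sums) auto
 have 2: "(%k. C * \<rho> ^ k) sums (C * (1 / (1 - \<rho>)))" using assms by (intro sums_mult geometric_sums) auto
 have 3: "(%k. C * \<rho> ^ k * (exp (\<delta> * (real k + 1)) - 1)) sums s \<delta>"
  unfolding eq using sums_diff[OF 1 2] by (simp add: s_def algebra_simps)
 show thesis using that[of \<delta>] d sums_summable[OF 3] sums_unique[OF 3] by simp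
qed

context markov_shift
begin

lemma tr_add_const: "tr E (%x. f x + c) S u x = ennreal (exp c) * tr E f S u x"
 unfolding tr_def
 by (subst nn_integral_cmult[symmetric])
  (auto intro!: nn_integral_cong simp: exp_add ennreal_mult ac_simps)

lemma tr_funpow_add_const:
 "(tr E (%x. f x + c) S ^^ n) u x = ennreal (exp (real n * c)) * (tr E f S ^^ n) u x"
proof (induction n arbitrary: x)
 case (Suc n)
 have IH: "(tr E (%x. f x + c) S ^^ n) u = (%x. ennreal (exp (real n * c)) * (tr E f S ^^ n) u x)"
  using Suc by blast
 have "(tr E (%x. f x + c) S ^^ Suc n) u x = ennreal (exp c) * tr E f S (%x. ennreal (exp (real n * c)) * (tr E f S ^^ n) u x) x"
  unfolding funpow.simps o_apply IH by (rule tr_add_const)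
 also have "... = ennreal (exp (real (Suc n) * c)) * (tr E f S ^^ Suc n) u x"
  by (simp add: tr_cmult mult.assoc[symmetric] ennreal_mult[symmetric] exp_add[symmetric] distrib_right add.commute)
 finally show ?case .
qed simp

lemma tr_funpow_pos:
 assumes "u y ~= 0" "y : X" "\<forall>i<k. y i : S"
 shows "(tr E f S ^^ k) u ((shift ^^ k) y) ~= 0"
 using assms(3)
proof (induction k)
 case (Suc k)
 define z where "z = (shift ^^ k) y"
 have z: "z : X" "z 0 = y k" using assms(2) funpow_shift_in_sigma by (auto simp: z_def) (simp add: funpow_shift)
 have "ennreal (exp (f (case_nat (z 0) (shift z)))) * (tr E f S ^^ k) u (case_nat (z 0) (shift z)) \<le>
   tr E f S ((tr E f S ^^ k) u) (shift z)"
 proof (rule tr_ge_point)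
  show "z 0 : S" using z Suc.prems by simp
  show "E (z 0) (shift z 0)" using z(1) by (simp add: sigma_plus_def shift_def)
 qed
 moreover have "(tr E f S ^^ k) u z ~= 0" using Suc by (auto simp: z_def)
 ultimately show ?case by (auto simp: z_def)
qed (simp add: assms)

text \<open>Cutting a path from \<open>a\<close> to \<open>x\<close> at its last visit to
  \<open>a\<close> leaves one excursion, which contributes a positive term.\<close>

lemma Lb_1_pos:
 assumes x: "x : X" shows "Lb f a (%_. 1) x ~= 0"
proof -
 obtain n y where y: "n >= 1" "y : X" "y 0 = a" "(shift ^^ n) y = x" using path_to[OF x, of a] .
 define i where "i = Max {i. i < n & y i = a}"
 have fin: "finite {i. i < n & y i = a}" and ne: "0 : {i. i < n & y i = a}" using y by auto
 have "i : {i. i < n & y i = a}" unfolding i_def by (rule Max_in[OF fin]) (use ne in blast)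
 then have i: "i < n" "y i = a" by auto
 have im: "j <= i" if "j < n" "y j = a" for j unfolding i_def using fin that by (intro Max_ge) auto
 define z where "z = (shift ^^ i) y"
 define w where "w = shift z"
 have z: "z : X" "z 0 = a" using y(2) i(2) by (auto simp: z_def) (simp add: funpow_shift)
 define k where "k = n - Suc i"
 have "tr E f {a} (%_. 1) w ~= 0"
  using z by (auto simp: tr_singleton w_def shift_def sigma_plus_def)
 moreover have "\<forall>j<k. w j : - {a}"
 proof (intro allI impI)
  fix j assume "j < k"
  then have "Suc (j + i) < n" using i by (simp add: k_def less_diff_conv)
  then show "w j : - {a}" using im[of "Suc (j + i)"] i by (auto simp: k_def w_def z_def funpow_shift shift_def)
 qed
 moreover have "w : X" using z by (auto simp: w_def)
 ultimately have "(tr E f (- {a}) ^^ k) (tr E f {a} (%_. 1)) ((shift ^^ k) w) ~= 0"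
  by (intro tr_funpow_pos) auto
 moreover have "(shift ^^ k) w = x"
  unfolding y(4)[symmetric] using i by (simp add: w_def z_def k_def funpow_shift shift_def)
 ultimately show ?thesis unfolding Lb_def G_def
  by (metis ennreal_suminf_lessD le_zero_eq linorder_not_less not_gr_zero suminf_eq_zero_iff summableI zero_le)
qed

lemma cone_indicator: "cone X 0 (%y. indicator {a} (y 0))"
 by (rule coneI) (auto simp: agree_def indicator_def)

text \<open>The cone condition spreads an infinite value over the whole cylinder of
  \<open>a\<close>; appending further returns of length \<open>n\<close> then keeps it infinite
  along the multiples of \<open>n\<close>.\<close>

lemma tr_funpow_infinite:
 assumes f: "wvar B f" "0 <= B" and x: "x : V a" and inf: "(tr E f UNIV ^^ n) (%y. indicator {a} (y 0)) x = top"
 shows "x' : V a ==> (tr E f UNIV ^^ (n * Suc j)) (%y. indicator {a} (y 0)) x' = top"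
proof (induction j arbitrary: x')
 case 0
 define D where "D = B * \<theta> / (1 - \<theta>)"
 have "cone X D ((tr E f UNIV ^^ n) (%y. indicator {a} (y 0)))"
 proof (rule cone_tr_funpow[OF f(1)])
  show "cone X D (%y. indicator {a} (y 0))" by (rule cone_mono[OF cone_indicator]) (use f theta in \<open>simp add: D_def\<close>)
  show "\<theta> * (B + D) <= D" using f theta by (simp add: D_def field_simps)
 qed
 from coneD[OF this, of 1 x x'] x 0
 have "top <= ennreal (exp (D * \<theta>)) * (tr E f UNIV ^^ n) (%y. indicator {a} (y 0)) x'" using inf by auto
 then have "(tr E f UNIV ^^ n) (%y. indicator {a} (y 0)) x' = top"
  by (auto simp: top_unique ennreal_mult_eq_top_iff)
 then show ?case by simp
next
 case (Suc j)
 have n0: "(tr E f UNIV ^^ n) (%y. indicator {a} (y 0)) x' ~= 0"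
 proof -
  have "(tr E f UNIV ^^ n) (%y. indicator {a} (y 0)) x <= ennreal (exp (B * \<theta> / (1 - \<theta>) * \<theta> ^ 1)) * (tr E f UNIV ^^ n) (%y. indicator {a} (y 0)) x'"
  proof (rule coneD)
   show "cone X (B * \<theta> / (1 - \<theta>)) ((tr E f UNIV ^^ n) (%y. indicator {a} (y 0)))"
   proof (rule cone_tr_funpow[OF f(1)])
    show "cone X (B * \<theta> / (1 - \<theta>)) (%y. indicator {a} (y 0))" by (rule cone_mono[OF cone_indicator]) (use f theta in simp)
    show "\<theta> * (B + B * \<theta> / (1 - \<theta>)) <= B * \<theta> / (1 - \<theta>)" using f theta by (simp add: field_simps)
   qed
  qed (use x Suc.prems in auto)
  then show ?thesis using inf by auto
 qed
 have "(tr E f UNIV ^^ n) (%y. top * indicator {a} (y 0)) x' \<le>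
   (tr E f UNIV ^^ n) ((tr E f UNIV ^^ (n * Suc j)) (%y. indicator {a} (y 0))) x'"
  using Suc by (intro tr_funpow_mono) (auto simp: indicator_def)
 also have "... = (tr E f UNIV ^^ (n * Suc (Suc j))) (%y. indicator {a} (y 0)) x'"
  by (simp add: funpow_add)
 finally have "top * (tr E f UNIV ^^ n) (%y. indicator {a} (y 0)) x' <= (tr E f UNIV ^^ (n * Suc (Suc j))) (%y. indicator {a} (y 0)) x'"
  unfolding tr_funpow_cmult .
 moreover have "top * (tr E f UNIV ^^ n) (%y. indicator {a} (y 0)) x' = top"
  using n0 by (simp add: ennreal_top_mult)
 ultimately show ?case by (simp only: top_unique)
qed

end

section \<open>Strong positive recurrence and the eigenvalue of the induced operator\<close>

locale spr_shift = markov_shift E \<theta> for E :: "'a::countable => 'a => bool" and \<theta> +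
 fixes \<phi> :: "(nat => 'a) => real" and a :: 'a and B P :: real
 assumes phi: "wvar B \<phi>" "0 <= B"
  and press: "gurevich_pressure E \<phi> a = ereal P"
  and spr: "limsup (%n. eln (Zn_star E \<phi> a n) / ereal (real n)) < ereal P"
begin

definition f0 :: "(nat => 'a) => real" where "f0 x = \<phi> x + - P"

text \<open>\<open>f0\<close> has pressure 0 and \<open>fd \<delta>\<close> has pressure \<delta>.
  Moving \<delta> to either side of 0 is how the eigenvalue of the induced operator is found to be
  1.\<close>

definition fd :: "real => (nat => 'a) => real" where "fd \<delta> x = f0 x + \<delta>"

lemma fd_eq: "fd \<delta> = (%x. f0 x + \<delta>)" "fd \<delta> = (%x. \<phi> x + (\<delta> - P))"
 by (auto simp: fd_def f0_def)

lemma tr_fd: "tr E (fd \<delta>) S u x = ennreal (exp \<delta>) * tr E f0 S u x"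
 by (subst fd_eq(1)) (rule tr_add_const[where f=f0 and c=\<delta>])

lemma tr_fd_funpow: "(tr E (fd \<delta>) S ^^ n) u x = ennreal (exp (real n * \<delta>)) * (tr E f0 S ^^ n) u x"
 by (subst fd_eq(1)) (rule tr_funpow_add_const[where f=f0 and c=\<delta>])

lemma tr_fd_funpow_phi: "(tr E (fd \<delta>) S ^^ n) u x = ennreal (exp (real n * (\<delta> - P))) * (tr E \<phi> S ^^ n) u x"
 by (subst fd_eq(2)) (rule tr_funpow_add_const[where f=\<phi> and c="\<delta> - P"])

lemma wvar_f0: "wvar B f0"
 unfolding f0_def[abs_def] by (rule wvar_add_const[OF phi(1)])

definition Ds :: real where "Ds = B * \<theta> / (1 - \<theta>)"

lemma Ds: "0 <= Ds" "\<theta> * (B + Ds) = Ds"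
 using phi(2) theta by (auto simp: Ds_def field_simps)

text \<open>Finite pressure bounds \<open>Zn\<close> only for large \<open>n\<close>; an infinite
  value at one time would recur at all multiples of it and violate that bound.\<close>

lemma Zn_finite:
 assumes "n >= 1" shows "Zn E \<phi> a n ~= top"
proof
 assume Z: "Zn E \<phi> a n = top"
 obtain x where x: "x : V a" using V_nonempty by blast
 have "(tr E \<phi> UNIV ^^ n) (%y. indicator {a} (y 0)) x = top"
  using tr_funpow_Zn(2)[OF _ _ assms phi, of x a] x Z by (auto simp: top_unique ennreal_mult_eq_top_iff)
 from tr_funpow_infinite[OF phi x this x]
 have inf: "(tr E \<phi> UNIV ^^ (n * Suc j)) (%y. indicator {a} (y 0)) x = top" for j .
 have "Zn E \<phi> a (n * Suc j) = top" for j
  using tr_funpow_Zn(1)[OF _ _ _ phi, of x a "n * Suc j"] x assms inf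
  by (auto simp: top_unique ennreal_mult_eq_top_iff)
 moreover have "limsup (%n. eln (Zn E \<phi> a n) / ereal (real n)) < ereal (P + 1)"
  using press by (simp add: gurevich_pressure_def)
 then obtain N where N: "!!n. n >= N ==> Zn E \<phi> a n <= ennreal (exp (real n * (P + 1)))"
  using limsup_eln_lessD by blast
 have "N <= n * Suc N" using assms by (simp add: trans_le_add2)
 from N[OF this] show False using calculation[of N] by (simp add: top_unique)
qed

definition b :: "nat => (nat => 'a) => ennreal" where
 "b k = (tr E f0 (- {a}) ^^ k) (tr E f0 {a} (%_. 1))"

text \<open>The rate is \<open>exp (q - P)\<close> for some \<open>q\<close> strictly between the
  growth rate of first returns and the pressure. The estimate stays on the cylinder of
  \<open>a\<close>, where an excursion can be closed up to a periodic orbit.\<close>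

lemma b_tail: "\<exists>C \<rho>. 0 < C & 0 < \<rho> & \<rho> < 1 & (\<forall>k. \<forall>x\<in>V a. b k x <= ennreal (C * \<rho> ^ k))"
proof -
 have b_eq: "b k x = ennreal (exp (real (Suc k) * - P)) * (tr E \<phi> (- {a}) ^^ k) (tr E \<phi> {a} (%_. 1)) x" for k x
 proof -
  have "b k x = (tr E f0 (- {a}) ^^ k) (%x. ennreal (exp (- P)) * tr E \<phi> {a} (%_. 1) x) x"
   unfolding b_def f0_def[abs_def] tr_add_const[abs_def] ..
  then show ?thesis
   unfolding tr_funpow_cmult f0_def[abs_def] tr_funpow_add_const
   by (simp add: mult.assoc[symmetric] ennreal_mult[symmetric] exp_add[symmetric] distrib_right)
 qed
 define M where "M = exp (B / (1 - \<theta>))"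
 have bZ: "b k x <= ennreal (exp (real (Suc k) * - P)) * (ennreal M * Zn_star E \<phi> a (Suc k))" if "x : V a" for k x
  unfolding b_eq M_def using that by (intro mult_left_mono tr_first_return_Zn_star phi) auto
 obtain q where q: "limsup (%n. eln (Zn_star E \<phi> a n) / ereal (real n)) < ereal q" "ereal q < ereal P"
  using ereal_dense2[OF spr] by blast
 obtain N where N: "!!n. n >= N ==> Zn_star E \<phi> a n <= ennreal (exp (real n * q))" using limsup_eln_lessD[OF q(1)] by blast
 have Zs: "Zn_star E \<phi> a (Suc k) ~= top" for k
 proof -
  have "Zn_star E \<phi> a (Suc k) <= Zn E \<phi> a (Suc k)"
   unfolding Zn_star_def Zn_def infsum_ennreal_eq_nn_integral
   by (auto simp: nn_integral_count_space_indicator intro!: nn_integral_mono split: split_indicator)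
  then show ?thesis using Zn_finite[of "Suc k"] by (metis One_nat_def Suc_le_mono le0 top.extremum_uniqueI)
 qed
 define \<rho> where "\<rho> = exp (q - P)"
 have \<rho>: "0 < \<rho>" "\<rho> < 1" using q by (auto simp: \<rho>_def)
 have big: "b k x <= ennreal (M * \<rho> ^ k)" if k: "Suc k >= N" and x: "x : V a" for k x
 proof -
  have "b k x <= ennreal (exp (real (Suc k) * - P)) * (ennreal M * ennreal (exp (real (Suc k) * q)))"
   using bZ[OF x, of k] N[OF k] by (meson dual_order.trans mult_left_mono zero_le)
  also have "... = ennreal (M * \<rho> ^ Suc k)"
   by (simp add: ennreal_mult[symmetric] M_def \<rho>_def exp_of_nat_mult[symmetric] exp_add[symmetric] algebra_simps)
  also have "... <= ennreal (M * \<rho> ^ k)"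
   using \<rho> by (intro ennreal_leI mult_left_mono) (auto simp: M_def mult_left_le_one_le)
  finally show ?thesis .
 qed
 define c where "c k = enn2real (ennreal (exp (real (Suc k) * - P)) * (ennreal M * Zn_star E \<phi> a (Suc k)))" for k
 have c: "b k x <= ennreal (c k)" if "x : V a" for k x
  using bZ[OF that, of k] Zs[of k] unfolding c_def
  by (subst ennreal_enn2real) (auto simp: ennreal_mult_less_top less_top)
 \<comment> \<open>The added sum pays for the finitely many lengths below the threshold
   \<open>N\<close>, where finiteness of the weights is all that is known.\<close>
 define C where "C = M + (\<Sum>k<N. c k / \<rho> ^ k)"
 have c0: "0 <= c k" for k by (simp add: c_def)
 have "b k x <= ennreal (C * \<rho> ^ k)" if x: "x : V a" for k x
 proof (cases "k < N")
  case True
  have "c k / \<rho> ^ k <= (\<Sum>k<N. c k / \<rho> ^ k)"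
   using True \<rho> c0 by (intro member_le_sum) auto
  then have "c k / \<rho> ^ k <= C" by (simp add: C_def M_def add_increasing)
  then have "c k <= C * \<rho> ^ k" using \<rho> by (simp add: field_simps)
  then show ?thesis using c[OF x, of k] by (meson ennreal_leI order_trans)
 next
  case False
  have "M <= C" using c0 \<rho> by (auto simp: C_def intro!: sum_nonneg)
  then have "M * \<rho> ^ k <= C * \<rho> ^ k" using \<rho> by (intro mult_right_mono) auto
  then show ?thesis using big[of k x] False x by (meson ennreal_leI order_trans le_SucI not_less)
 qed
 moreover have "0 < C" using c0 \<rho> by (auto simp: C_def M_def intro!: add_pos_nonneg sum_nonneg)
 ultimately show ?thesis using \<rho> by blast
qed

lemma Lb_sum: "Lb f0 a u x = (\<Sum>k. (tr E f0 (- {a}) ^^ k) (tr E f0 {a} u) x)"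
 by (simp add: Lb_def G_def)

text \<open>The excursion with index \<open>k\<close> lasts \<open>k + 1\<close> steps and meets the
  constant \<delta> that many times, so the perturbation reweights excursions by their return
  times.\<close>

lemma Lb_add_const:
 "Lb (fd \<delta>) a u x = (\<Sum>k. ennreal (exp (\<delta> * (real k + 1))) * (tr E f0 (- {a}) ^^ k) (tr E f0 {a} u) x)"
proof -
 have "(tr E (fd \<delta>) (- {a}) ^^ k) (tr E (fd \<delta>) {a} u) x =
   ennreal (exp (\<delta> * (real k + 1))) * (tr E f0 (- {a}) ^^ k) (tr E f0 {a} u) x" for k
 proof -
  have "tr E (fd \<delta>) {a} u = (%x. ennreal (exp \<delta>) * tr E f0 {a} u x)"
   by (rule ext) (rule tr_fd)
  then have "(tr E (fd \<delta>) (- {a}) ^^ k) (tr E (fd \<delta>) {a} u) x =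
    ennreal (exp (real k * \<delta>)) * (ennreal (exp \<delta>) * (tr E f0 (- {a}) ^^ k) (tr E f0 {a} u) x)"
   by (simp only: tr_funpow_cmult tr_fd_funpow ac_simps)
  also have "... = ennreal (exp (real k * \<delta> + \<delta>)) * (tr E f0 (- {a}) ^^ k) (tr E f0 {a} u) x"
   by (simp add: exp_add ennreal_mult mult.assoc)
  also have "real k * \<delta> + \<delta> = \<delta> * (real k + 1)" by (simp add: distrib_left mult.commute)
  finally show ?thesis .
 qed
 then show ?thesis by (simp only: Lb_def G_def)
qed

lemma Zn_le_of_tr:
 assumes "x : V a" "n >= 1"
 shows "Zn E \<phi> a n <= ennreal (exp (B / (1 - \<theta>))) * (ennreal (exp (real n * (P - \<delta>))) * (tr E (fd \<delta>) UNIV ^^ n) (%y. indicator {a} (y 0)) x)"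
proof -
 have "ennreal (exp (real n * (P - \<delta>))) * (tr E (fd \<delta>) UNIV ^^ n) (%y. indicator {a} (y 0)) x =
  ennreal (exp (real n * (P - \<delta>))) * (ennreal (exp (real n * (\<delta> - P))) * (tr E \<phi> UNIV ^^ n) (%y. indicator {a} (y 0)) x)"
  by (simp only: tr_fd_funpow_phi)
 also have "... = (tr E \<phi> UNIV ^^ n) (%y. indicator {a} (y 0)) x"
  by (simp add: mult.assoc[symmetric] ennreal_mult[symmetric] exp_add[symmetric] distrib_left[symmetric])
 finally show ?thesis using tr_funpow_Zn(2)[OF _ _ assms(2) phi, of x a] assms by simp
qed

lemma tr_le_Zn:
 assumes "x : V a" "n >= 1"
 shows "(tr E (fd \<delta>) UNIV ^^ n) (%y. indicator {a} (y 0)) x <= ennreal (exp (real n * (\<delta> - P))) * (ennreal (exp (B / (1 - \<theta>))) * Zn E \<phi> a n)"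
proof -
 have "(tr E (fd \<delta>) UNIV ^^ n) (%y. indicator {a} (y 0)) x =
  ennreal (exp (real n * (\<delta> - P))) * (tr E \<phi> UNIV ^^ n) (%y. indicator {a} (y 0)) x"
  by (simp only: tr_fd_funpow_phi)
 also have "... <= ennreal (exp (real n * (\<delta> - P))) * (ennreal (exp (B / (1 - \<theta>))) * Zn E \<phi> a n)"
  using tr_funpow_Zn(1)[OF _ _ assms(2) phi, of x a] assms by (intro mult_left_mono) auto
 finally show ?thesis .
qed

lemma Lb_1_finite: "x : V a ==> Lb f0 a (%_. 1) x ~= top"
proof -
 assume x: "x : V a"
 obtain C \<rho> where t: "0 < C" "0 < \<rho>" "\<rho> < 1" "!!k x. x : V a ==> b k x <= ennreal (C * \<rho> ^ k)" using b_tail by blast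
 have "Lb f0 a (%_. 1) x <= (\<Sum>k. ennreal (C * \<rho> ^ k))"
  unfolding Lb_sum b_def[symmetric] using t x by (intro suminf_le) auto
 also have "... = ennreal (\<Sum>k. C * \<rho> ^ k)" using t by (intro suminf_ennreal2 summable_mult summable_geometric) auto
 finally show ?thesis by (metis ennreal_neq_top top.extremum_uniqueI)
qed

text \<open>An eigenvalue other than 1 leaves room for a small \<delta>. If \<open>l < 1\<close>,
  raising the potential keeps the induced operator below 1; this yields a superharmonic function
  that is bounded on the cylinder and forces the pressure below \<open>P\<close>. If
  \<open>l > 1\<close>, lowering the potential keeps the induced operator above 1, so the Green
  function diverges although the pressure has become negative.\<close>

lemma eigenvalue_1:
 assumes l: "l > 0" and C: "C0 > 0" and hb: "!!x. x : V a ==> inverse C0 <= h x & h x <= C0"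
  and hc: "cone (V a) Ds (%x. ennreal (h x))"
  and ev: "!!x. x : V a ==> Lb f0 a (%x. ennreal (h x)) x = ennreal (l * h x)"
 shows "l = 1"
proof -
 obtain C \<rho> where t: "0 < C" "0 < \<rho>" "\<rho> < 1" "!!k x. x : V a ==> b k x <= ennreal (C * \<rho> ^ k)" using b_tail by blast
 define w where "w k x = (tr E f0 (- {a}) ^^ k) (tr E f0 {a} (%x. ennreal (h x))) x" for k x
 define C4 where "C4 = C0 * C0 * C"
 have iC: "0 < inverse C0" using C by simp
 have h0: "0 < h x" if "x : V a" for x using hb[OF that] iC by linarith
 \<comment> \<open>Comparing \<open>h\<close> with the constant \<open>C0\<close> reduces the
   excursion terms to the weights \<open>b k\<close>; the second factor \<open>C0\<close> in
   \<open>C4\<close> restores \<open>h x\<close> on the right.\<close>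
 have wle: "w k x <= ennreal (C4 * \<rho> ^ k) * ennreal (h x)" if x: "x : V a" for k x
 proof -
  have "w k x <= (tr E f0 (- {a}) ^^ k) (%x. ennreal C0 * tr E f0 {a} (%_. 1) x) x"
   unfolding w_def tr_cmult[symmetric] using x hb
   by (intro tr_funpow_mono tr_mono) (auto intro: ennreal_leI)
  also have "... = ennreal C0 * b k x" unfolding tr_funpow_cmult b_def ..
  also have "... <= ennreal C0 * ennreal (C * \<rho> ^ k)" using t x by (intro mult_left_mono) auto
  also have "... = ennreal (C0 * C * \<rho> ^ k)" using C t by (simp add: ennreal_mult[symmetric] mult.assoc)
  also have "... <= ennreal (C4 * \<rho> ^ k * h x)"
  proof (rule ennreal_leI)
   have "1 <= C0 * h x" using hb[OF x] C by (simp add: field_simps)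
   then have "C0 * C * \<rho> ^ k * 1 <= C0 * C * \<rho> ^ k * (C0 * h x)" using C t by (intro mult_left_mono) auto
   then show "C0 * C * \<rho> ^ k <= C4 * \<rho> ^ k * h x" by (simp add: C4_def ac_simps)
  qed
  also have "... = ennreal (C4 * \<rho> ^ k) * ennreal (h x)" using C t h0[OF x] by (simp add: C4_def ennreal_mult)
  finally show ?thesis .
 qed
 have wsum: "(\<Sum>k. w k x) = ennreal (l * h x)" if "x : V a" for x
  using ev[OF that] unfolding Lb_sum w_def .
 have C40: "0 <= C4" using C t by (simp add: C4_def)
 have pert: "\<exists>\<delta>>0. (\<forall>x\<in>V a. Lb (fd \<delta>) a (%x. ennreal (h x)) x <= ennreal ((l + \<epsilon>) * h x)) &
   (\<forall>x\<in>V a. ennreal ((l - \<epsilon>) * h x) <= Lb (fd (- \<delta>)) a (%x. ennreal (h x)) x)" if e: "\<epsilon> > 0" for \<epsilon>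
 proof -
  obtain \<delta> where d: "\<delta> > 0" "\<rho> * exp \<delta> < 1"
   "summable (%k. C4 * \<rho> ^ k * (exp (\<delta> * (real k + 1)) - 1))"
   "(\<Sum>k. C4 * \<rho> ^ k * (exp (\<delta> * (real k + 1)) - 1)) < \<epsilon>"
   using small_perturbation[of \<rho> \<epsilon> C4] t e by auto
  define ee where "ee k = exp (\<delta> * (real k + 1)) - 1" for k :: nat
  have ge1: "0 <= ee k" for k using d(1) by (simp add: ee_def)
  have ee1: "ennreal (exp (\<delta> * (real k + 1))) = 1 + ennreal (ee k)" for k
  proof -
   have "exp (\<delta> * (real k + 1)) = 1 + ee k" by (simp add: ee_def)
   then show ?thesis using ge1[of k] by simp
  qed
  note d' = d(3,4)[folded ee_def]
  have S: "(\<Sum>k. ennreal (ee k) * w k x) <= ennreal (\<epsilon> * h x)" if x: "x : V a" for x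
  proof -
   have "(\<Sum>k. ennreal (ee k) * w k x) \<le>
     (\<Sum>k. ennreal (h x) * ennreal (C4 * \<rho> ^ k * (ee k)))"
   proof (intro suminf_le allI summableI)
    fix k
    have "ennreal (ee k) * w k x <= ennreal (ee k) * (ennreal (C4 * \<rho> ^ k) * ennreal (h x))"
     by (intro mult_left_mono wle[OF x]) auto
    also have "... = ennreal (h x) * ennreal (C4 * \<rho> ^ k * (ee k))"
     using C40 t ge1[of k] by (subst ennreal_mult) (auto simp: ac_simps)
    finally show "ennreal (ee k) * w k x <= ennreal (h x) * ennreal (C4 * \<rho> ^ k * (ee k))" .
   qed
   also have "... = ennreal (h x) * ennreal (\<Sum>k. C4 * \<rho> ^ k * (ee k))"
   proof -
    have "0 <= C4 * \<rho> ^ k * (ee k)" for k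
     using C40 t ge1[of k] by (intro mult_nonneg_nonneg) auto
    then have "(\<Sum>k. ennreal (C4 * \<rho> ^ k * ee k)) = ennreal (\<Sum>k. C4 * \<rho> ^ k * ee k)"
     by (rule suminf_ennreal2[OF _ d'(1)])
    then show ?thesis unfolding ennreal_suminf_cmult by (rule arg_cong)
   qed
   also have "... <= ennreal (h x) * ennreal \<epsilon>" using d'(2) by (intro mult_left_mono ennreal_leI) auto
   also have "... = ennreal (\<epsilon> * h x)" using h0[OF x] e by (simp add: ennreal_mult[symmetric] mult.commute)
   finally show ?thesis .
  qed
  have A1: "Lb (fd \<delta>) a (%x. ennreal (h x)) x <= ennreal ((l + \<epsilon>) * h x)" if x: "x : V a" for x
  proof -
   have "Lb (fd \<delta>) a (%x. ennreal (h x)) x = (\<Sum>k. w k x + ennreal (ee k) * w k x)"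
   proof -
    have "ennreal (exp (\<delta> * (real k + 1))) * w k x = w k x + ennreal (ee k) * w k x" for k
     unfolding ee1 by (simp add: distrib_right)
    then show ?thesis by (simp only: Lb_add_const w_def[symmetric])
   qed
   also have "... = ennreal (l * h x) + (\<Sum>k. ennreal (ee k) * w k x)"
    unfolding wsum[OF x, symmetric] by (rule suminf_add[symmetric]) auto
   also have "... <= ennreal (l * h x) + ennreal (\<epsilon> * h x)" by (intro add_left_mono S x)
   also have "... = ennreal ((l + \<epsilon>) * h x)" using l e h0[OF x] by (simp add: distrib_right)
   finally show ?thesis .
  qed
  have A2: "ennreal ((l - \<epsilon>) * h x) <= Lb (fd (- \<delta>)) a (%x. ennreal (h x)) x" if x: "x : V a" for x
  proof -
   have "ennreal (l * h x) <= (\<Sum>k. ennreal (exp (- \<delta> * (real k + 1))) * w k x + ennreal (ee k) * w k x)"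
    unfolding wsum[OF x, symmetric]
   proof (intro suminf_le allI summableI)
    fix k
    define s where "s = \<delta> * (real k + 1)"
    have s: "0 <= s" using d(1) by (simp add: s_def)
    \<comment> \<open>The loss \<open>1 - exp (- s)\<close> from lowering is at most the gain
      \<open>exp s - 1\<close> from raising, so one summable bound serves both directions.\<close>
    have "1 <= exp (- s) + (exp s - 1)"
     using exp_ge_add_one_self[of s] exp_ge_add_one_self[of "- s"] by linarith
    then have "ennreal 1 <= ennreal (exp (- s) + (exp s - 1))" by (rule ennreal_leI)
    also have "... = ennreal (exp (- s)) + ennreal (exp s - 1)" by (rule ennreal_plus) (use s in auto)
    finally have "ennreal 1 <= ennreal (exp (- s)) + ennreal (exp s - 1)" .
    from mult_right_mono[OF this, of "w k x"]
    show "w k x <= ennreal (exp (- \<delta> * (real k + 1))) * w k x + ennreal (ee k) * w k x"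
     unfolding distrib_right by (simp add: s_def ee_def)
   qed
   also have "... = Lb (fd (- \<delta>)) a (%x. ennreal (h x)) x + (\<Sum>k. ennreal (ee k) * w k x)"
    unfolding Lb_add_const w_def by (rule suminf_add[symmetric]) auto
   also have "... <= Lb (fd (- \<delta>)) a (%x. ennreal (h x)) x + ennreal (\<epsilon> * h x)" by (intro add_left_mono S x)
   finally have "ennreal (l * h x) - ennreal (\<epsilon> * h x) <= Lb (fd (- \<delta>)) a (%x. ennreal (h x)) x"
    by (simp add: ennreal_minus_le_iff add.commute)
   then show ?thesis using e h0[OF x] by (simp add: ennreal_minus left_diff_distrib)
  qed
  show ?thesis using d(1) A1 A2 by blast
 qed
 have l_ge: "\<not> l < 1"
 proof
  assume "l < 1"
  then obtain \<delta> where d: "\<delta> > 0" "!!x. x : V a ==> Lb (fd \<delta>) a (%x. ennreal (h x)) x <= ennreal ((l + (1 - l)) * h x)"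
   using pert[of "1 - l"] by auto
  define f' where "f' = fd \<delta>"
  \<comment> \<open>One application of \<open>Lb\<close> extends \<open>h\<close> from the cylinder
    to \<open>X\<close>; because \<open>H\<close> is at most \<open>h\<close> on the cylinder, the
    first-step decomposition makes it superharmonic.\<close>
  define H where "H = Lb f' a (%x. ennreal (h x))"
  have Hh: "H x <= ennreal (h x)" if "x : V a" for x using d(2)[OF that] by (simp add: H_def f'_def)
  have wH: "ennreal (l * h x) <= H x" if "x : V a" for x
  proof -
   have "(\<Sum>k. 1 * w k x) <= (\<Sum>k. ennreal (exp (\<delta> * (real k + 1))) * w k x)"
    using d(1) by (intro suminf_le allI mult_right_mono) (auto simp flip: ennreal_1 intro!: ennreal_leI)
   then show ?thesis using wsum[OF that] unfolding H_def f'_def Lb_add_const w_def by simp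
  qed
  have super: "tr E f' UNIV H x <= H x" if "x : X" for x
  proof -
   have "tr E f' UNIV H x = tr E f' {a} H x + tr E f' (- {a}) H x" by (rule tr_split)
   also have "... <= tr E f' {a} (%x. ennreal (h x)) x + tr E f' (- {a}) H x"
    using Hh that by (intro add_right_mono tr_mono) auto
   also have "... = H x" unfolding H_def by (rule Lb_unfold[symmetric])
   finally show ?thesis .
  qed
  have iter: "(tr E f' UNIV ^^ n) H x <= H x" if "x : X" for n x
   using that
  proof (induction n arbitrary: x)
   case (Suc n)
   have "tr E f' UNIV ((tr E f' UNIV ^^ n) H) x <= tr E f' UNIV H x" using Suc by (intro tr_mono) auto
   then show ?case using super[OF Suc.prems] by simp
  qed simp
  have bnd: "(tr E f' UNIV ^^ n) (%y. indicator {a} (y 0)) x <= ennreal (C0 / l * C0)" if x: "x : V a" for n x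
  proof -
   have "(tr E f' UNIV ^^ n) (%y. indicator {a} (y 0)) x <= (tr E f' UNIV ^^ n) (%y. ennreal (C0 / l) * H y) x"
   proof (rule tr_funpow_mono)
    fix y assume y: "y : X"
    show "indicator {a} (y 0) <= ennreal (C0 / l) * H y"
    proof (cases "y 0 = a")
     case True
     then have yV: "y : V a" using y by simp
     have "1 <= C0 / l * (l * h y)" using hb[OF yV] C l by (simp add: field_simps)
     then have "1 <= ennreal (C0 / l) * ennreal (l * h y)"
      using C l h0[OF yV] by (subst ennreal_mult[symmetric]) (auto simp flip: ennreal_1 intro!: ennreal_leI)
     also have "... <= ennreal (C0 / l) * H y" by (intro mult_left_mono wH yV) auto
     finally show ?thesis using True by simp
    qed simp
   qed (use x in auto)
   also have "... = ennreal (C0 / l) * (tr E f' UNIV ^^ n) H x" by (simp add: tr_funpow_cmult)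
   also have "... <= ennreal (C0 / l) * H x" using iter x by (intro mult_left_mono) auto
   also have "... <= ennreal (C0 / l) * ennreal C0"
    using Hh[OF x] hb[OF x] by (intro mult_left_mono) (auto intro: order_trans ennreal_leI)
   also have "... = ennreal (C0 / l * C0)" using C l by (simp add: ennreal_mult[symmetric])
   finally show ?thesis .
  qed
  obtain x where x: "x : V a" using V_nonempty by blast
  have "Zn E \<phi> a n <= ennreal (exp (B / (1 - \<theta>)) * (C0 / l * C0) * exp (real n * (P - \<delta>)))" if n: "n >= 1" for n
  proof -
   have "Zn E \<phi> a n <= ennreal (exp (B / (1 - \<theta>))) * (ennreal (exp (real n * (P - \<delta>))) * ennreal (C0 / l * C0))"
    using Zn_le_of_tr[OF x n, of \<delta>] bnd[OF x, of n, unfolded f'_def]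
    by (meson mult_left_mono order_trans zero_le)
   also have "... = ennreal (exp (B / (1 - \<theta>)) * (C0 / l * C0) * exp (real n * (P - \<delta>)))"
    using C l by (simp add: ennreal_mult[symmetric] ac_simps)
   finally show ?thesis .
  qed
  then have "gurevich_pressure E \<phi> a <= ereal (P - \<delta>)"
   unfolding gurevich_pressure_def
   by (rule limsup_eln_le[where C="exp (B / (1 - \<theta>)) * (C0 / l * C0)"]) (use C l in auto)
  then show False using press d(1) by simp
 qed
 have l_le: "\<not> l > 1"
 proof
  assume "l > 1"
  then obtain \<delta> where d: "\<delta> > 0" "!!x. x : V a ==> ennreal ((l - (l - 1)) * h x) <= Lb (fd (- \<delta>)) a (%x. ennreal (h x)) x"
   using pert[of "l - 1"] by auto
  define f' where "f' = fd (- \<delta>)"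
  define I where "I y = (indicator {a} (y 0) :: ennreal)" for y :: "nat => 'a"
  \<comment> \<open>The full Green function at \<open>a\<close> for the lowered potential; its terms
    decay because the pressure has become \<open>- \<delta>\<close>.\<close>
  define U where "U x = (\<Sum>n. (tr E f' UNIV ^^ n) I x)" for x
  obtain x where x: "x : V a" using V_nonempty by blast
  have fin: "(tr E f' UNIV ^^ n) I x < top" for n
  proof (cases "n >= 1")
   case True
   have "(tr E f' UNIV ^^ n) I x <= ennreal (exp (real n * (- \<delta> - P))) * (ennreal (exp (B / (1 - \<theta>))) * Zn E \<phi> a n)"
    using tr_le_Zn[OF x True, of "- \<delta>"] unfolding f'_def I_def[abs_def] .
   also have "... < top" using Zn_finite[OF True] by (simp add: ennreal_mult_less_top less_top)
   finally show ?thesis .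
  next
   case False
   then have "n = 0" by simp
   then show ?thesis by (simp add: I_def indicator_def)
  qed
  have "limsup (%n. eln (Zn E \<phi> a n) / ereal (real n)) < ereal (P + \<delta> / 2)"
   using press d(1) by (simp add: gurevich_pressure_def)
  then obtain N0 where N0: "!!n. n >= N0 ==> Zn E \<phi> a n <= ennreal (exp (real n * (P + \<delta> / 2)))"
   using limsup_eln_lessD by blast
  define N where "N = max N0 1"
  have tailU: "(tr E f' UNIV ^^ n) I x <= ennreal (exp (B / (1 - \<theta>)) * exp (- \<delta> / 2) ^ n)" if n: "n >= N" for n
  proof -
   have "(tr E f' UNIV ^^ n) I x <= ennreal (exp (real n * (- \<delta> - P))) * (ennreal (exp (B / (1 - \<theta>))) * Zn E \<phi> a n)"
    using tr_le_Zn[OF x, of n "- \<delta>"] n unfolding f'_def I_def[abs_def] by (simp add: N_def)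
   also have "... <= ennreal (exp (real n * (- \<delta> - P))) * (ennreal (exp (B / (1 - \<theta>))) * ennreal (exp (real n * (P + \<delta> / 2))))"
    using N0 n by (intro mult_left_mono) (auto simp: N_def)
   also have "... = ennreal (exp (B / (1 - \<theta>)) * (exp (real n * (- \<delta> - P)) * exp (real n * (P + \<delta> / 2))))"
    by (simp add: ennreal_mult ac_simps)
   also have "exp (real n * (- \<delta> - P)) * exp (real n * (P + \<delta> / 2)) = exp (- \<delta> / 2) ^ n"
    unfolding exp_add[symmetric] exp_of_nat_mult[symmetric] by (simp add: algebra_simps)
   finally show ?thesis .
  qed
  have "U x < top"
  proof -
   have "U x = (\<Sum>n<N. (tr E f' UNIV ^^ n) I x) + (\<Sum>n. (tr E f' UNIV ^^ (n + N)) I x)"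
    unfolding U_def by (subst suminf_offset[of _ N]) (auto simp: add.commute)
   moreover have "(\<Sum>n<N. (tr E f' UNIV ^^ n) I x) < top" using fin by (simp add: ennreal_sum_less_top)
   moreover have "(\<Sum>n. (tr E f' UNIV ^^ (n + N)) I x) < top"
   proof -
    have "(\<Sum>n. (tr E f' UNIV ^^ (n + N)) I x) <= (\<Sum>n. ennreal (exp (B / (1 - \<theta>)) * exp (- \<delta> / 2) ^ (n + N)))"
     using tailU by (intro suminf_le) auto
    also have "... = ennreal (\<Sum>n. exp (B / (1 - \<theta>)) * exp (- \<delta> / 2) ^ (n + N))"
    proof (rule suminf_ennreal2)
     have "summable (%n. exp (B / (1 - \<theta>)) * exp (- \<delta> / 2) ^ n)"
      using d(1) by (intro summable_mult summable_geometric) auto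
     then show "summable (%n. exp (B / (1 - \<theta>)) * exp (- \<delta> / 2) ^ (n + N))"
      by (rule summable_ignore_initial_segment)
    qed auto
    finally show ?thesis by (rule le_less_trans) simp
   qed
   ultimately show ?thesis by simp
  qed
  moreover have "U x = top"
  proof -
   have Ueq: "U y = I y + tr E f' UNIV U y" for y
   proof -
    have "U y = (tr E f' UNIV ^^ 0) I y + (\<Sum>n. (tr E f' UNIV ^^ Suc n) I y)"
     unfolding U_def by (subst suminf_offset[of _ 1]) auto
    then show ?thesis unfolding U_def[abs_def] tr_suminf by simp
   qed
   \<comment> \<open>Paths are cut at their visits to \<open>a\<close>: \<open>U\<close> solves a
     renewal equation, and minimality of the excursion series turns it into an inequality on the
     cylinder.\<close>
   have UG: "1 + Lb f' a U y <= U y" if y: "y : V a" for y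
   proof -
    have "G f' a (%x. I x + tr E f' {a} U x) y <= U y"
    proof (rule G_least)
     fix z
     have "U z = I z + (tr E f' {a} U z + tr E f' (- {a}) U z)"
      using Ueq[of z] unfolding tr_split[of E f' U z "{a}"] .
     then show "I z + tr E f' {a} U z + tr E f' (- {a}) U z <= U z" by (simp add: add.assoc)
    qed (use y in auto)
    moreover have "1 <= G f' a I y" using G_ge[of I y f' a] y by (simp add: I_def)
    ultimately show ?thesis
     unfolding G_add Lb_def by (meson add_right_mono order_trans)
   qed
   \<comment> \<open>Each pass through the renewal inequality adds 1, which is at least
     \<open>h / C0\<close>, while the induced operator does not decrease the multiple of
     \<open>h\<close> gained so far. Hence \<open>U\<close> exceeds every multiple of
     \<open>h\<close>.\<close>
   have "ennreal (real j / C0) * ennreal (h y) <= U y" if "y : V a" for j y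
    using that
   proof (induction j arbitrary: y)
    case (Suc j)
    have "Lb f' a (%y. ennreal (real j / C0) * ennreal (h y)) y <= Lb f' a U y"
     using Suc by (intro Lb_mono) auto
    moreover have "ennreal (h y) <= Lb f' a (%x. ennreal (h x)) y"
     using d(2)[OF Suc.prems] by (simp add: f'_def)
    ultimately have "ennreal (real j / C0) * ennreal (h y) <= Lb f' a U y"
     unfolding Lb_cmult by (meson mult_left_mono order_trans zero_le)
    then have "1 + ennreal (real j / C0) * ennreal (h y) <= U y" using UG[OF Suc.prems] by (meson add_left_mono order_trans)
    moreover have "ennreal (real (Suc j) / C0) * ennreal (h y) <= 1 + ennreal (real j / C0) * ennreal (h y)"
    proof -
     have "real (Suc j) / C0 * h y <= 1 + real j / C0 * h y"
      using hb[OF Suc.prems] C by (simp add: field_simps)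
     then have "ennreal (real (Suc j) / C0 * h y) <= ennreal (1 + real j / C0 * h y)" by (rule ennreal_leI)
     moreover have "ennreal (real (Suc j) / C0) * ennreal (h y) = ennreal (real (Suc j) / C0 * h y)"
      using C h0[OF Suc.prems] by (intro ennreal_mult[symmetric]) auto
     moreover have "ennreal (1 + real j / C0 * h y) = ennreal 1 + ennreal (real j / C0 * h y)"
      using C h0[OF Suc.prems] by (intro ennreal_plus) auto
     moreover have "ennreal (real j / C0 * h y) = ennreal (real j / C0) * ennreal (h y)"
      using C h0[OF Suc.prems] by (intro ennreal_mult) auto
     ultimately show ?thesis by (simp only: ennreal_1)
    qed
    ultimately show ?case by (meson order_trans)
   qed simp
   note lower = this[OF x]
   show ?thesis
   proof (rule ccontr)
    assume "U x ~= top"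
    then obtain r where r: "U x = ennreal r" "0 <= r" by (metis ennreal_cases)
    have hx: "0 < h x / C0" using h0[OF x] C by simp
    obtain j :: nat where j: "real j > r / (h x / C0)" using reals_Archimedean2 by blast
    have "real j / C0 * h x <= r" using lower[of j] r C h0[OF x] by (simp add: ennreal_mult[symmetric])
    moreover have "r < real j * (h x / C0)" using j hx by (metis pos_divide_less_eq)
    ultimately show False by simp
   qed
  qed
  ultimately show False by simp
 qed
 show "l = 1" using l_ge l_le by linarith
qed

text \<open>The eigenfunction on the cylinder of \<open>a\<close> extends to \<open>X\<close> by \<open>h = Lb h\<close>; harmonicity for
 the full operator is then the first-step decomposition of excursions.\<close>

theorem harmonic_function:
 obtains h D where "!!x. x : X ==> h x > 0" "0 <= D" "cone X D (%x. ennreal (h x))"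
  "!!x. x : X ==> tr E f0 UNIV (%x. ennreal (h x)) x = ennreal (h x)"
  "!!x. x : X ==> Lb f0 a (%x. ennreal (h x)) x = ennreal (h x)"
proof -
 obtain l h C0 where l: "l > 0" and C: "C0 > 0" and hb: "!!x. x : V a ==> inverse C0 <= h x & h x <= C0"
  and hc: "cone (V a) (B * \<theta> / (1 - \<theta>)) (%x. ennreal (h x))"
  and ev: "!!x. x : V a ==> Lb f0 a (%x. ennreal (h x)) x = ennreal (l * h x)"
 proof (rule induced_eigenfunction[OF wvar_f0 phi(2), of a])
  show "Lb f0 a (%_. 1) x ~= top" "Lb f0 a (%_. 1) x ~= 0" if "x : V a" for x
   using Lb_1_finite[OF that] Lb_1_pos[of x] that by auto
 qed blast
 have l1: "l = 1" by (rule eigenvalue_1[OF l C hb _ ev]) (use hc in \<open>auto simp: Ds_def\<close>)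
 define H where "H = Lb f0 a (%x. ennreal (h x))"
 have HV: "H x = ennreal (h x)" if "x : V a" for x using ev[OF that] l1 by (simp add: H_def)
 have Hc: "cone X Ds H"
  using cone_Lb[OF wvar_f0 hc] Ds by (simp add: H_def Ds_def)
 have LH: "Lb f0 a H x = H x" if "x : X" for x
  unfolding H_def[symmetric] using Lb_cong[of a H "%x. ennreal (h x)" x] HV that by (simp add: H_def)
 have trH: "tr E f0 UNIV H x = H x" if "x : X" for x
 proof -
  have "tr E f0 UNIV H x = tr E f0 {a} H x + tr E f0 (- {a}) H x" by (rule tr_split)
  also have "tr E f0 {a} H x = tr E f0 {a} (%x. ennreal (h x)) x" using HV that by (intro tr_cong) auto
  also have "... + tr E f0 (- {a}) H x = H x" unfolding H_def by (rule Lb_unfold[symmetric])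
  finally show ?thesis .
 qed
 obtain x0 where x0: "x0 : V a" using V_nonempty by blast
 have h0: "0 < h x0" using hb[OF x0] C by (meson inverse_positive_iff_positive less_le_trans)
 \<comment> \<open>Bounds are known only on the cylinder of \<open>a\<close>; irreducibility carries
   finiteness and positivity to the rest of \<open>X\<close>.\<close>
 have fin: "H x ~= top" "H x ~= 0" if "x : X" for x
 proof -
  show "H x ~= top" by (rule superharmonic_finite[OF _ Hc _ _ that, of f0 x0]) (use trH x0 HV in auto)
  show "H x ~= 0" by (rule superharmonic_pos[OF _ Hc _ _ that, of f0 x0]) (use trH x0 HV h0 in auto)
 qed
 define k where "k x = enn2real (H x)" for x
 have k: "ennreal (k x) = H x" if "x : X" for x using fin(1)[OF that] by (simp add: k_def less_top)
 show thesis
 proof (rule that[of k Ds])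
  show "k x > 0" if "x : X" for x using fin[OF that] by (simp add: k_def enn2real_positive_iff less_top zero_less_iff_neq_zero)
  show "0 <= Ds" by (rule Ds)
  show "cone X Ds (%x. ennreal (k x))" by (rule cone_cong[OF Hc]) (simp add: k)
  show "tr E f0 UNIV (%x. ennreal (k x)) x = ennreal (k x)" if "x : X" for x
   using tr_cong[of E UNIV "%x. ennreal (k x)" H x f0] k that trH by simp
  show "Lb f0 a (%x. ennreal (k x)) x = ennreal (k x)" if "x : X" for x
   using Lb_cong[of a "%x. ennreal (k x)" H x f0] k that LH by simp
 qed
qed

end

section \<open>Entropy of finite partitions\<close>

definition eta :: "real => real" where "eta t = - (t * ln t)"

lemma eta_0 [simp]: "eta 0 = 0" by (simp add: eta_def)

lemma eta_nonneg: "0 <= t ==> t <= 1 ==> 0 <= eta t"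
 unfolding eta_def by (cases "t = 0") (auto simp: mult_le_0_iff)

text \<open>Gibbs inequality from \<open>ln t <= t - 1\<close>, for a \<open>q\<close> of total mass
  at most \<open>Z\<close> instead of 1. Upper bounds on entropy below come from a suitable choice
  of \<open>q\<close>.\<close>

lemma eta_sum_le_cross_entropy:
 fixes p q :: "'i => real"
 assumes "finite I" "!!i. i : I ==> 0 <= p i" "!!i. i : I ==> p i > 0 ==> q i > 0" "!!i. i : I ==> 0 <= q i"
  and "(\<Sum>i\<in>I. p i) = 1" "(\<Sum>i\<in>I. q i) <= Z" "Z > 0"
 shows "(\<Sum>i\<in>I. eta (p i)) <= (\<Sum>i\<in>I. - (p i * ln (q i))) + ln Z"
proof -
 have "eta (p i) + p i * ln (q i) <= q i / Z - p i + p i * ln Z" if i: "i : I" for i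
 proof (cases "p i = 0")
  case True
  then show ?thesis using assms i by simp
 next
  case False
  then have p: "p i > 0" and q: "q i > 0" using assms i by (auto simp: less_eq_real_def)
  have "ln (q i / (p i * Z)) <= q i / (p i * Z) - 1" using p q assms by (intro ln_le_minus_one) auto
  moreover have "ln (q i / (p i * Z)) = ln (q i) - (ln (p i) + ln Z)"
   using p q assms(7) by (simp add: ln_divide_pos ln_mult_pos)
  ultimately have "p i * (ln (q i) - (ln (p i) + ln Z)) <= p i * (q i / (p i * Z) - 1)"
   using p by (intro mult_left_mono) auto
  also have "... = q i / Z - p i" using p by (simp add: right_diff_distrib)
  finally show ?thesis unfolding eta_def by (simp add: right_diff_distrib distrib_left)
 qed
 then have "(\<Sum>i\<in>I. eta (p i) + p i * ln (q i)) <= (\<Sum>i\<in>I. q i / Z - p i + p i * ln Z)" by (rule sum_mono)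
 also have "... = (\<Sum>i\<in>I. q i) / Z - 1 + ln Z"
  by (simp add: sum.distrib sum_subtractf assms(5) sum_divide_distrib[symmetric] sum_distrib_right[symmetric])
 also have "... <= ln Z" using assms by simp
 finally show ?thesis by (simp add: sum.distrib sum_negf)
qed

text \<open>Gibbs inequality against the product of the two marginals.\<close>

lemma eta_sum_joint_le:
 fixes p :: "'i => 'j => real"
 assumes fin: "finite I" "finite J" and nn: "!!i j. i : I ==> j : J ==> 0 <= p i j"
  and tot: "(\<Sum>i\<in>I. \<Sum>j\<in>J. p i j) = 1"
 shows "(\<Sum>i\<in>I. \<Sum>j\<in>J. eta (p i j)) <= (\<Sum>i\<in>I. eta (\<Sum>j\<in>J. p i j)) + (\<Sum>j\<in>J. eta (\<Sum>i\<in>I. p i j))"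
proof -
 define x where "x i = (\<Sum>j\<in>J. p i j)" for i
 define y where "y j = (\<Sum>i\<in>I. p i j)" for j
 have px: "p i j <= x i" if "i : I" "j : J" for i j
  unfolding x_def using fin nn that by (intro member_le_sum) auto
 have py: "p i j <= y j" if "i : I" "j : J" for i j
  unfolding y_def using fin nn that by (intro member_le_sum) auto
 have x0: "0 <= x i" if "i : I" for i unfolding x_def using nn that by (intro sum_nonneg) auto
 have y0: "0 <= y j" if "j : J" for j unfolding y_def using nn that by (intro sum_nonneg) auto
 have sx: "(\<Sum>i\<in>I. x i) = 1" using tot by (simp add: x_def)
 have sy: "(\<Sum>j\<in>J. y j) = 1" using tot sum.swap[of p J I] by (simp add: y_def)
 have "(\<Sum>ij\<in>I\<times>J. eta (case ij of (i, j) => p i j)) \<le>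
  (\<Sum>ij\<in>I\<times>J. - ((case ij of (i, j) => p i j) * ln (case ij of (i, j) => x i * y j))) + ln 1"
 proof (rule eta_sum_le_cross_entropy)
  show "(\<Sum>ij\<in>I\<times>J. case ij of (i, j) => p i j) = 1" using tot by (simp add: sum.cartesian_product)
  have "(\<Sum>ij\<in>I\<times>J. case ij of (i, j) => x i * y j) = (\<Sum>i\<in>I. x i) * (\<Sum>j\<in>J. y j)"
   unfolding sum_product sum.cartesian_product ..
  then show "(\<Sum>ij\<in>I\<times>J. case ij of (i, j) => x i * y j) <= 1" using sx sy by simp
  show "0 < (case ij of (i, j) => x i * y j)" if "ij : I \<times> J" "0 < (case ij of (i, j) => p i j)" for ij
   using that px py by (cases ij) (auto intro!: mult_pos_pos intro: less_le_trans)
 qed (use fin nn x0 y0 in auto)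
 also have "... = (\<Sum>ij\<in>I\<times>J. - ((case ij of (i, j) => p i j) * ln (case ij of (i, j) => x i * y j)))"
  by (simp only: ln_one add_0_right)
 also have "... = (\<Sum>ij\<in>I\<times>J. case ij of (i, j) => - (p i j * ln (x i)) + - (p i j * ln (y j)))"
 proof -
  have eq: "- (p i j * ln (x i * y j)) = - (p i j * ln (x i)) + - (p i j * ln (y j))" if "i : I" "j : J" for i j
  proof (cases "p i j = 0")
   case False
   then have "0 < p i j" using nn[OF that] by simp
   then have "0 < x i" "0 < y j" using px[OF that] py[OF that] by linarith+
   then show ?thesis by (simp add: ln_mult_pos distrib_left)
  qed simp
  show ?thesis
  proof (rule sum.cong[OF refl])
   fix ij assume "ij : I \<times> J"
   then obtain i j where ij: "ij = (i, j)" "i : I" "j : J" by blast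
   show "- ((case ij of (i, j) => p i j) * ln (case ij of (i, j) => x i * y j)) =
     (case ij of (i, j) => - (p i j * ln (x i)) + - (p i j * ln (y j)))"
    unfolding ij(1) prod.case by (rule eq[OF ij(2,3)])
  qed
 qed
 also have "... = (\<Sum>i\<in>I. \<Sum>j\<in>J. - (p i j * ln (x i)) + - (p i j * ln (y j)))"
  by (rule sum.cartesian_product[symmetric])
 also have "... = (\<Sum>i\<in>I. \<Sum>j\<in>J. - (p i j * ln (x i))) + (\<Sum>j\<in>J. \<Sum>i\<in>I. - (p i j * ln (y j)))"
  by (simp only: sum.distrib sum.swap[of "%i j. - (p i j * ln (y j))" J I])
 also have "... = (\<Sum>i\<in>I. eta (x i)) + (\<Sum>j\<in>J. eta (y j))"
  by (simp add: eta_def x_def y_def sum_negf sum_distrib_right)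
 finally have "(\<Sum>ij\<in>I\<times>J. eta (case ij of (i, j) => p i j)) <= (\<Sum>i\<in>I. eta (x i)) + (\<Sum>j\<in>J. eta (y j))" .
 moreover have "(\<Sum>i\<in>I. \<Sum>j\<in>J. eta (p i j)) = (\<Sum>ij\<in>I\<times>J. eta (case ij of (i, j) => p i j))"
  unfolding sum.cartesian_product by (rule sum.cong) auto
 ultimately show ?thesis unfolding x_def y_def by simp
qed

text \<open>Fekete's lemma. \<open>entropy_wrt\<close> is written with \<open>lim\<close>, which
  carries information only once convergence is known.\<close>

lemma fekete_convergent:
 fixes a :: "nat => real"
 assumes nn: "!!n. 0 <= a n" and sub: "!!n k. a (n + k) <= a n + a k"
 shows "convergent (%n. a n / real n)"
proof -
 define L where "L = Inf ((%n. a n / real n) ` {1..})"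
 have bdd: "bdd_below ((%n. a n / real n) ` {1..})" using nn by (intro bdd_belowI[of _ 0]) auto
 have Lle: "L <= a n / real n" if "n >= 1" for n unfolding L_def using bdd that by (intro cInf_lower) auto
 have mult: "a (q * N) <= real q * a N" if "q >= 1" for q N
  using that
 proof (induction q rule: dec_induct)
  case (step q)
  have "a (Suc q * N) <= a (q * N) + a N" using sub[of "q * N" N] by (simp add: add.commute)
  also have "... <= real (Suc q) * a N" using step by (simp add: algebra_simps)
  finally show ?case .
 qed simp
 have "(%n. a n / real n) \<longlonglongrightarrow> L"
 proof (rule LIMSEQ_I)
  fix \<epsilon> :: real assume e: "0 < \<epsilon>"
  have "\<exists>t\<in>(%n. a n / real n) ` {1..}. t < L + \<epsilon> / 2"
   using cInf_lessD[of "(%n. a n / real n) ` {1..}" "L + \<epsilon> / 2"] e unfolding L_def by auto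
  then obtain N where N: "N >= 1" "a N / real N < L + \<epsilon> / 2" by auto
  define M where "M = (\<Sum>r<N. a r)"
  have M: "a r <= M" if "r < N" for r unfolding M_def using that nn by (intro member_le_sum) auto
  have M0: "0 <= M" unfolding M_def using nn by (intro sum_nonneg) auto
  obtain n0 :: nat where n0: "real n0 > 2 * M / \<epsilon>" using reals_Archimedean2 by blast
  have "norm (a n / real n - L) < \<epsilon>" if n: "n >= max N (Suc n0)" for n
  proof -
   define q where "q = n div N"
   define r where "r = n mod N"
   have q: "q >= 1" using n N by (simp add: q_def div_greater_zero_iff Suc_leI)
   have r: "r < N" using N by (simp add: r_def)
   have nq: "n = q * N + r" by (simp add: q_def r_def)
   have n1: "real n > 0" using n by simp
   have "a n <= real q * a N + M"
    using sub[of "q * N" r] mult[OF q, of N] M[OF r] by (simp add: nq[symmetric])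
   also have "real q * a N = real (q * N) * (a N / real N)" using N by simp
   also have "... <= real n * (a N / real N)" using nq nn by (intro mult_right_mono) auto
   finally have "a n / real n <= (real n * (a N / real N) + M) / real n" using n1 by (simp add: divide_right_mono)
   also have "... = a N / real N + M / real n" using n1 by (simp add: add_divide_distrib)
   also have "M / real n < \<epsilon> / 2"
   proof -
    have "2 * M / \<epsilon> < real n" using n0 n by linarith
    then show ?thesis using e n1 by (simp add: field_simps)
   qed
   finally have "a n / real n < L + \<epsilon>" using N by linarith
   moreover have "L <= a n / real n" using Lle n by simp
   ultimately show ?thesis by simp
  qed
  then show "\<exists>n0. \<forall>n\<ge>n0. norm (a n / real n - L) < \<epsilon>" by blast
 qed
 then show ?thesis by (auto simp: convergent_def)
qed

section \<open>Itineraries and entropy for an invariant measure\<close>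

definition icyl :: "'b measure => ('b => 'b) => nat => (nat => 'b set) => 'b set" where
 "icyl m T n F = space m \<inter> (\<Inter>k<n. (T ^^ k) -` F k)"

abbreviation itin :: "'c set => nat => (nat => 'c) set" where
 "itin Q n \<equiv> PiE {..<n} (%_. Q)"

lemma icyl_iff: "x : icyl m T n F \<longleftrightarrow> x : space m & (\<forall>k<n. (T ^^ k) x : F k)"
 by (auto simp: icyl_def)

lemma refine_eq_image: "refine m Q n = icyl m shift n ` itin Q n"
proof (rule set_eqI, rule iffI)
 fix A assume "A : refine m Q n"
 then obtain F where F: "\<forall>k<n. F k : Q" "A = space m \<inter> (\<Inter>k<n. (shift ^^ k) -` F k)" by (auto simp: refine_def)
 have "A = icyl m shift n (restrict F {..<n})" using F by (auto simp: icyl_def)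
 then show "A : icyl m shift n ` itin Q n" using F by (auto simp: PiE_iff extensional_def)
next
 fix A assume "A : icyl m shift n ` itin Q n"
 then show "A : refine m Q n" by (auto simp: refine_def icyl_def PiE_iff)
qed

locale invariant_shift =
 fixes E :: "'a::countable => 'a => bool" and m :: "(nat => 'a) measure"
 assumes inv: "invariant_prob E m"
begin

lemma sets_m [measurable_cong]: "sets m = sets (shift_space E)"
 using inv by (simp add: invariant_prob_def)

lemma space_m [simp]: "space m = sigma_plus E"
 using sets_eq_imp_space_eq[OF sets_m] by simp

sublocale prob_space m
 using inv by (simp add: invariant_prob_def)

lemma measurable_m: "f : borel_measurable m \<longleftrightarrow> f : borel_measurable (shift_space E)"
 unfolding measurable_cong_sets[OF sets_m refl] ..

lemma measurable_shift_m [measurable]: "shift : measurable m m"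
 unfolding measurable_cong_sets[OF sets_m sets_m] by (rule measurable_shift)

lemma measurable_funpow_m [measurable]: "(shift ^^ k) : measurable m m"
 unfolding measurable_cong_sets[OF sets_m sets_m] by (rule measurable_funpow_shift)

lemma distr_shift: "distr m m shift = m"
proof (rule measure_eqI)
 fix A assume "A : sets (distr m m shift)"
 then have A: "A : sets m" by simp
 then show "emeasure (distr m m shift) A = emeasure m A"
  using inv by (subst emeasure_distr) (auto simp: invariant_prob_def)
qed simp

lemma distr_funpow_shift: "distr m m (shift ^^ k) = m"
proof (induction k)
 case (Suc k)
 have "distr m m (shift ^^ Suc k) = distr (distr m m (shift ^^ k)) m shift"
  by (subst distr_distr) (auto simp: comp_def)
 also have "... = m" using Suc distr_shift by simp
 finally show ?case .
qed (simp add: distr_id2)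

lemma integral_funpow_shift:
 "u : borel_measurable m ==> (\<integral>x. u ((shift ^^ k) x) \<partial>m) = (\<integral>x. u x \<partial>m)" for u :: "_ => real"
 using integral_distr[of "shift ^^ k" m m u] by (simp add: distr_funpow_shift)

lemma integrable_funpow_shift:
 "integrable m u ==> integrable m (%x. u ((shift ^^ k) x))" for u :: "_ => real"
 using integrable_distr[of "shift ^^ k" m m u] by (simp add: distr_funpow_shift)

lemma integral_birkhoff:
 assumes "integrable m u" shows "(\<integral>x. birkhoff u n x \<partial>m) = real n * (\<integral>x. u x \<partial>m)"
  and "integrable m (birkhoff u n)"
 using assms integral_funpow_shift[of u] integrable_funpow_shift[OF assms]
 unfolding birkhoff_def[abs_def] by (auto simp: Bochner_Integration.integral_sum)

lemma measure_funpow_shift: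
 assumes "A : sets m" shows "measure m (space m \<inter> (shift ^^ k) -` A) = measure m A"
proof -
 have "measure (distr m m (shift ^^ k)) A = measure m ((shift ^^ k) -` A \<inter> space m)"
  using assms by (intro measure_distr) auto
 then show ?thesis by (simp only: distr_funpow_shift Int_commute)
qed

lemma icyl_sets: "(!!k. k < n ==> F k : sets m) ==> icyl m shift n F : sets m"
proof -
 assume F: "!!k. k < n ==> F k : sets m"
 have "icyl m shift n F = {x : space m. \<forall>k\<in>{..<n}. (shift ^^ k) x : F k}" by (auto simp: icyl_def)
 also have "... : sets m"
 proof (rule sets.sets_Collect_finite_All)
  fix k assume "k : {..<n}"
  then show "{x : space m. (shift ^^ k) x : F k} : sets m"
   using measurable_sets[OF measurable_funpow_m[of k] F[of k]] by (simp add: vimage_def Int_def conj_commute)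
 qed simp
 finally show ?thesis .
qed

context
 fixes Q assumes Q: "finite_partition m Q"
begin

lemma Q_props: "finite Q" "Q \<subseteq> sets m" "\<Union>Q = sigma_plus E" "disjoint Q"
 using Q by (auto simp: finite_partition_def)

lemma finite_itin: "finite (itin Q n)"
 using Q_props by (intro finite_PiE) auto

lemma itin_sets: "F : itin Q n ==> icyl m shift n F : sets m"
 using Q_props by (intro icyl_sets) (auto simp: PiE_iff)

lemma itin_disjoint: "F : itin Q n ==> F' : itin Q n ==> F ~= F' ==> icyl m shift n F \<inter> icyl m shift n F' = {}"
proof -
 assume F: "F : itin Q n" "F' : itin Q n" "F ~= F'"
 then obtain k where k: "k < n" "F k ~= F' k" by (metis PiE_ext lessThan_iff)
 then have "F k \<inter> F' k = {}" using Q_props(4) F by (auto simp: disjoint_def PiE_iff)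
 then have "(shift ^^ k) x \<notin> F k \<inter> F' k" for x by simp
 then show ?thesis using k(1) unfolding icyl_iff set_eq_iff Int_iff by blast
qed

lemma itin_cover: "x : sigma_plus E ==> \<exists>!F. F : itin Q n & x : icyl m shift n F"
proof -
 assume x: "x : sigma_plus E"
 have "\<exists>A\<in>Q. (shift ^^ k) x : A" for k using funpow_shift_in_sigma[OF x, of k] Q_props(3) by blast
 then obtain A where A: "!!k. A k : Q" "!!k. (shift ^^ k) x : A k" by metis
 have "restrict A {..<n} : itin Q n" "x : icyl m shift n (restrict A {..<n})"
  using A x by (auto simp: icyl_iff)
 moreover have "F = F'" if "F : itin Q n" "x : icyl m shift n F" "F' : itin Q n" "x : icyl m shift n F'" for F F'
  using itin_disjoint[of F n F'] that by blast
 ultimately show ?thesis by blast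
qed

text \<open>\<open>refine\<close> is a set of sets, in which different itineraries may name the same
  cell. Distinct itineraries have disjoint cells, so coinciding ones are empty and contribute
  \<open>0 * ln 0 = 0\<close>; entropies can therefore be summed over itineraries.\<close>

lemma part_entropy_refine: "part_entropy m (refine m Q n) = (\<Sum>F\<in>itin Q n. eta (measure m (icyl m shift n F)))"
proof -
 have "(\<Sum>A\<in>icyl m shift n ` itin Q n. measure m A * ln (measure m A)) =
   (\<Sum>F\<in>itin Q n. measure m (icyl m shift n F) * ln (measure m (icyl m shift n F)))"
 proof (subst sum.reindex_nontrivial[OF finite_itin])
  fix F F' assume *: "F : itin Q n" "F' : itin Q n" "F ~= F'" "icyl m shift n F = icyl m shift n F'"
  then have "icyl m shift n F = {}" using itin_disjoint[OF *(1-3)] by auto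
  then show "measure m (icyl m shift n F) * ln (measure m (icyl m shift n F)) = 0" by simp
 qed simp
 then show ?thesis by (simp add: part_entropy_def refine_eq_image eta_def sum_negf)
qed

lemma sum_itin: "A : sets m ==> (\<Sum>F\<in>itin Q n. measure m (A \<inter> icyl m shift n F)) = measure m A"
proof -
 assume A: "A : sets m"
 have "measure m A = measure m (\<Union>F\<in>itin Q n. A \<inter> icyl m shift n F)"
 proof (rule arg_cong[where f="measure m"])
  show "A = (\<Union>F\<in>itin Q n. A \<inter> icyl m shift n F)"
  proof (intro set_eqI iffI)
   fix x assume x: "x : A"
   then have "x : sigma_plus E" using sets.sets_into_space[OF A] by auto
   then obtain F where "F : itin Q n" "x : icyl m shift n F" using itin_cover[of x n] by blast
   then show "x : (\<Union>F\<in>itin Q n. A \<inter> icyl m shift n F)" using x by blast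
  qed blast
 qed
 also have "... = (\<Sum>F\<in>itin Q n. measure m (A \<inter> icyl m shift n F))"
 proof (rule finite_measure_finite_Union)
  show "disjoint_family_on (%F. A \<inter> icyl m shift n F) (itin Q n)"
   using itin_disjoint unfolding disjoint_family_on_def by blast
 qed (use finite_itin A itin_sets in auto)
 finally show ?thesis by simp
qed

lemma part_entropy_nonneg: "0 <= part_entropy m (refine m Q n)"
 unfolding part_entropy_refine by (intro sum_nonneg eta_nonneg) auto

text \<open>Concatenation identifies pairs of itineraries with long ones, and invariance of the
  measure identifies the second marginal with the law of an unshifted itinerary.\<close>

lemma part_entropy_subadditive:
 "part_entropy m (refine m Q (n + k)) <= part_entropy m (refine m Q n) + part_entropy m (refine m Q k)"
proof -
 define j where "j = (%(F, F'). restrict (%i. if i < n then F i else F' (i - n)) {..<n + k} :: nat => (nat => 'a) set)"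
 define C where "C F F' = icyl m shift n F \<inter> (space m \<inter> (shift ^^ n) -` icyl m shift k F')" for F F'
 have jC: "icyl m shift (n + k) (j (F, F')) = C F F'" for F F'
 proof -
  have "(\<forall>i<n + k. (shift ^^ i) x : (if i < n then F i else F' (i - n))) \<longleftrightarrow>
   (\<forall>i<n. (shift ^^ i) x : F i) & (\<forall>i<k. (shift ^^ (i + n)) x : F' i)" for x :: "nat => 'a"
  proof (intro iffI conjI allI impI)
   fix i assume *: "\<forall>i<n + k. (shift ^^ i) x : (if i < n then F i else F' (i - n))" "i < n"
   then show "(shift ^^ i) x : F i" using *(1)[rule_format, of i] by simp
  next
   fix i assume *: "\<forall>i<n + k. (shift ^^ i) x : (if i < n then F i else F' (i - n))" "i < k"
   then show "(shift ^^ (i + n)) x : F' i" using *(1)[rule_format, of "i + n"] by simp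
  next
   fix i assume *: "(\<forall>i<n. (shift ^^ i) x : F i) & (\<forall>i<k. (shift ^^ (i + n)) x : F' i)" "i < n + k"
   show "(shift ^^ i) x : (if i < n then F i else F' (i - n))"
   proof (cases "i < n")
    case False
    then have "(shift ^^ (i - n + n)) x : F' (i - n)" using * by (intro conjunct2[OF *(1), rule_format]) auto
    then show ?thesis using False by simp
   qed (use * in auto)
  qed
  then show ?thesis
   by (auto simp: icyl_iff C_def j_def funpow_shift_add simp del: funpow.simps)
 qed
 have bij: "bij_betw j (itin Q n \<times> itin Q k) (itin Q (n + k))"
 proof (rule bij_betw_byWitness[where f'="%F. (restrict F {..<n}, restrict (%i. F (i + n)) {..<k})"])
  show "\<forall>p\<in>itin Q n \<times> itin Q k. (restrict (j p) {..<n}, restrict (%i. j p (i + n)) {..<k}) = p"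
   by (auto simp: j_def PiE_iff extensional_def fun_eq_iff)
  show "\<forall>F\<in>itin Q (n + k). j (restrict F {..<n}, restrict (%i. F (i + n)) {..<k}) = F"
   by (auto simp: j_def PiE_iff extensional_def fun_eq_iff)
  show "j ` (itin Q n \<times> itin Q k) \<subseteq> itin Q (n + k)"
   by (auto simp: j_def PiE_iff extensional_def)
  show "(%F. (restrict F {..<n}, restrict (%i. F (i + n)) {..<k})) ` itin Q (n + k) \<subseteq> itin Q n \<times> itin Q k"
   by (auto simp: PiE_iff extensional_def)
 qed
 define p where "p F F' = measure m (C F F')" for F F'
 have Cs: "space m \<inter> (shift ^^ n) -` icyl m shift k F' : sets m" if "F' : itin Q k" for F'
  using measurable_sets[OF measurable_funpow_m[of n] itin_sets[OF that]] by (simp add: Int_commute)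
 have row: "(\<Sum>F'\<in>itin Q k. p F F') = measure m (icyl m shift n F)" if F: "F : itin Q n" for F
 proof -
  have "measure m (icyl m shift n F) = measure m (\<Union>F'\<in>itin Q k. C F F')"
  proof (rule arg_cong[where f="measure m"])
   show "icyl m shift n F = (\<Union>F'\<in>itin Q k. C F F')"
   proof (intro set_eqI iffI)
    fix x assume x: "x : icyl m shift n F"
    then have "(shift ^^ n) x : sigma_plus E" by (auto simp: icyl_iff)
    then show "x : (\<Union>F'\<in>itin Q k. C F F')" using itin_cover[of "(shift ^^ n) x" k] x by (auto simp: C_def icyl_iff)
   qed (auto simp: C_def)
  qed
  also have "... = (\<Sum>F'\<in>itin Q k. p F F')"
   unfolding p_def
  proof (rule finite_measure_finite_Union)
   show "disjoint_family_on (C F) (itin Q k)"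
    using itin_disjoint unfolding disjoint_family_on_def C_def by blast
  qed (use finite_itin itin_sets F Cs in \<open>auto simp: C_def\<close>)
  finally show ?thesis by simp
 qed
 have col: "(\<Sum>F\<in>itin Q n. p F F') = measure m (icyl m shift k F')" if F': "F' : itin Q k" for F'
 proof -
  have "(\<Sum>F\<in>itin Q n. p F F') = measure m (space m \<inter> (shift ^^ n) -` icyl m shift k F')"
   using sum_itin[OF Cs[OF F'], of n] by (simp add: p_def C_def Int_commute)
  then show ?thesis using measure_funpow_shift[OF itin_sets[OF F']] by simp
 qed
 have tot: "(\<Sum>F\<in>itin Q n. \<Sum>F'\<in>itin Q k. p F F') = 1"
  using sum_itin[OF sets.top, of n] row
  by (simp add: prob_space[simplified] icyl_def Int_assoc[symmetric])
 have "part_entropy m (refine m Q (n + k)) = (\<Sum>F\<in>itin Q n. \<Sum>F'\<in>itin Q k. eta (p F F'))"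
  unfolding part_entropy_refine sum.reindex_bij_betw[OF bij, symmetric] sum.cartesian_product
  by (intro sum.cong) (auto simp: p_def jC)
 also have "... <= (\<Sum>F\<in>itin Q n. eta (\<Sum>F'\<in>itin Q k. p F F')) + (\<Sum>F'\<in>itin Q k. eta (\<Sum>F\<in>itin Q n. p F F'))"
  by (rule eta_sum_joint_le[OF finite_itin finite_itin _ tot]) (simp add: p_def)
 also have "... = part_entropy m (refine m Q n) + part_entropy m (refine m Q k)"
  unfolding part_entropy_refine by (simp add: row col)
 finally show ?thesis .
qed

lemma entropy_wrt_LIMSEQ: "(%n. part_entropy m (refine m Q n) / real n) \<longlonglongrightarrow> entropy_wrt m Q"
 unfolding entropy_wrt_def
 using fekete_convergent[of "%n. part_entropy m (refine m Q n)", OF part_entropy_nonneg part_entropy_subadditive]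
 by (simp add: convergent_LIMSEQ_iff)

text \<open>With \<open>q\<close> read as a coding weight of total mass at most \<open>Z\<close> and
  \<open>R\<close> as a pointwise bound on the code length, the entropy of the cells is at most the
  mean code length plus \<open>ln Z\<close>.\<close>

lemma gibbs_bound:
 assumes R: "integrable m R" and q: "!!F x. F : itin Q n ==> x : icyl m shift n F ==> exp (- R x) <= q F"
  and q0: "!!F. F : itin Q n ==> 0 <= q F" and Z: "(\<Sum>F\<in>itin Q n. q F) <= Z" "Z > 0"
 shows "part_entropy m (refine m Q n) <= (\<integral>x. R x \<partial>m) + ln Z"
proof -
 define A where "A F = icyl m shift n F" for F
 have As: "A F : sets m" if "F : itin Q n" for F using itin_sets[OF that] by (simp add: A_def)
 have tot: "(\<Sum>F\<in>itin Q n. measure m (A F)) = 1"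
  using sum_itin[OF sets.top, of n] prob_space by (simp add: A_def icyl_def Int_assoc[symmetric])
 have "(\<Sum>F\<in>itin Q n. eta (measure m (A F))) <= (\<Sum>F\<in>itin Q n. - (measure m (A F) * ln (q F))) + ln Z"
 proof (rule eta_sum_le_cross_entropy[OF finite_itin _ _ q0 tot Z])
  fix F assume F: "F : itin Q n" "0 < measure m (A F)"
  then have "A F ~= {}" by auto
  then obtain x where "x : A F" by blast
  then have "exp (- R x) <= q F" using q F by (simp add: A_def)
  then show "0 < q F" by (meson exp_gt_zero less_le_trans)
 qed auto
 also have "(\<Sum>F\<in>itin Q n. - (measure m (A F) * ln (q F))) <= (\<Sum>F\<in>itin Q n. (\<integral>x. indicator (A F) x * R x \<partial>m))"
 proof (rule sum_mono)
  fix F assume F: "F : itin Q n"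
  have int: "integrable m (%x. indicator (A F) x * R x)"
   using integrable_mult_indicator[OF As[OF F] R] by simp
  show "- (measure m (A F) * ln (q F)) <= (\<integral>x. indicator (A F) x * R x \<partial>m)"
  proof -
   have "(\<integral>x. indicator (A F) x * (- ln (q F)) \<partial>m) <= (\<integral>x. indicator (A F) x * R x \<partial>m)"
   proof (rule integral_mono[OF _ int])
    show "integrable m (%x. indicator (A F) x * (- ln (q F)))"
     using As[OF F] by (intro integrable_mult_left integrable_real_indicator) (auto simp: emeasure_eq_measure)
    fix x
    show "indicator (A F) x * - ln (q F) <= indicator (A F) x * R x"
    proof (cases "x : A F")
     case True
     then have "exp (- R x) <= q F" using q F by (simp add: A_def)
     then have "- R x <= ln (q F)" by (metis exp_gt_zero ln_exp ln_le_cancel_iff less_le_trans)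
     then show ?thesis using True by simp
    qed simp
   qed
   moreover have "A F \<inter> sigma_plus E = A F" using sets.sets_into_space[OF As[OF F]] by auto
   ultimately show ?thesis using As[OF F] by (simp add: mult.commute)
  qed
 qed
 also have "(\<Sum>F\<in>itin Q n. (\<integral>x. indicator (A F) x * R x \<partial>m)) = (\<integral>x. (\<Sum>F\<in>itin Q n. indicator (A F) x * R x) \<partial>m)"
  using integrable_mult_indicator[OF As R] by (subst Bochner_Integration.integral_sum) auto
 also have "... = (\<integral>x. R x \<partial>m)"
 proof (rule Bochner_Integration.integral_cong[OF refl])
  fix x assume "x : space m"
  then have ex1: "\<exists>!F. F : itin Q n & x : A F" using itin_cover[of x n] by (simp add: A_def)
  then obtain F where F12: "F : itin Q n" "x : A F" by blast
  have F3: "F' = F" if "F' : itin Q n" "x : A F'" for F' using ex1 F12 that by blast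
  have "(\<Sum>F\<in>itin Q n. indicator (A F) x * R x) = (\<Sum>F'\<in>itin Q n. if F' = F then R x else 0)"
  proof (rule sum.cong[OF refl])
   fix F' assume F': "F' : itin Q n"
   show "indicator (A F') x * R x = (if F' = F then R x else 0)"
   proof (cases "F' = F")
    case False
    then have "x \<notin> A F'" using F3[OF F'] by blast
    then show ?thesis using False by simp
   qed (use F12 in simp)
  qed
  also have "... = R x" using F12(1) finite_itin by simp
  finally show "(\<Sum>F\<in>itin Q n. indicator (A F) x * R x) = R x" .
 qed
 finally show ?thesis unfolding part_entropy_refine A_def by simp
qed

end

text \<open>The sets that can be approximated form a sigma-algebra containing the cylinders.
  Dependence on finitely many letters survives finite unions after passing to a common length, so a
  countable union is truncated first.\<close>

lemma approx_by_cylinders: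
 assumes A: "A : sets m" and e: "\<epsilon> > 0"
 shows "\<exists>l A'. A' \<subseteq> sigma_plus E & (\<forall>x\<in>sigma_plus E. \<forall>y\<in>sigma_plus E. agree l x y --> x : A' --> y : A') &
  measure m ((A - A') \<union> (A' - A)) < \<epsilon>"
proof -
 define det where "det l A' \<longleftrightarrow> A' \<subseteq> sigma_plus E & (\<forall>x\<in>sigma_plus E. \<forall>y\<in>sigma_plus E. agree l x y --> x : A' --> y : A')" for l and A' :: "(nat => 'a) set"
 have det_mono: "det l' A'" if "det l A'" "l <= l'" for l l' A'
  using that agree_mono unfolding det_def by blast
 have det_sets: "A' : sets m" if "det l A'" for l A'
  unfolding sets_m using that
  by (intro locally_constant_set_measurable exI[of _ l]) (auto simp: det_def dest: agree_sym)
 have "A : sigma_sets (sigma_plus E) {{x : sigma_plus E. \<forall>i<n. x i = w i} |n w. True}"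
  using A unfolding sets_m shift_space_def by (subst (asm) sets_measure_of) auto
 then have "\<forall>\<epsilon>>0. \<exists>l A'. det l A' & measure m ((A - A') \<union> (A' - A)) < \<epsilon>"
 proof (induction rule: sigma_sets.induct)
  case (Basic a)
  then obtain n w where a: "a = {x : sigma_plus E. \<forall>i<n. x i = w i}" by blast
  have "det n a" by (auto simp: det_def a agree_def)
  then show ?case by (intro allI impI exI[of _ n] exI[of _ a]) auto
 next
  case Empty
  then show ?case by (intro allI impI exI[of _ 0] exI[of _ "{}"]) (auto simp: det_def)
 next
  case (Compl a)
  show ?case
  proof (intro allI impI)
   fix \<epsilon> :: real assume "\<epsilon> > 0"
   then obtain l A' where A': "det l A'" "measure m ((a - A') \<union> (A' - a)) < \<epsilon>" using Compl by blast
   have "det l (sigma_plus E - A')" using A'(1) by (auto simp: det_def dest: agree_sym)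
   moreover have "((sigma_plus E - a) - (sigma_plus E - A')) \<union> ((sigma_plus E - A') - (sigma_plus E - a)) \<subseteq> (a - A') \<union> (A' - a)"
    by auto
   moreover have "a : sets m" using Compl(1) unfolding sets_m shift_space_def by (subst sets_measure_of) auto
   ultimately show "\<exists>l A'. det l A' & measure m ((sigma_plus E - a - A') \<union> (A' - (sigma_plus E - a))) < \<epsilon>"
    using A' det_sets[OF A'(1)] by (intro exI[of _ l] exI[of _ "sigma_plus E - A'"] conjI le_less_trans[OF finite_measure_mono A'(2)]) auto
  qed
 next
  case (Union a)
  have as: "a i : sets m" for i using Union(1)[of i] unfolding sets_m shift_space_def by (subst sets_measure_of) auto
  show ?case
  proof (intro allI impI)
   fix \<epsilon> :: real assume e: "\<epsilon> > 0"
   have "(%n. measure m (\<Union>i<n. a i)) \<longlonglongrightarrow> measure m (\<Union>n. \<Union>i<n. a i)"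
    using as by (intro finite_Lim_measure_incseq) (auto simp: incseq_def intro: less_le_trans)
   moreover have "(\<Union>n. \<Union>i<n. a i) = (\<Union>i. a i)" by blast
   ultimately have "(%n. measure m (\<Union>i<n. a i)) \<longlonglongrightarrow> measure m (\<Union>i. a i)" by simp
   then have "\<forall>\<^sub>F n in sequentially. measure m (\<Union>i. a i) - \<epsilon> / 2 < measure m (\<Union>i<n. a i)"
    using e by (intro order_tendstoD) auto
   then obtain N where N: "measure m (\<Union>i. a i) - \<epsilon> / 2 < measure m (\<Union>i<N. a i)"
    by (auto simp: eventually_sequentially)
   have "\<forall>i. \<exists>l A'. det l A' & measure m ((a i - A') \<union> (A' - a i)) < \<epsilon> / (2 * (real N + 1))"
    using Union(2) e by auto
   then obtain l A' where A': "!!i. det (l i) (A' i)" "!!i. measure m ((a i - A' i) \<union> (A' i - a i)) < \<epsilon> / (2 * (real N + 1))"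
    by metis
   \<comment> \<open>The sum is a convenient common upper bound for the finitely many word
     lengths.\<close>
   define L where "L = (\<Sum>i<N. l i)"
   have dL: "det L (A' i)" if "i < N" for i
    using det_mono[OF A'(1), of i L] that by (auto simp: L_def intro: member_le_sum)
   have 1: "det L (\<Union>i<N. A' i)" using dL unfolding det_def by blast
   have "((\<Union>i. a i) - (\<Union>i<N. A' i)) \<union> ((\<Union>i<N. A' i) - (\<Union>i. a i)) \<subseteq>
     ((\<Union>i. a i) - (\<Union>i<N. a i)) \<union> (\<Union>i<N. (a i - A' i) \<union> (A' i - a i))" by auto
   then have "measure m (((\<Union>i. a i) - (\<Union>i<N. A' i)) \<union> ((\<Union>i<N. A' i) - (\<Union>i. a i))) \<le>
     measure m (((\<Union>i. a i) - (\<Union>i<N. a i)) \<union> (\<Union>i<N. (a i - A' i) \<union> (A' i - a i)))"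
    using as det_sets[OF A'(1)] by (intro finite_measure_mono) auto
   also have "... <= measure m ((\<Union>i. a i) - (\<Union>i<N. a i)) + measure m (\<Union>i<N. (a i - A' i) \<union> (A' i - a i))"
    using as det_sets[OF A'(1)] by (intro measure_Un_le) auto
   also have "measure m ((\<Union>i. a i) - (\<Union>i<N. a i)) = measure m (\<Union>i. a i) - measure m (\<Union>i<N. a i)"
    using as by (intro finite_measure_Diff) auto
   also have "measure m (\<Union>i<N. (a i - A' i) \<union> (A' i - a i)) <= (\<Sum>i<N. measure m ((a i - A' i) \<union> (A' i - a i)))"
    using as det_sets[OF A'(1)] by (intro finite_measure_subadditive_finite) auto
   also have "... <= (\<Sum>i<N. \<epsilon> / (2 * (real N + 1)))" using A'(2) by (intro sum_mono) (auto intro: less_imp_le)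
   also have "... <= \<epsilon> / 2" using e by (simp add: field_simps)
   finally have "measure m (((\<Union>i. a i) - (\<Union>i<N. A' i)) \<union> ((\<Union>i<N. A' i) - (\<Union>i. a i))) < \<epsilon>" using N by simp
   then show "\<exists>l A'. det l A' & measure m ((\<Union> (range a) - A') \<union> (A' - \<Union> (range a))) < \<epsilon>" using 1 by blast
  qed
 qed
 from this[rule_format, OF e] obtain l A' where d: "det l A'" and le: "measure m ((A - A') \<union> (A' - A)) < \<epsilon>" by blast
 show ?thesis
  by (intro exI[of _ l] exI[of _ A'] conjI conjunct1[OF d[unfolded det_def]] conjunct2[OF d[unfolded det_def]] le)
qed

text \<open>\<open>s\<close> predicts the atom containing \<open>x\<close> from \<open>l\<close>
  letters and errs on a small set. The partition is arbitrary whereas a coding argument sees only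
  words; this is the passage between the two.\<close>

lemma approx_partition:
 assumes Q: "finite_partition m Q" and e: "\<epsilon> > 0"
 obtains l s where "!!x y. x : sigma_plus E ==> y : sigma_plus E ==> agree l x y ==> s x = s y"
  "{x : sigma_plus E. x \<notin> s x} : sets m" "measure m {x : sigma_plus E. x \<notin> s x} <= \<epsilon>"
  "!!x. x : sigma_plus E ==> s x : Q"
proof -
 note Qp = Q_props[OF Q]
 have "\<forall>A\<in>Q. \<exists>l A'. A' \<subseteq> sigma_plus E & (\<forall>x\<in>sigma_plus E. \<forall>y\<in>sigma_plus E. agree l x y --> x : A' --> y : A') &
  measure m ((A - A') \<union> (A' - A)) < \<epsilon> / (real (card Q) + 1)"
  using Qp e by (intro ballI approx_by_cylinders) auto
 then obtain l A' where A': "!!A. A : Q ==> A' A \<subseteq> sigma_plus E"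
  "!!A x y. A : Q ==> x : sigma_plus E ==> y : sigma_plus E ==> agree (l A) x y ==> x : A' A ==> y : A' A"
  "!!A. A : Q ==> measure m ((A - A' A) \<union> (A' A - A)) < \<epsilon> / (real (card Q) + 1)" by metis
 define L where "L = (\<Sum>A\<in>Q. l A)"
 have "sigma_plus E ~= {}" using not_empty by simp
 then obtain A0 where A0: "A0 : Q" using Qp by blast
 \<comment> \<open>The approximating sets need be neither disjoint nor covering, so an arbitrary
   choice with default \<open>A0\<close> is made; it can be wrong only on the symmetric
   differences.\<close>
 define sel where "sel R = (if \<exists>A. R A then (SOME A. R A) else A0)" for R
 define s where "s x = sel (%A. A : Q & x : A' A)" for x
 have mem: "x : A' A \<longleftrightarrow> y : A' A" if "x : sigma_plus E" "y : sigma_plus E" "agree L x y" "A : Q" for x y A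
 proof -
  have "l A <= L" unfolding L_def using Qp that by (intro member_le_sum) auto
  then have "agree (l A) x y" using that agree_mono by blast
  then show ?thesis using A'(2)[of A x y] A'(2)[of A y x] that agree_sym by blast
 qed
 have As: "A' A : sets m" if "A : Q" for A
  unfolding sets_m
 proof (rule locally_constant_set_measurable[OF A'(1)[OF that]])
  fix x assume x: "x : A' A"
  show "\<exists>n. \<forall>y\<in>sigma_plus E. agree n y x --> y : A' A"
   using A'(1)[OF that] A'(2)[OF that, of x] x by (intro exI[of _ "l A"]) (auto dest: agree_sym)
 qed
 have sQ: "s x : Q" for x
 proof (cases "\<exists>A. A : Q & x : A' A")
  case True
  then have "(SOME A. A : Q & x : A' A) : Q" using someI_ex[of "%A. A : Q & x : A' A"] by blast
  moreover have "s x = (SOME A. A : Q & x : A' A)" unfolding s_def sel_def using True by (rule if_P)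
  ultimately show ?thesis by simp
 next
  case False
  then have "s x = A0" unfolding s_def sel_def by (rule if_not_P)
  then show ?thesis using A0 by simp
 qed
 have sdet: "s x = s y" if "x : sigma_plus E" "y : sigma_plus E" "agree L x y" for x y
 proof -
  have "(%A. A : Q & x : A' A) = (%A. A : Q & y : A' A)" using mem[OF that] by blast
  then show ?thesis unfolding s_def by (rule arg_cong)
 qed
 have sub: "{x : sigma_plus E. x \<notin> s x} \<subseteq> (\<Union>A\<in>Q. (A - A' A) \<union> (A' A - A))"
 proof
  fix x assume x: "x : {x : sigma_plus E. x \<notin> s x}"
  then obtain A where A: "A : Q" "x : A" using Qp by blast
  show "x : (\<Union>A\<in>Q. (A - A' A) \<union> (A' A - A))"
  proof (rule ccontr)
   assume c: "x \<notin> (\<Union>A\<in>Q. (A - A' A) \<union> (A' A - A))"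
   then have "x : A' A" using A by blast
   then have ex: "\<exists>A. A : Q & x : A' A" using A by blast
   have "(SOME A. A : Q & x : A' A) : Q & x : A' (SOME A. A : Q & x : A' A)"
    using someI_ex[OF ex] .
   then have "x : (SOME A. A : Q & x : A' A)" using c by blast
   moreover have "s x = (SOME A. A : Q & x : A' A)" unfolding s_def sel_def using ex by (rule if_P)
   ultimately show False using x by simp
  qed
 qed
 have bs: "{x : sigma_plus E. x \<notin> s x} : sets m"
 proof -
  have eq: "{x : sigma_plus E. x \<notin> s x} = sigma_plus E - (\<Union>A\<in>Q. A \<inter> {x : sigma_plus E. s x = A})"
   using sQ by auto
  have sA: "{x : sigma_plus E. s x = A} : sets m" for A
   unfolding sets_m
  proof (rule locally_constant_set_measurable)
   fix x assume x: "x : {x : sigma_plus E. s x = A}"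
   show "\<exists>n. \<forall>y\<in>sigma_plus E. agree n y x --> y : {x : sigma_plus E. s x = A}"
   proof (intro exI ballI impI)
    fix y assume y: "y : sigma_plus E" "agree L y x"
    then have "s y = s x" using x by (intro sdet) auto
    then show "y : {x : sigma_plus E. s x = A}" using x y by auto
   qed
  qed auto
  have "(\<Union>A\<in>Q. A \<inter> {x : sigma_plus E. s x = A}) : sets m"
  proof (rule sets.finite_UN[OF Qp(1)])
   fix A assume "A : Q"
   then have "A : sets m" using Qp(2) by blast
   then show "A \<inter> {x : sigma_plus E. s x = A} : sets m" using sA[of A] by (rule sets.Int)
  qed
  moreover have "sigma_plus E : sets m" using sets.top[of m] by (simp only: space_m)
  ultimately show ?thesis unfolding eq by (intro sets.Diff)
 qed
 have Us: "(A - A' A) \<union> (A' A - A) : sets m" if "A : Q" for A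
 proof -
  have "A : sets m" using Qp(2) that by blast
  then show ?thesis using As[OF that] by (intro sets.Un sets.Diff)
 qed
 have "measure m {x : sigma_plus E. x \<notin> s x} <= measure m (\<Union>A\<in>Q. (A - A' A) \<union> (A' A - A))"
  by (rule finite_measure_mono[OF sub sets.finite_UN[OF Qp(1) Us]])
 also have "... <= (\<Sum>A\<in>Q. measure m ((A - A' A) \<union> (A' A - A)))"
  by (rule finite_measure_subadditive_finite[OF Qp(1)]) (use Us in blast)
 also have "... <= (\<Sum>A\<in>Q. \<epsilon> / (real (card Q) + 1))" using A'(3) by (intro sum_mono less_imp_le)
 also have "... <= \<epsilon>" using e by (simp add: field_simps)
 finally have le: "measure m {x : sigma_plus E. x \<notin> s x} <= \<epsilon>" .
 show thesis by (rule that[of L s, OF sdet bs le sQ])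
qed

end

section \<open>The variational upper bound\<close>

lemma nn_integral_count_space_UNIV:
 "(\<integral>\<^sup>+x. f x \<partial>count_space A) = (\<integral>\<^sup>+x. f x * indicator A x \<partial>count_space UNIV)"
 by (simp add: nn_integral_restrict_space[symmetric] restrict_count_space)

locale markov_measure = markov_shift E \<theta> + invariant_shift E m
 for E :: "'a::countable => 'a => bool" and \<theta> m
begin

lemma prob_X [simp]: "measure m X = 1"
 using prob_space by simp

lemma finite_letters_approx:
 assumes "\<epsilon> > 0" obtains F where "finite F" "measure m {x : X. x 0 \<notin> F} <= \<epsilon>"
proof -
 define F where "F n = {b::'a. to_nat b < n}" for n
 have fin: "finite (F n)" for n
  unfolding F_def using finite_vimageI[OF finite_lessThan[of n] inj_to_nat] by (simp add: vimage_def lessThan_def)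
 have s: "{x : X. x 0 \<notin> F n} : sets m" for n
  unfolding sets_m by (rule locally_constant_set_measurable) (auto simp: agree_def intro!: exI[of _ 1])
 have "(%n. measure m {x : X. x 0 \<notin> F n}) \<longlonglongrightarrow> measure m (\<Inter>n. {x : X. x 0 \<notin> F n})"
  using s by (intro finite_Lim_measure_decseq) (auto simp: decseq_def F_def)
 moreover have "(\<Inter>n. {x : X. x 0 \<notin> F n}) = {}" by (auto simp: F_def intro: lessI)
 ultimately have "\<forall>\<^sub>F n in sequentially. measure m {x : X. x 0 \<notin> F n} < \<epsilon>"
  using assms by (intro order_tendstoD(2)[of _ 0]) auto
 then obtain n where "measure m {x : X. x 0 \<notin> F n} < \<epsilon>" by (auto simp: eventually_sequentially)
 then show thesis using that[of "F n"] fin by simp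
qed

lemma superharmonic_iter:
 assumes "!!x. x : X ==> tr E f UNIV H x <= H x" "x : X"
 shows "(tr E f UNIV ^^ n) H x <= H x"
 using assms(2)
proof (induction n arbitrary: x)
 case (Suc n)
 have "tr E f UNIV ((tr E f UNIV ^^ n) H) x <= tr E f UNIV H x" using Suc by (intro tr_mono) auto
 then show ?case using assms(1)[OF Suc.prems] by simp
qed simp

text \<open>On finitely many letters the cone condition bounds \<open>H\<close> from above and
  below, so a multiple of \<open>H\<close> dominates the indicator of \<open>F\<close>;
  superharmonicity then bounds the return weights uniformly in time.\<close>

lemma return_weight_bound:
 assumes H: "!!x. x : X ==> tr E f UNIV H x <= H x" "cone X D H" "0 <= D"
  and fin: "!!x. x : X ==> H x ~= top & H x ~= 0" and F: "finite F"
 shows "\<exists>C\<ge>0. \<forall>n. \<forall>z\<in>X. z 0 : F --> (tr E f UNIV ^^ n) (%y. indicator F (y 0)) z <= ennreal C"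
proof -
 have "\<forall>b. \<exists>z. z : V b" using V_nonempty by blast
 then obtain z where z: "!!b. z b : V b" by metis
 define h where "h b = enn2real (H (z b))" for b
 have h: "H (z b) = ennreal (h b)" "0 < h b" for b
  using fin[of "z b"] z[of b] by (auto simp: h_def less_top enn2real_positive_iff zero_less_iff_neq_zero)
 have cV: "cone (V b) D H" for b by (rule cone_subset[OF H(2)]) auto
 define c where "c = (\<Sum>b\<in>F. exp D / h b)"
 define d where "d = (\<Sum>b\<in>F. exp D * h b)"
 have c0: "0 <= c" unfolding c_def using h(2) by (intro sum_nonneg) (auto intro: less_imp_le)
 have d0: "0 <= d" unfolding d_def using h(2) by (intro sum_nonneg) (auto intro: less_imp_le)
 have ind: "indicator F (y 0) <= ennreal c * H y" if y: "y : X" for y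
 proof (cases "y 0 : F")
  case True
  have "exp D / h (y 0) <= c" unfolding c_def using True F h(2) by (intro member_le_sum) (auto intro: less_imp_le)
  then have c: "ennreal (exp D / h (y 0)) <= ennreal c" by (rule ennreal_leI)
  have "ennreal (h (y 0)) <= ennreal (exp D) * H y"
   using cone_V_bounds[OF cV, of "z (y 0)" "y 0" y] z y H(3) h by auto
  then have "ennreal (1 / h (y 0)) * ennreal (h (y 0)) <= ennreal (1 / h (y 0)) * (ennreal (exp D) * H y)"
   by (intro mult_left_mono) auto
  moreover have "ennreal (1 / h (y 0)) * ennreal (h (y 0)) = 1"
   using h(2)[of "y 0"] by (subst ennreal_mult[symmetric]) auto
  moreover have "ennreal (1 / h (y 0)) * (ennreal (exp D) * H y) = ennreal (exp D / h (y 0)) * H y"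
   using h(2)[of "y 0"] by (simp add: mult.assoc[symmetric] ennreal_mult[symmetric])
  ultimately have "1 <= ennreal (exp D / h (y 0)) * H y" by simp
  also have "... <= ennreal c * H y" using c by (intro mult_right_mono) auto
  finally show ?thesis using True by simp
 qed simp
 have "(tr E f UNIV ^^ n) (%y. indicator F (y 0)) w <= ennreal (c * d)" if w: "w : X" "w 0 : F" for n w
 proof -
  have "(tr E f UNIV ^^ n) (%y. indicator F (y 0)) w <= (tr E f UNIV ^^ n) (%y. ennreal c * H y) w"
   using ind w by (intro tr_funpow_mono) auto
  also have "... <= ennreal c * H w"
   unfolding tr_funpow_cmult using superharmonic_iter[OF H(1) w(1)] by (intro mult_left_mono) auto
  also have "H w <= ennreal (exp D) * ennreal (h (w 0))"
   using cone_V_bounds[OF cV, of w "w 0" "z (w 0)"] z w H(3) h by auto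
  also have "... <= ennreal d"
  proof -
   have "exp D * h (w 0) <= d" unfolding d_def using w F h(2) by (intro member_le_sum) (auto intro: less_imp_le)
   then show ?thesis using h(2)[of "w 0"] by (simp add: ennreal_mult[symmetric] ennreal_leI less_imp_le)
  qed
  also have "ennreal c * ennreal d = ennreal (c * d)" using c0 d0 by (simp add: ennreal_mult)
  finally show ?thesis by (simp add: mult_left_mono)
 qed
 then show ?thesis using c0 d0 by (intro exI[of _ "c * d"]) auto
qed

text \<open>A point is coded by its first and last visit \<open>I\<close>, \<open>J\<close> to a finite set of letters within the
 time window and by the word in between, which is given the weight of the potential. The symbols
 of the partition are guessed from that word inside \<open>[I, J]\<close> and coded uniformly outside.\<close>

lemma entropy_bound_n:
 assumes Q: "finite_partition m Q" and n: "n >= 1"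
  and f: "wvar Bf f" "0 <= Bf" "integrable m f" "!!x. x : X ==> f x <= K" "0 <= K"
  and F: "finite F" and z: "!!c. z c : V c"
  and C: "0 <= C" "!!k c. c : F ==> (tr E f UNIV ^^ k) (%y. indicator F (y 0)) (z c) <= ennreal C"
  and s: "!!x y. x : X ==> y : X ==> agree l x y ==> s x = s y" "!!x. x : X ==> s x : Q"
   "{x : X. x \<notin> s x} : sets m"
  and \<delta>: "0 < \<delta>" "\<delta> < 1"
 shows "part_entropy m (refine m Q n) <= - real n * (\<integral>x. f x \<partial>m)
   + (K + ln (real (card Q))) * (real n * measure m {x : X. x 0 \<notin> F} + 1) + real l * ln (real (card Q))
   + real n * (- ln (1 - \<delta>) + ln (real (card Q) / \<delta>) * measure m {x : X. x \<notin> s x})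
   + ln ((1 + exp (Bf / (1 - \<theta>)) * (real (card F) * C)) * (real n)\<^sup>2)"
proof -
 note Qp = Q_props[OF Q]
 have "X ~= {}" using V_nonempty by blast
 then have Qne: "Q ~= {}" using Qp by auto
 define p where "p = real (card Q)"
 have p1: "1 <= p" using Qp Qne by (simp add: p_def Suc_leI card_gt_0_iff)
 have lnp: "0 <= ln p" using p1 by simp
 define D' where "D' = Bf / (1 - \<theta>)"
 \<comment> \<open>Coding weight of an atom \<open>A\<close> given the prediction \<open>A'\<close>:
   nearly everything on a correct guess, a uniform share of \<delta> otherwise.\<close>
 define kap where "kap A A' = (if A = A' then 1 - \<delta> else \<delta> / p)" for A A' :: "(nat => 'a) set"
 have kap0: "0 <= kap A A'" for A A' using \<delta> p1 by (simp add: kap_def)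
 have kapsum: "(\<Sum>A\<in>Q. kap A A') <= 1" for A'
 proof (cases "A' : Q")
  case True
  have "(\<Sum>A\<in>Q. kap A A') = kap A' A' + (\<Sum>A\<in>Q - {A'}. kap A A')" using True Qp by (simp add: sum.remove)
  also have "(\<Sum>A\<in>Q - {A'}. kap A A') = (\<Sum>A\<in>Q - {A'}. \<delta> / p)" by (intro sum.cong) (auto simp: kap_def)
  also have "... = (p - 1) * (\<delta> / p)" using True Qp p1 by (simp add: p_def of_nat_diff card_gt_0_iff Suc_leI)
  also have "kap A' A' + (p - 1) * (\<delta> / p) <= 1" using p1 \<delta> by (simp add: kap_def field_simps)
  finally show ?thesis .
 next
  case False
  then have "(\<Sum>A\<in>Q. kap A A') = (\<Sum>A\<in>Q. \<delta> / p)" by (intro sum.cong) (auto simp: kap_def)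
  also have "... = \<delta>" using p1 by (simp add: p_def)
  finally show ?thesis using \<delta> by simp
 qed
 \<comment> \<open>The prediction at time \<open>k\<close> reads \<open>l\<close> letters of the
   recorded word, so it is available only while \<open>k + l\<close> does not exceed
   \<open>j\<close>; elsewhere all atoms get the weight \<open>1 / p\<close>.\<close>
 define kk where "kk i j y k A = (if i <= k & k + l <= j then kap A (s ((shift ^^ (k - i)) y)) else 1 / p)"
  for i j k :: nat and y and A
 have kk0: "0 <= kk i j y k A" for i j y k A using kap0 p1 by (simp add: kk_def)
 have kksum: "(\<Sum>A\<in>Q. kk i j y k A) <= 1" for i j y k
 proof (cases "i <= k & k + l <= j")
  case True
  then have "(\<Sum>A\<in>Q. kk i j y k A) = (\<Sum>A\<in>Q. kap A (s ((shift ^^ (k - i)) y)))" by (simp add: kk_def)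
  then show ?thesis using kapsum by simp
 next
  case False
  then have "(\<Sum>A\<in>Q. kk i j y k A) = (\<Sum>A\<in>Q. 1 / p)" unfolding kk_def by (simp only: if_False)
  also have "... = 1" using p1 by (simp add: p_def)
  finally show ?thesis by simp
 qed
 \<comment> \<open>The word between the two visits is represented by the point that continues it
   with a reference point \<open>z c\<close>. Words that start and end in \<open>F\<close> thus
   become preimages, and the hypothesis on \<open>C\<close> bounds their total weight.\<close>
 define Y where "Y k = {y : X. (\<exists>c\<in>F. (shift ^^ k) y = z c) & y 0 : F}" for k
 have Ysum: "(\<integral>\<^sup>+y. ennreal (exp (birkhoff f k y)) \<partial>count_space (Y k)) <= ennreal (real (card F) * C)" for k
 proof -
  have "(\<integral>\<^sup>+y. ennreal (exp (birkhoff f k y)) \<partial>count_space (Y k)) \<le>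
   (\<integral>\<^sup>+y. (\<Sum>c\<in>F. ennreal (exp (birkhoff f k y)) * indicator F (y 0) *
    indicator {y : X. (shift ^^ k) y = z c & (\<forall>i<k. y i : UNIV)} y) \<partial>count_space UNIV)"
   unfolding nn_integral_count_space_UNIV[where A="Y k"]
  proof (intro nn_integral_mono)
   fix y
   show "ennreal (exp (birkhoff f k y)) * indicator (Y k) y <= (\<Sum>c\<in>F. ennreal (exp (birkhoff f k y)) * indicator F (y 0) *
    indicator {y : X. (shift ^^ k) y = z c & (\<forall>i<k. y i : UNIV)} y)"
   proof (cases "y : Y k")
    case True
    then obtain c where c: "c : F" "(shift ^^ k) y = z c" "y : X" "y 0 : F" by (auto simp: Y_def)
    have "ennreal (exp (birkhoff f k y)) * indicator (Y k) y = ennreal (exp (birkhoff f k y)) * indicator F (y 0) *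
    indicator {y : X. (shift ^^ k) y = z c & (\<forall>i<k. y i : UNIV)} y" using c True by simp
    also have "... <= (\<Sum>c\<in>F. ennreal (exp (birkhoff f k y)) * indicator F (y 0) *
    indicator {y : X. (shift ^^ k) y = z c & (\<forall>i<k. y i : UNIV)} y)"
     using c F by (intro member_le_sum) auto
    finally show ?thesis .
   qed simp
  qed
  also have "... = (\<Sum>c\<in>F. \<integral>\<^sup>+y. ennreal (exp (birkhoff f k y)) * indicator F (y 0) *
    indicator {y : X. (shift ^^ k) y = z c & (\<forall>i<k. y i : UNIV)} y \<partial>count_space UNIV)"
   by (rule nn_integral_sum) simp
  also have "... = (\<Sum>c\<in>F. (tr E f UNIV ^^ k) (%y. indicator F (y 0)) (z c))"
   using z by (intro sum.cong refl) (auto simp: tr_funpow_preimages nn_integral_count_space_indicator)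
  also have "... <= (\<Sum>c\<in>F. ennreal C)" using C by (intro sum_mono) auto
  also have "... = ennreal (real (card F) * C)" using C(1) by (simp add: ennreal_mult ennreal_of_nat_eq_real_of_nat)
  finally show ?thesis .
 qed
 define wt where "wt i j y A = exp D' * exp (birkhoff f (j - i) y) * (\<Prod>k<n. kk i j y k (A k))" for i j y A
 have wt0: "0 <= wt i j y A" for i j y A unfolding wt_def using kk0 by (intro mult_nonneg_nonneg prod_nonneg) auto
 \<comment> \<open>The constant term serves orbits that never meet \<open>F\<close>; the double sum
   runs over the possible first and last visit times, which costs only a factor quadratic in
   \<open>n\<close>.\<close>
 define q where "q A = ennreal (1 / p ^ n) + (\<Sum>i<n. \<Sum>j<n. \<integral>\<^sup>+y. ennreal (wt i j y A) \<partial>count_space (Y (j - i)))" for A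
 define Z where "Z = (1 + exp D' * (real (card F) * C)) * (real n)\<^sup>2"
 have Z1: "1 + exp D' * (real (card F) * C) >= 1" using C(1) by simp
 have n1: "1 <= (real n)\<^sup>2" using n by simp
 have Z0: "Z > 0" unfolding Z_def using Z1 n1 by (intro mult_pos_pos) linarith+
 have qsum: "(\<Sum>A\<in>itin Q n. q A) <= ennreal Z"
 proof -
  have fin: "finite (itin Q n)" by (rule finite_itin[OF Q])
  have "(\<Sum>A\<in>itin Q n. ennreal (1 / p ^ n)) = 1"
  proof -
   have "card (itin Q n) = card Q ^ n" using card_PiE[of "{..<n}" "%_. Q"] by simp
   then have c: "of_nat (card (itin Q n)) = ennreal (p ^ n)" by (simp add: p_def ennreal_of_nat_eq_real_of_nat)
   have "(\<Sum>A\<in>itin Q n. ennreal (1 / p ^ n)) = ennreal (p ^ n) * ennreal (1 / p ^ n)" by (simp only: sum_constant c)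
   also have "... = ennreal (p ^ n * (1 / p ^ n))" using p1 by (intro ennreal_mult[symmetric]) auto
   finally show ?thesis using p1 by simp
  qed
  moreover have "(\<Sum>A\<in>itin Q n. \<Sum>i<n. \<Sum>j<n. \<integral>\<^sup>+y. ennreal (wt i j y A) \<partial>count_space (Y (j - i))) \<le>
    (\<Sum>i<n. \<Sum>j<n. ennreal (exp D' * (real (card F) * C)))"
  proof -
   have "(\<Sum>A\<in>itin Q n. \<integral>\<^sup>+y. ennreal (wt i j y A) \<partial>count_space (Y (j - i))) <= ennreal (exp D' * (real (card F) * C))" for i j
   proof -
    have "(\<Sum>A\<in>itin Q n. \<integral>\<^sup>+y. ennreal (wt i j y A) \<partial>count_space (Y (j - i))) =
      (\<integral>\<^sup>+y. (\<Sum>A\<in>itin Q n. ennreal (wt i j y A)) \<partial>count_space (Y (j - i)))"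
     by (rule nn_integral_sum[symmetric]) simp
    also have "... <= (\<integral>\<^sup>+y. ennreal (exp D') * ennreal (exp (birkhoff f (j - i) y)) \<partial>count_space (Y (j - i)))"
    proof (rule nn_integral_mono)
     fix y
     have "(\<Sum>A\<in>itin Q n. wt i j y A) = exp D' * exp (birkhoff f (j - i) y) * (\<Prod>k<n. \<Sum>A\<in>Q. kk i j y k A)"
      unfolding wt_def sum_distrib_left[symmetric] using Qp by (subst prod_sum_PiE) auto
     also have "... <= exp D' * exp (birkhoff f (j - i) y) * 1"
      using kksum kk0 by (intro mult_left_mono prod_le_1) (auto intro!: sum_nonneg)
     finally show "(\<Sum>A\<in>itin Q n. ennreal (wt i j y A)) <= ennreal (exp D') * ennreal (exp (birkhoff f (j - i) y))"
      using wt0 by (simp add: sum_ennreal ennreal_mult[symmetric] ennreal_leI)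
    qed
    also have "... = ennreal (exp D') * (\<integral>\<^sup>+y. ennreal (exp (birkhoff f (j - i) y)) \<partial>count_space (Y (j - i)))"
     by (rule nn_integral_cmult) simp
    also have "... <= ennreal (exp D') * ennreal (real (card F) * C)" by (intro mult_left_mono Ysum) auto
    also have "... = ennreal (exp D' * (real (card F) * C))" using C(1) by (subst ennreal_mult) auto
    finally show ?thesis .
   qed
   note bnd = this
   have "(\<Sum>A\<in>itin Q n. \<Sum>i<n. \<Sum>j<n. \<integral>\<^sup>+y. ennreal (wt i j y A) \<partial>count_space (Y (j - i))) =
    (\<Sum>i<n. \<Sum>j<n. \<Sum>A\<in>itin Q n. \<integral>\<^sup>+y. ennreal (wt i j y A) \<partial>count_space (Y (j - i)))"
    by (subst sum.swap) (intro sum.cong refl sum.swap)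
   also have "... <= (\<Sum>i<n. \<Sum>j<n. ennreal (exp D' * (real (card F) * C)))" by (intro sum_mono bnd)
   finally show ?thesis .
  qed
  ultimately have "(\<Sum>A\<in>itin Q n. q A) <= 1 + (\<Sum>i<n. \<Sum>j<n. ennreal (exp D' * (real (card F) * C)))"
   unfolding q_def sum.distrib by (intro add_mono) auto
  also have "... = ennreal (1 + (real n)\<^sup>2 * (exp D' * (real (card F) * C)))"
  proof -
   have "(\<Sum>i<n. \<Sum>j<n. ennreal (exp D' * (real (card F) * C))) = ennreal (\<Sum>i<n. \<Sum>j<n. exp D' * (real (card F) * C))"
    using C(1) by (simp add: ennreal_of_nat_eq_real_of_nat ennreal_mult)
   then show ?thesis using C(1) by (simp add: power2_eq_square mult.assoc)
  qed
  also have "... <= ennreal Z"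
   unfolding Z_def using n1 C(1) by (intro ennreal_leI) (simp add: distrib_left distrib_right mult.commute)
  finally show ?thesis .
 qed
 define NF where "NF = {x : X. x 0 \<notin> F}"
 define Bs where "Bs = {x : X. x \<notin> s x}"
 have NFs: "NF : sets m" unfolding NF_def sets_m
  by (rule locally_constant_set_measurable) (auto simp: agree_def intro!: exI[of _ 1])
 have Bss: "Bs : sets m" using s(3) by (simp add: Bs_def)
 have NFX: "NF \<inter> X = NF" "Bs \<inter> X = Bs" by (auto simp: NF_def Bs_def)
 \<comment> \<open>Bound for the code length of one predicted atom:
   \<open>- ln (1 - \<delta>)\<close> always, and \<open>ln (p / \<delta>)\<close> more when the
   prediction fails.\<close>
 define e where "e x = - ln (1 - \<delta>) + ln (p / \<delta>) * indicator Bs x" for x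
 have e1: "0 <= - ln (1 - \<delta>)" using \<delta> by simp
 have "1 <= p / \<delta>" using p1 \<delta> by (simp add: field_simps)
 then have e2: "0 <= ln (p / \<delta>)" by simp
 have e0: "0 <= e x" for x unfolding e_def using e1 e2 by (intro add_nonneg_nonneg mult_nonneg_nonneg) auto
 \<comment> \<open>A time outside \<open>F\<close> is charged \<open>K\<close> for the potential
   omitted there and \<open>ln p\<close> for a uniformly coded atom. The extra 1 pays for the
   potential at the last visit, and \<open>l\<close> times near it lack a prediction.\<close>
 define R where "R x = - birkhoff f n x + (K + ln p) * (birkhoff (indicator NF) n x + 1) + real l * ln p + birkhoff e n x" for x
 have intNF: "integrable m (indicator NF :: _ => real)" and intBs: "integrable m (indicator Bs :: _ => real)"
  using NFs Bss by (auto intro!: integrable_real_indicator simp: emeasure_eq_measure)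
 have inte: "integrable m e" unfolding e_def[abs_def] using intBs by auto
 have Rint: "integrable m R"
  unfolding R_def[abs_def] using integral_birkhoff(2)[OF f(3), of n] integral_birkhoff(2)[OF intNF, of n] integral_birkhoff(2)[OF inte, of n]
  by auto
 have "(\<integral>x. R x \<partial>m) = - (\<integral>x. birkhoff f n x \<partial>m) + (K + ln p) * ((\<integral>x. birkhoff (indicator NF) n x \<partial>m) + 1) + real l * ln p + (\<integral>x. birkhoff e n x \<partial>m)"
  unfolding R_def using integral_birkhoff(2)[OF f(3), of n] integral_birkhoff(2)[OF intNF, of n] integral_birkhoff(2)[OF inte, of n]
  by (simp add: prob_space)
 also have "... = - real n * (\<integral>x. f x \<partial>m) + (K + ln p) * (real n * measure m NF + 1) + real l * ln p
   + real n * (- ln (1 - \<delta>) + ln (p / \<delta>) * measure m Bs)"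
  unfolding integral_birkhoff(1)[OF f(3)] integral_birkhoff(1)[OF intNF] integral_birkhoff(1)[OF inte]
  using NFs Bss intBs NFX by (simp add: e_def[abs_def])
 finally have IR: "(\<integral>x. R x \<partial>m) = ..." .
 have cover: "ennreal (exp (- R x)) <= q A" if A: "A : itin Q n" and x: "x : icyl m shift n A" for A x
 proof -
  have xX: "x : X" and xA: "!!k. k < n ==> (shift ^^ k) x : A k" using x by (auto simp: icyl_iff)
  define S where "S = {k. k < n & x k : F}"
  have finS: "finite S" by (simp add: S_def)
  define N where "N = card {k. k < n & x k \<notin> F}"
  have Nb: "birkhoff (indicator NF) n x = real N"
  proof -
   have "birkhoff (indicator NF) n x = (\<Sum>k<n. if x k \<notin> F then 1 else 0)"
    unfolding birkhoff_def using xX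
    by (intro sum.cong refl) (auto simp: NF_def indicator_def funpow_shift_in_sigma, auto simp: funpow_shift)
   also have "... = real N" by (simp add: N_def sum.If_cases Int_def)
   finally show ?thesis .
  qed
  have be: "0 <= birkhoff e n x" unfolding birkhoff_def using e0 by (intro sum_nonneg) auto
  show ?thesis
  proof (cases "S = {}")
   case True
   have "N = n"
   proof -
    have "{k. k < n & x k \<notin> F} = {..<n}" using True by (auto simp: S_def)
    then show ?thesis by (simp add: N_def)
   qed
   have "birkhoff f n x <= real n * K"
    unfolding birkhoff_def using f(4) xX sum_bounded_above[of "{..<n}" "%k. f ((shift ^^ k) x)" K] by auto
   moreover have "real n * K + real n * ln p <= (K + ln p) * (real N + 1)"
    using \<open>N = n\<close> f(5) lnp by (simp add: algebra_simps)
   moreover have "0 <= real l * ln p" using lnp by simp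
   ultimately have "- R x <= - (real n * ln p)" unfolding R_def Nb using be by linarith
   then have "exp (- R x) <= exp (- (real n * ln p))" by simp
   also have "... = 1 / p ^ n" using p1 by (simp add: exp_minus exp_of_nat_mult inverse_eq_divide)
   finally have "ennreal (exp (- R x)) <= ennreal (1 / p ^ n)" by (rule ennreal_leI)
   also have "... <= q A" by (simp add: q_def)
   finally show ?thesis .
  next
   case False
   define I where "I = Min S"
   define J where "J = Max S"
   have IS: "I : S" and JS: "J : S" using finS False by (auto simp: I_def J_def)
   have Imin: "I <= k" and Jmax: "k <= J" if "k : S" for k using finS that by (auto simp: I_def J_def)
   have IJ: "I <= J" "I < n" "J < n" "x I : F" "x J : F" using IS JS Imin by (auto simp: S_def)
   define u where "u = (shift ^^ I) x"
   have uX: "u : X" using xX by (auto simp: u_def)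
   define d where "d = J - I"
   have ud: "u d = x J" using IJ by (simp add: u_def d_def funpow_shift)
   \<comment> \<open>The orbit is cut at the last visit and continued by the reference point. The
     letter at the cut is kept, so \<open>d + 1\<close> letters agree and bounded distortion applies
     to \<open>d\<close> steps.\<close>
   define y where "y = (%i. if i < d then u i else z (u d) (i - d))"
   have zd: "z (u d) : X" "z (u d) 0 = u d" using z by auto
   have agr: "agree (Suc d) u y" unfolding agree_def y_def using zd by (auto simp: less_Suc_eq)
   have yX: "y : X"
   proof -
    have "E (y i) (y (Suc i))" for i
    proof -
     consider "Suc i < d" | "Suc i = d" | "d <= i" by linarith
     then show ?thesis
     proof cases
      case 2
      then have "y i = u i" "y (Suc i) = u (Suc i)" using agr by (auto simp: agree_def)
      then show ?thesis using uX by (simp add: sigma_plus_def)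
     qed (use uX zd in \<open>auto simp: y_def sigma_plus_def Suc_diff_le\<close>)
    qed
    then show ?thesis by (simp add: sigma_plus_def)
   qed
   have y0: "y 0 = x I" using agr[unfolded agree_def, rule_format, of 0] by (simp add: u_def funpow_shift)
   have yY: "y : Y (J - I)"
   proof -
    have "(shift ^^ d) y = z (u d)" by (simp add: funpow_shift y_def fun_eq_iff)
    then show ?thesis using yX y0 IJ ud by (auto simp: Y_def d_def)
   qed
   have fy: "birkhoff f d u <= D' + birkhoff f d y"
    using wvar_birkhoff_1[OF f(1,2) uX yX agr] by (auto simp: D'_def)
   have fu: "birkhoff f n x - K * (real N + 1) <= birkhoff f d u"
   proof -
    have "birkhoff f d u = (\<Sum>k\<in>{I..<J}. f ((shift ^^ k) x))"
    proof -
     have "birkhoff f d u = (\<Sum>k<d. f ((shift ^^ (k + I)) x))" by (simp add: birkhoff_def u_def funpow_shift_add)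
     also have "... = (\<Sum>k\<in>{0 + I..<d + I}. f ((shift ^^ k) x))"
      unfolding sum.shift_bounds_nat_ivl by (simp add: lessThan_atLeast0)
     finally show ?thesis using IJ by (simp add: d_def)
    qed
    moreover have "birkhoff f n x = (\<Sum>k\<in>{I..<J}. f ((shift ^^ k) x)) + (\<Sum>k\<in>{..<n} - {I..<J}. f ((shift ^^ k) x))"
     unfolding birkhoff_def using IJ by (subst sum.subset_diff[of "{I..<J}" "{..<n}"]) (auto simp: add.commute)
    moreover have "(\<Sum>k\<in>{..<n} - {I..<J}. f ((shift ^^ k) x)) <= K * (real N + 1)"
    proof -
     \<comment> \<open>Before \<open>I\<close> and after \<open>J\<close> no time is a visit to
       \<open>F\<close>, so the only visit left out is \<open>J\<close> itself.\<close>
     have "{..<n} - {I..<J} \<subseteq> insert J {k. k < n & x k \<notin> F}"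
      using Imin Jmax by (auto simp: S_def not_less not_le) (meson antisym_conv linorder_not_le)+
     then have "card ({..<n} - {I..<J}) <= card (insert J {k. k < n & x k \<notin> F})" by (intro card_mono) auto
     also have "... <= N + 1" by (simp add: N_def card_insert_if)
     finally have c: "real (card ({..<n} - {I..<J})) <= real N + 1" by linarith
     have "(\<Sum>k\<in>{..<n} - {I..<J}. f ((shift ^^ k) x)) <= real (card ({..<n} - {I..<J})) * K"
      using f(4) xX sum_bounded_above[of "{..<n} - {I..<J}" "%k. f ((shift ^^ k) x)" K] by auto
     also have "... <= (real N + 1) * K" using c f(5) by (intro mult_right_mono) auto
     finally show ?thesis by (simp add: mult.commute)
    qed
    ultimately show ?thesis by linarith
   qed
   define bad where "bad = {k. k < n & \<not> (I <= k & k + l <= J)}"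
   have cbad: "real (card bad) <= real N + real l"
   proof -
    \<comment> \<open>A visit to \<open>F\<close> lies between \<open>I\<close> and
      \<open>J\<close>, so it is bad only if it is one of the last \<open>l\<close> times up to
      \<open>J\<close>.\<close>
    have "bad \<subseteq> {k. k < n & x k \<notin> F} \<union> {Suc J - l..<Suc J}"
    proof
     fix k assume k: "k : bad"
     show "k : {k. k < n & x k \<notin> F} \<union> {Suc J - l..<Suc J}"
     proof (cases "x k : F")
      case True
      then have "k : S" using k by (auto simp: S_def bad_def)
      then have "I <= k" "k <= J" using Imin Jmax by auto
      then show ?thesis using k by (auto simp: bad_def)
     qed (use k in \<open>auto simp: bad_def\<close>)
    qed
    then have "card bad <= card ({k. k < n & x k \<notin> F} \<union> {Suc J - l..<Suc J})" by (intro card_mono) auto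
    also have "... <= N + card {Suc J - l..<Suc J}" unfolding N_def by (rule card_Un_le)
    finally show ?thesis by simp
   qed
   have kkge: "exp (- (e ((shift ^^ k) x) + (if k : bad then ln p else 0))) <= kk I J y k (A k)" if k: "k < n" for k
   proof (cases "k : bad")
    case True
    then have "kk I J y k (A k) = 1 / p" by (auto simp: kk_def bad_def)
    also have "1 / p = exp (- ln p)" using p1 by (simp add: exp_minus inverse_eq_divide)
    finally show ?thesis using True e0[of "(shift ^^ k) x"] by simp
   next
    case False
    then have kI: "I <= k" "k + l <= J" using k by (auto simp: bad_def)
    define v where "v = (shift ^^ k) x"
    have vX: "v : X" using xX by (auto simp: v_def)
    have vu: "v = (shift ^^ (k - I)) u" using kI by (simp add: v_def u_def funpow_shift_add)
    have "agree (Suc d - (k - I)) v ((shift ^^ (k - I)) y)" unfolding vu by (rule agree_funpow_shift[OF agr])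
    then have "agree l v ((shift ^^ (k - I)) y)" by (rule agree_mono) (use kI in \<open>simp add: d_def\<close>)
    then have sv: "s ((shift ^^ (k - I)) y) = s v" using s(1)[OF vX, of "(shift ^^ (k - I)) y"] yX by auto
    have vA: "v : A k" "A k : Q" using xA[OF k] A k by (auto simp: v_def)
    have kk: "kk I J y k (A k) = kap (A k) (s v)" using kI by (simp add: kk_def sv)
    have "exp (- e v) <= kap (A k) (s v)"
    proof (cases "v : s v")
     case True
     then have "A k = s v" using vA s(2)[OF vX] Qp(4) by (auto simp: disjoint_def)
     moreover have "v \<notin> Bs" using True by (simp add: Bs_def)
     ultimately show ?thesis using \<delta> by (simp add: kap_def e_def)
    next
     case False
     then have "A k ~= s v" using vA by auto
     moreover have "v : Bs" using False vX by (simp add: Bs_def)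
     moreover have "exp (- ln (p / \<delta>)) = \<delta> / p" using p1 \<delta> by (simp add: exp_minus)
     moreover have "exp (- e v) <= exp (- ln (p / \<delta>))" using e1 \<open>v : Bs\<close> by (simp add: e_def)
     ultimately show ?thesis by (simp add: kap_def)
    qed
    then show ?thesis using False kk by (simp add: v_def)
   qed
   have "exp (- birkhoff e n x - ln p * real (card bad)) = (\<Prod>k<n. exp (- (e ((shift ^^ k) x) + (if k : bad then ln p else 0))))"
   proof -
    have "(\<Sum>k<n. if k : bad then ln p else 0) = ln p * real (card bad)"
    proof -
     have "{..<n} \<inter> bad = bad" by (auto simp: bad_def)
     then show ?thesis by (simp add: sum.If_cases)
    qed
    then have "- birkhoff e n x - ln p * real (card bad) = (\<Sum>k<n. - (e ((shift ^^ k) x) + (if k : bad then ln p else 0)))"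
     by (simp add: birkhoff_def sum_negf sum.distrib sum_subtractf)
    then show ?thesis by (simp only: exp_sum finite_lessThan)
   qed
   also have "... <= (\<Prod>k<n. kk I J y k (A k))" using kkge by (intro prod_mono) auto
   finally have prod: "exp (- birkhoff e n x - ln p * real (card bad)) <= (\<Prod>k<n. kk I J y k (A k))" .
   have "- R x <= D' + birkhoff f d y + (- birkhoff e n x - ln p * real (card bad))"
   proof -
    have "ln p * real (card bad) <= ln p * (real N + real l)" using cbad lnp by (intro mult_left_mono) auto
    then show ?thesis unfolding R_def Nb using fy fu lnp by (simp add: algebra_simps)
   qed
   then have "exp (- R x) <= exp (D' + birkhoff f d y + (- birkhoff e n x - ln p * real (card bad)))" by simp
   also have "... = exp D' * exp (birkhoff f d y) * exp (- birkhoff e n x - ln p * real (card bad))" by (simp only: exp_add)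
   also have "... <= wt I J y A" unfolding wt_def d_def[symmetric] using prod by (intro mult_left_mono) auto
   finally have "ennreal (exp (- R x)) <= ennreal (wt I J y A)" by (rule ennreal_leI)
   also have "... <= (\<integral>\<^sup>+y. ennreal (wt I J y A) \<partial>count_space (Y (J - I)))" by (rule nn_integral_ge_point[OF yY])
   also have "... <= (\<Sum>j<n. \<integral>\<^sup>+y. ennreal (wt I j y A) \<partial>count_space (Y (j - I)))"
    using IJ by (intro member_le_sum[of J]) auto
   also have "... <= (\<Sum>i<n. \<Sum>j<n. \<integral>\<^sup>+y. ennreal (wt i j y A) \<partial>count_space (Y (j - i)))"
    using IJ by (intro member_le_sum[of I "{..<n}" "%i. \<Sum>j<n. \<integral>\<^sup>+y. ennreal (wt i j y A) \<partial>count_space (Y (j - i))"]) auto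
   also have "... <= q A" by (simp add: q_def)
   finally show ?thesis .
  qed
 qed
 have qfin: "q A < top" if "A : itin Q n" for A
 proof -
  have "q A <= (\<Sum>A\<in>itin Q n. q A)" using that finite_itin[OF Q] by (intro member_le_sum) auto
  then show ?thesis using qsum by (meson ennreal_less_top le_less_trans)
 qed
 have "part_entropy m (refine m Q n) <= (\<integral>x. R x \<partial>m) + ln Z"
 proof (rule gibbs_bound[OF Q Rint, of n "%A. enn2real (q A)"])
  fix A x assume *: "A : itin Q n" "x : icyl m shift n A"
  show "exp (- R x) <= enn2real (q A)"
   using enn2real_mono[OF cover[OF *] qfin[OF *(1)]] by simp
 next
  have "ennreal (\<Sum>A\<in>itin Q n. enn2real (q A)) = (\<Sum>A\<in>itin Q n. q A)"
   using qfin by (subst sum_ennreal[symmetric]) (auto intro!: sum.cong)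
  then show "(\<Sum>A\<in>itin Q n. enn2real (q A)) <= Z" using qsum Z0 by (metis ennreal_le_iff less_imp_le)
 qed (use Z0 in auto)
 then show ?thesis unfolding IR Z_def NF_def Bs_def p_def D'_def .
qed

text \<open>Division by \<open>n\<close> removes the constants and the logarithm of the quadratic
  factor. What remains is controlled by three small quantities: the measure outside
  \<open>F\<close>, the noise level \<delta> and the prediction error. The superharmonic function
  supplies the growth bound.\<close>

theorem variational_upper_bound:
 assumes Q: "finite_partition m Q"
  and f: "wvar Bf f" "0 <= Bf" "integrable m f" "!!x. x : X ==> f x <= K" "0 <= K"
  and H: "!!x. x : X ==> tr E f UNIV H x <= H x" "cone X D H" "0 <= D" "!!x. x : X ==> H x ~= top & H x ~= 0"
 shows "entropy_wrt m Q + (\<integral>x. f x \<partial>m) <= 0"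
proof (rule field_le_epsilon)
 fix \<epsilon> :: real assume e: "\<epsilon> > 0"
 have "X ~= {}" using V_nonempty by blast
 then have "Q ~= {}" using Q_props[OF Q] by auto
 then have p1: "1 <= real (card Q)" using Q_props(1)[OF Q] by (simp add: Suc_leI card_gt_0_iff)
 define p where "p = real (card Q)"
 have lnp: "0 <= ln p" using p1 by (simp add: p_def)
 define \<epsilon>1 where "\<epsilon>1 = \<epsilon> / (3 * (K + ln p + 1))"
 have e1: "\<epsilon>1 > 0" using e f(5) lnp by (simp add: \<epsilon>1_def)
 obtain F where F: "finite F" "measure m {x : X. x 0 \<notin> F} <= \<epsilon>1" using finite_letters_approx[OF e1] .
 have gen: "t * (\<epsilon> / (3 * t)) = \<epsilon> / 3" if "t > 0" for t using that by simp
 define \<delta> where "\<delta> = 1 - exp (- \<epsilon> / 3)"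
 have \<delta>: "0 < \<delta>" "\<delta> < 1" "- ln (1 - \<delta>) = \<epsilon> / 3"
 proof -
  have "exp (- \<epsilon> / 3) < exp 0" using e by (intro exp_less_mono) simp
  then show "0 < \<delta>" by (simp add: \<delta>_def)
  show "\<delta> < 1" by (simp add: \<delta>_def)
  show "- ln (1 - \<delta>) = \<epsilon> / 3" by (simp add: \<delta>_def)
 qed
 \<comment> \<open>A wrong prediction costs \<open>ln (p / \<delta>)\<close>, so \<delta> is fixed
   before the accuracy of the prediction.\<close>
 define \<epsilon>2 where "\<epsilon>2 = \<epsilon> / (3 * (ln (p / \<delta>) + 1))"
 have "1 <= p / \<delta>" using p1 \<delta>(1,2) by (simp add: pos_le_divide_eq p_def)
 then have lnpd: "0 <= ln (p / \<delta>)" by simp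
 have e2: "\<epsilon>2 > 0" using e lnpd by (simp add: \<epsilon>2_def)
 have "\<exists>l s. (\<forall>x\<in>X. \<forall>y\<in>X. agree l x y --> s x = s y) & {x : X. x \<notin> s x} : sets m &
  measure m {x : X. x \<notin> s x} <= \<epsilon>2 & (\<forall>x\<in>X. s x : Q)"
 proof (rule approx_partition[OF Q e2])
  fix l s assume a: "!!x y. x : X ==> y : X ==> agree l x y ==> s x = s y" "{x : X. x \<notin> s x} : sets m"
   "measure m {x : X. x \<notin> s x} <= \<epsilon>2" "!!x. x : X ==> s x : Q"
  show ?thesis by (rule exI[of _ l], rule exI[of _ s]) (intro conjI ballI impI a; assumption)
 qed
 then obtain l s where s': "\<forall>x\<in>X. \<forall>y\<in>X. agree l x y --> s x = s y" and s2: "{x : X. x \<notin> s x} : sets m"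
  "measure m {x : X. x \<notin> s x} <= \<epsilon>2" and s4: "\<forall>x\<in>X. s x : Q" by (elim exE conjE)
 note s = s'[rule_format] s2 s4[rule_format]
 obtain C where C: "0 <= C" "!!n z. z : X ==> z 0 : F ==> (tr E f UNIV ^^ n) (%y. indicator F (y 0)) z <= ennreal C"
  using return_weight_bound[OF H F(1)] by blast
 have "\<forall>c. \<exists>z. z : V c" using V_nonempty by blast
 then obtain z where z: "!!c. z c : V c" by metis
 define c where "c = 1 + exp (Bf / (1 - \<theta>)) * (real (card F) * C)"
 have c: "c > 0" unfolding c_def using C(1) by (intro add_pos_nonneg) auto
 define A where "A = - (\<integral>x. f x \<partial>m) + (K + ln p) * measure m {x : X. x 0 \<notin> F} + (- ln (1 - \<delta>) + ln (p / \<delta>) * measure m {x : X. x \<notin> s x})"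
 define b where "b = (K + ln p) + real l * ln p + ln c"
 have "part_entropy m (refine m Q n) / real n <= A + b / real n + 2 * (ln (real n) / real n)" if n: "n >= 1" for n
 proof -
  have "part_entropy m (refine m Q n) <= - real n * (\<integral>x. f x \<partial>m)
   + (K + ln p) * (real n * measure m {x : X. x 0 \<notin> F} + 1) + real l * ln p
   + real n * (- ln (1 - \<delta>) + ln (p / \<delta>) * measure m {x : X. x \<notin> s x}) + ln (c * (real n)\<^sup>2)"
   unfolding c_def p_def
  proof (rule entropy_bound_n[OF Q n f F(1) z C(1) _ s(1) s(4) s(2) \<delta>(1,2)])
   show "(tr E f UNIV ^^ k) (%y. indicator F (y 0)) (z c) <= ennreal C" if "c : F" for k c
    using C(2)[of "z c" k] z[of c] that by auto
  qed
  also have "ln (c * (real n)\<^sup>2) = ln c + 2 * ln (real n)"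
   using c n by (simp add: ln_mult_pos ln_realpow)
  also have "- real n * (\<integral>x. f x \<partial>m)
   + (K + ln p) * (real n * measure m {x : X. x 0 \<notin> F} + 1) + real l * ln p
   + real n * (- ln (1 - \<delta>) + ln (p / \<delta>) * measure m {x : X. x \<notin> s x}) + (ln c + 2 * ln (real n)) = real n * A + b + 2 * ln (real n)"
  proof -
   have "- r * i + kp * (r * mu + 1) + lp + r * (x + y * v) + (lc + t) = r * (- i + kp * mu + (x + y * v)) + (kp + lp + lc) + t"
    for r i kp mu lp x y v lc t :: real by (simp add: algebra_simps)
   then show ?thesis unfolding A_def b_def .
  qed
  finally have "part_entropy m (refine m Q n) / real n <= (real n * A + b + 2 * ln (real n)) / real n"
   by (rule divide_right_mono) simp
  also have "... = A + b / real n + 2 * (ln (real n) / real n)" using n by (simp add: add_divide_distrib)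
  finally show ?thesis .
 qed
 moreover have "(%n. A + b / real n + 2 * (ln (real n) / real n)) \<longlonglongrightarrow> A + 0 + 2 * 0"
  by (intro tendsto_intros lim_const_over_n lim_ln_over_n)
 ultimately have "entropy_wrt m Q <= A + 0 + 2 * 0"
  by (intro LIMSEQ_le[OF entropy_wrt_LIMSEQ[OF Q]]) auto
 moreover have "(K + ln p) * measure m {x : X. x 0 \<notin> F} <= \<epsilon> / 3"
 proof -
  have "(K + ln p) * measure m {x : X. x 0 \<notin> F} <= (K + ln p + 1) * \<epsilon>1"
   using F(2) f(5) lnp by (intro mult_mono) auto
  also have "... = \<epsilon> / 3"
  proof -
   have "K + ln p + 1 > 0" using f(5) lnp by linarith
   then show ?thesis unfolding \<epsilon>1_def by (rule gen)
  qed
  finally show ?thesis .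
 qed
 moreover have "ln (p / \<delta>) * measure m {x : X. x \<notin> s x} <= \<epsilon> / 3"
 proof -
  have "ln (p / \<delta>) * measure m {x : X. x \<notin> s x} <= (ln (p / \<delta>) + 1) * \<epsilon>2"
   using s(3) lnpd by (intro mult_mono) auto
  also have "... = \<epsilon> / 3"
  proof -
   have "ln (p / \<delta>) + 1 > 0" using lnpd by linarith
   then show ?thesis unfolding \<epsilon>2_def by (rule gen)
  qed
  finally show ?thesis .
 qed
 ultimately show "entropy_wrt m Q + (\<integral>x. f x \<partial>m) <= 0 + \<epsilon>" using \<delta>(3) unfolding A_def by linarith
qed

end

section \<open>The variational lower bound\<close>

lemma invariant_shiftI: "invariant_prob E m ==> invariant_shift E m"
 by unfold_locales

text \<open>Bernoulli measures over finitely many periodic points of the same period \<open>L\<close>, viewed as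
 blocks, with all \<open>L\<close> starting phases averaged.\<close>

locale block_measure = markov_shift E \<theta> for E :: "'a::countable => 'a => bool" and \<theta> +
 fixes a :: 'a and L :: nat and XX :: "(nat => 'a) set" and w :: "(nat => 'a) => real"
 assumes L: "L >= 1" and XX: "finite XX" "XX \<subseteq> {x : sigma_plus E. (shift ^^ L) x = x & x 0 = a}"
  and w: "!!x. x : XX ==> 0 < w x" "(\<Sum>x\<in>XX. w x) = 1"
begin

abbreviation M0 :: "(nat => 'a) measure" where "M0 \<equiv> point_measure XX (%x. ennreal (w x))"

definition PM :: "(nat => nat => 'a) measure" where "PM = PiM UNIV (%_. M0)"

lemma prob_M0: "prob_space M0"
proof (rule prob_space_point_measure)
 have "(\<Sum>x\<in>XX. ennreal (w x)) = ennreal (\<Sum>x\<in>XX. w x)" using w(1) by (intro sum_ennreal) (auto intro: less_imp_le)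
 then show "(\<Sum>x\<in>XX. ennreal (w x)) = 1" using w(2) by simp
qed (use XX in auto)

sublocale PP: product_prob_space "%_::nat. M0" UNIV
proof -
 interpret prob_space M0 by (rule prob_M0)
 show "product_prob_space (%_::nat. M0)" by unfold_locales
qed

lemma prob_PM: "prob_space PM"
 unfolding PM_def by (rule prob_space_PiM) (rule prob_M0)

sublocale P: prob_space PM by (rule prob_PM)

lemma space_PM: "y : space PM \<longleftrightarrow> (\<forall>j. y j : XX)"
 by (auto simp: PM_def space_PiM PiE_iff space_point_measure)

lemma XXD: "x : XX ==> x : X" "x : XX ==> (shift ^^ L) x = x" "x : XX ==> x 0 = a" "x : XX ==> x L = a"
proof -
 show "x : XX ==> x : X" "x : XX ==> (shift ^^ L) x = x" "x : XX ==> x 0 = a" using XX by auto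
 then have "x : XX ==> (shift ^^ L) x 0 = a" by simp
 then show "x : XX ==> x L = a" by (simp add: funpow_shift)
qed

lemma XX_eqI: assumes "x : XX" "x' : XX" "!!i. i < L ==> x i = x' i" shows "x = x'"
proof
 fix i
 have per: "v (j + L * k) = v j" if "v : XX" for v j k
 proof (induction k)
  case (Suc k)
  have "v (j + L * k + L) = v (j + L * k)"
   using fun_cong[OF XXD(2)[OF that], of "j + L * k"] by (simp add: funpow_shift)
  then show ?case using Suc by (simp add: algebra_simps)
 qed simp
 show "x i = x' i"
  using per[OF assms(1), of "i mod L" "i div L"] per[OF assms(2), of "i mod L" "i div L"] assms(3)[of "i mod L"] L
  by simp
qed

definition cc :: "(nat => nat => 'a) => nat => 'a" where "cc y = (%i. y (i div L) (i mod L))"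

lemma cc_in_X: "y : space PM ==> cc y : X"
proof -
 assume y: "y : space PM"
 have "E (cc y i) (cc y (Suc i))" for i
 proof -
  have yi: "y (i div L) : XX" "y (Suc (i div L)) : XX" using y space_PM by auto
  have e: "E (y (i div L) (i mod L)) (y (i div L) (Suc (i mod L)))"
   using XXD(1)[OF yi(1)] by (simp add: sigma_plus_def)
  show ?thesis
  proof (cases "Suc (i mod L) = L")
   case True
   then have "Suc i mod L = 0" "Suc i div L = Suc (i div L)" by (auto simp: mod_Suc div_Suc)
   then show ?thesis using e True XXD(4)[OF yi(1)] XXD(3)[OF yi(2)] by (simp add: cc_def)
  next
   case False
   then have "Suc i mod L = Suc (i mod L)" "Suc i div L = i div L" by (auto simp: mod_Suc div_Suc)
   then show ?thesis using e by (simp add: cc_def)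
  qed
 qed
 then show ?thesis by (simp add: sigma_plus_def)
qed

text \<open>The extra letter is the \<open>a\<close> that opens the next block and also closes the
  periodic one; \<open>L + 1\<close> common letters are what bounded distortion over
  \<open>L\<close> steps requires.\<close>

lemma agree_cc: "y : space PM ==> agree (Suc L) (cc y) (y 0)"
 unfolding agree_def
proof (intro allI impI)
 fix i assume y: "y : space PM" and i: "i < Suc L"
 have y01: "y 0 : XX" "y 1 : XX" using y space_PM by auto
 show "cc y i = y 0 i"
 proof (cases "i = L")
  case True
  then show ?thesis using L XXD(4)[OF y01(1)] XXD(3)[OF y01(2)] by (simp add: cc_def)
 qed (use i in \<open>simp add: cc_def\<close>)
qed

lemma shift_L_cc: "(shift ^^ L) (cc y) = cc (%j. y (Suc j))"
 using L by (simp add: cc_def funpow_shift)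

lemma measurable_PM_component: "(%y. g (y j)) : measurable PM (count_space UNIV)" for g :: "(nat => 'a) => 'b"
proof -
 have "(%y. y j) : measurable PM M0" unfolding PM_def by (rule measurable_component_singleton) simp
 moreover have "g : measurable M0 (count_space UNIV)" by (auto simp: measurable_def sets_point_measure space_point_measure)
 ultimately show ?thesis by (rule measurable_compose)
qed

lemma measurable_PM_component_borel: "(%y. g (y j)) : borel_measurable PM" for g :: "(nat => 'a) => real"
 by (rule measurable_compose[OF measurable_PM_component[of g j], of id, simplified]) simp

lemma cc_measurable [measurable]: "cc : measurable PM (shift_space E)"
proof (rule measurable_to_shift_space)
 fix n and v :: "nat => 'a"
 have "{y : space PM. \<forall>i\<in>{..<n}. y (i div L) (i mod L) = v i} : sets PM"
 proof (rule sets.sets_Collect_finite_All)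
  fix i
  show "{y : space PM. y (i div L) (i mod L) = v i} : sets PM"
   using measurable_sets[OF measurable_PM_component[of "%x. x (i mod L)" "i div L"], of "{v i}"]
   by (simp add: vimage_def Int_def conj_commute)
 qed simp
 then show "{y : space PM. \<forall>i<n. cc y i = v i} : sets PM" unfolding cc_def Ball_def lessThan_iff .
qed (rule cc_in_X)

definition T :: "nat => (nat => nat => 'a) => nat => 'a" where "T k y = (shift ^^ k) (cc y)"

lemma T_measurable [measurable]: "T k : measurable PM (shift_space E)"
 unfolding T_def[abs_def] by measurable

lemma T_in_X: "y : space PM ==> T k y : X"
 unfolding T_def using cc_in_X by auto

definition Om :: "(nat \<times> (nat => nat => 'a)) measure" where "Om = measure_pmf (pmf_of_set {..<L}) \<Otimes>\<^sub>M PM"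

text \<open>The uniform law of the phase is a measure on all naturals. \<open>mod L\<close> does
  nothing on its support and keeps the phase below \<open>L\<close> everywhere, so that bounds hold
  at every point of the product.\<close>

definition nu :: "(nat => 'a) measure" where
 "nu = distr Om (shift_space E) (%p. T (fst p mod L) (snd p))"

lemma L_ne: "{..<L} ~= {}"
proof -
 have "0 : {..<L}" using L by simp
 then show ?thesis by blast
qed

lemma T_pair_measurable [measurable]: "(%p. T (fst p mod L) (snd p)) : measurable Om (shift_space E)"
proof -
 have "(%p. T (fst p mod L) (snd p)) : measurable (count_space UNIV \<Otimes>\<^sub>M PM) (shift_space E)"
  by (rule measurable_compose_countable'[where I=UNIV and g=fst and f="%k p. T (k mod L) (snd p)"])
   (auto intro: measurable_compose[OF measurable_snd])
 moreover have "sets Om = sets (count_space UNIV \<Otimes>\<^sub>M PM)"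
  unfolding Om_def by (intro sets_pair_measure_cong) auto
 ultimately show ?thesis by (simp cong: measurable_cong_sets)
qed

interpretation OmP: pair_prob_space "measure_pmf (pmf_of_set {..<L})" PM
 by unfold_locales

lemma prob_Om: "prob_space Om" unfolding Om_def by (rule OmP.prob_space_axioms)

lemma prob_nu: "prob_space nu"
 unfolding nu_def by (rule prob_space.prob_space_distr[OF prob_Om]) measurable

lemma sets_nu [simp]: "sets nu = sets (shift_space E)" by (simp add: nu_def)

lemma space_nu [simp]: "space nu = X" by (simp add: nu_def)

lemma emeasure_nu:
 assumes A: "A : sets (shift_space E)"
 shows "emeasure nu A = (\<Sum>k<L. emeasure PM (T k -` A \<inter> space PM)) / of_nat L"
proof -
 have s: "(%p. T (fst p mod L) (snd p)) -` A \<inter> space Om : sets Om" using A by measurable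
 have "emeasure nu A = emeasure Om ((%p. T (fst p mod L) (snd p)) -` A \<inter> space Om)"
  unfolding nu_def using A by (intro emeasure_distr) auto
 also have "... = (\<integral>\<^sup>+k. emeasure PM (Pair k -` ((%p. T (fst p mod L) (snd p)) -` A \<inter> space Om)) \<partial>measure_pmf (pmf_of_set {..<L}))"
  using s unfolding Om_def by (intro P.emeasure_pair_measure_alt)
 also have "... = (\<Sum>k<L. emeasure PM (Pair k -` ((%p. T (fst p mod L) (snd p)) -` A \<inter> space Om))) / of_nat L"
  using nn_integral_pmf_of_set[OF L_ne, of "%k. emeasure PM (Pair k -` ((%p. T (fst p mod L) (snd p)) -` A \<inter> space Om))"]
  by (simp add: ennreal_of_nat_eq_real_of_nat)
 also have "(\<Sum>k<L. emeasure PM (Pair k -` ((%p. T (fst p mod L) (snd p)) -` A \<inter> space Om))) =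
   (\<Sum>k<L. emeasure PM (T k -` A \<inter> space PM))"
 proof (intro sum.cong refl arg_cong[where f="emeasure PM"])
  fix k assume "k : {..<L}"
  then show "Pair k -` ((%p. T (fst p mod L) (snd p)) -` A \<inter> space Om) = T k -` A \<inter> space PM"
   by (auto simp: Om_def space_pair_measure)
 qed
 finally show ?thesis .
qed

lemma measure_nu:
 assumes A: "A : sets (shift_space E)"
 shows "measure nu A = (\<Sum>k<L. measure PM (T k -` A \<inter> space PM)) / real L"
proof -
 have "ennreal (measure nu A) = (\<Sum>k<L. ennreal (measure PM (T k -` A \<inter> space PM))) / ennreal (real L)"
  using emeasure_nu[OF A] finite_measure.emeasure_eq_measure[OF prob_space.finite_measure[OF prob_nu]] P.emeasure_eq_measure
  by (simp add: ennreal_of_nat_eq_real_of_nat)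
 also have "... = ennreal ((\<Sum>k<L. measure PM (T k -` A \<inter> space PM)) / real L)"
  using L by (simp add: sum_ennreal divide_ennreal sum_nonneg)
 finally show ?thesis by (simp add: sum_nonneg)
qed

lemma distr_PM_shift: "distr PM PM (%y j. y (Suc j)) = PM"
proof -
 have s: "inj_on Suc UNIV" "Suc : UNIV \<rightarrow> UNIV" by simp_all
 show ?thesis unfolding PM_def
  using distr_PiM_reindex[of UNIV "%_::nat. M0" Suc UNIV, OF prob_M0 s] unfolding restrict_UNIV .
qed

lemma emeasure_T_L:
 assumes A: "A : sets (shift_space E)"
 shows "emeasure PM (T L -` A \<inter> space PM) = emeasure PM (T 0 -` A \<inter> space PM)"
proof -
 have m: "(%y j. y (Suc j)) : measurable PM PM"
  unfolding PM_def by (rule measurable_PiM_single') (auto simp: space_PiM PiE_iff)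
 have B: "T 0 -` A \<inter> space PM : sets PM" using A by measurable
 have "emeasure PM (T 0 -` A \<inter> space PM) = emeasure (distr PM PM (%y j. y (Suc j))) (T 0 -` A \<inter> space PM)"
  by (simp only: distr_PM_shift)
 also have "... = emeasure PM ((%y j. y (Suc j)) -` (T 0 -` A \<inter> space PM) \<inter> space PM)"
  by (rule emeasure_distr[OF m B])
 also have "(%y j. y (Suc j)) -` (T 0 -` A \<inter> space PM) \<inter> space PM = T L -` A \<inter> space PM"
  by (auto simp: T_def shift_L_cc space_PM)
 finally show ?thesis by simp
qed

text \<open>The shift moves phase \<open>k\<close> to \<open>k + 1\<close>, and phase
  \<open>L\<close> has the law of phase 0 because the block sequence is stationary; the average over
  one period is therefore unchanged.\<close>

lemma invariant_nu: "invariant_prob E nu"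
 unfolding invariant_prob_def
proof (intro conjI ballI)
 fix A assume "A : sets nu"
 then have A: "A : sets (shift_space E)" by simp
 have sA: "shift -` A \<inter> X : sets (shift_space E)"
  using measurable_sets[OF measurable_shift A] by simp
 have Tk: "T k -` (shift -` A \<inter> X) \<inter> space PM = T (Suc k) -` A \<inter> space PM" for k
  using T_in_X by (auto simp: T_def)
 have "(\<Sum>k<L. emeasure PM (T (Suc k) -` A \<inter> space PM)) = (\<Sum>k<L. emeasure PM (T k -` A \<inter> space PM))"
 proof -
  have "(\<Sum>k<Suc L. emeasure PM (T k -` A \<inter> space PM)) = emeasure PM (T 0 -` A \<inter> space PM) + (\<Sum>k<L. emeasure PM (T (Suc k) -` A \<inter> space PM))"
   by (rule sum.lessThan_Suc_shift)
  moreover have "(\<Sum>k<Suc L. emeasure PM (T k -` A \<inter> space PM)) = (\<Sum>k<L. emeasure PM (T k -` A \<inter> space PM)) + emeasure PM (T 0 -` A \<inter> space PM)"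
   by (simp add: emeasure_T_L[OF A])
  ultimately show ?thesis
   by (metis (no_types, lifting) P.emeasure_finite add.commute ennreal_add_left_cancel infinity_ennreal_def)
 qed
 then show "emeasure nu (shift -` A \<inter> space nu) = emeasure nu A"
  unfolding space_nu emeasure_nu[OF A] emeasure_nu[OF sA] Tk by simp
qed (use prob_nu in auto)

sublocale N: invariant_shift E nu by (rule invariant_shiftI[OF invariant_nu])

lemma integral_component: "(\<integral>y. g (y j) \<partial>PM) = (\<Sum>x\<in>XX. w x * g x)" for g :: "_ => real"
proof -
 have "(\<integral>x. g x \<partial>M0) = (\<integral>x. g x \<partial>distr PM M0 (%y. y j))"
  unfolding PM_def by (subst distr_PiM_component) (auto simp: prob_M0)
 also have "... = (\<integral>y. g (y j) \<partial>PM)"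
 proof (rule integral_distr)
  show "(%y. y j) : measurable PM M0" unfolding PM_def by (rule measurable_component_singleton) simp
  show "g : borel_measurable M0" by (auto simp: measurable_def sets_point_measure space_point_measure)
 qed
 also have "(\<integral>x. g x \<partial>M0) = (\<Sum>x\<in>XX. w x * g x)"
 proof -
  have "(\<integral>x. g x \<partial>point_measure XX (%x. ennreal (w x))) = (\<Sum>x\<in>XX. w x *\<^sub>R g x)"
   using XX w(1) by (intro lebesgue_integral_point_measure_finite) (auto intro: less_imp_le)
  then show ?thesis by simp
 qed
 finally show ?thesis by simp
qed

lemma integrable_component: "integrable PM (%y. g (y j))" for g :: "_ => real"
proof (rule P.integrable_const_bound[of _ "\<Sum>x\<in>XX. \<bar>g x\<bar>"])
 have "\<bar>g (y j)\<bar> <= (\<Sum>x\<in>XX. \<bar>g x\<bar>)" if "y : space PM" for y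
  using that XX(1) space_PM by (intro member_le_sum) auto
 then show "AE y in PM. norm (g (y j)) <= (\<Sum>x\<in>XX. \<bar>g x\<bar>)" by (auto intro: AE_I2)
qed (rule measurable_PM_component_borel)

text \<open>A concatenated orbit follows the periodic point of its current block, and the subtracted
  constant is the distortion over one block.\<close>

lemma integral_nu:
 assumes f: "wvar B f" "0 <= B"
 shows "integrable nu f" "(\<Sum>x\<in>XX. w x * birkhoff f L x) - B / (1 - \<theta>) <= real L * (\<integral>x. f x \<partial>nu)"
proof -
 have fm [measurable]: "f : borel_measurable (shift_space E)" by (rule wvar_measurable[OF f(1)])
 \<comment> \<open>\<open>f\<close> may be unbounded on \<open>X\<close>, but within a block the
   orbit shares at least two letters with a shifted point of the finite set \<open>XX\<close>, and
   two letters are enough for \<open>wvar\<close>.\<close>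
 define K where "K = B + (\<Sum>x\<in>XX. \<Sum>k<L. \<bar>f ((shift ^^ k) x)\<bar>)"
 have fK: "\<bar>f (T k y)\<bar> <= K" if y: "y : space PM" and k: "k < L" for y k
 proof -
  have y0: "y 0 : XX" using y space_PM by auto
  have "agree (Suc L - k) (T k y) ((shift ^^ k) (y 0))" unfolding T_def by (rule agree_funpow_shift[OF agree_cc[OF y]])
  then have ag: "agree 2 (T k y) ((shift ^^ k) (y 0))" by (rule agree_mono) (use k in simp)
  have "\<bar>f (T k y) - f ((shift ^^ k) (y 0))\<bar> <= B * \<theta> ^ 2"
   using f(1)[unfolded wvar_def, rule_format, OF _ T_in_X[OF y] _ ag] XXD(1)[OF y0] by auto
  also have "... <= B" using theta_pow(2)[of 2] f(2) by (rule mult_left_le)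
  finally have "\<bar>f (T k y)\<bar> <= B + \<bar>f ((shift ^^ k) (y 0))\<bar>" by linarith
  also have "\<bar>f ((shift ^^ k) (y 0))\<bar> <= (\<Sum>k<L. \<bar>f ((shift ^^ k) (y 0))\<bar>)" using k by (intro member_le_sum) auto
  also have "... <= (\<Sum>x\<in>XX. \<Sum>k<L. \<bar>f ((shift ^^ k) x)\<bar>)"
   using y0 XX(1) by (intro member_le_sum[of _ _ "%x. \<Sum>k<L. \<bar>f ((shift ^^ k) x)\<bar>"]) (auto intro: sum_nonneg)
  finally show ?thesis by (simp add: K_def)
 qed
 have bound: "norm (f (T (fst p mod L) (snd p))) <= K" if "p : space Om" for p
  using that fK[of "snd p" "fst p mod L"] L by (auto simp: Om_def space_pair_measure)
 have meas: "(%p. f (T (fst p mod L) (snd p))) : borel_measurable Om" by measurable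
 have int: "integrable Om (%p. f (T (fst p mod L) (snd p)))"
  using bound meas prob_space.finite_measure[OF prob_Om]
  by (intro finite_measure.integrable_const_bound[of _ _ K]) (auto intro: AE_I2)
 show "integrable nu f"
  unfolding nu_def using int by (subst integrable_distr_eq) auto
 have "(\<integral>x. f x \<partial>nu) = (\<integral>p. f (T (fst p mod L) (snd p)) \<partial>Om)"
  unfolding nu_def by (subst integral_distr) auto
 also have "... = (\<integral>k. (\<integral>y. f (T (k mod L) y) \<partial>PM) \<partial>measure_pmf (pmf_of_set {..<L}))"
  using OmP.integral_fst'[of "%p. f (T (fst p mod L) (snd p))"] int by (simp add: Om_def)
 also have "... = (\<Sum>k<L. (\<integral>y. f (T k y) \<partial>PM)) / real L"
  using integral_pmf_of_set[OF L_ne, of "%k. (\<integral>y. f (T (k mod L) y) \<partial>PM)"] by simp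
 finally have eq: "real L * (\<integral>x. f x \<partial>nu) = (\<Sum>k<L. (\<integral>y. f (T k y) \<partial>PM))" using L by simp
 have intk: "integrable PM (%y. f (T k y))" if "k < L" for k
  using fK that by (intro P.integrable_const_bound[of _ K]) (auto intro: AE_I2)
 have "(\<Sum>k<L. (\<integral>y. f (T k y) \<partial>PM)) = (\<integral>y. (\<Sum>k<L. f (T k y)) \<partial>PM)"
  using intk by (subst Bochner_Integration.integral_sum) auto
 also have "... = (\<integral>y. birkhoff f L (cc y) \<partial>PM)" by (simp add: birkhoff_def T_def)
 finally have eq2: "real L * (\<integral>x. f x \<partial>nu) = (\<integral>y. birkhoff f L (cc y) \<partial>PM)" using eq by simp
 have "(\<Sum>x\<in>XX. w x * birkhoff f L x) - B / (1 - \<theta>) = (\<integral>y. birkhoff f L (y 0) - B / (1 - \<theta>) \<partial>PM)"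
  using integrable_component[of "birkhoff f L" 0] integral_component[of "birkhoff f L" 0] by (simp add: P.prob_space)
 also have "... <= (\<integral>y. birkhoff f L (cc y) \<partial>PM)"
 proof (rule integral_mono)
  show "integrable PM (%y. birkhoff f L (y 0) - B / (1 - \<theta>))" using integrable_component[of "birkhoff f L" 0] by auto
  show "integrable PM (%y. birkhoff f L (cc y))"
   unfolding birkhoff_def T_def[symmetric] using intk by auto
  fix y assume y: "y : space PM"
  have "\<bar>birkhoff f L (cc y) - birkhoff f L (y 0)\<bar> <= B / (1 - \<theta>)"
   using wvar_birkhoff_1[OF f cc_in_X[OF y] _ agree_cc[OF y]] XXD(1)[of "y 0"] y space_PM by auto
  then show "birkhoff f L (y 0) - B / (1 - \<theta>) <= birkhoff f L (cc y)" by linarith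
 qed
 finally show "(\<Sum>x\<in>XX. w x * birkhoff f L x) - B / (1 - \<theta>) <= real L * (\<integral>x. f x \<partial>nu)" using eq2 by simp
qed

definition Lt :: "'a set" where "Lt = (%(x, i). x i) ` (XX \<times> {..<L})"

definition cell :: "'a => (nat => 'a) set" where "cell c = {x : X. x 0 = c}"

text \<open>Entropy is taken over finite partitions, so all letters that do not occur in the blocks
  are merged into one cell; concatenated points never enter it.\<close>

definition Q0 :: "(nat => 'a) set set" where "Q0 = insert {x : X. x 0 \<notin> Lt} (cell ` Lt)"

lemma Q0_partition: "finite_partition nu Q0"
proof -
 have "finite Lt" using XX(1) by (simp add: Lt_def)
 moreover have "{x : X. x 0 : S} : sets (shift_space E)" for S
  by (rule locally_constant_set_measurable) (auto simp: agree_def intro!: exI[of _ 1])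
 from this[of "- Lt"] this[of "{c}" for c] have "Q0 \<subseteq> sets (shift_space E)" by (auto simp: Q0_def cell_def)
 ultimately show ?thesis
  by (auto simp: finite_partition_def Q0_def cell_def disjoint_def)
qed

lemma cc_letter: "y : space PM ==> cc y i : Lt"
 using L space_PM by (force simp: cc_def Lt_def)

lemma itin_T:
 assumes F: "F : itin Q0 n" and y: "y : space PM" "T k y : icyl nu shift n F" and y': "y' : space PM" "T k y' : icyl nu shift n F"
  and i: "i < n"
 shows "cc y (i + k) = cc y' (i + k)"
proof -
 have FQ: "F i : Q0" using F i by auto
 have m: "(shift ^^ i) (T k y) : F i" "(shift ^^ i) (T k y') : F i" using y y' i by (auto simp: icyl_iff)
 have c: "((shift ^^ i) (T k v)) 0 = cc v (i + k)" for v by (simp add: T_def funpow_shift)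
 have "F i ~= {x : X. x 0 \<notin> Lt}" using m(1) c[of y] cc_letter[OF y(1), of "i + k"] by auto
 then obtain l where "F i = cell l" using FQ by (auto simp: Q0_def)
 then show ?thesis using m c[of y] c[of y'] by (auto simp: cell_def)
qed

text \<open>Whatever the phase, a cell of length \<open>q * L\<close> determines the blocks 1 to
  \<open>q - 1\<close> completely, so its measure is at most the product of their weights. Block 0
  may be cut off by the phase, whence \<open>q - 1\<close>.\<close>

lemma entropy_phase:
 assumes k: "k < L" and n: "n = q * L"
 shows "(real q - 1) * (\<Sum>x\<in>XX. eta (w x)) \<le>
  (\<Sum>F\<in>itin Q0 n. eta (measure PM (T k -` icyl nu shift n F \<inter> space PM)))"
proof -
 define A where "A F = T k -` icyl nu shift n F \<inter> space PM" for F
 have As: "A F : sets PM" if "F : itin Q0 n" for F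
  using measurable_sets[OF T_measurable, of "icyl nu shift n F" k] N.itin_sets[OF Q0_partition that] by (simp add: A_def)
 define W where "W y = (\<Sum>j\<in>{1..<q}. - ln (w (y j)))" for y :: "nat => nat => 'a"
 have Wint: "integrable PM W"
  unfolding W_def[abs_def] by (intro Bochner_Integration.integrable_sum integrable_component[of "%x. - ln (w x)"])
 have le: "(\<integral>y. indicator (A F) y * W y \<partial>PM) <= eta (measure PM (A F))" if F: "F : itin Q0 n" for F
 proof (cases "measure PM (A F) = 0")
  case True
  have "AE y in PM. y \<notin> A F" using True As[OF F] by (subst AE_iff_measurable[OF As[OF F]]) (auto simp: P.emeasure_eq_measure dest: sets.sets_into_space)
  then have "(\<integral>y. indicator (A F) y * W y \<partial>PM) = (\<integral>y. 0 \<partial>PM)"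
   using As[OF F] Wint by (intro integral_cong_AE) (auto simp: indicator_def)
  then show ?thesis using True by simp
 next
  case False
  have ub: "measure PM (A F) <= exp (- W y)" if y: "y : A F" for y
  proof -
   have ysp: "y : space PM" "T k y : icyl nu shift n F" using y by (auto simp: A_def)
   have sub: "A F \<subseteq> {y' : space (PiM UNIV (%_. M0)). \<forall>j\<in>{1..<q}. y' j : {y j}}"
   proof
    fix y' assume y': "y' : A F"
    then have y'sp: "y' : space PM" "T k y' : icyl nu shift n F" by (auto simp: A_def)
    have "y' j = y j" if j: "j : {1..<q}" for j
    proof (rule XX_eqI)
     fix i assume i: "i < L"
     have "k <= j * L" using k j by (metis atLeastLessThan_iff le_trans less_imp_le_nat mult.commute mult_le_mono2 nat_mult_1_right)
     have "Suc j * L <= q * L" using j by (intro mult_right_mono) auto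
     then have b: "j * L + i - k < n" "j * L + i - k + k = j * L + i" using \<open>k <= j * L\<close> i n by auto
     have "cc y' (j * L + i) = cc y (j * L + i)"
      using itin_T[OF F y'sp ysp b(1)] b(2) by simp
     then show "y' j i = y j i" using i by (simp add: cc_def)
    qed (use ysp y'sp space_PM in auto)
    then show "y' : {y' : space (PiM UNIV (%_. M0)). \<forall>j\<in>{1..<q}. y' j : {y j}}" using y'sp by (auto simp: PM_def)
   qed
   have yj: "y j : XX" for j using ysp space_PM by auto
   have "emeasure PM {y' : space (PiM UNIV (%_. M0)). \<forall>j\<in>{1..<q}. y' j : {y j}} = (\<Prod>j\<in>{1..<q}. emeasure M0 {y j})"
    unfolding PM_def using yj by (intro PP.emeasure_PiM_Collect) (auto simp: sets_point_measure)
   also have "... = (\<Prod>j\<in>{1..<q}. ennreal (w (y j)))"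
    using yj XX(1) by (intro prod.cong refl) (simp add: emeasure_point_measure_finite)
   also have "... = ennreal (exp (- W y))"
   proof -
    have "exp (- W y) = (\<Prod>j\<in>{1..<q}. exp (ln (w (y j))))"
     unfolding W_def by (simp add: sum_negf exp_sum)
    also have "... = (\<Prod>j\<in>{1..<q}. w (y j))" using w(1) yj by (intro prod.cong refl) auto
    finally show ?thesis using w(1) yj by (subst prod_ennreal) (auto intro: less_imp_le)
   qed
   finally have eq: "emeasure PM {y' : space (PiM UNIV (%_. M0)). \<forall>j\<in>{1..<q}. y' j : {y j}} = ennreal (exp (- W y))" .
   have st: "{y' : space (PiM UNIV (%_. M0)). \<forall>j\<in>{1..<q}. y' j : {y j}} : sets PM"
   proof -
    have "{y' : space PM. \<forall>j\<in>{1..<q}. y' j : {y j}} : sets PM"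
    proof (rule sets.sets_Collect_finite_All)
     show "{y' : space PM. y' j : {y j}} : sets PM" for j
      using measurable_sets[OF measurable_PM_component[of "%x. x" j], of "{y j}"]
      by (simp add: vimage_def Int_def conj_commute)
    qed simp
    then show ?thesis by (simp add: PM_def)
   qed
   have "emeasure PM (A F) <= ennreal (exp (- W y))" using emeasure_mono[OF sub st] unfolding eq .
   then show ?thesis by (simp add: P.emeasure_eq_measure)
  qed
  have pos: "0 < measure PM (A F)" using False by (simp add: zero_less_measure_iff)
  have "(\<integral>y. indicator (A F) y * W y \<partial>PM) <= (\<integral>y. indicator (A F) y * (- ln (measure PM (A F))) \<partial>PM)"
  proof (rule integral_mono)
   show "integrable PM (%y. indicator (A F) y * W y)" using integrable_mult_indicator[OF As[OF F] Wint] by simp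
   show "integrable PM (%y. indicator (A F) y * (- ln (measure PM (A F))))"
    using As[OF F] by (intro integrable_mult_left integrable_real_indicator) (auto simp: P.emeasure_eq_measure)
   fix y
   show "indicator (A F) y * W y <= indicator (A F) y * (- ln (measure PM (A F)))"
   proof (cases "y : A F")
    case True
    then have "ln (measure PM (A F)) <= ln (exp (- W y))" using ub[OF True] pos by (subst ln_le_cancel_iff) auto
    then show ?thesis using True by simp
   qed simp
  qed
  also have "... = eta (measure PM (A F))"
   using As[OF F] sets.sets_into_space[OF As[OF F]] by (simp add: eta_def Int_absorb2 mult.commute)
  finally show ?thesis .
 qed
 have cov: "(\<Sum>F\<in>itin Q0 n. indicator (A F) y * W y) = W y" if y: "y : space PM" for y
 proof -
  have "\<exists>!F. F : itin Q0 n & T k y : icyl nu shift n F"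
   using N.itin_cover[OF Q0_partition T_in_X[OF y]] .
  then obtain F where F: "F : itin Q0 n" "T k y : icyl nu shift n F"
   and u: "!!F'. F' : itin Q0 n ==> T k y : icyl nu shift n F' ==> F' = F" by metis
  have "(\<Sum>F'\<in>itin Q0 n. indicator (A F') y * W y) = (\<Sum>F'\<in>itin Q0 n. if F' = F then W y else 0)"
  proof (rule sum.cong[OF refl])
   fix F' assume F': "F' : itin Q0 n"
   show "indicator (A F') y * W y = (if F' = F then W y else 0)"
   proof (cases "F' = F")
    case False
    then have "y \<notin> A F'" using u[OF F'] by (auto simp: A_def)
    then show ?thesis using False by simp
   qed (use F y in \<open>simp add: A_def\<close>)
  qed
  also have "... = W y" using F N.finite_itin[OF Q0_partition] by simp
  finally show ?thesis .
 qed
 have "(\<integral>y. W y \<partial>PM) = (\<Sum>j\<in>{1..<q}. \<Sum>x\<in>XX. w x * - ln (w x))"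
  unfolding W_def using integrable_component[of "%x. - ln (w x)"] integral_component[of "%x. - ln (w x)"]
  by (subst Bochner_Integration.integral_sum) (simp_all only:)
 also have "... = real (q - 1) * (\<Sum>x\<in>XX. eta (w x))" by (simp add: eta_def)
 finally have IW: "(\<integral>y. W y \<partial>PM) = real (q - 1) * (\<Sum>x\<in>XX. eta (w x))" .
 have "(\<integral>y. W y \<partial>PM) = (\<integral>y. (\<Sum>F\<in>itin Q0 n. indicator (A F) y * W y) \<partial>PM)"
  by (rule Bochner_Integration.integral_cong) (simp_all add: cov)
 also have "... = (\<Sum>F\<in>itin Q0 n. (\<integral>y. indicator (A F) y * W y \<partial>PM))"
  using integrable_mult_indicator[OF As Wint] by (subst Bochner_Integration.integral_sum) auto
 also have "... <= (\<Sum>F\<in>itin Q0 n. eta (measure PM (A F)))" by (intro sum_mono le)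
 finally have main: "real (q - 1) * (\<Sum>x\<in>XX. eta (w x)) <= (\<Sum>F\<in>itin Q0 n. eta (measure PM (A F)))" using IW by simp
 have w1: "w x <= 1" if "x : XX" for x
  using member_le_sum[OF that _ XX(1), of w] w by (auto intro: less_imp_le)
 have "0 <= (\<Sum>x\<in>XX. eta (w x))" using w(1) w1 by (intro sum_nonneg eta_nonneg) (auto intro: less_imp_le)
 then have "(real q - 1) * (\<Sum>x\<in>XX. eta (w x)) <= real (q - 1) * (\<Sum>x\<in>XX. eta (w x))" by (intro mult_right_mono) auto
 then show ?thesis using main unfolding A_def by linarith
qed

text \<open>Concavity of entropy over the phases, obtained by using the averaged measure as
  comparison weight for each phase.\<close>

lemma entropy_nu_n:
 assumes n: "n = q * L"
 shows "(real q - 1) * (\<Sum>x\<in>XX. eta (w x)) <= part_entropy nu (refine nu Q0 n)"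
proof -
 define c where "c F = icyl nu shift n F" for F
 have cs: "c F : sets (shift_space E)" if "F : itin Q0 n" for F
  using N.itin_sets[OF Q0_partition that] by (simp add: c_def)
 define p where "p k F = measure PM (T k -` c F \<inter> space PM)" for k F
 have nup: "measure nu (c F) = (\<Sum>k<L. p k F) / real L" if "F : itin Q0 n" for F
  using measure_nu[OF cs[OF that]] by (simp add: p_def)
 have tot: "(\<Sum>F\<in>itin Q0 n. measure nu (c F)) = 1"
  using N.sum_itin[OF Q0_partition sets.top, of n] N.prob_space by (simp add: c_def icyl_def Int_assoc[symmetric])
 have ptot: "(\<Sum>F\<in>itin Q0 n. p k F) = 1" for k
 proof -
  have "(\<Sum>F\<in>itin Q0 n. p k F) = measure PM (\<Union>F\<in>itin Q0 n. T k -` c F \<inter> space PM)"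
   unfolding p_def
  proof (rule P.finite_measure_finite_Union[symmetric])
   show "disjoint_family_on (%F. T k -` c F \<inter> space PM) (itin Q0 n)"
    using N.itin_disjoint[OF Q0_partition] unfolding disjoint_family_on_def c_def by blast
   show "(%F. T k -` c F \<inter> space PM) ` itin Q0 n \<subseteq> sets PM" using cs measurable_sets[OF T_measurable] by auto
  qed (rule N.finite_itin[OF Q0_partition])
  also have "(\<Union>F\<in>itin Q0 n. T k -` c F \<inter> space PM) = space PM"
  proof (intro equalityI subsetI)
   fix y assume y: "y : space PM"
   then show "y : (\<Union>F\<in>itin Q0 n. T k -` c F \<inter> space PM)"
    using N.itin_cover[OF Q0_partition T_in_X[OF y, of k], of n] by (auto simp: c_def)
  qed auto
  finally show ?thesis by (simp add: P.prob_space)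
 qed
 have "(real q - 1) * (\<Sum>x\<in>XX. eta (w x)) <= (\<Sum>F\<in>itin Q0 n. - (p k F * ln (measure nu (c F))))" if k: "k < L" for k
 proof -
  have "(real q - 1) * (\<Sum>x\<in>XX. eta (w x)) <= (\<Sum>F\<in>itin Q0 n. eta (p k F))"
   using entropy_phase[OF k n] by (simp add: p_def c_def)
  also have "... <= (\<Sum>F\<in>itin Q0 n. - (p k F * ln (measure nu (c F)))) + ln 1"
  proof (rule eta_sum_le_cross_entropy[OF N.finite_itin[OF Q0_partition] _ _ _ ptot])
   fix F assume F: "F : itin Q0 n" "0 < p k F"
   have "0 < (\<Sum>k<L. p k F)" using k F(2) by (intro sum_pos2[of _ k]) (auto simp: p_def)
   then show "0 < measure nu (c F)" using nup[OF F(1)] L by simp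
  qed (use tot in \<open>auto simp: p_def\<close>)
  finally show ?thesis by simp
 qed
 then have "(\<Sum>k<L. (real q - 1) * (\<Sum>x\<in>XX. eta (w x))) <= (\<Sum>k<L. \<Sum>F\<in>itin Q0 n. - (p k F * ln (measure nu (c F))))"
  by (intro sum_mono) auto
 also have "... = (\<Sum>F\<in>itin Q0 n. - ((\<Sum>k<L. p k F) * ln (measure nu (c F))))"
  by (subst sum.swap) (simp add: sum_negf sum_distrib_right)
 also have "... = (\<Sum>F\<in>itin Q0 n. real L * eta (measure nu (c F)))"
  using nup L by (intro sum.cong refl) (simp add: eta_def)
 also have "... = real L * part_entropy nu (refine nu Q0 n)"
  unfolding N.part_entropy_refine[OF Q0_partition] c_def by (simp add: sum_distrib_left)
 finally have "real L * ((real q - 1) * (\<Sum>x\<in>XX. eta (w x))) <= real L * part_entropy nu (refine nu Q0 n)" by simp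
 then show ?thesis using L by simp
qed

lemma entropy_nu: "(\<Sum>x\<in>XX. eta (w x)) / real L <= entropy_wrt nu Q0"
proof -
 define h where "h = (\<Sum>x\<in>XX. eta (w x))"
 have lim: "(%n. part_entropy nu (refine nu Q0 n) / real n) \<longlonglongrightarrow> entropy_wrt nu Q0"
  by (rule N.entropy_wrt_LIMSEQ[OF Q0_partition])
 have sm: "strict_mono (%q. q * L)" using L by (auto simp: strict_mono_def)
 have lim2: "(%q. part_entropy nu (refine nu Q0 (q * L)) / real (q * L)) \<longlonglongrightarrow> entropy_wrt nu Q0"
  using LIMSEQ_subseq_LIMSEQ[OF lim sm] by (simp add: comp_def)
 have "(%q. h / real L - h / real L * (1 / real q)) \<longlonglongrightarrow> h / real L - h / real L * 0"
  by (intro tendsto_intros lim_const_over_n)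
 moreover have "h / real L - h / real L * (1 / real q) <= part_entropy nu (refine nu Q0 (q * L)) / real (q * L)" if q: "q >= 1" for q
 proof -
  have "(real q - 1) * h / real (q * L) <= part_entropy nu (refine nu Q0 (q * L)) / real (q * L)"
   using entropy_nu_n[OF refl, of q] by (intro divide_right_mono) (auto simp: h_def)
  moreover have "(real q - 1) * h / real (q * L) = h / real L - h / real L * (1 / real q)"
   using q L by (simp add: field_simps)
  ultimately show ?thesis by simp
 qed
 ultimately have "h / real L - h / real L * 0 <= entropy_wrt nu Q0"
  by (intro LIMSEQ_le[OF _ lim2]) auto
 then show ?thesis by (simp add: h_def)
qed

end

lemma ext_integral_integrable:
 assumes "integrable M f" shows "ext_integral M f = ereal (\<integral>x. f x \<partial>M)"
proof -
 have p: "(\<integral>\<^sup>+x. ennreal (f x) \<partial>M) = ennreal (\<integral>x. max 0 (f x) \<partial>M)"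
  using assms by (subst nn_integral_eq_integral[symmetric]) (auto simp: ennreal_max_0 intro!: nn_integral_cong)
 have n: "(\<integral>\<^sup>+x. ennreal (- f x) \<partial>M) = ennreal (\<integral>x. max 0 (- f x) \<partial>M)"
  using assms by (subst nn_integral_eq_integral[symmetric]) (auto simp: ennreal_max_0 intro!: nn_integral_cong)
 have "(\<integral>x. f x \<partial>M) = (\<integral>x. max 0 (f x) - max 0 (- f x) \<partial>M)" by (rule Bochner_Integration.integral_cong) auto
 also have "... = (\<integral>x. max 0 (f x) \<partial>M) - (\<integral>x. max 0 (- f x) \<partial>M)" using assms by (intro Bochner_Integration.integral_diff) auto
 finally show ?thesis unfolding ext_integral_def p n by (simp add: enn2ereal_ennreal)
qed

context markov_shift
begin

text \<open>With weights proportional to \<open>exp (birkhoff f L x)\<close>, entropy plus energy of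
  the blocks is exactly the logarithm of their total weight, which exceeds \<open>L * q\<close>.
  Distortion costs one constant per block and becomes small when \<open>L\<close> is large.\<close>

theorem variational_lower_bound:
 assumes f: "wvar B f" "0 <= B" and q: "ereal q < gurevich_pressure E f a" and e: "\<epsilon> > 0"
 shows "\<exists>\<nu>. invariant_prob E \<nu> & ereal (q - \<epsilon>) <= ks_entropy \<nu> + ext_integral \<nu> f"
proof -
 define D where "D = B / (1 - \<theta>)"
 have D0: "0 <= D" using f theta by (simp add: D_def)
 obtain N :: nat where N: "real N > D / \<epsilon>" using reals_Archimedean2 by blast
 obtain L where L: "L >= N" "L >= 1" "ennreal (exp (real L * q)) < Zn E f a L"
  using limsup_eln_frequently[OF q[unfolded gurevich_pressure_def], of N] by blast
 \<comment> \<open>Finitely many periodic points are kept: they form a finite alphabet of blocks,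
   and the full sum might be infinite.\<close>
 have "Zn E f a L = (SUP F\<in>{F. finite F & F \<subseteq> {x : X. (shift ^^ L) x = x & x 0 = a}}. (\<Sum>x\<in>F. ennreal (exp (birkhoff f L x))))"
  unfolding Zn_def by (rule nonneg_infsum_complete) simp
 then obtain XX where XX: "finite XX" "XX \<subseteq> {x : X. (shift ^^ L) x = x & x 0 = a}"
  "ennreal (exp (real L * q)) < (\<Sum>x\<in>XX. ennreal (exp (birkhoff f L x)))"
  using L(3) by (auto simp: less_SUP_iff)
 define S where "S = (\<Sum>x\<in>XX. exp (birkhoff f L x))"
 have S: "exp (real L * q) < S"
  using XX(3) by (simp add: S_def sum_ennreal ennreal_less_iff)
 have S0: "0 < S" using S by (meson exp_gt_zero less_trans)
 define w where "w x = exp (birkhoff f L x) / S" for x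
 note L' = L
 interpret block_measure E \<theta> a L XX w
  by unfold_locales (use L XX S0 in \<open>auto simp: w_def S_def sum_divide_distrib[symmetric]\<close>)
 have w1: "(\<Sum>x\<in>XX. w x) = 1" by (rule w(2))
 have "real L * (\<integral>x. f x \<partial>nu) + (\<Sum>x\<in>XX. eta (w x)) >= (\<Sum>x\<in>XX. w x * birkhoff f L x + eta (w x)) - D"
  using integral_nu(2)[OF f] by (simp add: D_def sum.distrib)
 moreover have "(\<Sum>x\<in>XX. w x * birkhoff f L x + eta (w x)) = ln S"
 proof -
  have "w x * birkhoff f L x + eta (w x) = w x * ln S" for x
  proof -
   have "ln (w x) = birkhoff f L x - ln S" unfolding w_def using S0 by (simp add: ln_divide_pos)
   then show ?thesis by (simp add: eta_def right_diff_distrib)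
  qed
  then show ?thesis using w1 by (simp add: sum_distrib_right[symmetric])
 qed
 moreover have "ln S >= real L * q"
 proof -
  have "ln (exp (real L * q)) <= ln S" using S S0 by (subst ln_le_cancel_iff) auto
  then show ?thesis by simp
 qed
 ultimately have "real L * q - D <= real L * (\<integral>x. f x \<partial>nu) + (\<Sum>x\<in>XX. eta (w x))" by linarith
 then have "(real L * q - D) / real L <= (real L * (\<integral>x. f x \<partial>nu) + (\<Sum>x\<in>XX. eta (w x))) / real L"
  by (rule divide_right_mono) simp
 then have "q - D / real L <= (\<integral>x. f x \<partial>nu) + (\<Sum>x\<in>XX. eta (w x)) / real L"
  using L'(2) by (simp add: diff_divide_distrib add_divide_distrib)
 moreover have "D / real L <= \<epsilon>"
 proof -
  have "D / \<epsilon> < real L" using N L'(1) by linarith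
  then show ?thesis using e L'(2) by (simp add: field_simps)
 qed
 ultimately have main: "q - \<epsilon> <= entropy_wrt nu Q0 + (\<integral>x. f x \<partial>nu)" using entropy_nu by linarith
 have "ereal (entropy_wrt nu Q0) <= ks_entropy nu"
  unfolding ks_entropy_def by (rule SUP_upper) (simp add: Q0_partition)
 then have "ereal (entropy_wrt nu Q0) + ereal (\<integral>x. f x \<partial>nu) <= ks_entropy nu + ext_integral nu f"
  unfolding ext_integral_integrable[OF integral_nu(1)[OF f]] by (intro add_right_mono)
 moreover have "ereal (q - \<epsilon>) <= ereal (entropy_wrt nu Q0) + ereal (\<integral>x. f x \<partial>nu)" using main by simp
 ultimately show ?thesis using invariant_nu by (meson order_trans)
qed

end

section \<open>Equilibrium measures are invariant under the normalised transfer operator\<close>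

lemma ln_one_plus_lower: "0 <= t ==> t <= 1 ==> t - t\<^sup>2 <= ln (1 + t)" for t :: real
 by (rule ln_one_plus_pos_lower_bound)

context markov_shift
begin

text \<open>A Green function for a constant potential below minus the entropy converges
  geometrically. A constant potential has no distortion, so this function lies in the cone with
  constant 0 and depends on the first letter only. The series starts at \<open>N\<close>, where the
  growth bound holds.\<close>

lemma finite_entropy_superharmonic:
 assumes c: "gurevich_pressure E (%_. 0) c < \<infinity>"
 shows "\<exists>g H. 0 <= g & cone X 0 H & (\<forall>x. tr E (%_. 0 + - g) UNIV H x <= H x) & (\<forall>x\<in>X. H x ~= top & H x ~= 0)"
proof -
 obtain g0 :: nat where g0: "gurevich_pressure E (%_. 0) c < ereal (real g0)"
  using c less_PInf_Ex_of_nat[of "gurevich_pressure E (%_. 0) c"] by auto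
 define g where "g = real g0"
 have g: "limsup (%n. eln (Zn E (%_. 0) c n) / ereal (real n)) < ereal g"
  using g0 unfolding gurevich_pressure_def g_def by (rule less_le_trans) simp
 obtain N0 where N0: "!!n. n >= N0 ==> Zn E (%_. 0) c n <= ennreal (exp (real n * g))" using limsup_eln_lessD[OF g] by blast
 define N where "N = max N0 1"
 define f :: "(nat => 'a) => real" where "f = (%_. 0 + - (g + 1))"
 define I where "I y = (indicator {c} (y 0) :: ennreal)" for y :: "nat => 'a"
 define H where "H x = (\<Sum>n. (tr E f UNIV ^^ (n + N)) I x)" for x
 have fv: "wvar 0 f" by (simp add: wvar_def f_def)
 have Ic: "cone X 0 I" unfolding I_def[abs_def] by (rule cone_indicator)
 have Hc: "cone X 0 H"
  unfolding H_def[abs_def] by (intro cone_suminf cone_tr_funpow[OF fv Ic]) simp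
 have sup: "tr E f UNIV H x <= H x" for x
 proof -
  have "tr E f UNIV H x = (\<Sum>n. (tr E f UNIV ^^ (Suc n + N)) I x)" unfolding H_def[abs_def] tr_suminf by simp
  also have "... <= (tr E f UNIV ^^ (0 + N)) I x + ..." by simp
  also have "... = H x" unfolding H_def by (subst suminf_offset[of _ 1]) auto
  finally show ?thesis .
 qed
 obtain z p where z: "z : X" "z 0 = c" "p >= 1" "(shift ^^ p) z = z" using periodic_point_exists[of c] by blast
 have zk: "(shift ^^ (p * k)) z = z" for k
 proof (induction k)
  case (Suc k)
  have "(shift ^^ (p * Suc k)) z = (shift ^^ p) ((shift ^^ (p * k)) z)" by (simp add: funpow_add)
  then show ?case using Suc z by simp
 qed simp
 have termb: "(tr E f UNIV ^^ n) I z <= ennreal (exp (- 1) ^ n)" if n: "n >= N" for n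
 proof -
  have "(tr E f UNIV ^^ n) I z = ennreal (exp (real n * - (g + 1))) * (tr E (%_. 0) UNIV ^^ n) I z"
   unfolding f_def by (rule tr_funpow_add_const)
  also have "... <= ennreal (exp (real n * - (g + 1))) * ennreal (exp (real n * g))"
  proof (rule mult_left_mono)
   have "(tr E (%_. 0) UNIV ^^ n) I z <= ennreal (exp (0 / (1 - \<theta>))) * Zn E (%_. 0) c n"
    unfolding I_def[abs_def] using n by (intro tr_funpow_Zn(1) z wvar_const) (auto simp: N_def)
   also have "... <= ennreal (exp (real n * g))" using N0 n by (simp add: N_def)
   finally show "(tr E (%_. 0) UNIV ^^ n) I z <= ennreal (exp (real n * g))" .
  qed simp
  also have "ennreal (exp (real n * - (g + 1))) * ennreal (exp (real n * g)) = ennreal (exp (real n * - (g + 1) + real n * g))"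
   by (simp add: ennreal_mult[symmetric] exp_add)
  also have "real n * - (g + 1) + real n * g = real n * - 1" by (simp add: algebra_simps)
  also have "exp (real n * - 1) = exp (- 1) ^ n" by (rule exp_of_nat_mult)
  finally show ?thesis .
 qed
 have Hz: "H z ~= top"
 proof -
  have "H z <= (\<Sum>n. ennreal (exp (- 1) ^ (n + N)))" unfolding H_def by (intro suminf_le allI termb) auto
  also have "... = ennreal (\<Sum>n. exp (- 1) ^ (n + N))"
  proof (rule suminf_ennreal2)
   have "summable (%n. exp (- 1 :: real) ^ n)" by (intro summable_geometric) auto
   then show "summable (%n. exp (- 1 :: real) ^ (n + N))" by (rule summable_ignore_initial_segment)
  qed auto
  finally show ?thesis by (metis ennreal_neq_top top.extremum_uniqueI)
 qed
 have Hz0: "H z ~= 0"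
 proof -
  \<comment> \<open>A multiple of the period that is not smaller than \<open>N\<close> makes one
    term of the truncated series positive.\<close>
  have "(tr E f UNIV ^^ (p * N)) I ((shift ^^ (p * N)) z) ~= 0" using z by (intro tr_funpow_pos) (auto simp: I_def)
  then have pos: "(tr E f UNIV ^^ (p * N - N + N)) I z ~= 0" using zk z(3) by simp
  have "(tr E f UNIV ^^ (p * N - N + N)) I z <= H z"
   unfolding H_def using sum_le_suminf[of "%n. (tr E f UNIV ^^ (n + N)) I z" "{p * N - N}"] by simp
  then show ?thesis using pos by auto
 qed
 have Hfin: "H x ~= top & H x ~= 0" if "x : X" for x
  using superharmonic_finite[OF sup Hc z(1) Hz that] superharmonic_pos[OF sup Hc z(1) Hz0 that] by simp
 have "0 <= g + 1" by (simp add: g_def)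
 then show ?thesis using Hc sup Hfin unfolding f_def by blast
qed

end

section \<open>Integrability and maximality for an equilibrium measure\<close>

locale equilibrium_shift = spr_shift E \<theta> \<phi> a B P + markov_measure E \<theta> m
 for E :: "'a::countable => 'a => bool" and \<theta> \<phi> a B P m +
 assumes eqm: "equilibrium_measure E \<phi> m" and fin_ent: "\<exists>c. gurevich_pressure E (%_. 0) c < \<infinity>"
  and supfin: "bdd_above (\<phi> ` sigma_plus E)"
begin

text \<open>The upper bound for the constant potential \<open>- g\<close>, where the integral is
  known and only the entropy remains.\<close>

lemma entropy_bounded: "\<exists>c. \<forall>Q. finite_partition m Q --> entropy_wrt m Q <= c"
proof -
 obtain c where c: "gurevich_pressure E (%_. 0) c < \<infinity>" using fin_ent by blast
 obtain g H where H: "0 <= g" "cone X 0 H" "!!x. tr E (%_. 0 + - g) UNIV H x <= H x" "!!x. x : X ==> H x ~= top & H x ~= 0"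
  using finite_entropy_superharmonic[OF c] by blast
 have "entropy_wrt m Q <= g" if Q: "finite_partition m Q" for Q
 proof -
  have fv: "wvar 0 (%_. 0 + - g)" by (simp add: wvar_def)
  have "entropy_wrt m Q + (\<integral>x. 0 + - g \<partial>m) <= 0"
   by (rule variational_upper_bound[OF Q fv _ _ _ order_refl H(3) H(2) _ H(4)]) (use H(1) in auto)
  then show ?thesis by (simp add: prob_space)
 qed
 then show ?thesis by blast
qed

lemma pressure_le: "ereal P <= ks_entropy m + ext_integral m \<phi>"
proof (rule ereal_le_epsilon2)
 fix \<epsilon> :: real assume e: "\<epsilon> > 0"
 have "ereal (P - \<epsilon> / 2) < gurevich_pressure E \<phi> a" using press e by simp
 then obtain \<nu> where "invariant_prob E \<nu>" "ereal (P - \<epsilon> / 2 - \<epsilon> / 2) <= ks_entropy \<nu> + ext_integral \<nu> \<phi>"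
  using variational_lower_bound[OF phi, of "P - \<epsilon> / 2" a "\<epsilon> / 2"] e by auto
 then have "ereal (P - \<epsilon>) <= ks_entropy m + ext_integral m \<phi>"
  using eqm unfolding equilibrium_measure_def by (auto intro: order_trans)
 then have "ereal (P - \<epsilon>) + ereal \<epsilon> <= ks_entropy m + ext_integral m \<phi> + ereal \<epsilon>" by (rule add_right_mono)
 then show "ereal P <= ks_entropy m + ext_integral m \<phi> + ereal \<epsilon>" by simp
qed

definition Ku :: real where "Ku = max 0 (SUP x\<in>X. \<phi> x)"

lemma phi_le: "x : X ==> \<phi> x <= Ku" "0 <= Ku"
proof -
 show "x : X ==> \<phi> x <= Ku" unfolding Ku_def using supfin by (intro order_trans[OF cSUP_upper max.cobounded2]) auto
qed (simp add: Ku_def)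

lemma phi_measurable: "\<phi> : borel_measurable m"
 unfolding measurable_m by (rule wvar_measurable[OF phi(1)])

lemma ks_le: "(!!Q. finite_partition m Q ==> entropy_wrt m Q <= c) ==> ks_entropy m <= ereal c"
 unfolding ks_entropy_def by (intro SUP_least) auto

text \<open>The positive part is bounded. An infinite negative part would make entropy plus integral
  equal to \<open>-\<infinity>\<close>, as the entropy is bounded, but that sum is at least
  \<open>P\<close>.\<close>

lemma phi_integrable: "integrable m \<phi>"
proof -
 have [measurable]: "\<phi> : borel_measurable m" by (rule phi_measurable)
 obtain c where c: "ks_entropy m <= ereal c" using entropy_bounded ks_le by blast
 have p: "(\<integral>\<^sup>+x. ennreal (\<phi> x) \<partial>m) < top"
 proof -
  have "(\<integral>\<^sup>+x. ennreal (\<phi> x) \<partial>m) <= (\<integral>\<^sup>+x. ennreal Ku \<partial>m)"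
   using phi_le by (intro nn_integral_mono ennreal_leI) auto
  also have "... < top" using emeasure_space_1 by simp
  finally show ?thesis .
 qed
 have n: "(\<integral>\<^sup>+x. ennreal (- \<phi> x) \<partial>m) < top"
 proof (rule ccontr)
  assume "\<not> (\<integral>\<^sup>+x. ennreal (- \<phi> x) \<partial>m) < top"
  then have "(\<integral>\<^sup>+x. ennreal (- \<phi> x) \<partial>m) = top" using top.not_eq_extremum by blast
  moreover obtain r where "(\<integral>\<^sup>+x. ennreal (\<phi> x) \<partial>m) = ennreal r" "0 <= r" using p by (metis ennreal_cases less_irrefl)
  ultimately have "ext_integral m \<phi> = - \<infinity>" by (simp add: ext_integral_def enn2ereal_ennreal)
  then have e: "ks_entropy m + ext_integral m \<phi> = - \<infinity>" using c by (cases "ks_entropy m") auto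
  have "ereal P <= - \<infinity>" using pressure_le unfolding e .
  then show False by simp
 qed
 show ?thesis by (rule real_integrable_def[THEN iffD2]) (use p n in auto)
qed

text \<open>The upper bound applied to any potential with a positive superharmonic function, against
 the maximality of \<open>m\<close>.\<close>

lemma equilibrium_inequality:
 assumes f: "wvar Bf f" "0 <= Bf" "integrable m f" "!!x. x : X ==> f x <= K" "0 <= K"
  and H: "!!x. x : X ==> tr E f UNIV H x <= H x" "cone X D H" "0 <= D" "!!x. x : X ==> H x ~= top & H x ~= 0"
 shows "P + (\<integral>x. f x \<partial>m) <= (\<integral>x. \<phi> x \<partial>m)"
proof -
 have "ks_entropy m <= ereal (- (\<integral>x. f x \<partial>m))"
 proof (rule ks_le)
  fix Q assume "finite_partition m Q"
  from variational_upper_bound[OF this f H] show "entropy_wrt m Q <= - (\<integral>x. f x \<partial>m)" by linarith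
 qed
 then have "ereal P <= ereal (- (\<integral>x. f x \<partial>m)) + ereal (\<integral>x. \<phi> x \<partial>m)"
  using pressure_le unfolding ext_integral_integrable[OF phi_integrable] by (meson add_right_mono order_trans)
 then show ?thesis by simp
qed

end

section \<open>The normalised Markov operator\<close>

locale normalised_shift = equilibrium_shift E \<theta> \<phi> a B P m
 for E :: "'a::countable => 'a => bool" and \<theta> \<phi> a B P m +
 fixes h :: "(nat => 'a) => real" and D :: real
 assumes hpos: "!!x. x : sigma_plus E ==> h x > 0" and D0: "0 <= D" and hcone: "cone X D (%x. ennreal (h x))"
  and hharm: "!!x. x : sigma_plus E ==> tr E f0 UNIV (%x. ennreal (h x)) x = ennreal (h x)"
  and hLb: "!!x. x : sigma_plus E ==> Lb f0 a (%x. ennreal (h x)) x = ennreal (h x)"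
begin

text \<open>Cohomologous to \<open>f0\<close> and chosen so that the weights \<open>exp lg\<close>
  over the preimages of any point sum to 1. They are the transition probabilities of a walk
  backwards in time.\<close>

definition lg :: "(nat => 'a) => real" where "lg x = f0 x + ln (h x) + - ln (h (shift x))"

definition Ag :: real where "Ag = B + D + D / \<theta>"

lemma Ag: "0 <= Ag" using phi(2) D0 theta by (simp add: Ag_def)

lemma wvar_lg: "wvar Ag lg"
 unfolding lg_def[abs_def] Ag_def
 by (intro wvar_add wvar_f0 wvar_ln[OF hcone hpos] wvar_ln_shift[OF hcone hpos])

lemma tr_lg: "x : X ==> tr E lg S u x = ennreal (1 / h x) * tr E f0 S (%y. ennreal (h y) * u y) x"
proof -
 assume x: "x : X"
 have "ennreal (exp (lg (case_nat b x))) * u (case_nat b x) =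
   ennreal (1 / h x) * (ennreal (exp (f0 (case_nat b x))) * (ennreal (h (case_nat b x)) * u (case_nat b x)))"
  if b: "E b (x 0)" for b
 proof -
  have hb: "h (case_nat b x) > 0" "h x > 0" using hpos x b by auto
  have "exp (lg (case_nat b x)) = 1 / h x * (exp (f0 (case_nat b x)) * h (case_nat b x))"
   by (simp only: lg_def exp_add exp_minus shift_case_nat exp_ln[OF hb(1)] exp_ln[OF hb(2)]) (simp add: divide_inverse ac_simps)
  then have "ennreal (exp (lg (case_nat b x))) = ennreal (1 / h x) * (ennreal (exp (f0 (case_nat b x))) * ennreal (h (case_nat b x)))"
   using hb by (simp only:, subst ennreal_mult) (auto simp: ennreal_mult less_imp_le)
  then show ?thesis by (simp add: ac_simps)
 qed
 then show ?thesis unfolding tr_def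
  by (subst nn_integral_cmult[symmetric]) (auto intro!: nn_integral_cong)
qed

lemma h_inv: "x : X ==> ennreal (h x) * ennreal (1 / h x) = 1"
 using hpos[of x] by (subst ennreal_mult[symmetric]) (auto intro: less_imp_le)

lemma tr_lg_funpow: "x : X ==> (tr E lg S ^^ k) u x = ennreal (1 / h x) * (tr E f0 S ^^ k) (%y. ennreal (h y) * u y) x"
proof (induction k arbitrary: x)
 case 0
 have "ennreal (1 / h x) * (ennreal (h x) * u x) = (ennreal (h x) * ennreal (1 / h x)) * u x" by (simp add: ac_simps)
 then show ?case using h_inv[OF 0] by simp
next
 case (Suc k)
 have "(tr E lg S ^^ Suc k) u x = ennreal (1 / h x) * tr E f0 S (%y. ennreal (h y) * (tr E lg S ^^ k) u y) x"
  using tr_lg[OF Suc.prems] by simp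
 also have "tr E f0 S (%y. ennreal (h y) * (tr E lg S ^^ k) u y) x = tr E f0 S ((tr E f0 S ^^ k) (%y. ennreal (h y) * u y)) x"
 proof (rule tr_cong[OF _ Suc.prems])
  fix y assume y: "y : X"
  have "ennreal (h y) * (tr E lg S ^^ k) u y = (ennreal (h y) * ennreal (1 / h y)) * (tr E f0 S ^^ k) (%y. ennreal (h y) * u y) y"
   using Suc.IH[OF y] by (simp add: mult.assoc)
  then show "ennreal (h y) * (tr E lg S ^^ k) u y = (tr E f0 S ^^ k) (%y. ennreal (h y) * u y) y" using h_inv[OF y] by simp
 qed
 finally show ?case by simp
qed

lemma tr_lg_1: "x : X ==> tr E lg UNIV (%_. 1) x = 1"
 using tr_lg[of x UNIV "%_. 1"] hharm[of x] h_inv[of x] by (simp add: mult.commute)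

lemma excursion_lg: "x : X ==> (tr E lg (- {a}) ^^ k) (tr E lg {a} u) x =
  ennreal (1 / h x) * (tr E f0 (- {a}) ^^ k) (tr E f0 {a} (%y. ennreal (h y) * u y)) x"
proof -
 assume x: "x : X"
 have "(tr E f0 (- {a}) ^^ k) (%y. ennreal (h y) * tr E lg {a} u y) x = (tr E f0 (- {a}) ^^ k) (tr E f0 {a} (%y. ennreal (h y) * u y)) x"
 proof (rule tr_funpow_cong[OF _ x])
  fix y assume y: "y : X"
  have "ennreal (h y) * tr E lg {a} u y = (ennreal (h y) * ennreal (1 / h y)) * tr E f0 {a} (%y. ennreal (h y) * u y) y"
   using tr_lg[OF y] by (simp add: mult.assoc)
  then show "ennreal (h y) * tr E lg {a} u y = tr E f0 {a} (%y. ennreal (h y) * u y) y" using h_inv[OF y] by simp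
 qed
 then show ?thesis using tr_lg_funpow[OF x] by simp
qed

text \<open>Recurrence of the backward walk: it reaches \<open>a\<close> with probability one from
  every point. This is the eigenvalue equation of the induced operator divided by
  \<open>h\<close>.\<close>

lemma Lb_lg_1: "x : X ==> Lb lg a (%_. 1) x = 1"
proof -
 assume x: "x : X"
 have "Lb lg a (%_. 1) x = (\<Sum>k. ennreal (1 / h x) * (tr E f0 (- {a}) ^^ k) (tr E f0 {a} (%y. ennreal (h y) * 1)) x)"
  unfolding Lb_def G_def using excursion_lg[OF x] by simp
 also have "... = ennreal (1 / h x) * Lb f0 a (%x. ennreal (h x)) x"
  unfolding ennreal_suminf_cmult Lb_sum by simp
 also have "... = 1" using hLb[OF x] h_inv[OF x] by (simp add: mult.commute)
 finally show ?thesis .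
qed

text \<open>On one cylinder \<open>h\<close> varies by a factor of at most \<open>exp D\<close>, so
  the tail estimate for \<open>f0\<close> survives the normalisation there.\<close>

lemma excursion_tail:
 "\<exists>C \<rho>. 0 < C & 0 < \<rho> & \<rho> < 1 & (\<forall>k. \<forall>x\<in>V a. (tr E lg (- {a}) ^^ k) (tr E lg {a} (%_. 1)) x <= ennreal (C * \<rho> ^ k))"
proof -
 obtain C \<rho> where t: "0 < C" "0 < \<rho>" "\<rho> < 1" "!!k x. x : V a ==> b k x <= ennreal (C * \<rho> ^ k)" using b_tail by blast
 have "(tr E lg (- {a}) ^^ k) (tr E lg {a} (%_. 1)) x <= ennreal (exp D * C * \<rho> ^ k)" if x: "x : V a" for k x
 proof -
  have xX: "x : X" using x by simp
  have hV: "ennreal (h y) <= ennreal (exp D) * ennreal (h x)" if "y : V a" for y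
   using cone_V_bounds[OF cone_subset[OF hcone] that x D0] by auto
  have "(tr E f0 (- {a}) ^^ k) (tr E f0 {a} (%y. ennreal (h y) * 1)) x \<le>
   (tr E f0 (- {a}) ^^ k) (%x'. (ennreal (exp D) * ennreal (h x)) * tr E f0 {a} (%_. 1) x') x"
   unfolding tr_cmult[symmetric]
  proof (rule tr_funpow_mono[OF _ xX])
   fix y assume "y : X"
   then show "tr E f0 {a} (%y. ennreal (h y) * 1) y <= tr E f0 {a} (%y. ennreal (exp D) * ennreal (h x) * 1) y"
    using hV by (intro tr_mono) auto
  qed
  also have "... = (ennreal (exp D) * ennreal (h x)) * b k x" unfolding tr_funpow_cmult b_def ..
  also have "... <= (ennreal (exp D) * ennreal (h x)) * ennreal (C * \<rho> ^ k)" using t(4)[OF x] by (intro mult_left_mono) auto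
  finally have "(tr E lg (- {a}) ^^ k) (tr E lg {a} (%_. 1)) x <= ennreal (1 / h x) * ((ennreal (exp D) * ennreal (h x)) * ennreal (C * \<rho> ^ k))"
   unfolding excursion_lg[OF xX] by (rule mult_left_mono) simp
  also have "... = (ennreal (h x) * ennreal (1 / h x)) * (ennreal (exp D) * ennreal (C * \<rho> ^ k))" by (simp add: ac_simps)
  also have "... = ennreal (exp D * C * \<rho> ^ k)" using h_inv[OF xX] t by (simp add: ennreal_mult mult.assoc)
  finally show ?thesis .
 qed
 then show ?thesis using t by (intro exI[of _ "exp D * C"] exI[of _ \<rho>]) auto
qed

lemma lg_measurable: "lg : borel_measurable m"
 unfolding measurable_m by (rule wvar_measurable[OF wvar_lg])

lemma tr_lg_measurable: "u : borel_measurable m ==> tr E lg S u : borel_measurable m"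
 using lg_measurable unfolding measurable_m by (rule tr_measurable)

text \<open>For \<open>F = 1 + s u\<close> the potential \<open>f0 + ln F - ln (L F) \<circ> shift\<close> has the same positive
 harmonic function, so maximality of \<open>m\<close> gives \<open>\<integral> ln F <= \<integral> ln (L F)\<close>; now let \<open>s\<close> tend to \<open>0\<close>.\<close>

lemma integral_le_tr:
 assumes u: "!!x. x : X ==> 0 <= u x & u x <= 1" and Cu: "0 <= Cu"
  and lip: "!!n x y. n >= 1 ==> x : X ==> y : X ==> agree n x y ==> \<bar>u x - u y\<bar> <= Cu * \<theta> ^ n"
 shows "(\<integral>\<^sup>+x. ennreal (u x) \<partial>m) <= (\<integral>\<^sup>+x. tr E lg UNIV (%x. ennreal (u x)) x \<partial>m)"
proof -
 have um [measurable]: "u : borel_measurable m"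
  unfolding measurable_m by (rule wvar_measurable[of Cu]) (use lip in \<open>auto simp: wvar_def\<close>)
 define w where "w x = enn2real (tr E lg UNIV (%x. ennreal (u x)) x)" for x
 have tru1: "tr E lg UNIV (%x. ennreal (u x)) x <= 1" if x: "x : X" for x
 proof -
  have "tr E lg UNIV (%x. ennreal (u x)) x <= tr E lg UNIV (%_. 1) x"
   using u x by (intro tr_mono) (auto simp flip: ennreal_1 intro!: ennreal_leI)
  then show ?thesis using tr_lg_1[OF x] by simp
 qed
 have w: "tr E lg UNIV (%x. ennreal (u x)) x = ennreal (w x)" "0 <= w x" "w x <= 1" if x: "x : X" for x
 proof -
  have "tr E lg UNIV (%x. ennreal (u x)) x < top" using tru1[OF x] by (rule le_less_trans) simp
  then show "tr E lg UNIV (%x. ennreal (u x)) x = ennreal (w x)" by (simp add: w_def)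
  show "w x <= 1" unfolding w_def using tru1[OF x] by (intro enn2real_leI) auto
 qed (simp add: w_def)
 have wm [measurable]: "w : borel_measurable m"
  unfolding w_def[abs_def] using tr_lg_measurable[of "%x. ennreal (u x)" UNIV] by measurable
 have ui: "integrable m u" using u by (intro integrable_const_bound[of _ 1]) auto
 have wi: "integrable m w" using w by (intro integrable_const_bound[of _ 1]) auto
 have main: "(\<integral>x. u x \<partial>m) - s <= (\<integral>x. w x \<partial>m)" if s: "0 < s" "s <= 1" for s
 proof -
  define F where "F x = 1 + s * u x" for x
  define LF where "LF x = 1 + s * w x" for x
  have F1: "1 <= F x" "F x <= 2" if "x : X" for x
   using u[OF that] s mult_le_one[of s "u x"] by (auto simp: F_def)
  have LF1: "1 <= LF x" "LF x <= 2" if "x : X" for x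
   using w[OF that] s mult_le_one[of s "w x"] by (auto simp: LF_def)
  have trF: "tr E lg UNIV (%x. ennreal (F x)) x = ennreal (LF x)" if x: "x : X" for x
  proof -
   have "tr E lg UNIV (%x. ennreal (F x)) x = tr E lg UNIV (%x. 1 + ennreal s * ennreal (u x)) x"
    using x u s by (intro tr_cong) (auto simp: F_def ennreal_mult)
   also have "... = 1 + ennreal s * ennreal (w x)"
    unfolding tr_add tr_cmult using tr_lg_1[OF x] w[OF x] by simp
   finally show ?thesis using s w[OF x] by (simp add: LF_def ennreal_mult)
  qed
  \<comment> \<open>\<open>F >= 1\<close> turns the additive Hoelder bound for \<open>u\<close> into
    a multiplicative one.\<close>
  have Fc: "cone X Cu (%x. ennreal (F x))"
  proof (rule coneI)
   fix n x y assume n: "1 <= n" "x : X" "y : X" "agree n x y"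
   have "F x <= F y + s * (Cu * \<theta> ^ n)"
    using mult_left_mono[of "u x - u y" "Cu * \<theta> ^ n" s] lip[OF n] s by (simp add: F_def algebra_simps)
   also have "... <= F y + Cu * \<theta> ^ n * F y"
   proof -
    have c: "0 <= Cu * \<theta> ^ n" using Cu theta_pow(1)[of n] by simp
    have "s * (Cu * \<theta> ^ n) <= Cu * \<theta> ^ n" using s c by (intro mult_left_le_one_le) auto
    also have "... <= Cu * \<theta> ^ n * F y" using mult_left_mono[OF F1(1)[OF n(3)] c] by simp
    finally show ?thesis by simp
   qed
   also have "... = (1 + Cu * \<theta> ^ n) * F y" by (simp add: distrib_right)
   also have "... <= exp (Cu * \<theta> ^ n) * F y"
    using F1(1)[OF n(3)] by (intro mult_right_mono exp_ge_add_one_self) auto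
   finally show "ennreal (F x) <= ennreal (exp (Cu * \<theta> ^ n)) * ennreal (F y)"
    using F1(1)[OF n(3)] by (simp add: ennreal_mult[symmetric] ennreal_leI)
  qed
  have "cone X (\<theta> * (Ag + Cu)) (tr E lg UNIV (%x. ennreal (F x)))" by (rule cone_tr[OF wvar_lg Fc]) auto
  then have LFc: "cone X (\<theta> * (Ag + Cu)) (%x. ennreal (LF x))" by (rule cone_cong) (simp add: trF)
  have Fp: "0 < F x" and LFp: "0 < LF x" if "x : X" for x using F1[OF that] LF1[OF that] by linarith+
  define f where "f x = f0 x + ln (F x) + - ln (LF (shift x))" for x
  have fv: "wvar (B + Cu + \<theta> * (Ag + Cu) / \<theta>) f"
   unfolding f_def[abs_def] by (intro wvar_add wvar_f0 wvar_ln[OF Fc Fp] wvar_ln_shift[OF LFc LFp])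
  have Fm: "F : borel_measurable m" "LF : borel_measurable m" unfolding F_def[abs_def] LF_def[abs_def] by measurable
  have lnF: "integrable m (%x. ln (F x))"
  proof (rule integrable_const_bound[of _ 1])
   have "0 <= ln (F x) & ln (F x) <= 1" if "x : X" for x
    using F1[OF that] ln_le_minus_one[of "F x"] by auto
   then show "AE x in m. norm (ln (F x)) <= 1" by (intro AE_I2) auto
  qed (use Fm in measurable)
  have lnLF: "integrable m (%x. ln (LF x))"
  proof (rule integrable_const_bound[of _ 1])
   have "0 <= ln (LF x) & ln (LF x) <= 1" if "x : X" for x
    using LF1[OF that] ln_le_minus_one[of "LF x"] by auto
   then show "AE x in m. norm (ln (LF x)) <= 1" by (intro AE_I2) auto
  qed (use Fm in measurable)
  have lnLFs: "integrable m (%x. ln (LF (shift x)))" "(\<integral>x. ln (LF (shift x)) \<partial>m) = (\<integral>x. ln (LF x) \<partial>m)"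
   using integrable_funpow_shift[OF lnLF, of 1] integral_funpow_shift[OF borel_measurable_integrable[OF lnLF], of 1] by auto
  have f0i: "integrable m f0" unfolding f0_def[abs_def] using phi_integrable by auto
  have fi: "integrable m f" unfolding f_def[abs_def] using f0i lnF lnLFs(1) by auto
  have "P + (\<integral>x. f x \<partial>m) <= (\<integral>x. \<phi> x \<partial>m)"
  proof (rule equilibrium_inequality[OF fv _ fi, where H="%x. ennreal (h x)" and D=D and K="Ku + \<bar>P\<bar> + 1"])
   show "0 <= B + Cu + \<theta> * (Ag + Cu) / \<theta>" using phi(2) Cu Ag theta by simp
   show "f x <= Ku + \<bar>P\<bar> + 1" if x: "x : X" for x
   proof -
    have "ln (F x) <= 1" using F1[OF x] ln_le_minus_one[of "F x"] by auto
    moreover have "0 <= ln (LF (shift x))" using LF1(1)[of "shift x"] x by (intro ln_ge_zero) auto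
    moreover have "f0 x <= Ku + \<bar>P\<bar>" using phi_le(1)[OF x] unfolding f0_def by linarith
    ultimately show ?thesis unfolding f_def by linarith
   qed
   show "0 <= Ku + \<bar>P\<bar> + 1" using phi_le(2) by simp
   show "ennreal (h x) ~= top & ennreal (h x) ~= 0" if "x : X" for x using hpos[OF that] by (simp add: ennreal_eq_0_iff)
   \<comment> \<open>The factor \<open>F\<close> enters under the operator, where normalisation
     gives \<open>h * LF\<close>; the factor \<open>1 / LF\<close>, constant over the preimages of
     \<open>x\<close>, restores \<open>h\<close> exactly.\<close>
   show "tr E f UNIV (%x. ennreal (h x)) x <= ennreal (h x)" if x: "x : X" for x
   proof -
    have "tr E f UNIV (%x. ennreal (h x)) x = ennreal (1 / LF x) * tr E f0 UNIV (%y. ennreal (h y) * ennreal (F y)) x"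
    proof -
     have "ennreal (exp (f (case_nat b x))) * ennreal (h (case_nat b x)) =
       ennreal (1 / LF x) * (ennreal (exp (f0 (case_nat b x))) * (ennreal (h (case_nat b x)) * ennreal (F (case_nat b x))))"
      if b: "E b (x 0)" for b
     proof -
      have p: "0 < F (case_nat b x)" "0 < LF x" "0 < h (case_nat b x)" using Fp LFp hpos x b by auto
      have "exp (f (case_nat b x)) = 1 / LF x * (exp (f0 (case_nat b x)) * F (case_nat b x))"
       by (simp only: f_def exp_add exp_minus shift_case_nat exp_ln[OF p(1)] exp_ln[OF p(2)]) (simp add: divide_inverse ac_simps)
      then have "ennreal (exp (f (case_nat b x))) = ennreal (1 / LF x) * (ennreal (exp (f0 (case_nat b x))) * ennreal (F (case_nat b x)))"
       using p by (simp only:, subst ennreal_mult) (auto simp: ennreal_mult less_imp_le)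
      then show ?thesis by (simp add: ac_simps)
     qed
     then show ?thesis unfolding tr_def
      by (subst nn_integral_cmult[symmetric]) (auto intro!: nn_integral_cong)
    qed
    also have "tr E f0 UNIV (%y. ennreal (h y) * ennreal (F y)) x = (ennreal (h x) * ennreal (1 / h x)) * tr E f0 UNIV (%y. ennreal (h y) * ennreal (F y)) x"
     using h_inv[OF x] by simp
    also have "... = ennreal (h x) * ennreal (LF x)"
     unfolding mult.assoc tr_lg[OF x, symmetric] trF[OF x] ..
    also have "ennreal (1 / LF x) * (ennreal (h x) * ennreal (LF x)) = ennreal (h x)"
     using LFp[OF x] hpos[OF x] by (simp add: ennreal_mult[symmetric] less_imp_le)
    finally show ?thesis by simp
   qed
  qed (use hcone D0 in auto)
  moreover have "(\<integral>x. f x \<partial>m) = (\<integral>x. \<phi> x \<partial>m) - P + (\<integral>x. ln (F x) \<partial>m) - (\<integral>x. ln (LF x) \<partial>m)"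
   unfolding f_def using f0i lnF lnLFs phi_integrable by (simp add: f0_def[abs_def] prob_space)
  ultimately have ln_le: "(\<integral>x. ln (F x) \<partial>m) <= (\<integral>x. ln (LF x) \<partial>m)" by linarith
  \<comment> \<open>The first-order terms of the two logarithms are \<open>s * u\<close> and
    \<open>s * w\<close>; the quadratic error leaves an error \<open>s\<close> after division by
    \<open>s\<close>.\<close>
  have "(\<integral>x. s * u x - s\<^sup>2 \<partial>m) <= (\<integral>x. ln (F x) \<partial>m)"
  proof (rule integral_mono[OF _ lnF])
   show "integrable m (%x. s * u x - s\<^sup>2)" using ui by auto
   fix x assume "x : space m"
   then have x: "x : X" by simp
   have su: "0 <= s * u x" "s * u x <= 1" using u[OF x] s by (auto intro: mult_le_one)
   have "(s * u x)\<^sup>2 <= s\<^sup>2" using u[OF x] s by (intro power_mono) (auto intro: mult_left_le)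
   then show "s * u x - s\<^sup>2 <= ln (F x)" using ln_one_plus_lower[OF su] by (simp add: F_def)
  qed
  also have "... <= (\<integral>x. ln (LF x) \<partial>m)" by (rule ln_le)
  also have "... <= (\<integral>x. s * w x \<partial>m)"
  proof (rule integral_mono[OF lnLF])
   show "integrable m (%x. s * w x)" using wi by auto
   show "ln (LF x) <= s * w x" if "x : space m" for x
    using ln_le_minus_one[of "LF x"] LFp that by (simp add: LF_def)
  qed
  finally have "s * (\<integral>x. u x \<partial>m) - s\<^sup>2 <= s * (\<integral>x. w x \<partial>m)" using ui wi by (simp add: prob_space)
  then have "s * ((\<integral>x. u x \<partial>m) - s) <= s * (\<integral>x. w x \<partial>m)" by (simp add: right_diff_distrib power2_eq_square)
  then show ?thesis using s by simp
 qed
 have "(\<integral>x. u x \<partial>m) <= (\<integral>x. w x \<partial>m)"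
 proof (rule field_le_epsilon)
  fix e :: real assume "0 < e"
  then have "(\<integral>x. u x \<partial>m) - min e 1 <= (\<integral>x. w x \<partial>m)" by (intro main) auto
  then show "(\<integral>x. u x \<partial>m) <= (\<integral>x. w x \<partial>m) + e" by linarith
 qed
 moreover have "(\<integral>\<^sup>+x. ennreal (u x) \<partial>m) = ennreal (\<integral>x. u x \<partial>m)" using ui u by (intro nn_integral_eq_integral) auto
 moreover have "(\<integral>\<^sup>+x. tr E lg UNIV (%x. ennreal (u x)) x \<partial>m) = (\<integral>\<^sup>+x. ennreal (w x) \<partial>m)"
  using w by (intro nn_integral_cong) auto
 moreover have "(\<integral>\<^sup>+x. ennreal (w x) \<partial>m) = ennreal (\<integral>x. w x \<partial>m)" using wi w by (intro nn_integral_eq_integral) auto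
 ultimately show ?thesis by (simp add: ennreal_leI)
qed

text \<open>The inequality holds for the indicator of the cylinder and for that of its complement.
  Since \<open>T 1 = 1\<close>, both sides add up to 1 over the two sets, so each inequality is an
  equality.\<close>

lemma emeasure_tr_cylinder:
 "(\<integral>\<^sup>+x. tr E lg UNIV (indicator {x : X. \<forall>i<n. x i = v i}) x \<partial>m) = emeasure m {x : X. \<forall>i<n. x i = v i}"
proof -
 define A where "A = {x : X. \<forall>i<n. x i = v i}"
 have As: "A : sets m" unfolding A_def sets_m by (rule cylinder_in_sets)
 define u :: "(nat => 'a) => real" where "u = indicator A"
 \<comment> \<open>The constant only has to dominate the jump that occurs when fewer than
   \<open>n\<close> letters agree.\<close>
 have lip: "\<bar>u x - u y\<bar> <= 1 / \<theta> ^ n * \<theta> ^ k" if k: "k >= 1" "x : X" "y : X" "agree k x y" for k x y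
 proof (cases "n <= k")
  case True
  then have "x : A \<longleftrightarrow> y : A" using k by (auto simp: A_def agree_def)
  then have "\<bar>u x - u y\<bar> = 0" by (simp add: u_def indicator_def)
  then show ?thesis using theta by simp
 next
  case False
  then have "\<theta> ^ n <= \<theta> ^ k" using theta by (intro power_decreasing) auto
  then have "1 <= 1 / \<theta> ^ n * \<theta> ^ k" using theta_pow(1)[of n] by (simp add: field_simps)
  moreover have "\<bar>u x - u y\<bar> <= 1" by (simp add: u_def indicator_def)
  ultimately show ?thesis by linarith
 qed
 have C0: "0 <= 1 / \<theta> ^ n" using theta by simp
 have ei: "ennreal (u x) = indicator A x" for x by (simp add: u_def indicator_def)
 have 1: "emeasure m A <= (\<integral>\<^sup>+x. tr E lg UNIV (indicator A) x \<partial>m)"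
  using integral_le_tr[of u "1 / \<theta> ^ n", OF _ C0 lip] As unfolding ei by (simp add: u_def)
 have lip': "\<bar>(1 - u x) - (1 - u y)\<bar> <= 1 / \<theta> ^ n * \<theta> ^ k" if "k >= 1" "x : X" "y : X" "agree k x y" for k x y
  using lip[OF that] by (simp add: abs_minus_commute)
 have ei': "ennreal (1 - u x) = indicator (X - A) x" if "x : X" for x using that by (simp add: u_def indicator_def)
 have "(\<integral>\<^sup>+x. ennreal (1 - u x) \<partial>m) <= (\<integral>\<^sup>+x. tr E lg UNIV (%x. ennreal (1 - u x)) x \<partial>m)"
  by (rule integral_le_tr[OF _ C0 lip']) (auto simp: u_def indicator_def)
 moreover have "(\<integral>\<^sup>+x. ennreal (1 - u x) \<partial>m) = emeasure m (X - A)"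
 proof -
  have "(\<integral>\<^sup>+x. ennreal (1 - u x) \<partial>m) = (\<integral>\<^sup>+x. indicator (X - A) x \<partial>m)" by (intro nn_integral_cong) (simp add: ei')
  then show ?thesis using As sets.compl_sets[OF As] by simp
 qed
 moreover have "(\<integral>\<^sup>+x. tr E lg UNIV (%x. ennreal (1 - u x)) x \<partial>m) = (\<integral>\<^sup>+x. tr E lg UNIV (indicator (X - A)) x \<partial>m)"
  by (intro nn_integral_cong tr_cong) (auto simp: ei')
 ultimately have 2: "emeasure m (X - A) <= (\<integral>\<^sup>+x. tr E lg UNIV (indicator (X - A)) x \<partial>m)" by simp
 have sum1: "(\<integral>\<^sup>+x. tr E lg UNIV (indicator A) x \<partial>m) + (\<integral>\<^sup>+x. tr E lg UNIV (indicator (X - A)) x \<partial>m) = 1"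
 proof -
  have [measurable]: "tr E lg UNIV (indicator A) : borel_measurable m" "tr E lg UNIV (indicator (X - A)) : borel_measurable m"
   using As sets.compl_sets[OF As] by (auto intro!: tr_lg_measurable)
  have "(\<integral>\<^sup>+x. tr E lg UNIV (indicator A) x \<partial>m) + (\<integral>\<^sup>+x. tr E lg UNIV (indicator (X - A)) x \<partial>m) =
    (\<integral>\<^sup>+x. tr E lg UNIV (indicator A) x + tr E lg UNIV (indicator (X - A)) x \<partial>m)"
   by (rule nn_integral_add[symmetric]) auto
  also have "... = (\<integral>\<^sup>+x. 1 \<partial>m)"
  proof (rule nn_integral_cong)
   fix x assume "x : space m"
   then have x: "x : X" by simp
   have "tr E lg UNIV (indicator A) x + tr E lg UNIV (indicator (X - A)) x = tr E lg UNIV (%_. 1) x"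
    unfolding tr_add[symmetric] using x by (intro tr_cong) (auto simp: indicator_def)
   then show "tr E lg UNIV (indicator A) x + tr E lg UNIV (indicator (X - A)) x = 1" using tr_lg_1[OF x] by simp
  qed
  finally show ?thesis using emeasure_space_1 by simp
 qed
 have sum2: "emeasure m A + emeasure m (X - A) = 1"
  using emeasure_compl[OF As] emeasure_space_1 As prob_le_1[of A]
  by (simp add: emeasure_eq_measure prob_compl[OF As, simplified] ennreal_plus[symmetric] del: ennreal_plus)
 have "(\<integral>\<^sup>+x. tr E lg UNIV (indicator A) x \<partial>m) <= emeasure m A"
 proof -
  have "emeasure m (X - A) + (\<integral>\<^sup>+x. tr E lg UNIV (indicator A) x \<partial>m) \<le>
    (\<integral>\<^sup>+x. tr E lg UNIV (indicator (X - A)) x \<partial>m) + (\<integral>\<^sup>+x. tr E lg UNIV (indicator A) x \<partial>m)"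
   by (rule add_right_mono[OF 2])
  also have "... = emeasure m (X - A) + emeasure m A" using sum1 sum2 by (simp add: add.commute)
  finally show ?thesis by (simp add: ennreal_add_left_cancel_le emeasure_eq_measure)
 qed
 then show ?thesis using 1 unfolding A_def by (rule antisym)
qed

lemma emeasure_tr:
 assumes "A : sets m"
 shows "(\<integral>\<^sup>+x. tr E lg UNIV (indicator A) x \<partial>m) = emeasure m A"
proof -
 \<comment> \<open>The empty set is added because two cylinders may be disjoint, and the generator
   has to be closed under intersection.\<close>
 define Gn where "Gn = insert {} {{x : X. \<forall>i<n. x i = v i} |n v. True}"
 have "A : sigma_sets X {{x : X. \<forall>i<n. x i = v i} |n v. True}"
  using assms unfolding sets_m shift_space_def by (subst (asm) sets_measure_of) auto
 then have A: "A : sigma_sets X Gn"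
  using sigma_sets_mono'[of "{{x : X. \<forall>i<n. x i = v i} |n v. True}" Gn X] unfolding Gn_def by blast
 have Gs: "sigma_sets X Gn \<subseteq> sets m"
 proof -
  have "Gn \<subseteq> sets m"
  proof
   fix S assume "S : Gn"
   then consider "S = {}" | n v where "S = {x : X. \<forall>i<n. x i = v i}" by (auto simp: Gn_def)
   then show "S : sets m" by cases (simp_all add: sets_m cylinder_in_sets)
  qed
  then show ?thesis using sets.sigma_sets_subset[of Gn m] by simp
 qed
 have stable: "Int_stable Gn"
 proof (rule Int_stableI)
  fix S S' assume S: "S : Gn" "S' : Gn"
  show "S \<inter> S' : Gn"
  proof (cases "S \<inter> S' = {}")
   case False
   then obtain x where x: "x : S" "x : S'" by blast
   obtain n v where v: "S = {x : X. \<forall>i<n. x i = v i}" using S x by (auto simp: Gn_def)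
   obtain n' v' where v': "S' = {x : X. \<forall>i<n'. x i = v' i}" using S x by (auto simp: Gn_def)
   have "S \<inter> S' = {y : X. \<forall>i<max n n'. y i = x i}"
    using x unfolding v v' by (auto simp: less_max_iff_disj)
   then show ?thesis unfolding Gn_def by blast
  qed (simp add: Gn_def)
 qed
 have sub: "Gn \<subseteq> Pow X" by (auto simp: Gn_def)
 show ?thesis
 proof (rule sigma_sets_induct_disjoint[OF stable sub A])
  fix S assume "S : Gn"
  then consider "S = {}" | n v where "S = {x : X. \<forall>i<n. x i = v i}" by (auto simp: Gn_def)
  then show "(\<integral>\<^sup>+x. tr E lg UNIV (indicator S) x \<partial>m) = emeasure m S"
  proof cases
   case 1
   then have "(indicator S :: _ => ennreal) = (%_. 0)" by auto
   then show ?thesis using 1 by simp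
  next
   case 2
   then show ?thesis using emeasure_tr_cylinder by simp
  qed
 next
  have "(indicator {} :: (nat => 'a) => ennreal) = (%_. 0)" by auto
  then show "(\<integral>\<^sup>+x. tr E lg UNIV (indicator {}) x \<partial>m) = emeasure m {}" by simp
 next
  fix S assume S: "S : sigma_sets X Gn" "(\<integral>\<^sup>+x. tr E lg UNIV (indicator S) x \<partial>m) = emeasure m S"
  have Sm: "S : sets m" using S Gs by blast
  have [measurable]: "tr E lg UNIV (indicator S) : borel_measurable m" "tr E lg UNIV (indicator (X - S)) : borel_measurable m"
   using Sm sets.compl_sets[OF Sm] by (auto intro!: tr_lg_measurable)
  have "(\<integral>\<^sup>+x. tr E lg UNIV (indicator S) x \<partial>m) + (\<integral>\<^sup>+x. tr E lg UNIV (indicator (X - S)) x \<partial>m) =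
    (\<integral>\<^sup>+x. tr E lg UNIV (indicator S) x + tr E lg UNIV (indicator (X - S)) x \<partial>m)"
   by (rule nn_integral_add[symmetric]) auto
  also have "... = (\<integral>\<^sup>+x. 1 \<partial>m)"
  proof (rule nn_integral_cong)
   fix x assume "x : space m"
   then have x: "x : X" by simp
   have "tr E lg UNIV (indicator S) x + tr E lg UNIV (indicator (X - S)) x = tr E lg UNIV (%_. 1) x"
    unfolding tr_add[symmetric] using x by (intro tr_cong) (auto simp: indicator_def)
   then show "tr E lg UNIV (indicator S) x + tr E lg UNIV (indicator (X - S)) x = 1" using tr_lg_1[OF x] by simp
  qed
  finally have e: "emeasure m S + (\<integral>\<^sup>+x. tr E lg UNIV (indicator (X - S)) x \<partial>m) = 1" using S(2) emeasure_space_1 by simp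
  have "(\<integral>\<^sup>+x. tr E lg UNIV (indicator (X - S)) x \<partial>m) = 1 - emeasure m S"
   by (subst e[symmetric]) (rule ennreal_add_diff_cancel_left[symmetric], simp add: emeasure_eq_measure)
  also have "... = emeasure m (X - S)" using emeasure_compl[OF Sm] emeasure_space_1 by (simp add: emeasure_eq_measure)
  finally show "(\<integral>\<^sup>+x. tr E lg UNIV (indicator (X - S)) x \<partial>m) = emeasure m (X - S)" .
 next
  fix S :: "nat => (nat => 'a) set" assume S: "disjoint_family S" "range S \<subseteq> sigma_sets X Gn"
   "!!i. (\<integral>\<^sup>+x. tr E lg UNIV (indicator (S i)) x \<partial>m) = emeasure m (S i)"
  have Sm: "S i : sets m" for i using S Gs by blast
  have "(indicator (\<Union>i. S i) :: _ => ennreal) = (%x. \<Sum>i. indicator (S i) x)"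
   using suminf_indicator[OF S(1)] by (simp add: fun_eq_iff)
  then have "(\<integral>\<^sup>+x. tr E lg UNIV (indicator (\<Union>i. S i)) x \<partial>m) = (\<integral>\<^sup>+x. (\<Sum>i. tr E lg UNIV (indicator (S i)) x) \<partial>m)"
   by (simp add: tr_suminf)
  also have "... = (\<Sum>i. (\<integral>\<^sup>+x. tr E lg UNIV (indicator (S i)) x \<partial>m))"
   using Sm by (intro nn_integral_suminf tr_lg_measurable) auto
  also have "... = emeasure m (\<Union>i. S i)" unfolding S(3) using Sm S(1) by (intro suminf_emeasure) auto
  finally show "(\<integral>\<^sup>+x. tr E lg UNIV (indicator (\<Union>i. S i)) x \<partial>m) = emeasure m (\<Union>i. S i)" .
 qed
qed

theorem nn_integral_tr:
 assumes "u : borel_measurable m"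
 shows "(\<integral>\<^sup>+x. tr E lg UNIV u x \<partial>m) = (\<integral>\<^sup>+x. u x \<partial>m)"
 using assms
proof (induction rule: borel_measurable_induct)
 case (cong f g)
 have "(\<integral>\<^sup>+x. tr E lg UNIV f x \<partial>m) = (\<integral>\<^sup>+x. tr E lg UNIV g x \<partial>m)"
  using cong(3) by (intro nn_integral_cong tr_cong) auto
 moreover have "(\<integral>\<^sup>+x. f x \<partial>m) = (\<integral>\<^sup>+x. g x \<partial>m)" using cong(3) by (intro nn_integral_cong) auto
 ultimately show ?case using cong(4) by simp
next
 case (set A)
 then show ?case using emeasure_tr by simp
next
 case (mult u c)
 then show ?case using tr_lg_measurable[of u UNIV] by (simp add: tr_cmult nn_integral_cmult)
next
 case (add u v)
 then show ?case using tr_lg_measurable[of u UNIV] tr_lg_measurable[of v UNIV] by (simp add: tr_add nn_integral_add)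
next
 case (seq U)
 have inc: "U k y <= U (Suc k) y" for k y using seq(3) by (simp add: incseq_Suc_iff le_fun_def)
 have e: "Sup (range U) = (%y. SUP k. U k y)" by (auto simp: fun_eq_iff image_comp)
 have "(\<integral>\<^sup>+x. tr E lg UNIV (Sup (range U)) x \<partial>m) = (\<integral>\<^sup>+x. (SUP k. tr E lg UNIV (U k) x) \<partial>m)"
  unfolding e using tr_SUP[of U, OF inc] by simp
 also have "... = (SUP k. \<integral>\<^sup>+x. tr E lg UNIV (U k) x \<partial>m)"
 proof (rule nn_integral_monotone_convergence_SUP_AE)
  fix k
  show "AE x in m. tr E lg UNIV (U k) x <= tr E lg UNIV (U (Suc k)) x" using inc by (intro AE_I2 tr_mono) auto
  show "tr E lg UNIV (U k) : borel_measurable m" using seq by (intro tr_lg_measurable) auto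
 qed
 also have "... = (SUP k. \<integral>\<^sup>+x. U k x \<partial>m)" using seq by simp
 also have "... = (\<integral>\<^sup>+x. (SUP k. U k x) \<partial>m)"
  using seq by (intro nn_integral_monotone_convergence_SUP[symmetric]) auto
 finally show ?case unfolding e .
qed

end

section \<open>Square integrability of the Green function\<close>

lemma suminf_geometric_ennreal:
 fixes C \<rho> :: real
 assumes "0 <= C" "0 <= \<rho>" "\<rho> < 1"
 shows "(\<Sum>k. ennreal (C * \<rho> ^ k)) = ennreal (C / (1 - \<rho>))"
proof -
 have "(%k. C * \<rho> ^ k) sums (C * (1 / (1 - \<rho>)))" using assms by (intro sums_mult geometric_sums) auto
 then show ?thesis using assms by (subst suminf_ennreal_eq[of _ "C * (1 / (1 - \<rho>))"]) auto
qed

context normalised_shift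
begin

abbreviation un :: "(nat => 'a) => ennreal" where "un \<equiv> (%_. 1)"
abbreviation TT where "TT \<equiv> tr E lg UNIV"
abbreviation AA where "AA \<equiv> tr E lg {a}"
abbreviation BB where "BB \<equiv> tr E lg (- {a})"
abbreviation gg where "gg \<equiv> G lg a (%_. 1)"

lemma TT_split: "TT u x = AA u x + BB u x"
 by (rule tr_split)

text \<open>Total probability for the backward walk: either it has met \<open>a\<close> within the
  first \<open>k\<close> steps, or it has avoided \<open>a\<close> so far.\<close>

lemma BB_sum: "x : X ==> (\<Sum>j<k. (BB ^^ j) (AA un) x) + (BB ^^ k) un x = 1"
proof (induction k)
 case (Suc k)
 have "(BB ^^ k) un x = (BB ^^ k) (%y. AA un y + BB un y) x"
 proof (rule tr_funpow_cong[OF _ Suc.prems])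
  fix y assume "y : X"
  then show "(1::ennreal) = AA un y + BB un y" using tr_lg_1[of y] TT_split[of un y] by simp
 qed
 also have "... = (BB ^^ k) (AA un) x + (BB ^^ k) (BB un) x" unfolding tr_funpow_add ..
 also have "(BB ^^ k) (BB un) x = (BB ^^ Suc k) un x" by (simp add: funpow_swap1)
 finally have e: "(BB ^^ k) un x = (BB ^^ k) (AA un) x + (BB ^^ Suc k) un x" .
 show ?case unfolding sum.lessThan_Suc add.assoc e[symmetric] by (rule Suc.IH[OF Suc.prems])
qed simp

lemma BB_le_1: "x : X ==> (BB ^^ k) un x <= 1"
 using BB_sum[of x k] by (metis add.commute le_iff_add)

lemma AA_sum_1: "x : X ==> (\<Sum>j. (BB ^^ j) (AA un) x) = 1"
 using Lb_lg_1[of x] unfolding Lb_def G_def .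

lemma AA_sum_le_1: "x : X ==> (\<Sum>j<k. (BB ^^ j) (AA un) x) <= 1"
 using BB_sum[of x k] by (metis le_iff_add)

text \<open>Survival for \<open>k\<close> steps is the tail of the hitting distribution because that
  distribution has total mass 1; the finite initial part is cancelled from both expressions.\<close>

lemma BB_tail: "x : X ==> (BB ^^ k) un x = (\<Sum>j. (BB ^^ (j + k)) (AA un) x)"
proof -
 assume x: "x : X"
 define S where "S = (\<Sum>j<k. (BB ^^ j) (AA un) x)"
 have "(\<Sum>j. (BB ^^ j) (AA un) x) = (\<Sum>j. (BB ^^ (j + k)) (AA un) x) + S"
  unfolding S_def by (rule suminf_offset) simp
 then have 1: "S + (\<Sum>j. (BB ^^ (j + k)) (AA un) x) = 1" using AA_sum_1[OF x] by (simp add: add.commute)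
 have 2: "S + (BB ^^ k) un x = 1" unfolding S_def by (rule BB_sum[OF x])
 have "S <= 1" unfolding S_def by (rule AA_sum_le_1[OF x])
 then have "S ~= top" by (metis ennreal_one_less_top leD)
 moreover have "S + (BB ^^ k) un x = S + (\<Sum>j. (BB ^^ (j + k)) (AA un) x)" unfolding 1 2 ..
 ultimately show ?thesis by (simp add: ennreal_add_left_cancel)
qed

lemma BB_V: "\<exists>C \<rho>. 0 < C & 0 < \<rho> & \<rho> < 1 & (\<forall>k. \<forall>x\<in>V a. (BB ^^ k) un x <= ennreal (C * \<rho> ^ k))"
proof -
 obtain C \<rho> where t: "0 < C" "0 < \<rho>" "\<rho> < 1" "!!k x. x : V a ==> (BB ^^ k) (AA un) x <= ennreal (C * \<rho> ^ k)"
  using excursion_tail by blast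
 have "(BB ^^ k) un x <= ennreal (C / (1 - \<rho>) * \<rho> ^ k)" if x: "x : V a" for k x
 proof -
  have "x : X" using x by simp
  then have "(BB ^^ k) un x = (\<Sum>j. (BB ^^ (j + k)) (AA un) x)" by (rule BB_tail)
  also have "... <= (\<Sum>j. ennreal (C * \<rho> ^ (j + k)))" using t(4)[OF x] by (intro suminf_le) auto
  also have "... = (\<Sum>j. ennreal ((C * \<rho> ^ k) * \<rho> ^ j))" by (simp add: power_add ac_simps)
  also have "... = ennreal (C * \<rho> ^ k / (1 - \<rho>))" using t by (intro suminf_geometric_ennreal) auto
  finally show ?thesis by (simp add: ac_simps)
 qed
 then show ?thesis using t by (intro exI[of _ "C / (1 - \<rho>)"] exI[of _ \<rho>]) auto
qed

lemma gg_V: "\<exists>C\<ge>1. \<forall>x\<in>V a. gg x <= ennreal C"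
proof -
 obtain C \<rho> where t: "0 < C" "0 < \<rho>" "\<rho> < 1" "!!k x. x : V a ==> (BB ^^ k) un x <= ennreal (C * \<rho> ^ k)"
  using BB_V by blast
 have "gg x <= ennreal (max 1 (C / (1 - \<rho>)))" if x: "x : V a" for x
 proof -
  have "gg x <= (\<Sum>k. ennreal (C * \<rho> ^ k))" unfolding G_def using t(4)[OF x] by (intro suminf_le) auto
  also have "... = ennreal (C / (1 - \<rho>))" using t by (intro suminf_geometric_ennreal) auto
  also have "... <= ennreal (max 1 (C / (1 - \<rho>)))" by (intro ennreal_leI) simp
  finally show ?thesis .
 qed
 then show ?thesis by (intro exI[of _ "max 1 (C / (1 - \<rho>))"]) auto
qed

text \<open>The summand 1 produces the gap \<open>1 - \<theta>\<close> between the two cone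
  constants that contraction needs, and it makes \<open>Dc >= 1\<close>, which later places a
  translate of \<psi> in the cone.\<close>

definition Dc :: real where "Dc = \<theta> * Ag / (1 - \<theta>) + 1"
definition Dc' :: real where "Dc' = \<theta> * (Ag + Dc)"

lemma Dc: "1 <= Dc" "0 <= Dc'" "Dc' < Dc" "\<theta> * (Ag + Dc) <= Dc"
proof -
 have q: "0 <= \<theta> * Ag / (1 - \<theta>)" using Ag theta by simp
 then show "1 <= Dc" by (simp add: Dc_def)
 then show "0 <= Dc'" unfolding Dc'_def using Ag theta by (intro mult_nonneg_nonneg) auto
 have "(1 - \<theta>) * (\<theta> * Ag / (1 - \<theta>)) = \<theta> * Ag" using theta by simp
 then have "(1 - \<theta>) * Dc = \<theta> * Ag + (1 - \<theta>)" by (simp add: Dc_def distrib_left)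
 then have "Dc - Dc' = 1 - \<theta>" unfolding Dc'_def by (simp add: algebra_simps)
 then show "Dc' < Dc" using theta by linarith
 then show "\<theta> * (Ag + Dc) <= Dc" unfolding Dc'_def by simp
qed

definition gm :: real where "gm = gam Dc Dc'"

lemma gm: "0 <= gm" "gm < 1"
 unfolding gm_def using gam_bounds[OF Dc(2,3)] by auto

lemma gg_cone: "cone X Dc gg"
 using Dc by (intro cone_G[OF wvar_lg] cone_const) auto

lemma gg_measurable: "gg : borel_measurable m"
 unfolding measurable_m by (rule cone_measurable[OF gg_cone])

lemma BB_measurable: "(BB ^^ k) un : borel_measurable m"
 using lg_measurable unfolding measurable_m by (intro tr_funpow_measurable) auto

lemma gg_ge_1: "1 <= gg x"
 using G_ge[of un x] by simp

text \<open>A step that starts at a letter other than \<open>a\<close> is one term of the unfolded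
  Green series, so finiteness passes backwards along a path into the cylinder of \<open>a\<close>;
  points that start with \<open>a\<close> are covered by the bound on the cylinder.\<close>

lemma gg_finite_path: "y : X ==> (shift ^^ n) y : V a ==> gg y ~= top"
proof (induction n arbitrary: y)
 case 0
 obtain C where "\<forall>x\<in>V a. gg x <= ennreal C" using gg_V by blast
 then have "gg y <= ennreal C" using 0 by simp
 then show ?case by (metis ennreal_neq_top top.extremum_uniqueI)
next
 case (Suc n)
 show ?case
 proof (cases "y 0 = a")
  case True
  obtain C where "\<forall>x\<in>V a. gg x <= ennreal C" using gg_V by blast
  then have "gg y <= ennreal C" using True Suc.prems by simp
  then show ?thesis by (metis ennreal_neq_top top.extremum_uniqueI)
 next
  case False
  have sX: "shift y : X" using Suc.prems by auto
  have "(shift ^^ n) (shift y) : V a" using Suc.prems(2) by (simp add: funpow_swap1)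
  then have fin: "gg (shift y) ~= top" by (rule Suc.IH[OF sX])
  have "ennreal (exp (lg (case_nat (y 0) (shift y)))) * gg (case_nat (y 0) (shift y)) <= BB gg (shift y)"
  proof (rule tr_ge_point)
   show "y 0 : - {a}" using False by simp
   show "E (y 0) (shift y 0)" using Suc.prems(1) by (simp add: sigma_plus_def shift_def)
  qed
  also have "... <= gg (shift y)" using G_unfold[of lg a un "shift y"] by (metis add.commute le_iff_add)
  finally have "ennreal (exp (lg y)) * gg y <= gg (shift y)" by simp
  then have "ennreal (exp (lg y)) * gg y ~= top" using fin by (metis top.extremum_uniqueI)
  then show ?thesis by (auto simp: ennreal_mult_eq_top_iff)
 qed
qed

lemma gg_finite: "x : X ==> gg x ~= top"
proof -
 assume x: "x : X"
 obtain z where z: "z : V a" using V_nonempty[of a] by blast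
 then have "z : X" by simp
 then obtain n y where y: "n >= 1" "y : X" "y 0 = x 0" "(shift ^^ n) y = z" using path_to by blast
 have "gg y ~= top" by (rule gg_finite_path[of y n]) (use y z in auto)
 moreover have "gg x <= ennreal (exp (Dc * \<theta> ^ 1)) * gg y"
  by (rule coneD[OF gg_cone]) (use x y in auto)
 ultimately show ?thesis by (metis ennreal_mult_eq_top_iff ennreal_neq_top top.extremum_uniqueI)
qed

definition gr :: "(nat => 'a) => real" where "gr x = enn2real (gg x)"

lemma gr: "x : X ==> gg x = ennreal (gr x)" "x : X ==> 1 <= gr x"
proof -
 show e: "x : X ==> gg x = ennreal (gr x)" using gg_finite[of x] unfolding gr_def by (simp add: less_top)
 have "x : X ==> ennreal 1 <= ennreal (gr x)" using gg_ge_1[of x] e by simp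
 then show "x : X ==> 1 <= gr x" by (subst (asm) ennreal_le_iff2) auto
qed

lemma gr_measurable: "gr : borel_measurable m"
 unfolding gr_def[abs_def] using gg_measurable by measurable

lemma BB_tendsto_0: "x : X ==> (%k. (BB ^^ k) un x) \<longlonglongrightarrow> 0"
proof -
 assume x: "x : X"
 define S where "S k = (\<Sum>j<k. (BB ^^ j) (AA un) x)" for k
 have "S \<longlonglongrightarrow> (\<Sum>j. (BB ^^ j) (AA un) x)" unfolding S_def[abs_def] by (rule summable_LIMSEQ) simp
 then have S: "S \<longlonglongrightarrow> 1" unfolding AA_sum_1[OF x] .
 have "(BB ^^ k) un x = 1 - S k" for k
 proof -
  have "S k <= 1" unfolding S_def by (rule AA_sum_le_1[OF x])
  then have fin: "S k < top" by (rule le_less_trans) simp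
  have e: "S k + (BB ^^ k) un x = 1" unfolding S_def by (rule BB_sum[OF x])
  have "(S k + (BB ^^ k) un x) - S k = (BB ^^ k) un x" by (rule ennreal_add_diff_cancel_left) (use fin in simp)
  then show ?thesis unfolding e by (rule sym)
 qed
 moreover have "(%k. 1 - S k) \<longlonglongrightarrow> 1 - 1" by (intro tendsto_diff_ennreal_general tendsto_const S) auto
 ultimately show ?thesis by simp
qed

text \<open>Invariance under \<open>T\<close> makes the integral of \<open>B u\<close> equal to the
  integral of \<open>u\<close> off the cylinder of \<open>a\<close>. Successive integrals thus
  differ by the contribution of the cylinder, where a uniform tail bound holds.\<close>

lemma nn_integral_BB_step:
 assumes "0 <= c" "!!x. x : V a ==> (BB ^^ k) un x <= ennreal c"
 shows "(\<integral>\<^sup>+x. (BB ^^ k) un x \<partial>m) <= (\<integral>\<^sup>+x. (BB ^^ Suc k) un x \<partial>m) + ennreal c"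
proof -
 define w where "w y = indicator (- {a}) (y 0) * (BB ^^ k) un y" for y :: "nat => 'a"
 have wm: "w : borel_measurable m"
 proof -
  have "(%y. indicator (- {a}) (y 0) :: ennreal) : borel_measurable m"
   unfolding measurable_m by (rule measurable_compose[OF measurable_coord]) simp
  then show ?thesis unfolding w_def[abs_def] using BB_measurable[of k] by (rule borel_measurable_times_ennreal)
 qed
 have "(\<integral>\<^sup>+x. (BB ^^ k) un x \<partial>m) <= (\<integral>\<^sup>+x. w x + ennreal c \<partial>m)"
 proof (rule nn_integral_mono)
  fix x assume "x : space m"
  then have x: "x : X" by simp
  show "(BB ^^ k) un x <= w x + ennreal c"
  proof (cases "x 0 = a")
   case True
   then have "(BB ^^ k) un x <= ennreal c" using assms(2) x by simp
   then show ?thesis by (rule order_trans) simp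
  qed (simp add: w_def)
 qed
 also have "... = (\<integral>\<^sup>+x. w x \<partial>m) + ennreal c"
  using wm by (subst nn_integral_add) (auto simp: emeasure_space_1[simplified])
 also have "(\<integral>\<^sup>+x. w x \<partial>m) = (\<integral>\<^sup>+x. TT w x \<partial>m)" by (rule nn_integral_tr[OF wm, symmetric])
 also have "... = (\<integral>\<^sup>+x. (BB ^^ Suc k) un x \<partial>m)"
  unfolding funpow.simps o_apply tr_restrict[of E lg "- {a}"] w_def[abs_def] ..
 finally show ?thesis .
qed

text \<open>The integrals tend to 0 by dominated convergence, so each is at most the sum of the
  later increments, a geometric tail. In this way \<open>m\<close> inherits exponential return tails
  although uniform bounds are available on the cylinder alone.\<close>

lemma nn_integral_BB:
 "\<exists>C \<rho>. 0 < C & 0 < \<rho> & \<rho> < 1 & (\<forall>k. (\<integral>\<^sup>+x. (BB ^^ k) un x \<partial>m) <= ennreal (C * \<rho> ^ k))"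
proof -
 obtain C \<rho> where t: "0 < C" "0 < \<rho>" "\<rho> < 1" "!!k x. x : V a ==> (BB ^^ k) un x <= ennreal (C * \<rho> ^ k)"
  using BB_V by blast
 define q where "q k = (\<integral>\<^sup>+x. (BB ^^ k) un x \<partial>m)" for k
 have step: "q k <= q (Suc k) + ennreal (C * \<rho> ^ k)" for k
  unfolding q_def using t by (intro nn_integral_BB_step) auto
 have iter: "q k <= q (k + n) + ennreal (\<Sum>j<n. C * \<rho> ^ (k + j))" for k n
 proof (induction n)
  case (Suc n)
  have "q k <= (q (Suc (k + n)) + ennreal (C * \<rho> ^ (k + n))) + ennreal (\<Sum>j<n. C * \<rho> ^ (k + j))"
   by (rule order_trans[OF Suc add_right_mono[OF step]])
  also have "... = q (k + Suc n) + ennreal (\<Sum>j<Suc n. C * \<rho> ^ (k + j))"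
   using t by (simp add: ac_simps sum_nonneg flip: ennreal_plus)
  finally show ?case .
 qed simp
 have lim: "q \<longlonglongrightarrow> 0"
 proof -
  have "(%k. (\<integral>\<^sup>+x. (BB ^^ k) un x \<partial>m)) \<longlonglongrightarrow> (\<integral>\<^sup>+x. 0 \<partial>m)"
  proof (rule nn_integral_dominated_convergence[where w="%_. 1"])
   show "(\<integral>\<^sup>+x. 1 \<partial>m) < \<infinity>" using emeasure_space_1 by simp
   show "AE x in m. (BB ^^ k) un x <= 1" for k using BB_le_1 by (intro AE_I2) auto
   show "AE x in m. (%k. (BB ^^ k) un x) \<longlonglongrightarrow> 0" using BB_tendsto_0 by (intro AE_I2) auto
  qed (use BB_measurable in auto)
  then show ?thesis unfolding q_def[abs_def] by simp
 qed
 have "q k <= ennreal (C / (1 - \<rho>) * \<rho> ^ k)" for k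
 proof -
  have "q k <= q (n + k) + ennreal (C / (1 - \<rho>) * \<rho> ^ k)" for n
  proof -
   have s: "(%j. (C * \<rho> ^ k) * \<rho> ^ j) sums ((C * \<rho> ^ k) * (1 / (1 - \<rho>)))"
    using t by (intro sums_mult geometric_sums) auto
   have "(\<Sum>j<n. (C * \<rho> ^ k) * \<rho> ^ j) <= (\<Sum>j. (C * \<rho> ^ k) * \<rho> ^ j)"
    using t by (intro sum_le_suminf sums_summable[OF s]) auto
   also have "... = C / (1 - \<rho>) * \<rho> ^ k" using sums_unique[OF s] by simp
   finally have "(\<Sum>j<n. C * \<rho> ^ (k + j)) <= C / (1 - \<rho>) * \<rho> ^ k" by (simp add: power_add mult.assoc)
   then have le: "ennreal (\<Sum>j<n. C * \<rho> ^ (k + j)) <= ennreal (C / (1 - \<rho>) * \<rho> ^ k)" by (rule ennreal_leI)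
   show ?thesis unfolding add.commute[of n k] by (rule order_trans[OF iter add_left_mono[OF le]])
  qed
  moreover have "(%n. q (n + k) + ennreal (C / (1 - \<rho>) * \<rho> ^ k)) \<longlonglongrightarrow> 0 + ennreal (C / (1 - \<rho>) * \<rho> ^ k)"
   by (rule tendsto_add[OF LIMSEQ_ignore_initial_segment[OF lim, of k] tendsto_const])
  ultimately have "q k <= 0 + ennreal (C / (1 - \<rho>) * \<rho> ^ k)" by (intro LIMSEQ_le_const) auto
  then show ?thesis by simp
 qed
 then show ?thesis using t unfolding q_def by (intro exI[of _ "C / (1 - \<rho>)"] exI[of _ \<rho>]) auto
qed

text \<open>With \<open>p\<^sub>k = B\<^sup>k 1 <= 1\<close> and \<open>W = \<Sum> t\<^sup>-\<^sup>k p\<^sub>k\<close> one has \<open>p\<^sub>k\<^sup>2 <= p\<^sub>k <= t\<^sup>k W\<close>, so \<open>\<Sum> p\<^sub>k\<close> is at most a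
 multiple of the square root of \<open>W\<close>, which is integrable when \<open>t\<close> is close to \<open>1\<close>.\<close>

lemma gr_square_le:
 assumes t: "0 < s" "s < 1" and x: "x : X"
 shows "ennreal ((gr x)\<^sup>2) <= ennreal (1 / (1 - s)\<^sup>2) * (\<Sum>k. ennreal (1 / s\<^sup>2 ^ k) * (BB ^^ k) un x)"
proof -
 define W where "W = (\<Sum>k. ennreal (1 / s\<^sup>2 ^ k) * (BB ^^ k) un x)"
 define p where "p k = enn2real ((BB ^^ k) un x)" for k
 have fin: "(BB ^^ k) un x < top" for k using BB_le_1[OF x, of k] by (rule le_less_trans) simp
 have p: "(BB ^^ k) un x = ennreal (p k)" "0 <= p k" "p k <= 1" for k
 proof -
  show e: "(BB ^^ k) un x = ennreal (p k)" using fin[of k] by (simp add: p_def)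
  show 0: "0 <= p k" by (simp add: p_def)
  show "p k <= 1" using BB_le_1[OF x, of k] unfolding e by (simp flip: ennreal_1)
 qed
 show ?thesis
 proof (cases "W = top")
  case True
  then show ?thesis using t unfolding W_def[symmetric] by (simp add: ennreal_mult_top)
 next
  case False
  then obtain w where w: "W = ennreal w" "0 <= w" by (metis ennreal_cases)
  have pk: "p k <= sqrt w * s ^ k" for k
  proof -
   have "ennreal (1 / s\<^sup>2 ^ k) * (BB ^^ k) un x <= W"
    unfolding W_def using sum_le_suminf[of "%k. ennreal (1 / s\<^sup>2 ^ k) * (BB ^^ k) un x" "{k}"] by simp
   then have "ennreal (1 / s\<^sup>2 ^ k * p k) <= ennreal w" unfolding p(1) w(1) using p(2)[of k] t by (subst ennreal_mult) auto
   then have "1 / s\<^sup>2 ^ k * p k <= w" using w(2) by simp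
   then have "p k <= w * s\<^sup>2 ^ k" using t by (simp add: field_simps)
   moreover have "(p k)\<^sup>2 <= p k" using p(2,3)[of k] by (simp add: power2_eq_square mult_left_le)
   moreover have "(sqrt w * s ^ k)\<^sup>2 = w * s\<^sup>2 ^ k" using w(2) by (simp add: power_mult_distrib power_mult[symmetric] mult.commute)
   ultimately have "(p k)\<^sup>2 <= (sqrt w * s ^ k)\<^sup>2" by linarith
   then show ?thesis by (rule power2_le_imp_le) (use w t in simp)
  qed
  have "gg x <= (\<Sum>k. ennreal (sqrt w * s ^ k))"
   unfolding G_def p(1) using pk by (intro suminf_le allI ennreal_leI) auto
  also have "... = ennreal (sqrt w / (1 - s))" using t w by (intro suminf_geometric_ennreal) auto
  finally have "ennreal (gr x) <= ennreal (sqrt w / (1 - s))" unfolding gr(1)[OF x] .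
  then have "gr x <= sqrt w / (1 - s)" using t w by (subst (asm) ennreal_le_iff) auto
  then have "(gr x)\<^sup>2 <= (sqrt w / (1 - s))\<^sup>2" using gr(2)[OF x] by (intro power_mono) auto
  also have "... = 1 / (1 - s)\<^sup>2 * w" using w by (simp add: power_divide)
  finally have "ennreal ((gr x)\<^sup>2) <= ennreal (1 / (1 - s)\<^sup>2 * w)" by (rule ennreal_leI)
  also have "... = ennreal (1 / (1 - s)\<^sup>2) * ennreal w" using w by (intro ennreal_mult) auto
  finally show ?thesis unfolding W_def[symmetric] w(1) .
 qed
qed

lemma gr_square_integrable: "integrable m (%x. (gr x)\<^sup>2)"
proof -
 obtain C \<rho> where t: "0 < C" "0 < \<rho>" "\<rho> < 1" "!!k. (\<integral>\<^sup>+x. (BB ^^ k) un x \<partial>m) <= ennreal (C * \<rho> ^ k)"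
  using nn_integral_BB by blast
 \<comment> \<open>With \<rho> equal to \<open>s ^ 4\<close>, the integrals decay like
   \<open>s ^ (4 * k)\<close>, and after division by \<open>s ^ (2 * k)\<close> a summable factor
   \<open>s ^ (2 * k)\<close> remains.\<close>
 define s where "s = sqrt (sqrt \<rho>)"
 have s: "0 < s" "s < 1" "s\<^sup>2 = sqrt \<rho>" "0 < s\<^sup>2" "s\<^sup>2 < 1"
  using t by (auto simp: s_def)
 have r: "\<rho> = s\<^sup>2 * s\<^sup>2" unfolding s(3) using t by simp
 have m1: "(%x. ennreal (1 / s\<^sup>2 ^ k) * (BB ^^ k) un x) : borel_measurable m" for k
  using BB_measurable by measurable
 have "(\<integral>\<^sup>+x. ennreal ((gr x)\<^sup>2) \<partial>m) <= (\<integral>\<^sup>+x. ennreal (1 / (1 - s)\<^sup>2) * (\<Sum>k. ennreal (1 / s\<^sup>2 ^ k) * (BB ^^ k) un x) \<partial>m)"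
  using gr_square_le[OF s(1,2)] by (intro nn_integral_mono) auto
 also have "... = ennreal (1 / (1 - s)\<^sup>2) * (\<integral>\<^sup>+x. (\<Sum>k. ennreal (1 / s\<^sup>2 ^ k) * (BB ^^ k) un x) \<partial>m)"
  using m1 by (intro nn_integral_cmult borel_measurable_suminf_order)
 also have "(\<integral>\<^sup>+x. (\<Sum>k. ennreal (1 / s\<^sup>2 ^ k) * (BB ^^ k) un x) \<partial>m) = (\<Sum>k. \<integral>\<^sup>+x. ennreal (1 / s\<^sup>2 ^ k) * (BB ^^ k) un x \<partial>m)"
  using m1 by (intro nn_integral_suminf)
 also have "... = (\<Sum>k. ennreal (1 / s\<^sup>2 ^ k) * (\<integral>\<^sup>+x. (BB ^^ k) un x \<partial>m))"
  using BB_measurable by (intro suminf_cong nn_integral_cmult)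
 finally have 1: "(\<integral>\<^sup>+x. ennreal ((gr x)\<^sup>2) \<partial>m) \<le>
   ennreal (1 / (1 - s)\<^sup>2) * (\<Sum>k. ennreal (1 / s\<^sup>2 ^ k) * (\<integral>\<^sup>+x. (BB ^^ k) un x \<partial>m))" .
 have "(\<Sum>k. ennreal (1 / s\<^sup>2 ^ k) * (\<integral>\<^sup>+x. (BB ^^ k) un x \<partial>m)) <= (\<Sum>k. ennreal (C * s\<^sup>2 ^ k))"
 proof (intro suminf_le allI)
  fix k
  have "ennreal (1 / s\<^sup>2 ^ k) * (\<integral>\<^sup>+x. (BB ^^ k) un x \<partial>m) <= ennreal (1 / s\<^sup>2 ^ k) * ennreal (C * \<rho> ^ k)"
   by (intro mult_left_mono t(4)) simp
  also have "... = ennreal (1 / s\<^sup>2 ^ k * (C * \<rho> ^ k))" using t s by (intro ennreal_mult[symmetric]) auto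
  also have "1 / s\<^sup>2 ^ k * (C * \<rho> ^ k) = C * s\<^sup>2 ^ k" unfolding r power_mult_distrib using s(4) by simp
  finally show "ennreal (1 / s\<^sup>2 ^ k) * (\<integral>\<^sup>+x. (BB ^^ k) un x \<partial>m) <= ennreal (C * s\<^sup>2 ^ k)" .
 qed auto
 also have "... = ennreal (C / (1 - s\<^sup>2))" using t s by (intro suminf_geometric_ennreal) auto
 finally have "ennreal (1 / (1 - s)\<^sup>2) * (\<Sum>k. ennreal (1 / s\<^sup>2 ^ k) * (\<integral>\<^sup>+x. (BB ^^ k) un x \<partial>m)) \<le>
   ennreal (1 / (1 - s)\<^sup>2) * ennreal (C / (1 - s\<^sup>2))" by (rule mult_left_mono) simp
 also have "... < \<infinity>" by (simp add: ennreal_mult_less_top)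
 finally have "(\<integral>\<^sup>+x. ennreal ((gr x)\<^sup>2) \<partial>m) < \<infinity>" using 1 by (rule le_less_trans[rotated])
 then show ?thesis using gr_measurable by (intro integrableI_nonneg) auto
qed

section \<open>Full support and continuous coboundaries\<close>

lemma cylinder_path:
 assumes x: "x : X"
 shows "z : X ==> \<exists>k y. Suc n <= k & y : X & agree (Suc n) z y & (shift ^^ k) y = x"
proof (induction n arbitrary: z)
 case 0
 obtain k y where "k >= 1" "y : X" "y 0 = z 0" "(shift ^^ k) y = x" using path_to[OF x, of "z 0"] by blast
 then show ?case by (intro exI[of _ k] exI[of _ y]) simp
next
 case (Suc n)
 have "shift z : X" using Suc.prems by auto
 then obtain k y where y: "Suc n <= k" "y : X" "agree (Suc n) (shift z) y" "(shift ^^ k) y = x"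
  using Suc.IH by blast
 have "y 0 = z (Suc 0)" using y(3)[unfolded agree_def, rule_format, of 0] by (simp add: shift_def)
 moreover have "E (z 0) (z (Suc 0))" using Suc.prems by (simp add: sigma_plus_def)
 ultimately have c: "case_nat (z 0) y : X" using y(2) by simp
 have ag: "agree (Suc (Suc n)) z (case_nat (z 0) y)"
  using y(3) agree_case_nat[of "Suc n" "z 0" "shift z" y] by (simp only: case_nat_shift)
 have "(shift ^^ Suc k) (case_nat (z 0) y) = x" using y(4) by (simp add: funpow_Suc_right del: funpow.simps)
 then show ?case using y(1) c ag by (intro exI[of _ "Suc k"] exI[of _ "case_nat (z 0) y"]) simp
qed

lemma nn_integral_tr_funpow: "u : borel_measurable m ==> (\<integral>\<^sup>+x. (TT ^^ k) u x \<partial>m) = (\<integral>\<^sup>+x. u x \<partial>m)"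
proof (induction k)
 case (Suc k)
 have "(TT ^^ k) u : borel_measurable m"
  using lg_measurable Suc.prems unfolding measurable_m by (rule tr_funpow_measurable)
 then have "(\<integral>\<^sup>+x. TT ((TT ^^ k) u) x \<partial>m) = (\<integral>\<^sup>+x. (TT ^^ k) u x \<partial>m)" by (rule nn_integral_tr)
 then show ?case using Suc by simp
qed simp

text \<open>Every point has an iterated preimage in the cylinder, so some iterate of
  \<open>T\<close> applied to its indicator is positive there; for a null cylinder all these
  iterates would have integral 0.\<close>

lemma full_support:
 assumes z: "z : X"
 shows "emeasure m {y : X. agree (Suc n) z y} ~= 0"
proof
 define A where "A = {y : X. agree (Suc n) z y}"
 have "A = {y : X. agree (Suc n) y z}" unfolding A_def using agree_sym by blast
 then have As: "A : sets m" unfolding sets_m using cylinder_agree_in_sets by simp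
 assume "emeasure m {y : X. agree (Suc n) z y} = 0"
 then have A0: "emeasure m A = 0" by (simp add: A_def)
 have "AE x in m. (TT ^^ k) (indicator A) x = 0" for k
 proof -
  have "(\<integral>\<^sup>+x. (TT ^^ k) (indicator A) x \<partial>m) = 0"
   using nn_integral_tr_funpow[of "indicator A" k] As A0 by simp
  moreover have "(TT ^^ k) (indicator A) : borel_measurable m"
   using lg_measurable As unfolding measurable_m sets_m by (intro tr_funpow_measurable) auto
  ultimately show ?thesis by (simp add: nn_integral_0_iff_AE)
 qed
 then have "AE x in m. \<forall>k. (TT ^^ k) (indicator A) x = 0" by (simp add: AE_all_countable)
 moreover have "\<exists>k. (TT ^^ k) (indicator A) x ~= 0" if "x : space m" for x
 proof -
  have "x : X" using that by simp
  then obtain k y where y: "Suc n <= k" "y : X" "agree (Suc n) z y" "(shift ^^ k) y = x" using cylinder_path[OF _ z] by blast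
  then have "(TT ^^ k) (indicator A) ((shift ^^ k) y) ~= 0" by (intro tr_funpow_pos) (auto simp: A_def)
  then show ?thesis using y(4) by blast
 qed
 ultimately have "AE x in m. False" by (elim AE_mp) (intro AE_I2, blast)
 then show False by simp
qed

text \<open>Full support upgrades an almost sure identity to one at every point; this is how
  vanishing variance gives a coboundary equation on all of \<open>X\<close>.\<close>

lemma AE_zero_continuous:
 assumes c: "shift_continuous E M" and z: "AE x in m. M x = 0" and x: "x : X"
 shows "M x = 0"
proof (rule ccontr)
 assume nz: "M x ~= 0"
 then have "\<bar>M x\<bar> > 0" by simp
 then obtain n where n: "\<forall>y\<in>X. agree n x y --> \<bar>M x - M y\<bar> < \<bar>M x\<bar>"
  using c[unfolded shift_continuous_iff, rule_format, OF x] by blast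
 define A where "A = {y : X. agree (Suc n) x y}"
 have "A = {y : X. agree (Suc n) y x}" unfolding A_def using agree_sym by blast
 then have As: "A : sets m" unfolding sets_m using cylinder_agree_in_sets by simp
 have "M y ~= 0" if "y : A" for y
 proof -
  have "agree n x y" using that agree_mono[of "Suc n" x y n] by (simp add: A_def)
  then have "\<bar>M x - M y\<bar> < \<bar>M x\<bar>" using n that by (simp add: A_def)
  then show ?thesis by auto
 qed
 then have "AE y in m. y \<notin> A" using z by (auto elim: eventually_mono)
 then have "emeasure m A = 0" using As by (subst (asm) AE_iff_measurable[OF As]) (auto simp: A_def)
 then show False using full_support[OF x, of n] by (simp add: A_def)
qed

lemma splice:
 assumes y: "y : X" and x: "x : X" and k: "y k = x 0"
 defines "w \<equiv> (%i. if i < k then y i else x (i - k))"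
 shows "w : X" "(shift ^^ k) w = x"
proof -
 have "E (w i) (w (Suc i))" for i
 proof -
  have Ey: "E (y i) (y (Suc i))" and Ex: "E (x (i - k)) (x (Suc (i - k)))" using x y by (auto simp: sigma_plus_def)
  consider "Suc i < k" | "Suc i = k" | "k <= i" by linarith
  then show ?thesis
  proof cases
   case 1 then show ?thesis using Ey by (simp add: w_def)
  next
   case 2 then show ?thesis using Ey k by (auto simp: w_def)
  next
   case 3 then show ?thesis using Ex by (simp add: w_def Suc_diff_le)
  qed
 qed
 then show "w : X" by (simp add: sigma_plus_def)
 show "(shift ^^ k) w = x" by (simp add: funpow_shift w_def)
qed

lemma coboundary_iter:
 fixes r :: "(nat => 'a) => real"
 assumes r: "!!x. x : X ==> \<bar>r x - r (shift x)\<bar> <= K" and x: "x : X"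
 shows "\<bar>r x - r ((shift ^^ k) x)\<bar> <= real k * K"
proof (induction k)
 case (Suc k)
 have "(shift ^^ k) x : X" using x by auto
 then have "\<bar>r ((shift ^^ k) x) - r (shift ((shift ^^ k) x))\<bar> <= K" by (rule r)
 moreover have "(shift ^^ Suc k) x = shift ((shift ^^ k) x)" by simp
 ultimately have "\<bar>r x - r ((shift ^^ Suc k) x)\<bar> <= real k * K + K" using Suc by (simp del: funpow.simps)
 then show ?case by (simp add: distrib_right)
qed simp

text \<open>Continuity is used at a single point \<open>z\<close>. One fixed word that starts like
  \<open>z\<close> and leads to \<open>a\<close> can be put in front of every point of the cylinder;
  the spliced point has a value close to \<open>r z\<close> and reaches the given point in a fixed
  number of steps, each changing \<open>r\<close> by at most \<open>K\<close>.\<close>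

lemma coboundary_bounded_V:
 assumes c: "shift_continuous E r" and r: "!!x. x : X ==> \<bar>r x - r (shift x)\<bar> <= K"
 shows "\<exists>C\<ge>0. \<forall>x\<in>V a. \<bar>r x\<bar> <= C"
proof -
 obtain z where z: "z : X" "z 0 = a" using V_nonempty[of a] by blast
 have K: "0 <= K" using r[OF z(1)] by linarith
 have "\<exists>n. \<forall>y\<in>X. agree n z y --> \<bar>r z - r y\<bar> < 1"
  using c[unfolded shift_continuous_iff, rule_format, OF z(1), of 1] by simp
 then obtain n where n: "!!y. y : X ==> agree n z y ==> \<bar>r z - r y\<bar> < 1" by blast
 obtain k y where y: "Suc n <= k" "y : X" "agree (Suc n) z y" "(shift ^^ k) y = z"
  using cylinder_path[OF z(1) z(1), of n] by blast
 have "(shift ^^ k) y 0 = a" using y(4) z(2) by simp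
 then have yk: "y k = a" by (simp add: funpow_shift)
 have "\<bar>r x\<bar> <= \<bar>r z\<bar> + 1 + real k * K" if x: "x : V a" for x
 proof -
  define w where "w = (%i. if i < k then y i else x (i - k))"
  have xX: "x : X" and yx: "y k = x 0" using x yk by auto
  have w: "w : X" "(shift ^^ k) w = x" unfolding w_def using splice[OF y(2) xX yx] by auto
  have "agree n z w" using y(1,3) by (auto simp: agree_def w_def)
  then have "\<bar>r z - r w\<bar> < 1" by (rule n[OF w(1)])
  moreover have "\<bar>r w - r x\<bar> <= real k * K" using coboundary_iter[of r K w k, OF r w(1)] w(2) by simp
  ultimately show ?thesis by linarith
 qed
 moreover have "0 <= \<bar>r z\<bar> + 1 + real k * K" using K by simp
 ultimately show ?thesis by blast
qed

lemma BB_eq_1: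
 "x : X ==> (\<forall>j y. 1 <= j --> j <= k --> y : V a --> (shift ^^ j) y ~= x) ==> (BB ^^ k) un x = 1"
proof (induction k arbitrary: x)
 case (Suc k)
 have na: "\<not> E a (x 0)"
 proof
  assume "E a (x 0)"
  then have m1: "case_nat a x : V a" using Suc.prems(1) by simp
  show False using Suc.prems(2)[rule_format, OF _ _ m1, of 1] by simp
 qed
 have pre: "(BB ^^ k) un (case_nat c x) = 1" if c: "E c (x 0)" for c
 proof (rule Suc.IH)
  show "case_nat c x : X" using c Suc.prems(1) by simp
  show "\<forall>j y. 1 <= j --> j <= k --> y : V a --> (shift ^^ j) y ~= case_nat c x"
  proof (intro allI impI notI)
   fix j y assume j: "1 <= j" "j <= k" "y : V a" "(shift ^^ j) y = case_nat c x"
   have "(shift ^^ Suc j) y = x" using j(4) by simp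
   moreover have "1 <= Suc j" "Suc j <= Suc k" using j by auto
   ultimately show False using Suc.prems(2) j(3) by blast
  qed
 qed
 have "BB ((BB ^^ k) un) x = TT un x"
  unfolding tr_def[of E lg "- {a}" "(BB ^^ k) un" x] tr_def[of E lg UNIV un x]
  by (rule nn_integral_cong) (use na pre in auto)
 then show ?case using tr_lg_1[OF Suc.prems(1)] by simp
qed simp

text \<open>With \<open>N\<close> the least number of steps from \<open>a\<close> to
  \<open>x\<close>, no backward walk from \<open>x\<close> meets \<open>a\<close> earlier, so the
  Green function is at least \<open>N\<close>. Meanwhile \<open>r\<close> changes by at most
  \<open>K\<close> per step, starting from a bounded value on the cylinder.\<close>

lemma coboundary_le_gr:
 assumes c: "shift_continuous E r" and r: "!!x. x : X ==> \<bar>r x - r (shift x)\<bar> <= K"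
 shows "\<exists>C\<ge>0. \<forall>x\<in>X. \<bar>r x\<bar> <= C * gr x"
proof -
 obtain C where C: "0 <= C" "!!x. x : V a ==> \<bar>r x\<bar> <= C" using coboundary_bounded_V[OF c r] by blast
 obtain z where z: "z : X" using V_nonempty[of a] by blast
 have K: "0 <= K" using r[OF z] by linarith
 have "\<bar>r x\<bar> <= (C + K) * gr x" if x: "x : X" for x
 proof -
  define Q where "Q N \<longleftrightarrow> 1 <= N & (\<exists>y\<in>V a. (shift ^^ N) y = x)" for N :: nat
  define N where "N = (LEAST N. Q N)"
  obtain n y0 where "n >= 1" "y0 : X" "y0 0 = a" "(shift ^^ n) y0 = x" using path_to[OF x, of a] by blast
  then have "Q n" unfolding Q_def by auto
  then have QN: "Q N" unfolding N_def by (rule LeastI)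
  then obtain y where y: "y : V a" "(shift ^^ N) y = x" unfolding Q_def by blast
  have BN: "(BB ^^ k) un x = 1" if k: "k < N" for k
  proof (rule BB_eq_1[OF x], intro allI impI notI)
   fix j y assume "1 <= j" "j <= k" "y : V a" "(shift ^^ j) y = x"
   then have "Q j" unfolding Q_def by blast
   then have "N <= j" unfolding N_def by (rule Least_le)
   then show False using k \<open>j <= k\<close> by simp
  qed
  have "ennreal (real N) = (\<Sum>k<N. (BB ^^ k) un x)" using BN by (simp add: ennreal_of_nat_eq_real_of_nat)
  also have "... <= gg x" unfolding G_def by (rule sum_le_suminf) auto
  finally have "ennreal (real N) <= ennreal (gr x)" unfolding gr(1)[OF x] .
  then have N: "real N <= gr x" using gr(2)[OF x] by (subst (asm) ennreal_le_iff) auto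
  have yX: "y : X" using y by simp
  have "\<bar>r y - r x\<bar> <= real N * K" using coboundary_iter[of r K y N, OF r yX] y(2) by simp
  then have "\<bar>r x\<bar> <= C + real N * K" using C(2)[OF y(1)] by linarith
  also have "... <= C * gr x + gr x * K"
   using mult_left_mono[OF gr(2)[OF x] C(1)] mult_right_mono[OF N K] by simp
  finally show ?thesis by (simp add: algebra_simps)
 qed
 then show ?thesis using C(1) K by (intro exI[of _ "C + K"]) auto
qed

end

section \<open>The Poisson equation\<close>

context normalised_shift
begin

lemma Lb_const: "x : X ==> Lb lg a (%_. ennreal c) x = ennreal c"
 using Lb_cmult[of lg a "ennreal c" "%_. 1" x] Lb_lg_1[of x] by simp

lemma Lb_bounds:
 assumes "!!y. y : V a ==> ennreal \<alpha> <= w y & w y <= ennreal \<beta>" "x : X"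
 shows "ennreal \<alpha> <= Lb lg a w x & Lb lg a w x <= ennreal \<beta>"
 using Lb_mono[of a "%_. ennreal \<alpha>" w x lg] Lb_mono[of a w "%_. ennreal \<beta>" x lg] assms Lb_const[OF assms(2)] by simp

text \<open>On the cylinder this is the contraction; elsewhere \<open>Lb\<close> averages values
  taken on the cylinder, so one application carries the same bounds to \<open>X\<close>. Hence the
  iterates are counted from \<open>Suc n\<close>.\<close>

lemma Lb_iterate_limit:
 assumes u: "cone (V a) Dc u" and S: "!!x. x : V a ==> u x <= ennreal S" "0 <= S"
 shows "\<exists>c t. 0 <= c & (\<forall>n. \<forall>x\<in>X. (Lb lg a ^^ Suc n) u x = ennreal (t n x) & 0 <= t n x & \<bar>t n x - c\<bar> <= gm ^ n * S)"
proof -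
 have ex: "\<exists>c\<ge>0. \<forall>x\<in>V a. ennreal c <= (Lb lg a ^^ n) u x & (Lb lg a ^^ n) u x <= ennreal (c + gam Dc Dc' ^ n * S)" for n
 proof (rule cone_contraction[where K="%_. Lb lg a" and U="%n. (Lb lg a ^^ n) u"])
  show "Lb lg a (%y. ennreal c + u y) x = ennreal c + Lb lg a u x" if "x : V a" for c u x
   using that Lb_const[of x c] by (simp add: Lb_add)
  show "Lb lg a u x <= Lb lg a v x" if "!!y. y : V a ==> u y <= v y" "x : V a" for u v x
   using that by (intro Lb_mono) auto
  show "cone (V a) Dc' (Lb lg a u)" if "cone (V a) Dc u" for u
   using cone_Lb[OF wvar_lg that Dc(4)] unfolding Dc'_def by (rule cone_subset) auto
 qed (use u S Dc in auto)
 have "\<forall>n. \<exists>c. 0 <= c & (\<forall>x\<in>V a. ennreal c <= (Lb lg a ^^ n) u x & (Lb lg a ^^ n) u x <= ennreal (c + gm ^ n * S))"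
 proof
  fix n
  show "\<exists>c. 0 <= c & (\<forall>x\<in>V a. ennreal c <= (Lb lg a ^^ n) u x & (Lb lg a ^^ n) u x <= ennreal (c + gm ^ n * S))"
   unfolding gm_def by (rule ex)
 qed
 from choice[OF this] obtain c
  where cn: "\<forall>n. 0 <= c n & (\<forall>x\<in>V a. ennreal (c n) <= (Lb lg a ^^ n) u x & (Lb lg a ^^ n) u x <= ennreal (c n + gm ^ n * S))" ..
 have c0: "0 <= c n" for n using cn[rule_format, of n] by (rule conjunct1)
 have c: "ennreal (c n) <= (Lb lg a ^^ n) u x & (Lb lg a ^^ n) u x <= ennreal (c n + gm ^ n * S)" if "x : V a" for n x
  using conjunct2[OF spec[OF cn, of n]] that by (rule bspec)
 have b: "ennreal (c n) <= (Lb lg a ^^ Suc (n + k)) u x & (Lb lg a ^^ Suc (n + k)) u x <= ennreal (c n + gm ^ n * S)"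
  if "x : X" for n k x
  using that
 proof (induction k arbitrary: x)
  case 0
  have "ennreal (c n) <= Lb lg a ((Lb lg a ^^ n) u) x & Lb lg a ((Lb lg a ^^ n) u) x <= ennreal (c n + gm ^ n * S)"
   by (rule Lb_bounds[OF _ 0]) (erule c)
  then show ?case by simp
 next
  case (Suc k)
  have "ennreal (c n) <= Lb lg a ((Lb lg a ^^ Suc (n + k)) u) x & Lb lg a ((Lb lg a ^^ Suc (n + k)) u) x <= ennreal (c n + gm ^ n * S)"
  proof (rule Lb_bounds[OF _ Suc.prems])
   fix y assume "y : V a"
   then have "y : X" by simp
   then show "ennreal (c n) <= (Lb lg a ^^ Suc (n + k)) u y & (Lb lg a ^^ Suc (n + k)) u y <= ennreal (c n + gm ^ n * S)"
    by (rule Suc.IH)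
  qed
  then show ?case by simp
 qed
 define t where "t n x = enn2real ((Lb lg a ^^ Suc n) u x)" for n x
 have te: "(Lb lg a ^^ Suc n) u x = ennreal (t n x)" if x: "x : X" for n x
 proof -
  have "(Lb lg a ^^ Suc n) u x <= ennreal (c n + gm ^ n * S)" using b[OF x, of n 0] by simp
  then have "(Lb lg a ^^ Suc n) u x < top" by (rule le_less_trans) simp
  then show ?thesis unfolding t_def by (simp del: funpow.simps)
 qed
 have t0: "0 <= t n x" for n x by (simp add: t_def)
 have tb: "c n <= t (n + k) x" "t (n + k) x <= c n + gm ^ n * S" if x: "x : X" for n k x
 proof -
  have "0 <= c n + gm ^ n * S" using c0[of n] gm S(2) by simp
  then show "t (n + k) x <= c n + gm ^ n * S"
   using b[OF x, of n k] unfolding te[OF x] by (simp add: ennreal_le_iff)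
  show "c n <= t (n + k) x" using b[OF x, of n k] t0[of "n + k" x] unfolding te[OF x] by (simp add: ennreal_le_iff)
 qed
 obtain x0 where x0: "x0 : X" using V_nonempty[of a] by blast
 have cc: "c n <= c k + gm ^ k * S" for n k
  using tb(1)[OF x0, of n k] tb(2)[OF x0, of k n] unfolding add.commute[of k n] by linarith
 have bdd: "bdd_above (range c)" using cc[of _ 0] by (intro bdd_aboveI[of _ "c 0 + gm ^ 0 * S"]) auto
 define cs where "cs = (SUP n. c n)"
 have cs1: "c n <= cs" for n unfolding cs_def by (rule cSUP_upper[OF _ bdd]) simp
 have cs2: "cs <= c n + gm ^ n * S" for n unfolding cs_def by (rule cSUP_least) (auto intro: cc)
 have "\<bar>t n x - cs\<bar> <= gm ^ n * S" if x: "x : X" for n x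
  using tb[OF x, of n 0] cs1[of n] cs2[of n] by (simp add: abs_le_iff)
 moreover have "0 <= cs" using c0[of 0] cs1[of 0] by linarith
 ultimately show ?thesis using te t0 by (intro exI[of _ cs] exI[of _ t]) auto
qed

text \<open>\<open>G w\<close> solves \<open>T u + w = u\<close> up to the term \<open>A u\<close>
  that re-enters through \<open>a\<close>. Since \<open>A R + B (Lb R) = Lb R\<close>, adding
  \<open>Lb R\<close> absorbs the re-entry term of \<open>R\<close> and creates that of
  \<open>Lb R\<close>, so a partial sum carries a single error term, the last one.\<close>

lemma telescope:
 "TT (%y. \<Sum>n<Suc N. (Lb lg a ^^ n) (G lg a w) y) x + w x =
 (\<Sum>n<Suc N. (Lb lg a ^^ n) (G lg a w) x) + AA ((Lb lg a ^^ N) (G lg a w)) x"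
proof (induction N)
 case 0
 have "TT (G lg a w) x + w x = (w x + BB (G lg a w) x) + AA (G lg a w) x" by (simp add: TT_split ac_simps)
 then show ?case by (simp add: G_unfold[symmetric])
next
 case (Suc N)
 define S where "S y = (\<Sum>n<Suc N. (Lb lg a ^^ n) (G lg a w) y)" for y
 define R where "R = (Lb lg a ^^ N) (G lg a w)"
 define R' where "R' = Lb lg a R"
 have S': "(\<Sum>n<Suc (Suc N). (Lb lg a ^^ n) (G lg a w) y) = S y + R' y" for y
  by (simp add: S_def R'_def R_def)
 have IH: "TT S x + w x = S x + AA R x" using Suc unfolding S_def R_def .
 have "TT (%y. S y + R' y) x + w x = (TT S x + w x) + (AA R' x + BB R' x)"
  by (simp add: tr_add TT_split[of R'] ac_simps)
 also have "... = (S x + AA R x) + (AA R' x + BB R' x)" unfolding IH ..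
 also have "... = S x + (AA R x + BB R' x) + AA R' x" by (simp add: ac_simps)
 also have "AA R x + BB R' x = R' x" unfolding R'_def by (rule Lb_unfold[symmetric])
 finally show ?case unfolding S' by (simp add: R'_def R_def)
qed

text \<open>Linearity for signed functions while the operator acts on nonnegative ones: negative
  terms are moved to the other side. The constant \<open>e\<close> does not grow, because the
  restricted operator maps 1 below 1.\<close>

lemma tr_real_le:
 assumes x: "x : X"
  and ineq: "!!y. y : X ==> 0 <= p y & 0 <= q y & 0 <= r y & 0 <= s y & p y + c * q y <= r y + d * s y + e"
  and cde: "0 <= c" "0 <= d" "0 <= e"
  and tr: "tr E lg S (%y. ennreal (p y)) x = ennreal p'" "tr E lg S (%y. ennreal (q y)) x = ennreal q'"
   "tr E lg S (%y. ennreal (r y)) x = ennreal r'" "tr E lg S (%y. ennreal (s y)) x = ennreal s'"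
  and nn: "0 <= p'" "0 <= q'" "0 <= r'" "0 <= s'"
 shows "p' + c * q' <= r' + d * s' + e"
proof -
 have "tr E lg S (%_. 1) x <= 1" using tr_le_UNIV[of E lg S "%_. 1" x] tr_lg_1[OF x] by simp
 then have one: "ennreal e * tr E lg S (%_. 1) x <= ennreal e" by (metis mult.right_neutral mult_left_mono zero_le)
 have "tr E lg S (%y. ennreal (p y) + ennreal c * ennreal (q y)) x \<le>
   tr E lg S (%y. (ennreal (r y) + ennreal d * ennreal (s y)) + ennreal e * 1) x"
 proof (rule tr_mono[OF _ x])
  fix y assume y: "y : X"
  note i = ineq[OF y]
  have "ennreal (p y + c * q y) <= ennreal (r y + d * s y + e)" using i by (intro ennreal_leI) auto
  moreover have "ennreal (p y + c * q y) = ennreal (p y) + ennreal c * ennreal (q y)"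
   using i cde by (simp add: ennreal_plus ennreal_mult)
  moreover have "ennreal (r y + d * s y + e) = (ennreal (r y) + ennreal d * ennreal (s y)) + ennreal e * 1"
   using i cde by (simp add: ennreal_plus ennreal_mult)
  ultimately show "ennreal (p y) + ennreal c * ennreal (q y) <= (ennreal (r y) + ennreal d * ennreal (s y)) + ennreal e * 1" by simp
 qed
 then have "ennreal p' + ennreal c * ennreal q' <= (ennreal r' + ennreal d * ennreal s') + ennreal e * tr E lg S (%_. 1) x"
  unfolding tr_add tr_cmult tr .
 also have "... <= (ennreal r' + ennreal d * ennreal s') + ennreal e" by (rule add_left_mono[OF one])
 finally have "ennreal p' + ennreal c * ennreal q' <= (ennreal r' + ennreal d * ennreal s') + ennreal e" .
 moreover have "ennreal p' + ennreal c * ennreal q' = ennreal (p' + c * q')"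
  using nn cde by (simp add: ennreal_plus ennreal_mult)
 moreover have "(ennreal r' + ennreal d * ennreal s') + ennreal e = ennreal (r' + d * s' + e)"
  using nn cde by (simp add: ennreal_plus ennreal_mult)
 ultimately have "ennreal (p' + c * q') <= ennreal (r' + d * s' + e)" by simp
 then show ?thesis using nn cde by (subst (asm) ennreal_le_iff) auto
qed

lemma cone_continuous:
 assumes c: "cone X D' u" and u: "!!x. x : X ==> u x = ennreal (f x)" "!!x. x : X ==> 0 <= f x" and D': "0 <= D'"
 shows "shift_continuous E f"
 unfolding shift_continuous_iff
proof (intro ballI allI impI)
 fix x and \<epsilon> :: real assume x: "x : X" and e: "0 < \<epsilon>"
 have "(%n. exp (D' * \<theta> ^ Suc n)) \<longlonglongrightarrow> exp (D' * 0)"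
  using theta by (intro tendsto_intros LIMSEQ_Suc LIMSEQ_power_zero) auto
 then have "(%n. (exp (D' * \<theta> ^ Suc n) - 1) * (exp D' * f x)) \<longlonglongrightarrow> (exp (D' * 0) - 1) * (exp D' * f x)"
  by (intro tendsto_mult tendsto_diff tendsto_const)
 then have "(%n. (exp (D' * \<theta> ^ Suc n) - 1) * (exp D' * f x)) \<longlonglongrightarrow> 0" by simp
 then have "\<forall>\<^sub>F n in sequentially. (exp (D' * \<theta> ^ Suc n) - 1) * (exp D' * f x) < \<epsilon>" using e by (rule order_tendstoD(2))
 then obtain n where n: "(exp (D' * \<theta> ^ Suc n) - 1) * (exp D' * f x) < \<epsilon>" by (auto simp: eventually_sequentially)
 define q where "q = exp (D' * \<theta> ^ Suc n)"
 have q: "1 <= q" "q <= exp D'" unfolding q_def using D' theta_pow(1,2)[of "Suc n"] by (auto intro: mult_left_le simp del: power_Suc)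
 have "\<bar>f x - f y\<bar> < \<epsilon>" if y: "y : X" "agree (Suc n) x y" for y
 proof -
  have "u x <= ennreal q * u y" unfolding q_def by (rule coneD[OF c _ x y]) simp
  then have 1: "f x <= q * f y" unfolding u(1)[OF x] u(1)[OF y(1)] using u(2)[OF y(1)] q
   by (simp add: ennreal_mult[symmetric] ennreal_le_iff)
  have "u y <= ennreal q * u x" unfolding q_def by (rule coneD[OF c _ y(1) x agree_sym[OF y(2)]]) simp
  then have 2: "f y <= q * f x" unfolding u(1)[OF x] u(1)[OF y(1)] using u(2)[OF x] q
   by (simp add: ennreal_mult[symmetric] ennreal_le_iff)
  have fy: "f y <= exp D' * f x" using 2 mult_right_mono[OF q(2) u(2)[OF x]] by linarith
  have "(q - 1) * f x <= (q - 1) * (exp D' * f x)"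
   using q D' u(2)[OF x] mult_right_mono[of 1 "exp D'" "f x"] by (intro mult_left_mono) auto
  moreover have "(q - 1) * f y <= (q - 1) * (exp D' * f x)" using q fy by (intro mult_left_mono) auto
  moreover have "f x - f y <= (q - 1) * f y" "f y - f x <= (q - 1) * f x" using 1 2 by (auto simp: algebra_simps)
  ultimately show ?thesis using n unfolding q_def[symmetric] by linarith
 qed
 then show "\<exists>n. \<forall>y\<in>X. agree n x y --> \<bar>f x - f y\<bar> < \<epsilon>" by blast
qed

lemma shift_continuous_add: "shift_continuous E f ==> shift_continuous E g ==> shift_continuous E (%x. f x + g x)"
 unfolding shift_continuous_iff
proof (intro ballI allI impI)
 fix x and \<epsilon> :: real
 assume f: "\<forall>x\<in>X. \<forall>\<epsilon>>0. \<exists>n. \<forall>y\<in>X. agree n x y --> \<bar>f x - f y\<bar> < \<epsilon>"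
  and g: "\<forall>x\<in>X. \<forall>\<epsilon>>0. \<exists>n. \<forall>y\<in>X. agree n x y --> \<bar>g x - g y\<bar> < \<epsilon>" and x: "x : X" and e: "0 < \<epsilon>"
 have e2: "0 < \<epsilon> / 2" using e by simp
 obtain n where n: "\<forall>y\<in>X. agree n x y --> \<bar>f x - f y\<bar> < \<epsilon> / 2" using f x e2 by blast
 obtain k where k: "\<forall>y\<in>X. agree k x y --> \<bar>g x - g y\<bar> < \<epsilon> / 2" using g x e2 by blast
 have "\<bar>(f x + g x) - (f y + g y)\<bar> < \<epsilon>" if y: "y : X" "agree (max n k) x y" for y
 proof -
  have "agree n x y" "agree k x y" using agree_mono[OF y(2)] by auto
  then have "\<bar>f x - f y\<bar> < \<epsilon> / 2" "\<bar>g x - g y\<bar> < \<epsilon> / 2" using n k y(1) by auto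
  then show ?thesis by linarith
 qed
 then show "\<exists>n. \<forall>y\<in>X. agree n x y --> \<bar>f x + g x - (f y + g y)\<bar> < \<epsilon>" by blast
qed

lemma shift_continuous_cmult: "shift_continuous E f ==> shift_continuous E (%x. c * f x)"
 unfolding shift_continuous_iff
proof (intro ballI allI impI)
 fix x and \<epsilon> :: real
 assume f: "\<forall>x\<in>X. \<forall>\<epsilon>>0. \<exists>n. \<forall>y\<in>X. agree n x y --> \<bar>f x - f y\<bar> < \<epsilon>" and x: "x : X" and e: "0 < \<epsilon>"
 have e2: "0 < \<epsilon> / (\<bar>c\<bar> + 1)" using e by (simp add: add_nonneg_pos)
 obtain n where n: "\<forall>y\<in>X. agree n x y --> \<bar>f x - f y\<bar> < \<epsilon> / (\<bar>c\<bar> + 1)" using f x e2 by blast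
 have "\<bar>c * f x - c * f y\<bar> < \<epsilon>" if y: "y : X" "agree n x y" for y
 proof -
  have "\<bar>c * f x - c * f y\<bar> = \<bar>c\<bar> * \<bar>f x - f y\<bar>" by (simp add: abs_mult[symmetric] right_diff_distrib)
  also have "... <= (\<bar>c\<bar> + 1) * \<bar>f x - f y\<bar>" by (intro mult_right_mono) auto
  also have "... < (\<bar>c\<bar> + 1) * (\<epsilon> / (\<bar>c\<bar> + 1))" using n y by (intro mult_strict_left_mono) auto
  also have "... = \<epsilon>" by (simp add: add_nonneg_eq_0_iff)
  finally show ?thesis .
 qed
 then show "\<exists>n. \<forall>y\<in>X. agree n x y --> \<bar>c * f x - c * f y\<bar> < \<epsilon>" by blast
qed

lemma shift_continuous_uniform_limit:
 assumes f: "!!n. shift_continuous E (f n)" and lim: "e \<longlonglongrightarrow> 0" and b: "!!n x. x : X ==> \<bar>v x - f n x\<bar> <= e n"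
 shows "shift_continuous E v"
 unfolding shift_continuous_iff
proof (intro ballI allI impI)
 fix x and \<epsilon> :: real assume x: "x : X" and e: "0 < \<epsilon>"
 have "\<forall>\<^sub>F n in sequentially. e n < \<epsilon> / 3" using lim e by (intro order_tendstoD(2)) auto
 then obtain N where N: "e N < \<epsilon> / 3" by (auto simp: eventually_sequentially)
 have e3: "0 < \<epsilon> / 3" using e by simp
 obtain n where n: "\<forall>y\<in>X. agree n x y --> \<bar>f N x - f N y\<bar> < \<epsilon> / 3"
  using f[of N, unfolded shift_continuous_iff, rule_format, OF x e3] by blast
 have "\<bar>v x - v y\<bar> < \<epsilon>" if y: "y : X" "agree n x y" for y
 proof -
  have "\<bar>f N x - f N y\<bar> < \<epsilon> / 3" using n y by blast
  then show ?thesis using b[OF x, of N] b[OF y(1), of N] N by linarith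
 qed
 then show "\<exists>n. \<forall>y\<in>X. agree n x y --> \<bar>v x - v y\<bar> < \<epsilon>" by blast
qed

lemma shift_continuous_shift: "shift_continuous E f ==> shift_continuous E (%x. f (shift x))"
 unfolding shift_continuous_iff
proof (intro ballI allI impI)
 fix x and \<epsilon> :: real
 assume f: "\<forall>x\<in>X. \<forall>\<epsilon>>0. \<exists>n. \<forall>y\<in>X. agree n x y --> \<bar>f x - f y\<bar> < \<epsilon>" and x: "x : X" and e: "0 < \<epsilon>"
 have sx: "shift x : X" using x by auto
 obtain n where n: "\<forall>y\<in>X. agree n (shift x) y --> \<bar>f (shift x) - f y\<bar> < \<epsilon>" using f sx e by blast
 have "\<bar>f (shift x) - f (shift y)\<bar> < \<epsilon>" if y: "y : X" "agree (Suc n) x y" for y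
  using n agree_shift[OF y(2)] shift_in_sigma[OF y(1)] by blast
 then show "\<exists>n. \<forall>y\<in>X. agree n x y --> \<bar>f (shift x) - f (shift y)\<bar> < \<epsilon>" by blast
qed

text \<open>One constant serves both the supremum and the Hoelder seminorm. The estimates below are
  homogeneous in it, which is what makes the final bound linear in the norm.\<close>

definition hol :: "real => ((nat => 'a) => real) => bool" where
 "hol K \<psi> \<longleftrightarrow> (\<forall>x\<in>X. \<bar>\<psi> x\<bar> <= K) & (\<forall>n\<ge>1. \<forall>x\<in>X. \<forall>y\<in>X. agree n x y --> \<bar>\<psi> x - \<psi> y\<bar> <= K * \<theta> ^ n)"

text \<open>Unfolding shows that \<open>B\<close> does not increase the Green function, and
  \<open>A\<close> reads it on the cylinder only, where it is bounded.\<close>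

lemma TT_gr_finite: "\<exists>C\<ge>0. \<forall>x\<in>X. TT gg x <= ennreal (C * gr x)"
proof -
 obtain C where C: "1 <= C" "!!x. x : V a ==> gg x <= ennreal C" using gg_V by blast
 have "TT gg x <= ennreal ((C + 1) * gr x)" if x: "x : X" for x
 proof -
  have "AA gg x <= AA (%_. ennreal C * 1) x" using C by (intro tr_mono[OF _ x]) auto
  also have "... = ennreal C * AA (%_. 1) x" by (rule tr_cmult)
  also have "... <= ennreal C * 1"
   using tr_le_UNIV[of E lg "{a}" "%_. 1" x] tr_lg_1[OF x] by (intro mult_left_mono) auto
  finally have 1: "AA gg x <= ennreal C" by simp
  have 2: "BB gg x <= gg x" using G_unfold[of lg a un x] by (metis add.commute le_iff_add)
  have "TT gg x <= ennreal C + ennreal (gr x)" unfolding TT_split using 1 2 unfolding gr(1)[OF x] by (rule add_mono)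
  also have "... = ennreal (C + gr x)" using C gr(2)[OF x] by (subst ennreal_plus) auto
  also have "... <= ennreal ((C + 1) * gr x)"
   using mult_left_mono[OF gr(2)[OF x], of C] C by (intro ennreal_leI) (simp add: distrib_right)
  finally show ?thesis .
 qed
 then show ?thesis using C by (intro exI[of _ "C + 1"]) auto
qed

text \<open>Adding \<open>2 * K\<close> makes the data at least \<open>K\<close>, which puts them in
  a cone. The \<open>Lb\<close> iterates of \<open>G w1\<close> and of \<open>G 1\<close> both
  converge to constants, and \<kappa> is the ratio of these, so the combination with \<kappa> tends
  to 0 geometrically. In the end \<open>\<kappa> - 2 * K\<close> turns out to be the integral of
  \<psi>.\<close>

lemma poisson_data:
 assumes C0: "1 <= C0" "!!x. x : V a ==> gg x <= ennreal C0" and K: "0 < K" and psi: "hol K \<psi>"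
 defines "w1 \<equiv> (%x. ennreal (\<psi> x + 2 * K))"
 shows "\<exists>\<kappa> d t1 tg. 0 <= \<kappa> & \<kappa> <= 6 * K * C0 &
  (\<forall>x\<in>X. G lg a w1 x = ennreal (d x) & 0 <= d x & d x <= 3 * K * gr x) & shift_continuous E d &
  (\<forall>n. shift_continuous E (t1 n) & shift_continuous E (tg n)) &
  (\<forall>n. \<forall>x\<in>X. (Lb lg a ^^ Suc n) (G lg a w1) x = ennreal (t1 n x) & 0 <= t1 n x &
    (Lb lg a ^^ Suc n) gg x = ennreal (tg n x) & 0 <= tg n x & \<bar>t1 n x - \<kappa> * tg n x\<bar> <= 9 * K * C0\<^sup>2 * gm ^ n)"
proof -
 have pb: "K <= \<psi> x + 2 * K" "\<psi> x + 2 * K <= 3 * K" if "x : X" for x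
  using psi that unfolding hol_def by (auto simp: abs_le_iff)
 have w1c: "cone X Dc w1"
 proof (rule coneI)
  fix n x y assume n: "1 <= n" "x : X" "y : X" "agree n x y"
  define q where "q = \<theta> ^ n"
  have q: "0 <= q" unfolding q_def using theta_pow(1)[of n] by simp
  have "\<bar>\<psi> x - \<psi> y\<bar> <= K * q" using psi n unfolding hol_def q_def by blast
  then have "\<psi> x + 2 * K <= (\<psi> y + 2 * K) + q * K" by (simp add: abs_le_iff mult.commute)
  also have "... <= (\<psi> y + 2 * K) + q * (\<psi> y + 2 * K)" using pb(1)[OF n(3)] q by (intro add_left_mono mult_left_mono)
  also have "... = (1 + q) * (\<psi> y + 2 * K)" by (simp add: distrib_right)
  also have "... <= exp (Dc * q) * (\<psi> y + 2 * K)"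
  proof (rule mult_right_mono)
   have "1 + q <= exp q" by (rule exp_ge_add_one_self)
   also have "... <= exp (Dc * q)" using mult_right_mono[OF Dc(1) q] by simp
   finally show "1 + q <= exp (Dc * q)" .
   show "0 <= \<psi> y + 2 * K" using pb(1)[OF n(3)] K by linarith
  qed
  finally have "ennreal (\<psi> x + 2 * K) <= ennreal (exp (Dc * q) * (\<psi> y + 2 * K))" by (rule ennreal_leI)
  also have "... = ennreal (exp (Dc * q)) * ennreal (\<psi> y + 2 * K)"
   using pb(1)[OF n(3)] K by (intro ennreal_mult) auto
  finally show "w1 x <= ennreal (exp (Dc * \<theta> ^ n)) * w1 y" unfolding w1_def q_def .
 qed
 have D1c: "cone X Dc (G lg a w1)" by (rule cone_G[OF wvar_lg w1c Dc(4)])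
 define d where "d x = enn2real (G lg a w1 x)" for x
 have D1le: "G lg a w1 x <= ennreal (3 * K * gr x)" if x: "x : X" for x
 proof -
  have "G lg a w1 x <= G lg a (%_. ennreal (3 * K) * 1) x"
   unfolding w1_def using pb by (intro G_mono[OF _ x]) (auto intro: ennreal_leI)
  also have "... = ennreal (3 * K) * gg x" by (rule G_cmult)
  also have "... = ennreal (3 * K * gr x)" unfolding gr(1)[OF x] using K gr(2)[OF x] by (intro ennreal_mult[symmetric]) auto
  finally show ?thesis .
 qed
 have d: "G lg a w1 x = ennreal (d x)" "0 <= d x" "d x <= 3 * K * gr x" if x: "x : X" for x
 proof -
  have "G lg a w1 x < top" using D1le[OF x] by (rule le_less_trans) simp
  then show e: "G lg a w1 x = ennreal (d x)" by (simp add: d_def)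
  show "0 <= d x" by (simp add: d_def)
  have "0 <= 3 * K * gr x" using K gr(2)[OF x] by simp
  then show "d x <= 3 * K * gr x" using D1le[OF x] unfolding e by (simp add: ennreal_le_iff)
 qed
 have dcont: "shift_continuous E d" by (rule cone_continuous[OF D1c d(1,2)]) (use Dc in auto)
 have D1V: "G lg a w1 x <= ennreal (3 * K * C0)" if x: "x : V a" for x
 proof -
  have xX: "x : X" using x by simp
  have "ennreal (gr x) <= ennreal C0" using C0(2)[OF x] unfolding gr(1)[OF xX] .
  then have "gr x <= C0" using C0(1) by (simp add: ennreal_le_iff)
  then have "3 * K * gr x <= 3 * K * C0" using K by (intro mult_left_mono) auto
  then show ?thesis using D1le[OF xX] ennreal_leI order_trans by blast
 qed
 have S1: "0 <= 3 * K * C0" using K C0(1) by simp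
 have C00: "0 <= C0" using C0(1) by simp
 have D1cV: "cone (V a) Dc (G lg a w1)" by (rule cone_subset[OF D1c]) auto
 have ggcV: "cone (V a) Dc gg" by (rule cone_subset[OF gg_cone]) auto
 obtain c1 t1 where c1: "0 <= c1" and t1: "!!n x. x : X ==> (Lb lg a ^^ Suc n) (G lg a w1) x = ennreal (t1 n x) & 0 <= t1 n x & \<bar>t1 n x - c1\<bar> <= gm ^ n * (3 * K * C0)"
  using Lb_iterate_limit[OF D1cV D1V S1] by blast
 obtain cg tg where cg: "0 <= cg" and tg: "!!n x. x : X ==> (Lb lg a ^^ Suc n) gg x = ennreal (tg n x) & 0 <= tg n x & \<bar>tg n x - cg\<bar> <= gm ^ n * C0"
  using Lb_iterate_limit[OF ggcV C0(2) C00] by blast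
 obtain x0 where x0: "x0 : X" using V_nonempty[of a] by blast
 have Lb1: "1 <= (Lb lg a ^^ n) gg x" if "x : X" for n x
  using that
 proof (induction n arbitrary: x)
  case 0
  then show ?case using gg_ge_1 by simp
 next
  case (Suc n)
  have "Lb lg a (%_. 1) x <= Lb lg a ((Lb lg a ^^ n) gg) x" by (rule Lb_mono[OF _ Suc.prems]) (use Suc.IH in blast)
  then show ?case using Lb_lg_1[OF Suc.prems] by simp
 qed
 \<comment> \<open>The Green function is at least 1 and \<open>Lb\<close> preserves that bound, so
   the denominator of \<kappa> cannot be small.\<close>
 have cg1: "1 <= cg"
 proof -
  have "1 <= cg + gm ^ n * C0" for n
  proof -
   have "ennreal 1 <= ennreal (tg n x0)" using Lb1[OF x0, of "Suc n"] tg[OF x0, of n] by simp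
   then have "1 <= tg n x0" by (subst (asm) ennreal_le_iff2) auto
   moreover have "\<bar>tg n x0 - cg\<bar> <= gm ^ n * C0" using tg[OF x0] by blast
   ultimately show ?thesis by linarith
  qed
  moreover have "(%n. cg + gm ^ n * C0) \<longlonglongrightarrow> cg + 0 * C0"
   using gm by (intro tendsto_intros LIMSEQ_power_zero) auto
  ultimately have "1 <= cg + 0 * C0" by (intro LIMSEQ_le_const) auto
  then show ?thesis by simp
 qed
 \<comment> \<open>The first iterate and its distance to the limit are each at most
   \<open>3 * K * C0\<close>.\<close>
 have c1le: "c1 <= 6 * K * C0"
 proof -
  have "(Lb lg a ^^ Suc 0) (G lg a w1) x0 <= ennreal (3 * K * C0)"
   using Lb_bounds[of 0 "G lg a w1" "3 * K * C0" x0] D1V x0 by simp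
  then have "t1 0 x0 <= 3 * K * C0" using t1[OF x0, of 0] S1 by (simp add: ennreal_le_iff)
  moreover have "\<bar>t1 0 x0 - c1\<bar> <= gm ^ 0 * (3 * K * C0)" using t1[OF x0] by blast
  ultimately show ?thesis by (simp add: abs_le_iff)
 qed
 define \<kappa> where "\<kappa> = c1 / cg"
 have k0: "0 <= \<kappa>" unfolding \<kappa>_def using c1 cg by simp
 have k1: "\<kappa> <= 6 * K * C0"
 proof -
  have "\<kappa> <= c1" unfolding \<kappa>_def using c1 cg1 by (simp add: divide_le_eq mult_left_le_one_le mult_le_cancel_left1)
  then show ?thesis using c1le by linarith
 qed
 have kc: "\<kappa> * cg = c1" unfolding \<kappa>_def using cg1 by simp
 \<comment> \<open>The coefficient 9 is 3 from the iterates of the data plus 6 from \<kappa> times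
   those of the Green function; \<open>C0 >= 1\<close> lets both be written with the square of
   \<open>C0\<close>.\<close>
 have diff: "\<bar>t1 n x - \<kappa> * tg n x\<bar> <= 9 * K * C0\<^sup>2 * gm ^ n" if x: "x : X" for n x
 proof -
  define q where "q = gm ^ n"
  have q: "0 <= q" unfolding q_def using gm by simp
  have 1: "\<bar>t1 n x - c1\<bar> <= q * (3 * K * C0)" using t1[OF x] unfolding q_def by blast
  have "\<bar>tg n x - cg\<bar> <= q * C0" using tg[OF x] unfolding q_def by blast
  then have "\<kappa> * \<bar>tg n x - cg\<bar> <= (6 * K * C0) * (q * C0)" using k0 k1 q C00 K by (intro mult_mono) auto
  moreover have "\<kappa> * \<bar>tg n x - cg\<bar> = \<bar>\<kappa> * tg n x - c1\<bar>" unfolding kc[symmetric] right_diff_distrib[symmetric] using k0 by (simp add: abs_mult)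
  ultimately have 2: "\<bar>\<kappa> * tg n x - c1\<bar> <= (6 * K * C0) * (q * C0)" by simp
  have "0 <= 3 * K * C0 * q" using S1 q by (rule mult_nonneg_nonneg)
  then have "(3 * K * C0 * q) * 1 <= (3 * K * C0 * q) * C0" by (rule mult_left_mono[OF C0(1)])
  then have "q * (3 * K * C0) <= (3 * K * C0) * (q * C0)" by (simp add: ac_simps)
  then have "\<bar>t1 n x - \<kappa> * tg n x\<bar> <= (3 * K * C0) * (q * C0) + (6 * K * C0) * (q * C0)" using 1 2 by linarith
  also have "... = 9 * K * C0\<^sup>2 * q" by (simp add: power2_eq_square algebra_simps)
  finally show ?thesis unfolding q_def .
 qed
 have itc: "cone X Dc ((Lb lg a ^^ n) u)" if u: "cone X Dc u" for n u
 proof (induction n)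
  case (Suc n)
  have "cone X (\<theta> * (Ag + Dc)) (Lb lg a ((Lb lg a ^^ n) u))"
   by (rule cone_Lb[OF wvar_lg cone_subset[OF Suc] Dc(4)]) auto
  then show ?case using cone_mono[OF _ Dc(4)] by simp
 qed (use u in simp)
 have "shift_continuous E (t1 n)" for n
  by (rule cone_continuous[OF itc[OF D1c, of "Suc n"]]) (use t1 Dc in auto)
 moreover have "shift_continuous E (tg n)" for n
  by (rule cone_continuous[OF itc[OF gg_cone, of "Suc n"]]) (use tg Dc in auto)
 moreover have "(Lb lg a ^^ Suc n) (G lg a w1) x = ennreal (t1 n x) & 0 <= t1 n x &
    (Lb lg a ^^ Suc n) gg x = ennreal (tg n x) & 0 <= tg n x & \<bar>t1 n x - \<kappa> * tg n x\<bar> <= 9 * K * C0\<^sup>2 * gm ^ n" if "x : X" for n x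
  using t1[OF that] tg[OF that] diff[OF that] by blast
 moreover have "G lg a w1 x = ennreal (d x) & 0 <= d x & d x <= 3 * K * gr x" if "x : X" for x using d[OF that] by blast
 ultimately show ?thesis using k0 k1 dcont by (intro exI[of _ \<kappa>] exI[of _ d] exI[of _ t1] exI[of _ tg] conjI) auto
qed

lemma gr_continuous: "shift_continuous E gr"
 by (rule cone_continuous[OF gg_cone gr(1)]) (use gr(2) Dc in force)+

text \<open>The combined series converges although the two telescoped series need not. Since
  \<open>T\<close> acts on nonnegative functions, the equation is stated for \<open>v\<close> plus
  the majorant \<open>C1 * K * gr\<close>, with the image of the majorant on the other side. The
  three summands of \<open>C1\<close> bound \<open>d\<close>, the multiple \<kappa> of the Green
  function, and the geometric series of differences.\<close>

lemma poisson:
 assumes C0: "1 <= C0" "!!x. x : V a ==> gg x <= ennreal C0" and K: "0 < K" and psi: "hol K \<psi>"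
 defines "C1 \<equiv> 3 + 6 * C0 + 9 * C0\<^sup>2 / (1 - gm)"
 shows "\<exists>\<kappa> v. 0 <= \<kappa> & \<kappa> <= 6 * K * C0 & shift_continuous E v & (\<forall>x\<in>X. \<bar>v x\<bar> <= C1 * K * gr x) &
  (\<forall>x\<in>X. TT (%y. ennreal (v y + C1 * K * gr y)) x =
   ennreal (v x - (\<psi> x + 2 * K - \<kappa>) + enn2real (TT (%y. ennreal (C1 * K * gr y)) x)) &
   0 <= v x - (\<psi> x + 2 * K - \<kappa>) + enn2real (TT (%y. ennreal (C1 * K * gr y)) x))"
proof -
 define w1 where "w1 = (%x. ennreal (\<psi> x + 2 * K))"
 obtain \<kappa> d t1 tg where k: "0 <= \<kappa>" "\<kappa> <= 6 * K * C0"
  and d: "!!x. x : X ==> G lg a w1 x = ennreal (d x) & 0 <= d x & d x <= 3 * K * gr x" and dc: "shift_continuous E d"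
  and tc: "!!n. shift_continuous E (t1 n)" "!!n. shift_continuous E (tg n)"
  and t: "!!n x. x : X ==> (Lb lg a ^^ Suc n) (G lg a w1) x = ennreal (t1 n x) & 0 <= t1 n x &
    (Lb lg a ^^ Suc n) gg x = ennreal (tg n x) & 0 <= tg n x & \<bar>t1 n x - \<kappa> * tg n x\<bar> <= 9 * K * C0\<^sup>2 * gm ^ n"
  using poisson_data[OF C0 K psi] unfolding w1_def by blast
 define Cd where "Cd = 9 * K * C0\<^sup>2"
 have Cd: "0 <= Cd" unfolding Cd_def using K C0 by simp
 have gm1: "0 < 1 - gm" using gm by simp
 define \<delta> where "\<delta> n x = t1 n x - \<kappa> * tg n x" for n x
 have db: "\<bar>\<delta> n x\<bar> <= Cd * gm ^ n" if "x : X" for n x using t[OF that, of n] unfolding \<delta>_def Cd_def by blast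
 have gs: "(%n. Cd * gm ^ n) sums (Cd * (1 / (1 - gm)))" using gm by (intro sums_mult geometric_sums) auto
 have ds: "summable (%n. \<delta> n x)" if "x : X" for x
  by (rule summable_comparison_test'[OF sums_summable[OF gs], of 0]) (use db[OF that] in auto)
 define e where "e N x = d x + (- \<kappa>) * gr x + (\<Sum>n<N. \<delta> n x)" for N x
 define v where "v x = d x + (- \<kappa>) * gr x + (\<Sum>n. \<delta> n x)" for x
 define \<epsilon> where "\<epsilon> N = Cd / (1 - gm) * gm ^ N" for N
 have ve: "\<bar>v x - e N x\<bar> <= \<epsilon> N" if x: "x : X" for N x
 proof -
  have "v x - e N x = (\<Sum>n. \<delta> (n + N) x)"
   unfolding v_def e_def using suminf_split_initial_segment[OF ds[OF x], of N] by simp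
  moreover have gs2: "(%n. (Cd * gm ^ N) * gm ^ n) sums ((Cd * gm ^ N) * (1 / (1 - gm)))" using gm by (intro sums_mult geometric_sums) auto
  moreover have bb: "norm (\<delta> (n + N) x) <= (Cd * gm ^ N) * gm ^ n" for n
   using db[OF x, of "n + N"] by (simp add: power_add ac_simps)
  have "norm (\<Sum>n. \<delta> (n + N) x) <= (\<Sum>n. (Cd * gm ^ N) * gm ^ n)"
   by (rule norm_suminf_le[OF bb sums_summable[OF gs2]])
  moreover have "(\<Sum>n. (Cd * gm ^ N) * gm ^ n) = \<epsilon> N" using sums_unique[OF gs2] by (simp add: \<epsilon>_def)
  ultimately show ?thesis by simp
 qed
 have \<epsilon>0: "0 <= \<epsilon> N" for N unfolding \<epsilon>_def using Cd gm by simp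
 have \<epsilon>lim: "\<epsilon> \<longlonglongrightarrow> 0"
 proof -
  have "(%N. Cd / (1 - gm) * gm ^ N) \<longlonglongrightarrow> Cd / (1 - gm) * 0" using gm by (intro tendsto_intros LIMSEQ_power_zero) auto
  then show ?thesis unfolding \<epsilon>_def[abs_def] by simp
 qed
 have sumc: "shift_continuous E (%x. \<Sum>n<N. \<delta> n x)" for N
 proof (induction N)
  case 0
  then show ?case by (simp add: shift_continuous_iff)
 next
  case (Suc N)
  have "shift_continuous E (%x. t1 N x + (- \<kappa>) * tg N x)" by (intro shift_continuous_add shift_continuous_cmult tc)
  then have "shift_continuous E (\<delta> N)" unfolding \<delta>_def[abs_def] by simp
  from shift_continuous_add[OF Suc this] show ?case by simp
 qed
 have econt: "shift_continuous E (e N)" for N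
  unfolding e_def[abs_def] by (intro shift_continuous_add shift_continuous_cmult sumc dc gr_continuous)
 have vcont: "shift_continuous E v" by (rule shift_continuous_uniform_limit[OF econt \<epsilon>lim ve])
 have C1K: "C1 * K = 3 * K + 6 * K * C0 + Cd / (1 - gm)"
  unfolding C1_def Cd_def by (simp add: algebra_simps)
 have vb: "\<bar>v x\<bar> <= C1 * K * gr x" if x: "x : X" for x
 proof -
  have g: "1 <= gr x" by (rule gr(2)[OF x])
  have "\<bar>v x - (d x + (- \<kappa>) * gr x)\<bar> <= Cd / (1 - gm)" using ve[OF x, of 0] unfolding e_def \<epsilon>_def by simp
  moreover have "Cd / (1 - gm) <= Cd / (1 - gm) * gr x" using mult_left_mono[OF g, of "Cd / (1 - gm)"] Cd gm1 by simp
  moreover have "0 <= d x" "d x <= 3 * K * gr x" using d[OF x] by auto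
  moreover have "0 <= \<kappa> * gr x" "\<kappa> * gr x <= 6 * K * C0 * gr x" using k g by (auto intro: mult_right_mono)
  ultimately have "\<bar>v x\<bar> <= 3 * K * gr x + 6 * K * C0 * gr x + Cd / (1 - gm) * gr x" by (simp add: abs_le_iff)
  then show ?thesis unfolding C1K by (simp add: distrib_right)
 qed
 have C1K0: "0 <= C1 * K" unfolding C1K using K C0 Cd gm1 by simp
 define H where "H y = C1 * K * gr y" for y
 have H0: "0 <= H y" if "y : X" for y unfolding H_def using C1K0 gr(2)[OF that] by simp
 have vH: "0 <= v y + H y" if "y : X" for y using vb[OF that] unfolding H_def by (simp add: abs_le_iff)
 have main: "TT (%y. ennreal (v y + H y)) x = ennreal (v x - (\<psi> x + 2 * K - \<kappa>) + enn2real (TT (%y. ennreal (H y)) x)) &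
   0 <= v x - (\<psi> x + 2 * K - \<kappa>) + enn2real (TT (%y. ennreal (H y)) x)" if x: "x : X" for x
 proof -
  obtain CT where CT: "0 <= CT" "!!x. x : X ==> TT gg x <= ennreal (CT * gr x)" using TT_gr_finite by blast
  define TH where "TH = enn2real (TT (%y. ennreal (H y)) x)"
  have "TT (%y. ennreal (H y)) x = TT (%y. ennreal (C1 * K) * gg y) x"
  proof (rule tr_cong[OF _ x])
   fix y assume y: "y : X"
   have "0 <= gr y" using gr(2)[OF y] by simp
   then show "ennreal (H y) = ennreal (C1 * K) * gg y" unfolding H_def gr(1)[OF y] using C1K0 by (intro ennreal_mult)
  qed
  also have "... = ennreal (C1 * K) * TT gg x" by (rule tr_cmult)
  also have "... <= ennreal (C1 * K) * ennreal (CT * gr x)" by (intro mult_left_mono CT(2) x) simp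
  also have "... < top" by (simp add: ennreal_mult_less_top)
  finally have THf: "TT (%y. ennreal (H y)) x < top" .
  then have THe: "TT (%y. ennreal (H y)) x = ennreal TH" and TH0: "0 <= TH" by (auto simp: TH_def)
  define \<tau> where "\<tau> = enn2real (TT (%y. ennreal (v y + H y)) x)"
  have "TT (%y. ennreal (v y + H y)) x <= TT (%y. 2 * ennreal (H y)) x"
  proof (rule tr_mono[OF _ x])
   fix y assume y: "y : X"
   have "ennreal (v y + H y) <= ennreal (2 * H y)" using vb[OF y] by (intro ennreal_leI) (simp add: H_def abs_le_iff)
   then show "ennreal (v y + H y) <= 2 * ennreal (H y)" using H0[OF y] by (simp add: ennreal_mult)
  qed
  also have "... = 2 * TT (%y. ennreal (H y)) x" by (rule tr_cmult)
  also have "... < top" using THf by (simp add: ennreal_mult_less_top)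
  finally have "TT (%y. ennreal (v y + H y)) x < top" .
  then have \<tau>e: "TT (%y. ennreal (v y + H y)) x = ennreal \<tau>" and \<tau>0: "0 <= \<tau>" by (auto simp: \<tau>_def)
  define r1 where "r1 N y = d y + (\<Sum>n<N. t1 n y)" for N y
  define rg where "rg N y = gr y + (\<Sum>n<N. tg n y)" for N y
  have r0: "0 <= r1 N y" "0 <= rg N y" if y: "y : X" for N y
   unfolding r1_def rg_def using d[OF y] t[OF y] gr(2)[OF y] by (auto intro!: add_nonneg_nonneg sum_nonneg)
  have s1: "(\<Sum>n<Suc N. (Lb lg a ^^ n) (G lg a w1) y) = ennreal (r1 N y)" if y: "y : X" for N y
  proof -
   have "(\<Sum>n<Suc N. (Lb lg a ^^ n) (G lg a w1) y) = G lg a w1 y + (\<Sum>n<N. (Lb lg a ^^ Suc n) (G lg a w1) y)"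
    by (subst sum.lessThan_Suc_shift) simp
   also have "... = ennreal (d y) + (\<Sum>n<N. ennreal (t1 n y))" using d[OF y] t[OF y] by (simp del: funpow.simps)
   also have "... = ennreal (r1 N y)" unfolding r1_def using d[OF y] t[OF y] by (simp add: sum_ennreal sum_nonneg)
   finally show ?thesis .
  qed
  have sg: "(\<Sum>n<Suc N. (Lb lg a ^^ n) gg y) = ennreal (rg N y)" if y: "y : X" for N y
  proof -
   have "(\<Sum>n<Suc N. (Lb lg a ^^ n) gg y) = gg y + (\<Sum>n<N. (Lb lg a ^^ Suc n) gg y)"
    by (subst sum.lessThan_Suc_shift) simp
   also have "... = ennreal (gr y) + (\<Sum>n<N. ennreal (tg n y))" using gr(1)[OF y] t[OF y] by (simp del: funpow.simps)
   also have "... = ennreal (rg N y)" unfolding rg_def using gr(2)[OF y] t[OF y] by (simp add: sum_ennreal sum_nonneg)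
   finally show ?thesis .
  qed
  have er: "e N y = r1 N y - \<kappa> * rg N y" for N y
   unfolding e_def r1_def rg_def \<delta>_def by (simp add: sum_subtractf sum_distrib_left algebra_simps)
  \<comment> \<open>The equation holds for partial sums up to the re-entry terms \<open>A1\<close>
    and \<open>A2\<close>. \<open>i1\<close> and \<open>i2\<close> compare partial sums with
    \<open>v\<close> under \<open>T\<close>, \<open>i3\<close> and \<open>i4\<close> show that
    \<open>A1 - \<kappa> * A2\<close> is small, and \<open>vx\<close> compares at the point
    \<open>x\<close>.\<close>
  have key: "\<bar>\<tau> - (v x - (\<psi> x + 2 * K - \<kappa>) + TH)\<bar> <= 2 * \<epsilon> (Suc N) + Cd * gm ^ N" for N
  proof -
   define A1 where "A1 = enn2real (AA (%y. ennreal (t1 N y)) x)"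
   define A2 where "A2 = enn2real (AA (%y. ennreal (tg N y)) x)"
   have "AA (%y. ennreal (t1 N y)) x < top" by (auto simp: tr_singleton ennreal_mult_less_top)
   then have A1e: "AA (%y. ennreal (t1 N y)) x = ennreal A1" "0 <= A1" by (auto simp: A1_def)
   have "AA (%y. ennreal (tg N y)) x < top" by (auto simp: tr_singleton ennreal_mult_less_top)
   then have A2e: "AA (%y. ennreal (tg N y)) x = ennreal A2" "0 <= A2" by (auto simp: A2_def)
   have AA1: "AA ((Lb lg a ^^ Suc N) (G lg a w1)) x = ennreal A1" unfolding A1e(1)[symmetric] using t by (intro tr_cong[OF _ x]) blast
   have AA2: "AA ((Lb lg a ^^ Suc N) gg) x = ennreal A2" unfolding A2e(1)[symmetric] using t by (intro tr_cong[OF _ x]) blast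
   define R1 where "R1 = enn2real (TT (%y. ennreal (r1 (Suc N) y)) x)"
   define R2 where "R2 = enn2real (TT (%y. ennreal (rg (Suc N) y)) x)"
   have "TT (%y. \<Sum>n<Suc (Suc N). (Lb lg a ^^ n) (G lg a w1) y) x = TT (%y. ennreal (r1 (Suc N) y)) x"
    using s1 by (intro tr_cong[OF _ x]) blast
   then have T1: "TT (%y. ennreal (r1 (Suc N) y)) x + ennreal (\<psi> x + 2 * K) = ennreal (r1 (Suc N) x) + ennreal A1"
    using telescope[where N="Suc N" and w=w1 and x=x] unfolding s1[OF x] AA1 by (simp only: w1_def)
   have "TT (%y. \<Sum>n<Suc (Suc N). (Lb lg a ^^ n) gg y) x = TT (%y. ennreal (rg (Suc N) y)) x"
    using sg by (intro tr_cong[OF _ x]) blast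
   then have T2: "TT (%y. ennreal (rg (Suc N) y)) x + 1 = ennreal (rg (Suc N) x) + ennreal A2"
    using telescope[where N="Suc N" and w="%_. 1" and x=x] unfolding sg[OF x] AA2 by (simp only:)
   have p0: "0 <= \<psi> x + 2 * K" using psi x K unfolding hol_def by (auto simp: abs_le_iff)
   have "TT (%y. ennreal (r1 (Suc N) y)) x <= ennreal (r1 (Suc N) x) + ennreal A1" using T1 by (metis le_iff_add)
   then have "TT (%y. ennreal (r1 (Suc N) y)) x < top" by (rule le_less_trans) simp
   then have R1e: "TT (%y. ennreal (r1 (Suc N) y)) x = ennreal R1" "0 <= R1" by (auto simp: R1_def)
   have "TT (%y. ennreal (rg (Suc N) y)) x <= ennreal (rg (Suc N) x) + ennreal A2" using T2 by (metis le_iff_add)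
   then have "TT (%y. ennreal (rg (Suc N) y)) x < top" by (rule le_less_trans) simp
   then have R2e: "TT (%y. ennreal (rg (Suc N) y)) x = ennreal R2" "0 <= R2" by (auto simp: R2_def)
   have "ennreal (R1 + (\<psi> x + 2 * K)) = ennreal (r1 (Suc N) x + A1)"
    using T1 unfolding R1e(1) using R1e(2) p0 r0[OF x] A1e(2) by (simp only: ennreal_plus)
   then have R1: "R1 + (\<psi> x + 2 * K) = r1 (Suc N) x + A1" using R1e(2) p0 r0[OF x] A1e(2) by (subst (asm) ennreal_inj) auto
   have "ennreal (R2 + 1) = ennreal (rg (Suc N) x + A2)"
    using T2 unfolding R2e(1) using R2e(2) r0[OF x] A2e(2) by (simp only: ennreal_plus ennreal_1 zero_le_one)
   then have R2: "R2 + 1 = rg (Suc N) x + A2" using R2e(2) r0[OF x] A2e(2) by (subst (asm) ennreal_inj) auto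
   have i1: "\<tau> + \<kappa> * R2 <= R1 + 1 * TH + \<epsilon> (Suc N)"
   proof (rule tr_real_le[OF x _ k(1) _ \<epsilon>0 \<tau>e R2e(1) R1e(1) THe \<tau>0 R2e(2) R1e(2) TH0])
    fix y assume y: "y : X"
    have "v y <= e (Suc N) y + \<epsilon> (Suc N)" using ve[OF y, of "Suc N"] by (simp add: abs_le_iff)
    then show "0 <= v y + H y & 0 <= rg (Suc N) y & 0 <= r1 (Suc N) y & 0 <= H y & v y + H y + \<kappa> * rg (Suc N) y <= r1 (Suc N) y + 1 * H y + \<epsilon> (Suc N)"
     using vH[OF y] r0[OF y] H0[OF y] unfolding er by simp
   qed simp
   have i2: "R1 + 1 * TH <= \<tau> + \<kappa> * R2 + \<epsilon> (Suc N)"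
   proof (rule tr_real_le[OF x _ _ k(1) \<epsilon>0 R1e(1) THe \<tau>e R2e(1) R1e(2) TH0 \<tau>0 R2e(2)])
    fix y assume y: "y : X"
    have "e (Suc N) y <= v y + \<epsilon> (Suc N)" using ve[OF y, of "Suc N"] by (simp add: abs_le_iff)
    then show "0 <= r1 (Suc N) y & 0 <= H y & 0 <= v y + H y & 0 <= rg (Suc N) y & r1 (Suc N) y + 1 * H y <= v y + H y + \<kappa> * rg (Suc N) y + \<epsilon> (Suc N)"
     using vH[OF y] r0[OF y] H0[OF y] unfolding er by simp
   qed simp
   have z: "AA (%y. ennreal 0) x = ennreal 0" by simp
   have CN: "0 <= Cd * gm ^ N" using Cd gm by simp
   have i3: "A1 + 0 * A2 <= 0 + \<kappa> * A2 + Cd * gm ^ N"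
   proof (rule tr_real_le[OF x _ _ k(1) CN A1e(1) A2e(1) z A2e(1) A1e(2) A2e(2) _ A2e(2)])
    fix y assume y: "y : X"
    show "0 <= t1 N y & 0 <= tg N y & (0::real) <= 0 & 0 <= tg N y & t1 N y + 0 * tg N y <= 0 + \<kappa> * tg N y + Cd * gm ^ N"
     using t[OF y, of N] unfolding Cd_def by (auto simp: abs_le_iff)
   qed auto
   have i4: "0 + \<kappa> * A2 <= A1 + 0 * A2 + Cd * gm ^ N"
   proof (rule tr_real_le[OF x _ k(1) _ CN z A2e(1) A1e(1) A2e(1) _ A2e(2) A1e(2) A2e(2)])
    fix y assume y: "y : X"
    show "(0::real) <= 0 & 0 <= tg N y & 0 <= t1 N y & 0 <= tg N y & 0 + \<kappa> * tg N y <= t1 N y + 0 * tg N y + Cd * gm ^ N"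
     using t[OF y, of N] unfolding Cd_def by (auto simp: abs_le_iff)
   qed auto
   have kR: "\<kappa> * R2 + \<kappa> = \<kappa> * rg (Suc N) x + \<kappa> * A2" using arg_cong[OF R2, of "%z. \<kappa> * z"] by (simp add: distrib_left)
   have vx: "\<bar>v x - (r1 (Suc N) x - \<kappa> * rg (Suc N) x)\<bar> <= \<epsilon> (Suc N)" using ve[OF x, of "Suc N"] unfolding er .
   show ?thesis unfolding abs_le_iff using i1 i2 i3 i4 R1 kR vx[unfolded abs_le_iff] by auto
  qed
  have "(%N. 2 * \<epsilon> (Suc N) + Cd * gm ^ N) \<longlonglongrightarrow> 2 * 0 + Cd * 0"
   using gm by (intro tendsto_intros LIMSEQ_Suc[OF \<epsilon>lim] LIMSEQ_power_zero) auto
  then have "\<bar>\<tau> - (v x - (\<psi> x + 2 * K - \<kappa>) + TH)\<bar> <= 2 * 0 + Cd * 0"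
   using key by (intro LIMSEQ_le_const) auto
  then have "\<tau> = v x - (\<psi> x + 2 * K - \<kappa>) + TH" by simp
  then show ?thesis using \<tau>e \<tau>0 unfolding TH_def by simp
 qed
 show ?thesis using k vcont vb main unfolding H_def by blast
qed

end

section \<open>Asymptotic variance\<close>

context normalised_shift
begin

definition L2 :: "((nat => 'a) => real) => bool" where
 "L2 f \<longleftrightarrow> f : borel_measurable m & integrable m (%x. (f x)\<^sup>2)"

lemma L2_bound:
 assumes "L2 f" "g : borel_measurable m" "!!x. x : X ==> \<bar>g x\<bar> <= \<bar>f x\<bar>"
 shows "L2 g"
proof -
 have "integrable m (%x. (g x)\<^sup>2)"
 proof (rule Bochner_Integration.integrable_bound)
  show "integrable m (%x. (f x)\<^sup>2)" using assms(1) by (simp add: L2_def)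
  show "(%x. (g x)\<^sup>2) : borel_measurable m" using assms(2) by measurable
  show "AE x in m. norm ((g x)\<^sup>2) <= norm ((f x)\<^sup>2)"
   using assms(3) by (intro AE_I2) (simp add: abs_le_square_iff[symmetric])
 qed
 then show ?thesis using assms(2) by (simp add: L2_def)
qed

lemma L2_prod:
 assumes "L2 f" "L2 g" shows "integrable m (%x. f x * g x)"
proof (rule Bochner_Integration.integrable_bound[where f="%x. (f x)\<^sup>2 + (g x)\<^sup>2"])
 show "integrable m (%x. (f x)\<^sup>2 + (g x)\<^sup>2)" using assms by (simp add: L2_def)
 show "(%x. f x * g x) : borel_measurable m" using assms unfolding L2_def by (intro borel_measurable_times) auto
 have "\<bar>p * q\<bar> <= p\<^sup>2 + q\<^sup>2" for p q :: real
 proof -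
  have "2 * (\<bar>p\<bar> * \<bar>q\<bar>) <= p\<^sup>2 + q\<^sup>2" using sum_squares_bound[of "\<bar>p\<bar>" "\<bar>q\<bar>"] by (simp add: mult.assoc)
  moreover have "0 <= \<bar>p\<bar> * \<bar>q\<bar>" by simp
  ultimately show ?thesis unfolding abs_mult by linarith
 qed
 then show "AE x in m. norm (f x * g x) <= norm ((f x)\<^sup>2 + (g x)\<^sup>2)" by (intro AE_I2) simp
qed

lemma L2_const: "L2 (%_. c)"
 by (simp add: L2_def)

lemma L2_cmult: "L2 f ==> L2 (%x. c * f x)"
 unfolding L2_def by (auto simp: power_mult_distrib)

lemma L2_add: "L2 f ==> L2 g ==> L2 (%x. f x + g x)"
proof -
 assume f: "L2 f" and g: "L2 g"
 have e: "(f x + g x)\<^sup>2 = (f x)\<^sup>2 + (g x)\<^sup>2 + 2 * (f x * g x)" for x by (simp add: power2_sum)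
 have "integrable m (%x. (f x + g x)\<^sup>2)"
  unfolding e using f g L2_prod[OF f g] by (intro Bochner_Integration.integrable_add integrable_mult_right) (auto simp: L2_def)
 then show "L2 (%x. f x + g x)" using f g unfolding L2_def by (intro conjI borel_measurable_add) auto
qed

lemma L2_diff: "L2 f ==> L2 g ==> L2 (%x. f x - g x)"
 using L2_add[of f "%x. - 1 * g x"] L2_cmult[of g "- 1"] by simp

lemma L2_integrable: "L2 f ==> integrable m f"
 using L2_prod[OF _ L2_const[of 1], of f] by simp

lemma L2_shift: "L2 f ==> L2 (%x. f ((shift ^^ k) x))" "L2 f ==> (\<integral>x. (f ((shift ^^ k) x))\<^sup>2 \<partial>m) = (\<integral>x. (f x)\<^sup>2 \<partial>m)"
proof -
 assume f: "L2 f"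
 have fm: "f : borel_measurable m" and fi: "integrable m (%x. (f x)\<^sup>2)" using f by (auto simp: L2_def)
 have "(%x. f ((shift ^^ k) x)) : borel_measurable m"
  using fm unfolding measurable_m by (rule measurable_compose[OF measurable_funpow_shift])
 then show "L2 (%x. f ((shift ^^ k) x))" using integrable_funpow_shift[OF fi, of k] by (simp add: L2_def)
 show "(\<integral>x. (f ((shift ^^ k) x))\<^sup>2 \<partial>m) = (\<integral>x. (f x)\<^sup>2 \<partial>m)"
  by (rule integral_funpow_shift[OF borel_measurable_integrable[OF fi]])
qed

lemma L2_birkhoff: "L2 f ==> L2 (birkhoff f n)"
proof (induction n)
 case 0
 have "birkhoff f 0 = (%_. 0)" by (simp add: fun_eq_iff)
 then show ?case by (simp add: L2_const)
next
 case (Suc n)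
 have "birkhoff f (Suc n) = (%x. birkhoff f n x + f ((shift ^^ n) x))" by (simp add: fun_eq_iff birkhoff_Suc)
 then show ?case using L2_add[OF Suc.IH[OF Suc.prems] L2_shift(1)[OF Suc.prems, of n]] by simp
qed

lemma square_perturbation: "0 < t ==> \<bar>(p + q)\<^sup>2 - p\<^sup>2\<bar> <= t * p\<^sup>2 + (1 / t + 1) * q\<^sup>2" for p q t :: real
proof -
 assume t: "0 < t"
 have "0 <= (t * \<bar>p\<bar> - \<bar>q\<bar>)\<^sup>2" by simp
 then have "2 * t * (\<bar>p\<bar> * \<bar>q\<bar>) <= t\<^sup>2 * p\<^sup>2 + q\<^sup>2" by (simp add: power2_diff power_mult_distrib algebra_simps)
 then have "(2 * t * (\<bar>p\<bar> * \<bar>q\<bar>)) / t <= (t\<^sup>2 * p\<^sup>2 + q\<^sup>2) / t" using t by (intro divide_right_mono) auto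
 moreover have "(2 * t * (\<bar>p\<bar> * \<bar>q\<bar>)) / t = 2 * \<bar>p * q\<bar>" using t by (simp add: abs_mult)
 moreover have "(t\<^sup>2 * p\<^sup>2 + q\<^sup>2) / t = t * p\<^sup>2 + 1 / t * q\<^sup>2" using t by (simp add: field_simps power2_eq_square)
 ultimately have 1: "2 * \<bar>p * q\<bar> <= t * p\<^sup>2 + 1 / t * q\<^sup>2" by simp
 have "\<bar>(p + q)\<^sup>2 - p\<^sup>2\<bar> = \<bar>2 * (p * q) + q\<^sup>2\<bar>" by (simp add: power2_sum)
 also have "... <= \<bar>2 * (p * q)\<bar> + \<bar>q\<^sup>2\<bar>" by (rule abs_triangle_ineq)
 also have "... = 2 * \<bar>p * q\<bar> + q\<^sup>2" by (simp add: abs_mult)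
 finally show ?thesis using 1 by (simp add: distrib_right)
qed

text \<open>A perturbation bounded in L2 is negligible against \<open>n\<close>: the weight
  \<open>t = 1 / sqrt n\<close> in Young's inequality makes the relative and the absolute error
  vanish together.\<close>

lemma L2_perturbation:
 assumes g: "!!n. L2 (g n)" and d: "!!n. L2 (d n)" and C: "!!n. (\<integral>x. (d n x)\<^sup>2 \<partial>m) <= C"
  and lim: "(%n. 1 / real n * (\<integral>x. (g n x)\<^sup>2 \<partial>m)) \<longlonglongrightarrow> s"
 shows "(%n. 1 / real n * (\<integral>x. (g n x + d n x)\<^sup>2 \<partial>m)) \<longlonglongrightarrow> s"
proof -
 define A where "A n = 1 / real n * (\<integral>x. (g n x + d n x)\<^sup>2 \<partial>m)" for n
 define Q where "Q n = 1 / real n * (\<integral>x. (g n x)\<^sup>2 \<partial>m)" for n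
 define e where "e n = sqrt (1 / real n)" for n
 have e0: "e \<longlonglongrightarrow> 0"
  using tendsto_real_sqrt[OF lim_1_over_n] unfolding e_def[abs_def] by simp
 have bound: "norm (A n - Q n) <= e n * Q n + (e n + 1 / real n) * C" if n: "n >= 1" for n
 proof -
  define t where "t = e n"
  have t: "0 < t" "t\<^sup>2 = 1 / real n" using n by (auto simp: t_def e_def)
  have gi: "integrable m (%x. (g n x)\<^sup>2)" and di: "integrable m (%x. (d n x)\<^sup>2)" and si: "integrable m (%x. (g n x + d n x)\<^sup>2)"
   using g d L2_add[OF g d] by (auto simp: L2_def)
  have "\<bar>(\<integral>x. (g n x + d n x)\<^sup>2 \<partial>m) - (\<integral>x. (g n x)\<^sup>2 \<partial>m)\<bar> = \<bar>\<integral>x. (g n x + d n x)\<^sup>2 - (g n x)\<^sup>2 \<partial>m\<bar>"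
   using gi si by simp
  also have "... <= (\<integral>x. \<bar>(g n x + d n x)\<^sup>2 - (g n x)\<^sup>2\<bar> \<partial>m)" by (rule integral_abs_bound)
  also have "... <= (\<integral>x. t * (g n x)\<^sup>2 + (1 / t + 1) * (d n x)\<^sup>2 \<partial>m)"
   using gi di si square_perturbation[OF t(1)] by (intro integral_mono) auto
  also have "... = t * (\<integral>x. (g n x)\<^sup>2 \<partial>m) + (1 / t + 1) * (\<integral>x. (d n x)\<^sup>2 \<partial>m)" using gi di by simp
  also have "... <= t * (\<integral>x. (g n x)\<^sup>2 \<partial>m) + (1 / t + 1) * C" using C[of n] t(1) by (intro add_left_mono mult_left_mono) auto
  finally have "1 / real n * \<bar>(\<integral>x. (g n x + d n x)\<^sup>2 \<partial>m) - (\<integral>x. (g n x)\<^sup>2 \<partial>m)\<bar> <= 1 / real n * (t * (\<integral>x. (g n x)\<^sup>2 \<partial>m) + (1 / t + 1) * C)"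
   by (rule mult_left_mono) simp
  moreover have "1 / real n * (1 / t) = t" unfolding t(2)[symmetric] using t(1) by (simp add: power2_eq_square)
  then have "1 / real n * ((1 / t + 1) * C) = (t + 1 / real n) * C" by (metis mult.assoc distrib_left mult.right_neutral)
  moreover have "norm (A n - Q n) = 1 / real n * \<bar>(\<integral>x. (g n x + d n x)\<^sup>2 \<partial>m) - (\<integral>x. (g n x)\<^sup>2 \<partial>m)\<bar>"
   unfolding A_def Q_def right_diff_distrib[symmetric] by (simp add: abs_mult)
  moreover have "1 / real n * (t * (\<integral>x. (g n x)\<^sup>2 \<partial>m)) = t * Q n" unfolding Q_def by simp
  ultimately show ?thesis unfolding t_def[symmetric] distrib_left by linarith
 qed
 have "(%n. e n * Q n + (e n + 1 / real n) * C) \<longlonglongrightarrow> 0 * s + (0 + 0) * C"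
  using lim unfolding Q_def[abs_def, symmetric] by (intro tendsto_intros e0 lim_1_over_n)
 then have "(%n. e n * Q n + (e n + 1 / real n) * C) \<longlonglongrightarrow> 0" by simp
 then have "(%n. A n - Q n) \<longlonglongrightarrow> 0"
  by (rule Lim_null_comparison[rotated]) (use bound in \<open>auto simp: eventually_sequentially\<close>)
 then have "(%n. (A n - Q n) + Q n) \<longlonglongrightarrow> 0 + s" using lim unfolding Q_def[abs_def, symmetric] by (rule tendsto_add)
 then show ?thesis unfolding A_def[abs_def] by simp
qed

definition vseq :: "((nat => 'a) => real) => nat => real" where
 "vseq f n = 1 / real n * (\<integral>x. (birkhoff f n x - (\<integral>y. birkhoff f n y \<partial>m))\<^sup>2 \<partial>m)"

lemma asymp_var_limit: "vseq f \<longlonglongrightarrow> s ==> asymp_var m f = s"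
 unfolding asymp_var_def vseq_def[abs_def] by (rule limI)

text \<open>The coboundary telescopes to a difference of two values of \<open>r\<close> along the
  orbit, whose second moment is at most four times that of \<open>r\<close> for every
  \<open>n\<close>.\<close>

lemma coboundary_variance:
 assumes f: "L2 f" and r: "L2 r" and g: "!!x. x : X ==> g x = f x + c + (r x - r (shift x))"
  and lim: "vseq f \<longlonglongrightarrow> s"
 shows "vseq g \<longlonglongrightarrow> s"
proof -
 have bg: "birkhoff g n x = birkhoff f n x + real n * c + (r x - r ((shift ^^ n) x))" if x: "x : X" for n x
 proof (induction n)
  case (Suc n)
  have "(shift ^^ n) x : X" using x by auto
  then have "g ((shift ^^ n) x) = f ((shift ^^ n) x) + c + (r ((shift ^^ n) x) - r (shift ((shift ^^ n) x)))" by (rule g)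
  then show ?case using Suc by (simp add: birkhoff_Suc distrib_right)
 qed simp
 define d where "d n x = r x - r ((shift ^^ n) x)" for n x
 have d2: "L2 (d n)" for n unfolding d_def[abs_def] by (intro L2_diff r L2_shift(1))
 have dz: "(\<integral>x. d n x \<partial>m) = 0" for n
  unfolding d_def using L2_integrable[OF r] L2_integrable[OF L2_shift(1)[OF r, of n]]
   integral_funpow_shift[OF borel_measurable_integrable[OF L2_integrable[OF r]], of n] by simp
 have db: "(\<integral>x. (d n x)\<^sup>2 \<partial>m) <= 4 * (\<integral>x. (r x)\<^sup>2 \<partial>m)" for n
 proof -
  have ri: "integrable m (%x. (r x)\<^sup>2)" "integrable m (%x. (r ((shift ^^ n) x))\<^sup>2)" using r L2_shift(1)[OF r, of n] by (auto simp: L2_def)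
  have "(\<integral>x. (d n x)\<^sup>2 \<partial>m) <= (\<integral>x. 2 * (r x)\<^sup>2 + 2 * (r ((shift ^^ n) x))\<^sup>2 \<partial>m)"
  proof (rule integral_mono)
   show "integrable m (%x. (d n x)\<^sup>2)" using d2[of n] by (simp add: L2_def)
   show "integrable m (%x. 2 * (r x)\<^sup>2 + 2 * (r ((shift ^^ n) x))\<^sup>2)" using ri by simp
   have "(p - q)\<^sup>2 <= 2 * p\<^sup>2 + 2 * q\<^sup>2" for p q :: real
    using zero_le_power2[of "p + q"] by (simp add: power2_sum power2_diff)
   then show "(d n x)\<^sup>2 <= 2 * (r x)\<^sup>2 + 2 * (r ((shift ^^ n) x))\<^sup>2" for x unfolding d_def .
  qed
  also have "... = 4 * (\<integral>x. (r x)\<^sup>2 \<partial>m)" using ri L2_shift(2)[OF r, of n] by simp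
  finally show ?thesis .
 qed
 define fc where "fc n x = birkhoff f n x - (\<integral>y. birkhoff f n y \<partial>m)" for n x
 have fc2: "L2 (fc n)" for n unfolding fc_def[abs_def] by (intro L2_diff L2_birkhoff f L2_const)
 have ig: "(\<integral>y. birkhoff g n y \<partial>m) = (\<integral>y. birkhoff f n y \<partial>m) + real n * c" for n
 proof -
  have "(\<integral>y. birkhoff g n y \<partial>m) = (\<integral>y. birkhoff f n y + real n * c + d n y \<partial>m)"
   using bg by (intro Bochner_Integration.integral_cong) (auto simp: d_def)
  also have "... = (\<integral>y. birkhoff f n y \<partial>m) + real n * c + (\<integral>y. d n y \<partial>m)"
   using L2_integrable[OF L2_birkhoff[OF f, of n]] L2_integrable[OF d2[of n]] prob_space by simp
  finally show ?thesis using dz by simp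
 qed
 have "vseq g n = 1 / real n * (\<integral>x. (fc n x + d n x)\<^sup>2 \<partial>m)" for n
  unfolding vseq_def ig
  by (rule arg_cong[where f="%z. 1 / real n * z"], rule Bochner_Integration.integral_cong) (auto simp: bg fc_def d_def algebra_simps)
 moreover have "(%n. 1 / real n * (\<integral>x. (fc n x + d n x)\<^sup>2 \<partial>m)) \<longlonglongrightarrow> s"
  by (rule L2_perturbation[OF fc2 d2 db]) (use lim in \<open>simp add: vseq_def[abs_def] fc_def\<close>)
 ultimately show ?thesis by presburger
qed

text \<open>The first summand is peeled off instead of the last: what remains is a function of
  \<open>shift x\<close>, to which \<open>M\<close> is orthogonal, so second moments add up
  exactly.\<close>

lemma martingale_variance:
 assumes M: "L2 M" and orth: "!!F. L2 F ==> (\<integral>x. M x * F (shift x) \<partial>m) = 0"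
 shows "vseq M \<longlonglongrightarrow> (\<integral>x. (M x)\<^sup>2 \<partial>m)"
proof -
 have M0: "(\<integral>x. M x \<partial>m) = 0" using orth[OF L2_const[of 1]] by simp
 have bz: "(\<integral>x. birkhoff M n x \<partial>m) = 0" for n
 proof (induction n)
  case (Suc n)
  have "(\<integral>x. birkhoff M (Suc n) x \<partial>m) = (\<integral>x. birkhoff M n x \<partial>m) + (\<integral>x. M ((shift ^^ n) x) \<partial>m)"
   unfolding birkhoff_Suc using L2_integrable[OF L2_birkhoff[OF M, of n]] L2_integrable[OF L2_shift(1)[OF M, of n]] by simp
  also have "(\<integral>x. M ((shift ^^ n) x) \<partial>m) = (\<integral>x. M x \<partial>m)"
   by (rule integral_funpow_shift[OF borel_measurable_integrable[OF L2_integrable[OF M]]])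
  finally show ?case using Suc M0 by simp
 qed simp
 have bs: "(\<integral>x. (birkhoff M n x)\<^sup>2 \<partial>m) = real n * (\<integral>x. (M x)\<^sup>2 \<partial>m)" for n
 proof (induction n)
  case (Suc n)
  have b2: "L2 (%x. birkhoff M n (shift x))" using L2_shift(1)[OF L2_birkhoff[OF M, of n], of 1] by simp
  have i: "integrable m (%x. (M x)\<^sup>2)" "integrable m (%x. (birkhoff M n (shift x))\<^sup>2)" "integrable m (%x. M x * birkhoff M n (shift x))"
   using M b2 L2_prod[OF M b2] by (auto simp: L2_def)
  have "(\<integral>x. (birkhoff M (Suc n) x)\<^sup>2 \<partial>m) = (\<integral>x. (M x)\<^sup>2 + (birkhoff M n (shift x))\<^sup>2 + 2 * (M x * birkhoff M n (shift x)) \<partial>m)"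
   unfolding birkhoff_Suc_shift power2_sum by (simp add: mult.assoc)
  also have "... = (\<integral>x. (M x)\<^sup>2 \<partial>m) + (\<integral>x. (birkhoff M n (shift x))\<^sup>2 \<partial>m) + 2 * (\<integral>x. M x * birkhoff M n (shift x) \<partial>m)"
   using i by simp
  also have "(\<integral>x. M x * birkhoff M n (shift x) \<partial>m) = 0" by (rule orth[OF L2_birkhoff[OF M]])
  also have "(\<integral>x. (birkhoff M n (shift x))\<^sup>2 \<partial>m) = (\<integral>x. (birkhoff M n x)\<^sup>2 \<partial>m)"
   using L2_shift(2)[OF L2_birkhoff[OF M, of n], of 1] by simp
  finally show ?case using Suc by (simp add: distrib_right)
 qed simp
 have "vseq M n = (\<integral>x. (M x)\<^sup>2 \<partial>m)" if "n >= 1" for n unfolding vseq_def bz using bs[of n] that by simp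
 then have "\<forall>\<^sub>F n in sequentially. (\<integral>x. (M x)\<^sup>2 \<partial>m) = vseq M n" unfolding eventually_sequentially by (metis (full_types))
 then show ?thesis by (rule Lim_transform_eventually[OF tendsto_const])
qed

lemma tr_dual_integral:
 assumes w: "w : borel_measurable m" "w' : borel_measurable m" and F: "F : borel_measurable m" "!!x. x : X ==> 0 <= F x"
  and ww: "!!x. x : X ==> 0 <= w x & 0 <= w' x & TT (%y. ennreal (w y)) x = ennreal (w' x)"
 shows "(\<integral>x. w x * F (shift x) \<partial>m) = (\<integral>x. w' x * F x \<partial>m)"
proof -
 have sX: "shift x : X" if "x : X" for x using that by auto
 have Fs: "(%x. F (shift x)) : borel_measurable m"
  using F(1) unfolding measurable_m by (rule measurable_compose[OF measurable_shift])
 have um: "(%y. ennreal (F (shift y)) * ennreal (w y)) : borel_measurable m" using Fs w by measurable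
 have "(\<integral>\<^sup>+x. ennreal (w x * F (shift x)) \<partial>m) = (\<integral>\<^sup>+x. ennreal (F (shift x)) * ennreal (w x) \<partial>m)"
  using ww F(2) sX by (intro nn_integral_cong) (auto simp: ennreal_mult mult.commute)
 also have "... = (\<integral>\<^sup>+x. TT (%y. ennreal (F (shift y)) * ennreal (w y)) x \<partial>m)" by (rule nn_integral_tr[OF um, symmetric])
 also have "... = (\<integral>\<^sup>+x. ennreal (F x) * TT (%y. ennreal (w y)) x \<partial>m)"
  by (rule nn_integral_cong) (rule tr_mult_shift[where w="%z. ennreal (F z)"])
 also have "... = (\<integral>\<^sup>+x. ennreal (w' x * F x) \<partial>m)"
  using ww F(2) by (intro nn_integral_cong) (auto simp: ennreal_mult mult.commute)
 finally have e: "(\<integral>\<^sup>+x. ennreal (w x * F (shift x)) \<partial>m) = (\<integral>\<^sup>+x. ennreal (w' x * F x) \<partial>m)" .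
 have "(\<integral>x. w x * F (shift x) \<partial>m) = enn2real (\<integral>\<^sup>+x. ennreal (w x * F (shift x)) \<partial>m)"
  using w Fs ww F(2) sX by (intro integral_eq_nn_integral) (auto intro!: AE_I2 mult_nonneg_nonneg)
 moreover have "(\<integral>x. w' x * F x \<partial>m) = enn2real (\<integral>\<^sup>+x. ennreal (w' x * F x) \<partial>m)"
  using w F ww by (intro integral_eq_nn_integral) (auto intro!: AE_I2 mult_nonneg_nonneg)
 ultimately show ?thesis using e by simp
qed

text \<open>The majorant \<open>H\<close> is integrated separately and cancelled, and a signed
  \<open>F\<close> is split into its positive and negative parts. Square integrability keeps all
  products integrable, so that these subtractions make sense.\<close>

lemma poisson_dual:
 assumes v: "L2 v" "L2 H" "L2 \<eta>" "L2 TH" and F: "L2 F"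
  and p: "!!x. x : X ==> 0 <= H x & 0 <= v x + H x & 0 <= TH x & 0 <= \<eta> x + TH x"
   "!!x. x : X ==> TT (%y. ennreal (v y + H y)) x = ennreal (\<eta> x + TH x)"
   "!!x. x : X ==> TT (%y. ennreal (H y)) x = ennreal (TH x)"
 shows "(\<integral>x. v x * F (shift x) \<partial>m) = (\<integral>x. \<eta> x * F x \<partial>m)"
proof -
 have pos: "(\<integral>x. v x * F (shift x) \<partial>m) = (\<integral>x. \<eta> x * F x \<partial>m)" if F: "L2 F" and F0: "!!x. 0 <= F x" for F
 proof -
  have Fs: "L2 (%x. F (shift x))" using L2_shift(1)[OF F, of 1] by simp
  have mm: "v : borel_measurable m" "H : borel_measurable m" "\<eta> : borel_measurable m" "TH : borel_measurable m" "F : borel_measurable m"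
   using v F by (auto simp: L2_def)
  have i: "integrable m (%x. v x * F (shift x))" "integrable m (%x. H x * F (shift x))" "integrable m (%x. \<eta> x * F x)" "integrable m (%x. TH x * F x)"
   using v F Fs by (auto intro: L2_prod)
  have 1: "(\<integral>x. (v x + H x) * F (shift x) \<partial>m) = (\<integral>x. (\<eta> x + TH x) * F x \<partial>m)"
   by (rule tr_dual_integral) (use mm F0 p in auto)
  have 2: "(\<integral>x. H x * F (shift x) \<partial>m) = (\<integral>x. TH x * F x \<partial>m)"
   by (rule tr_dual_integral) (use mm F0 p in auto)
  have "(\<integral>x. (v x + H x) * F (shift x) \<partial>m) = (\<integral>x. v x * F (shift x) \<partial>m) + (\<integral>x. H x * F (shift x) \<partial>m)"
   unfolding distrib_right using i by simp
  moreover have "(\<integral>x. (\<eta> x + TH x) * F x \<partial>m) = (\<integral>x. \<eta> x * F x \<partial>m) + (\<integral>x. TH x * F x \<partial>m)"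
   unfolding distrib_right using i by simp
  ultimately show ?thesis using 1 2 by simp
 qed
 have Fm: "F : borel_measurable m" using F by (simp add: L2_def)
 define Fp where "Fp x = max 0 (F x)" for x
 define Fn where "Fn x = max 0 (- F x)" for x
 have Fp: "L2 Fp" and Fn: "L2 Fn"
  using Fm by (auto intro!: L2_bound[OF F] simp: Fp_def[abs_def] Fn_def[abs_def])
 have F0: "0 <= Fp x" "0 <= Fn x" for x by (auto simp: Fp_def Fn_def)
 have Fe: "F x = Fp x - Fn x" for x by (auto simp: Fp_def Fn_def)
 have s: "L2 (%x. Fp (shift x))" "L2 (%x. Fn (shift x))" using L2_shift(1)[OF Fp, of 1] L2_shift(1)[OF Fn, of 1] by auto
 have "(\<integral>x. v x * F (shift x) \<partial>m) = (\<integral>x. v x * Fp (shift x) \<partial>m) - (\<integral>x. v x * Fn (shift x) \<partial>m)"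
  unfolding Fe right_diff_distrib using L2_prod[OF v(1) s(1)] L2_prod[OF v(1) s(2)] by simp
 also have "... = (\<integral>x. \<eta> x * Fp x \<partial>m) - (\<integral>x. \<eta> x * Fn x \<partial>m)"
  using pos[OF Fp F0(1)] pos[OF Fn F0(2)] by simp
 also have "... = (\<integral>x. \<eta> x * F x \<partial>m)"
  unfolding Fe right_diff_distrib using L2_prod[OF v(3) Fp] L2_prod[OF v(3) Fn] by simp
 finally show ?thesis .
qed

lemma L2_gr: "L2 gr"
 using gr_measurable gr_square_integrable by (simp add: L2_def)

lemma hol_measurable: "hol K \<psi> ==> \<psi> : borel_measurable m"
 unfolding measurable_m by (rule wvar_measurable[of K]) (auto simp: hol_def wvar_def)

lemma hol_continuous: "hol K \<psi> ==> shift_continuous E \<psi>"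
proof -
 assume h: "hol K \<psi>"
 show ?thesis
 proof (rule shift_continuous_iff[THEN iffD2], intro ballI allI impI)
  fix x and \<epsilon> :: real assume x: "x : X" and e: "0 < \<epsilon>"
  have "(%n. K * \<theta> ^ n) \<longlonglongrightarrow> K * 0" using theta by (intro tendsto_intros LIMSEQ_power_zero) auto
  then have "\<forall>\<^sub>F n in sequentially. K * \<theta> ^ n < \<epsilon>" using e by (intro order_tendstoD(2)) auto
  then obtain N where N: "!!n. n >= N ==> K * \<theta> ^ n < \<epsilon>" unfolding eventually_sequentially by blast
  have "\<bar>\<psi> x - \<psi> y\<bar> < \<epsilon>" if y: "y : X" "agree (Suc N) x y" for y
  proof -
   have "\<bar>\<psi> x - \<psi> y\<bar> <= K * \<theta> ^ Suc N" using h x y unfolding hol_def by (metis Suc_eq_plus1_left le_add1)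
   also have "... < \<epsilon>" by (rule N) simp
   finally show ?thesis .
  qed
  then show "\<exists>n. \<forall>y\<in>X. agree n x y --> \<bar>\<psi> x - \<psi> y\<bar> < \<epsilon>" by blast
 qed
qed

text \<open>Gordin's method: the Poisson equation says \<open>T v = - u\<close>, so \<open>M\<close>
  is \<open>v\<close> minus \<open>T v\<close> composed with the shift, and duality makes it
  orthogonal to every square integrable function of \<open>shift x\<close>. The constants do not
  involve \<psi>, which gives one bound for all data.\<close>

lemma martingale_decomposition:
 "\<exists>C>0. \<forall>K \<psi>. 0 < K --> hol K \<psi> --> (\<exists>u c M. shift_continuous E u & shift_continuous E M & L2 u & L2 M &
  (\<forall>x\<in>X. \<psi> x = M x + c + (u x - u (shift x))) & (\<forall>F. L2 F --> (\<integral>x. M x * F (shift x) \<partial>m) = 0) &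
  (\<integral>x. (M x)\<^sup>2 \<partial>m) <= C * K\<^sup>2)"
proof -
 obtain C0 where C0: "1 <= C0" "!!x. x : V a ==> gg x <= ennreal C0" using gg_V by blast
 obtain CT where CT: "0 <= CT" "!!x. x : X ==> TT gg x <= ennreal (CT * gr x)" using TT_gr_finite by blast
 define C1 where "C1 = 3 + 6 * C0 + 9 * C0\<^sup>2 / (1 - gm)"
 have C1: "0 <= C1" unfolding C1_def using C0 gm by simp
 define C2 where "C2 = 3 + 6 * C0 + C1"
 define \<Gamma> where "\<Gamma> = (\<integral>x. (gr x)\<^sup>2 \<partial>m)"
 have \<Gamma>: "0 <= \<Gamma>" unfolding \<Gamma>_def by (rule Bochner_Integration.integral_nonneg) simp
 define C where "C = 2 * (C1\<^sup>2 + C2\<^sup>2) * \<Gamma> + 1"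
 have C: "0 < C" unfolding C_def using \<Gamma> by (simp add: add_nonneg_pos)
 have "\<exists>u c M. shift_continuous E u & shift_continuous E M & L2 u & L2 M &
  (\<forall>x\<in>X. \<psi> x = M x + c + (u x - u (shift x))) & (\<forall>F. L2 F --> (\<integral>x. M x * F (shift x) \<partial>m) = 0) &
  (\<integral>x. (M x)\<^sup>2 \<partial>m) <= C * K\<^sup>2" if K: "0 < K" and psi: "hol K \<psi>" for K \<psi>
 proof -
  obtain \<kappa> v where k: "0 <= \<kappa>" "\<kappa> <= 6 * K * C0" and vc: "shift_continuous E v"
   and vb: "!!x. x : X ==> \<bar>v x\<bar> <= C1 * K * gr x"
   and vT: "!!x. x : X ==> TT (%y. ennreal (v y + C1 * K * gr y)) x =
    ennreal (v x - (\<psi> x + 2 * K - \<kappa>) + enn2real (TT (%y. ennreal (C1 * K * gr y)) x)) &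
    0 <= v x - (\<psi> x + 2 * K - \<kappa>) + enn2real (TT (%y. ennreal (C1 * K * gr y)) x)"
   using poisson[OF C0 K psi] unfolding C1_def[symmetric] by blast
  define H where "H y = C1 * K * gr y" for y
  define TH where "TH x = enn2real (TT (%y. ennreal (H y)) x)" for x
  define u where "u x = (\<psi> x + 2 * K - \<kappa>) - v x" for x
  define M where "M x = v x + u (shift x)" for x
  have CK: "0 <= C1 * K" using C1 K by simp
  have H2: "L2 H" unfolding H_def[abs_def] by (rule L2_cmult[OF L2_gr])
  have H0: "0 <= H x" if "x : X" for x unfolding H_def using CK gr(2)[OF that] by simp
  have vm: "v : borel_measurable m" unfolding measurable_m by (rule measurable_shift_continuous[OF vc])
  have v2: "L2 v" by (rule L2_bound[OF H2 vm]) (use vb H0 in \<open>fastforce simp: H_def\<close>)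
  have THle: "TT (%y. ennreal (H y)) x <= ennreal (C1 * K * CT * gr x)" if x: "x : X" for x
  proof -
   have "TT (%y. ennreal (H y)) x = TT (%y. ennreal (C1 * K) * gg y) x"
   proof (rule tr_cong[OF _ x])
    fix y assume y: "y : X"
    have "0 <= gr y" using gr(2)[OF y] by simp
    then show "ennreal (H y) = ennreal (C1 * K) * gg y" unfolding H_def gr(1)[OF y] using CK by (intro ennreal_mult)
   qed
   also have "... = ennreal (C1 * K) * TT gg x" by (rule tr_cmult)
   also have "... <= ennreal (C1 * K) * ennreal (CT * gr x)" by (intro mult_left_mono CT(2) x) simp
   also have "... = ennreal (C1 * K * CT * gr x)"
    using CK CT(1) gr(2)[OF x] by (subst ennreal_mult[symmetric]) (auto simp: mult.assoc)
   finally show ?thesis .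
  qed
  have THe: "TT (%y. ennreal (H y)) x = ennreal (TH x)" "0 <= TH x" "TH x <= C1 * K * CT * gr x" if x: "x : X" for x
  proof -
   have "TT (%y. ennreal (H y)) x < top" using THle[OF x] by (rule le_less_trans) simp
   then show e: "TT (%y. ennreal (H y)) x = ennreal (TH x)" by (simp add: TH_def)
   show "0 <= TH x" by (simp add: TH_def)
   have "0 <= C1 * K * CT * gr x" using CK CT(1) gr(2)[OF x] by simp
   then show "TH x <= C1 * K * CT * gr x" using THle[OF x] unfolding e by (simp add: ennreal_le_iff)
  qed
  have Hm: "H : borel_measurable m" using H2 by (simp add: L2_def)
  have "(%y. ennreal (H y)) : borel_measurable m" using Hm by measurable
  then have "TT (%y. ennreal (H y)) : borel_measurable m" by (rule tr_lg_measurable)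
  then have THm: "TH : borel_measurable m" unfolding TH_def[abs_def] by measurable
  have TH2: "L2 TH"
   by (rule L2_bound[OF L2_cmult[OF L2_gr, of "C1 * K * CT"] THm]) (use THe in fastforce)
  have pm: "\<psi> : borel_measurable m" by (rule hol_measurable[OF psi])
  have um: "u : borel_measurable m" unfolding u_def[abs_def] using pm vm by measurable
  have ub: "\<bar>u x\<bar> <= C2 * K * gr x" if x: "x : X" for x
  proof -
   have "\<bar>\<psi> x\<bar> <= K" using psi x unfolding hol_def by blast
   then have "\<bar>u x\<bar> <= (3 * K + 6 * K * C0) + C1 * K * gr x" using vb[OF x] k K unfolding u_def abs_le_iff by linarith
   also have "3 * K + 6 * K * C0 <= (3 * K + 6 * K * C0) * gr x"
    using mult_left_mono[OF gr(2)[OF x], of "3 * K + 6 * K * C0"] K C0(1) by simp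
   finally show ?thesis unfolding C2_def by (simp add: algebra_simps)
  qed
  have C2: "0 <= C2" unfolding C2_def using C1 C0 by simp
  have u2: "L2 u" by (rule L2_bound[OF L2_cmult[OF L2_gr, of "C2 * K"] um]) (use ub in fastforce)
  have us2: "L2 (%x. u (shift x))" using L2_shift(1)[OF u2, of 1] by simp
  have M2: "L2 M" unfolding M_def[abs_def] by (rule L2_add[OF v2 us2])
  have uc: "shift_continuous E u"
  proof -
   have "shift_continuous E (%x. \<psi> x + ((2 * K - \<kappa>) + (- 1) * v x))"
    by (intro shift_continuous_add shift_continuous_cmult vc hol_continuous[OF psi]) (simp add: shift_continuous_iff)
   then show ?thesis unfolding u_def[abs_def] by (simp add: algebra_simps)
  qed
  have Mc: "shift_continuous E M" unfolding M_def[abs_def] by (intro shift_continuous_add shift_continuous_shift vc uc)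
  define \<eta> where "\<eta> x = (- 1) * u x" for x
  have \<eta>2: "L2 \<eta>" unfolding \<eta>_def[abs_def] by (rule L2_cmult[OF u2])
  have orth: "(\<integral>x. M x * F (shift x) \<partial>m) = 0" if F: "L2 F" for F
  proof -
   have Fs: "L2 (%x. F (shift x))" using L2_shift(1)[OF F, of 1] by simp
   have 1: "(\<integral>x. v x * F (shift x) \<partial>m) = (\<integral>x. \<eta> x * F x \<partial>m)"
   proof (rule poisson_dual[OF v2 H2 \<eta>2 TH2 F])
    fix x assume x: "x : X"
    have e: "\<eta> x + TH x = v x - (\<psi> x + 2 * K - \<kappa>) + enn2real (TT (%y. ennreal (C1 * K * gr y)) x)"
     by (simp add: \<eta>_def u_def TH_def H_def)
    show "0 <= H x & 0 <= v x + H x & 0 <= TH x & 0 <= \<eta> x + TH x"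
     using H0[OF x] vb[OF x] THe(2)[OF x] vT[OF x] unfolding e H_def abs_le_iff by auto
    show "TT (%y. ennreal (v y + H y)) x = ennreal (\<eta> x + TH x)" using vT[OF x] unfolding e H_def by blast
    show "TT (%y. ennreal (H y)) x = ennreal (TH x)" by (rule THe(1)[OF x])
   qed
   have 2: "(\<integral>x. u (shift x) * F (shift x) \<partial>m) = (\<integral>x. u x * F x \<partial>m)"
    using integral_funpow_shift[OF borel_measurable_integrable[OF L2_prod[OF u2 F]], of 1] by simp
   have "(\<integral>x. M x * F (shift x) \<partial>m) = (\<integral>x. v x * F (shift x) \<partial>m) + (\<integral>x. u (shift x) * F (shift x) \<partial>m)"
    unfolding M_def distrib_right using L2_prod[OF v2 Fs] L2_prod[OF us2 Fs] by simp
   also have "... = (\<integral>x. \<eta> x * F x \<partial>m) + (\<integral>x. u x * F x \<partial>m)" unfolding 1 2 ..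
   also have "... = 0" unfolding \<eta>_def by simp
   finally show ?thesis .
  qed
  have "(\<integral>x. (M x)\<^sup>2 \<partial>m) <= (\<integral>x. 2 * (v x)\<^sup>2 + 2 * (u (shift x))\<^sup>2 \<partial>m)"
  proof (rule integral_mono)
   show "integrable m (%x. (M x)\<^sup>2)" using M2 by (simp add: L2_def)
   show "integrable m (%x. 2 * (v x)\<^sup>2 + 2 * (u (shift x))\<^sup>2)" using v2 us2 by (simp add: L2_def)
   have "(p + q)\<^sup>2 <= 2 * p\<^sup>2 + 2 * q\<^sup>2" for p q :: real
    using zero_le_power2[of "p - q"] by (simp add: power2_sum power2_diff)
   then show "(M x)\<^sup>2 <= 2 * (v x)\<^sup>2 + 2 * (u (shift x))\<^sup>2" for x unfolding M_def .
  qed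
  also have "... = 2 * (\<integral>x. (v x)\<^sup>2 \<partial>m) + 2 * (\<integral>x. (u (shift x))\<^sup>2 \<partial>m)" using v2 us2 by (simp add: L2_def)
  also have "(\<integral>x. (u (shift x))\<^sup>2 \<partial>m) = (\<integral>x. (u x)\<^sup>2 \<partial>m)" using L2_shift(2)[OF u2, of 1] by simp
  finally have Mle: "(\<integral>x. (M x)\<^sup>2 \<partial>m) <= 2 * (\<integral>x. (v x)\<^sup>2 \<partial>m) + 2 * (\<integral>x. (u x)\<^sup>2 \<partial>m)" .
  have sq: "(\<integral>x. (f x)\<^sup>2 \<partial>m) <= (q * K)\<^sup>2 * \<Gamma>" if f: "L2 f" "!!x. x : X ==> \<bar>f x\<bar> <= q * K * gr x" for f q
  proof -
   have "(\<integral>x. (f x)\<^sup>2 \<partial>m) <= (\<integral>x. (q * K)\<^sup>2 * (gr x)\<^sup>2 \<partial>m)"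
   proof (rule integral_mono)
    show "integrable m (%x. (f x)\<^sup>2)" using f(1) by (simp add: L2_def)
    show "integrable m (%x. (q * K)\<^sup>2 * (gr x)\<^sup>2)" using L2_gr by (simp add: L2_def)
    fix x assume "x : space m"
    then have "\<bar>f x\<bar> <= q * K * gr x" using f(2) by simp
    then have "\<bar>f x\<bar>\<^sup>2 <= (q * K * gr x)\<^sup>2" by (intro power_mono) auto
    then show "(f x)\<^sup>2 <= (q * K)\<^sup>2 * (gr x)\<^sup>2" by (simp add: power_mult_distrib)
   qed
   then show ?thesis unfolding \<Gamma>_def by simp
  qed
  have "(\<integral>x. (M x)\<^sup>2 \<partial>m) <= 2 * ((C1 * K)\<^sup>2 * \<Gamma>) + 2 * ((C2 * K)\<^sup>2 * \<Gamma>)"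
   using Mle sq[OF v2 vb] sq[OF u2 ub] by linarith
  also have "... = 2 * (C1\<^sup>2 + C2\<^sup>2) * \<Gamma> * K\<^sup>2" by (simp add: power_mult_distrib algebra_simps)
  also have "... <= C * K\<^sup>2" unfolding C_def by (simp add: mult_right_mono)
  finally have Mn: "(\<integral>x. (M x)\<^sup>2 \<partial>m) <= C * K\<^sup>2" .
  have "\<psi> x = M x + (\<kappa> - 2 * K) + (u x - u (shift x))" for x unfolding M_def u_def by simp
  then show ?thesis using uc Mc u2 M2 orth Mn by blast
 qed
 then show ?thesis using C by blast
qed

section \<open>Hoelder functions, coboundaries and the three assertions\<close>

lemma L2_hol: "hol K \<psi> ==> L2 \<psi>"
 by (rule L2_bound[OF L2_const[of K] hol_measurable]) (auto simp: hol_def)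

lemma hol_mono: "hol K \<psi> ==> K <= K' ==> hol K' \<psi>"
 unfolding hol_def by (meson mult_right_mono order_trans theta_pow(1) less_imp_le)

text \<open>Two different points with \<open>n\<close> common letters have \<open>sep_time\<close>
  at least \<open>n\<close>, and \<open>exp (- \<beta>) <= \<theta>\<close> converts the rate of
  decay. From here on \<beta> enters only through the norm, so the final constant can be the same
  for all \<beta>.\<close>

lemma in_H_hol:
 assumes H: "in_H E \<beta> \<psi>" and b: "0 < \<beta>" "exp (- \<beta>) <= \<theta>"
 shows "hol (H_norm E \<beta> \<psi>) \<psi>" "0 <= H_norm E \<beta> \<psi>"
proof -
 define S1 where "S1 = Sup (insert 0 (sup_part E \<psi>))"
 define S2 where "S2 = Sup (insert 0 (hol_part E \<beta> \<psi>))"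
 have bd: "bdd_above (insert 0 (sup_part E \<psi>))" "bdd_above (insert 0 (hol_part E \<beta> \<psi>))"
  using H unfolding in_H_def by auto
 have s0: "0 <= S1" "0 <= S2" unfolding S1_def S2_def using bd by (auto intro: cSup_upper)
 have s1: "\<bar>\<psi> x\<bar> <= S1" if "x : X" for x
  unfolding S1_def using bd(1) that by (intro cSup_upper) (auto simp: sup_part_def)
 have s2: "\<bar>\<psi> x - \<psi> y\<bar> <= S2 * \<theta> ^ n" if xy: "x : X" "y : X" "agree n x y" for x y n
 proof (cases "x = y")
  case True
  then show ?thesis using s0 theta by simp
 next
  case False
  define s where "s = real (sep_time x y)"
  have n: "real n <= s" unfolding s_def using sep_time_ge_of_agree[OF False xy(3)] by simp
  have "\<bar>\<psi> x - \<psi> y\<bar> * exp (\<beta> * s) <= S2"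
   unfolding S2_def s_def using bd(2) xy False by (intro cSup_upper) (auto simp: hol_part_def)
  then have "\<bar>\<psi> x - \<psi> y\<bar> * exp (\<beta> * s) * exp (- (\<beta> * s)) <= S2 * exp (- (\<beta> * s))" by (intro mult_right_mono) auto
  then have "\<bar>\<psi> x - \<psi> y\<bar> <= S2 * exp (- (\<beta> * s))" by (simp add: mult.assoc exp_add[symmetric])
  also have "... <= S2 * exp (real n * - \<beta>)" using n b s0 by (intro mult_left_mono) (auto simp: mult.commute mult_left_mono)
  also have "exp (real n * - \<beta>) = exp (- \<beta>) ^ n" by (rule exp_of_nat_mult)
  also have "S2 * exp (- \<beta>) ^ n <= S2 * \<theta> ^ n" using b s0 by (intro mult_left_mono power_mono) auto
  finally show ?thesis .
 qed
 have e: "H_norm E \<beta> \<psi> = S1 + S2" unfolding H_norm_def S1_def S2_def ..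
 show "0 <= H_norm E \<beta> \<psi>" unfolding e using s0 by simp
 show "hol (H_norm E \<beta> \<psi>) \<psi>" unfolding hol_def e
 proof (intro conjI ballI allI impI)
  show "\<bar>\<psi> x\<bar> <= S1 + S2" if "x : X" for x using s1[OF that] s0 by linarith
  show "\<bar>\<psi> x - \<psi> y\<bar> <= (S1 + S2) * \<theta> ^ n" if "x : X" "y : X" "agree n x y" for x y n
  proof -
   have "0 <= S1 * \<theta> ^ n" using s0 theta_pow(1)[of n] by simp
   then show ?thesis using s2[OF that] unfolding distrib_right by linarith
  qed
 qed
qed

lemma coboundary_L2:
 assumes c: "shift_continuous E r" and r: "!!x. x : X ==> \<bar>r x - r (shift x)\<bar> <= K"
 shows "L2 r"
proof -
 obtain C where C: "0 <= C" "!!x. x : X ==> \<bar>r x\<bar> <= C * gr x" using coboundary_le_gr[OF c r] by blast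
 have "r : borel_measurable m" unfolding measurable_m by (rule measurable_shift_continuous[OF c])
 then show ?thesis by (rule L2_bound[OF L2_cmult[OF L2_gr, of C]]) (use C in fastforce)
qed

lemma coboundary_invariance:
 assumes p: "hol K \<psi>" "hol K' \<phi>'" and r: "shift_continuous E r" "!!x. x : X ==> \<psi> x - \<phi>' x = r x - r (shift x) + c"
 shows "asymp_var m \<psi> = asymp_var m \<phi>'"
proof -
 define J where "J = max 1 K'"
 have J: "0 < J" "hol J \<phi>'" using hol_mono[OF p(2), of J] by (auto simp: J_def)
 obtain u c' M where M: "L2 u" "L2 M" "\<forall>x\<in>X. \<phi>' x = M x + c' + (u x - u (shift x))" "\<forall>F. L2 F --> (\<integral>x. M x * F (shift x) \<partial>m) = 0"
  using martingale_decomposition J by blast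
 have lim: "vseq \<phi>' \<longlonglongrightarrow> (\<integral>x. (M x)\<^sup>2 \<partial>m)"
  by (rule coboundary_variance[OF M(2) M(1) _ martingale_variance[OF M(2)]]) (use M in auto)
 \<comment> \<open>Both functions are bounded, so \<open>r\<close> has bounded increments; this is
   what makes an arbitrary continuous solution square integrable.\<close>
 have "\<bar>r x - r (shift x)\<bar> <= K + K' + \<bar>c\<bar>" if x: "x : X" for x
 proof -
  have "\<bar>\<psi> x\<bar> <= K" "\<bar>\<phi>' x\<bar> <= K'" using p x unfolding hol_def by auto
  then show ?thesis using r(2)[OF x] by linarith
 qed
 then have r2: "L2 r" by (rule coboundary_L2[OF r(1)])
 have "vseq \<psi> \<longlonglongrightarrow> (\<integral>x. (M x)\<^sup>2 \<partial>m)"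
 proof (rule coboundary_variance[OF L2_hol[OF p(2)] r2 _ lim])
  show "\<psi> x = \<phi>' x + c + (r x - r (shift x))" if "x : X" for x using r(2)[OF that] by linarith
 qed
 then show ?thesis using lim asymp_var_limit by simp
qed

theorem variance_properties:
 "(\<forall>\<beta>>0. exp (- \<beta>) <= \<theta> -->
   (\<forall>\<psi>. in_H E \<beta> \<psi> -->
    (asymp_sd m \<psi> = 0 \<longleftrightarrow>
     (\<exists>r c. shift_continuous E r &
        (\<forall>x\<in>sigma_plus E. \<psi> x = r x - r (shift x) + c)))) &
   (\<forall>\<psi> \<phi>'. in_H E \<beta> \<psi> & in_H E \<beta> \<phi>' &
    (\<exists>r c. shift_continuous E r &
        (\<forall>x\<in>sigma_plus E. \<psi> x - \<phi>' x = r x - r (shift x) + c))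
    --> asymp_sd m \<psi> = asymp_sd m \<phi>')) &
  (\<exists>M>1. \<forall>\<beta>>0. exp (- \<beta>) <= \<theta> -->
   (\<forall>\<psi>. in_H E \<beta> \<psi> --> asymp_sd m \<psi> <= M * H_norm E \<beta> \<psi>))"
proof -
 obtain C where C: "0 < C" and dec: "!!K \<psi>. 0 < K ==> hol K \<psi> ==> \<exists>u c M. shift_continuous E u & shift_continuous E M & L2 u & L2 M &
  (\<forall>x\<in>X. \<psi> x = M x + c + (u x - u (shift x))) & (\<forall>F. L2 F --> (\<integral>x. M x * F (shift x) \<partial>m) = 0) &
  (\<integral>x. (M x)\<^sup>2 \<partial>m) <= C * K\<^sup>2"
  using martingale_decomposition by blast
 have inv: "asymp_sd m \<psi> = asymp_sd m \<phi>'"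
  if "0 < \<beta>" "exp (- \<beta>) <= \<theta>" "in_H E \<beta> \<psi>" "in_H E \<beta> \<phi>'" "shift_continuous E r" "\<forall>x\<in>X. \<psi> x - \<phi>' x = r x - r (shift x) + c" for \<beta> \<psi> \<phi>' r c
  unfolding asymp_sd_def
  using coboundary_invariance[OF in_H_hol(1)[OF that(3,1,2)] in_H_hol(1)[OF that(4,1,2)] that(5)] that(6) by simp
 have zero_H: "in_H E \<beta> (%_. 0)" for \<beta>
  unfolding in_H_def sup_part_def hol_part_def by (auto intro!: bdd_aboveI[of _ 0])
 have zero_sd: "asymp_sd m (%_. 0) = 0"
 proof -
  have b: "birkhoff (%_. 0) n x = 0" for n and x :: "nat => 'a" by (simp add: birkhoff_def)
  have "vseq (%_. 0) \<longlonglongrightarrow> 0" unfolding vseq_def[abs_def] b by simp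
  then show ?thesis using asymp_var_limit by (simp add: asymp_sd_def)
 qed
 have fwd: "\<exists>r c. shift_continuous E r & (\<forall>x\<in>X. \<psi> x = r x - r (shift x) + c)"
  if b: "0 < \<beta>" "exp (- \<beta>) <= \<theta>" and H: "in_H E \<beta> \<psi>" and z: "asymp_sd m \<psi> = 0" for \<beta> \<psi>
 proof -
  define J where "J = max 1 (H_norm E \<beta> \<psi>)"
  have J: "0 < J" "hol J \<psi>" using hol_mono[OF in_H_hol(1)[OF H b], of J] by (auto simp: J_def)
  obtain u c M where M: "shift_continuous E u" "shift_continuous E M" "L2 u" "L2 M" "\<forall>x\<in>X. \<psi> x = M x + c + (u x - u (shift x))"
   "\<forall>F. L2 F --> (\<integral>x. M x * F (shift x) \<partial>m) = 0" using dec[OF J] by blast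
  have "vseq \<psi> \<longlonglongrightarrow> (\<integral>x. (M x)\<^sup>2 \<partial>m)"
   by (rule coboundary_variance[OF M(4) M(3) _ martingale_variance[OF M(4)]]) (use M in auto)
  then have "asymp_var m \<psi> = (\<integral>x. (M x)\<^sup>2 \<partial>m)" by (rule asymp_var_limit)
  then have "(\<integral>x. (M x)\<^sup>2 \<partial>m) = 0" using z by (simp add: asymp_sd_def)
  then have "AE x in m. (M x)\<^sup>2 = 0"
   using M(4) unfolding L2_def by (subst (asm) integral_nonneg_eq_0_iff_AE) auto
  then have "AE x in m. M x = 0" by simp
  then have M0: "M x = 0" if "x : X" for x using AE_zero_continuous[OF M(2) _ that] by blast
  have "\<psi> x = u x - u (shift x) + c" if "x : X" for x
   using M(5) M0[OF that] that by simp
  then show ?thesis using M(1) by blast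
 qed
 \<comment> \<open>A coboundary plus a constant differs by a coboundary and a constant from the zero
   function, whose variance is 0.\<close>
 have bwd: "asymp_sd m \<psi> = 0"
  if "0 < \<beta>" "exp (- \<beta>) <= \<theta>" "in_H E \<beta> \<psi>" "shift_continuous E r" "\<forall>x\<in>X. \<psi> x = r x - r (shift x) + c" for \<beta> \<psi> r c
  using inv[OF that(1,2,3) zero_H that(4), of c] that(5) zero_sd by simp
 have bnd: "asymp_sd m \<psi> <= sqrt C * K" if K: "0 < K" and h: "hol K \<psi>" for K \<psi>
 proof -
  obtain u c M where M: "L2 u" "L2 M" "\<forall>x\<in>X. \<psi> x = M x + c + (u x - u (shift x))"
   "\<forall>F. L2 F --> (\<integral>x. M x * F (shift x) \<partial>m) = 0" "(\<integral>x. (M x)\<^sup>2 \<partial>m) <= C * K\<^sup>2" using dec[OF K h] by blast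
  have "vseq \<psi> \<longlonglongrightarrow> (\<integral>x. (M x)\<^sup>2 \<partial>m)"
   by (rule coboundary_variance[OF M(2) M(1) _ martingale_variance[OF M(2)]]) (use M in auto)
  then have "asymp_var m \<psi> = (\<integral>x. (M x)\<^sup>2 \<partial>m)" by (rule asymp_var_limit)
  then have "asymp_sd m \<psi> <= sqrt (C * K\<^sup>2)" unfolding asymp_sd_def using M(5) by simp
  also have "... = sqrt C * K" using K by (simp add: real_sqrt_mult)
  finally show ?thesis .
 qed
 \<comment> \<open>The decomposition asks for a positive constant while the norm may be 0, hence the
   approximation by \<open>N + d\<close>; the added units make the final constant exceed 1.\<close>
 have sdb: "asymp_sd m \<psi> <= (sqrt C + 1 + 1) * H_norm E \<beta> \<psi>"
  if b: "0 < \<beta>" "exp (- \<beta>) <= \<theta>" and H: "in_H E \<beta> \<psi>" for \<beta> \<psi>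
 proof -
  define N where "N = H_norm E \<beta> \<psi>"
  have N: "0 <= N" "hol N \<psi>" unfolding N_def using in_H_hol[OF H b] by auto
  have sC: "0 < sqrt C" using C by simp
  have "asymp_sd m \<psi> <= sqrt C * N"
  proof (rule field_le_epsilon)
   fix e :: real assume e: "0 < e"
   define d where "d = e / sqrt C"
   have d: "0 < d" "sqrt C * d = e" unfolding d_def using e sC by auto
   have "asymp_sd m \<psi> <= sqrt C * (N + d)" by (rule bnd) (use N d hol_mono[OF N(2), of "N + d"] in auto)
   then show "asymp_sd m \<psi> <= sqrt C * N + e" using d by (simp add: distrib_left)
  qed
  then show ?thesis unfolding N_def[symmetric] using N by (simp add: distrib_right)
 qed
 have "1 < sqrt C + 1 + 1" using C by (simp add: add_pos_pos)
 then have "\<exists>M>1. \<forall>\<beta>>0. exp (- \<beta>) <= \<theta> --> (\<forall>\<psi>. in_H E \<beta> \<psi> --> asymp_sd m \<psi> <= M * H_norm E \<beta> \<psi>)"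
  using sdb by blast
 moreover have "asymp_sd m \<psi> = 0 \<longleftrightarrow> (\<exists>r c. shift_continuous E r & (\<forall>x\<in>X. \<psi> x = r x - r (shift x) + c))"
  if "0 < \<beta>" "exp (- \<beta>) <= \<theta>" "in_H E \<beta> \<psi>" for \<beta> \<psi>
  using fwd[OF that] bwd[OF that] by blast
 ultimately show ?thesis using inv by blast
qed

end

section \<open>Finiteness of the pressure and conclusion\<close>

context markov_shift
begin

text \<open>Where \<phi> is at most \<open>K\<close>, a superharmonic function for the constant
  potential \<open>- g\<close> is also one for \<open>\<phi> - (K + g)\<close>. It depends on the
  first letter only, so it is constant on the cylinder of \<open>a\<close> and bounds the partition
  functions there.\<close>

lemma gurevich_pressure_bounded:
 assumes phi: "wvar B \<phi>" "0 <= B" and up: "!!x. x : X ==> \<phi> x <= K" and fin: "gurevich_pressure E (%_. 0) c < \<infinity>"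
 shows "\<exists>q. gurevich_pressure E \<phi> a <= ereal q"
proof -
 obtain g H where H: "0 <= g" "cone X 0 H" "!!x. tr E (%_. 0 + - g) UNIV H x <= H x" "!!x. x : X ==> H x ~= top & H x ~= 0"
  using finite_entropy_superharmonic[OF fin] by blast
 obtain x where x: "x : X" "x 0 = a" using V_nonempty[of a] by blast
 obtain t where t: "H x = ennreal t" "0 <= t" using H(4)[OF x(1)] by (metis ennreal_cases)
 have t0: "0 < t" using t H(4)[OF x(1)] by (cases "t = 0") auto
 define q where "q = K + g"
 define f where "f = (%x. \<phi> x + - q)"
 define I where "I y = (indicator {a} (y 0) :: ennreal)" for y :: "nat => 'a"
 have sup: "tr E f UNIV H y <= H y" if y: "y : X" for y
 proof -
  have "tr E f UNIV H y <= tr E (%_. 0 + - g) UNIV H y"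
   unfolding tr_def
  proof (rule nn_integral_mono)
   fix b
   have "E b (y 0) ==> \<phi> (case_nat b y) <= K" using up y by simp
   then show "(if b : UNIV & E b (y 0) then ennreal (exp (f (case_nat b y))) * H (case_nat b y) else 0)
    <= (if b : UNIV & E b (y 0) then ennreal (exp (0 + - g)) * H (case_nat b y) else 0)"
    by (auto simp: f_def q_def intro!: mult_right_mono ennreal_leI)
  qed
  also have "... <= H y" by (rule H(3))
  finally show ?thesis .
 qed
 have iter: "(tr E f UNIV ^^ n) H y <= H y" if "y : X" for n y
  using that
 proof (induction n arbitrary: y)
  case (Suc n)
  have "tr E f UNIV ((tr E f UNIV ^^ n) H) y <= tr E f UNIV H y" using Suc by (intro tr_mono) auto
  also have "... <= H y" by (rule sup[OF Suc.prems])
  finally show ?case unfolding funpow.simps o_apply .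
 qed simp
 have IH: "I y <= ennreal (1 / t) * H y" if y: "y : X" for y
 proof (cases "y 0 = a")
  case True
  have "H x <= ennreal (exp (0 * \<theta> ^ 1)) * H y" by (rule coneD[OF H(2) _ x(1) y]) (use True x in auto)
  then have "ennreal t <= H y" using t by simp
  then have "ennreal (1 / t) * ennreal t <= ennreal (1 / t) * H y" by (rule mult_left_mono) simp
  moreover have "ennreal (1 / t) * ennreal t = 1" using t0 by (simp add: ennreal_mult[symmetric])
  ultimately show ?thesis using True by (simp add: I_def)
 qed (simp add: I_def)
 have trI: "(tr E f UNIV ^^ n) I x <= 1" for n
 proof -
  have "(tr E f UNIV ^^ n) I x <= (tr E f UNIV ^^ n) (%y. ennreal (1 / t) * H y) x" by (rule tr_funpow_mono[OF IH x(1)])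
  also have "... = ennreal (1 / t) * (tr E f UNIV ^^ n) H x" unfolding tr_funpow_cmult ..
  also have "... <= ennreal (1 / t) * H x" by (rule mult_left_mono[OF iter[OF x(1)]]) simp
  also have "... = 1" unfolding t(1) using t0 by (simp add: ennreal_mult[symmetric])
  finally show ?thesis .
 qed
 define C where "C = exp (B / (1 - \<theta>))"
 have Zb: "Zn E \<phi> a n <= ennreal (C * exp (real n * q))" if n: "n >= 1" for n
 proof -
  have "(tr E f UNIV ^^ n) I x = ennreal (exp (real n * - q)) * (tr E \<phi> UNIV ^^ n) I x"
   unfolding f_def by (rule tr_funpow_add_const)
  then have "ennreal (exp (real n * q)) * (ennreal (exp (real n * - q)) * (tr E \<phi> UNIV ^^ n) I x) <= ennreal (exp (real n * q)) * 1"
   using trI[of n] by (intro mult_left_mono) auto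
  moreover have "ennreal (exp (real n * q)) * ennreal (exp (real n * - q)) = 1"
   by (simp add: ennreal_mult[symmetric] exp_add[symmetric])
  ultimately have le: "(tr E \<phi> UNIV ^^ n) I x <= ennreal (exp (real n * q))" by (simp add: mult.assoc[symmetric])
  have "Zn E \<phi> a n <= ennreal C * (tr E \<phi> UNIV ^^ n) I x"
   unfolding C_def I_def[abs_def] by (rule tr_funpow_Zn(2)[OF x n phi])
  also have "... <= ennreal C * ennreal (exp (real n * q))" by (rule mult_left_mono[OF le]) simp
  also have "... = ennreal (C * exp (real n * q))" by (rule ennreal_mult[symmetric]) (auto simp: C_def)
  finally show ?thesis .
 qed
 have C0: "0 < C" by (simp add: C_def)
 have "limsup (%n. eln (Zn E \<phi> a n) / ereal (real n)) <= ereal q"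
  by (rule limsup_eln_le[where Z="Zn E \<phi> a" and C=C and q=q]) (use Zb C0 in auto)
 then show ?thesis unfolding gurevich_pressure_def by blast
qed

end

theorem theorem3p4:
  fixes E :: "'a::countable \<Rightarrow> 'a \<Rightarrow> bool"
    and \<phi> :: "(nat \<Rightarrow> 'a) \<Rightarrow> real"
    and \<theta> :: real
    and m :: "(nat \<Rightarrow> 'a) measure"
  assumes mix: "mixing E"
    and fin_ent: "\<exists>a. gurevich_pressure E (\<lambda>_. 0) a < \<infinity>"
    and theta: "0 < \<theta>" "\<theta> < 1"
    and hol: "weakly_holder E \<theta> \<phi>"
    and spr: "SPR E \<phi>"
    and supfin: "bdd_above (\<phi> ` sigma_plus E)"
    and eq: "equilibrium_measure E \<phi> m"
  shows
   "(\<forall>\<beta>>0. exp (- \<beta>) \<le> \<theta> \<longrightarrow>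
      (\<forall>\<psi>. in_H E \<beta> \<psi> \<longrightarrow>
         (asymp_sd m \<psi> = 0 \<longleftrightarrow>
          (\<exists>r c. shift_continuous E r \<and>
                 (\<forall>x\<in>sigma_plus E. \<psi> x = r x - r (shift x) + c)))) \<and>
      (\<forall>\<psi> \<phi>'. in_H E \<beta> \<psi> \<and> in_H E \<beta> \<phi>' \<and>
         (\<exists>r c. shift_continuous E r \<and>
                (\<forall>x\<in>sigma_plus E. \<psi> x - \<phi>' x = r x - r (shift x) + c))
         \<longrightarrow> asymp_sd m \<psi> = asymp_sd m \<phi>')) \<and>
    (\<exists>M>1. \<forall>\<beta>>0. exp (- \<beta>) \<le> \<theta> \<longrightarrow>
       (\<forall>\<psi>. in_H E \<beta> \<psi> \<longrightarrow> asymp_sd m \<psi> \<le> M * H_norm E \<beta> \<psi>))"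
proof -
  have irr: "E\<^sup>+\<^sup>+ a b" for a b using mix unfolding mixing_def by blast
  interpret MS: markov_shift E \<theta> by unfold_locales (use theta irr in auto)
  obtain A where A: "\<forall>n\<ge>2. \<forall>x\<in>sigma_plus E. \<forall>y\<in>sigma_plus E. (\<forall>i<n. x i = y i) \<longrightarrow> \<bar>\<phi> x - \<phi> y\<bar> \<le> A * \<theta> ^ n"
    using hol unfolding weakly_holder_def by blast
  define B where "B = max A 0"
  have "MS.wvar A \<phi>" unfolding MS.wvar_def agree_def using A by blast
  then have phi: "MS.wvar B \<phi>" "0 \<le> B" unfolding B_def using MS.wvar_nonneg by auto
  obtain a where a: "limsup (\<lambda>n. eln (Zn_star E \<phi> a n) / ereal (real n)) < gurevich_pressure E \<phi> a"
    using spr unfolding SPR_def by blast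
  obtain K where K: "\<And>x. x \<in> sigma_plus E \<Longrightarrow> \<phi> x \<le> K" using supfin unfolding bdd_above_def by blast
  obtain c where c: "gurevich_pressure E (\<lambda>_. 0) c < \<infinity>" using fin_ent by blast
  obtain q where q: "gurevich_pressure E \<phi> a \<le> ereal q" using MS.gurevich_pressure_bounded[OF phi K c] by blast
  \<comment> \<open>The pressure is below \<infinity> by the bound \<open>q\<close>, and the strict
    inequality of the SPR condition excludes \<open>-\<infinity>\<close>.\<close>
  obtain P where P: "gurevich_pressure E \<phi> a = ereal P" using q a by (cases "gurevich_pressure E \<phi> a") auto
  have inv: "invariant_prob E m" using eq unfolding equilibrium_measure_def by blast
  interpret ES: equilibrium_shift E \<theta> \<phi> a B P m
    by unfold_locales (use phi P a inv eq fin_ent supfin in auto)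
  obtain h D where h: "\<And>x. x \<in> sigma_plus E \<Longrightarrow> h x > 0" "0 \<le> D" "MS.cone (sigma_plus E) D (\<lambda>x. ennreal (h x))"
    "\<And>x. x \<in> sigma_plus E \<Longrightarrow> tr E ES.f0 UNIV (\<lambda>x. ennreal (h x)) x = ennreal (h x)"
    "\<And>x. x \<in> sigma_plus E \<Longrightarrow> MS.Lb ES.f0 a (\<lambda>x. ennreal (h x)) x = ennreal (h x)"
    using ES.harmonic_function by blast
  interpret NS: normalised_shift E \<theta> \<phi> a B P m h D by unfold_locales (use h in auto)
  show ?thesis by (rule NS.variance_properties)
qed

end
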